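(* Let $i\colon Z\to X$ be the embedding of a submanifold and let $\mathcal{Q}$ be a Courant algebroid on $X$, locally free of finite rank over $\mathcal{O}_X$. For an (almost) Dirac structure $\mathcal{K}$ in $\mathcal{Q}$ supported on $Z$ (one then has $\pi^\dagger(\mathcal{N}^\vee_{Z|X})\subset\mathcal{K}\subset\mathcal{T}_Z\times_{i^*\mathcal{T}_X}i^*\mathcal{Q}$) put $i^{++}\mathcal{K}:=\mathcal{K}/\pi^\dagger(\mathcal{N}^\vee_{Z|X})\subset i^{++}\mathcal{Q}$. (1) If $\mathcal{K}$ is a Dirac structure in $\mathcal{Q}$ supported on $Z$, then $i^{++}\mathcal{K}$ is a Dirac structure in $i^{++}\mathcal{Q}$. (2) The assignment $\mathcal{K}\mapsto i^{++}\mathcal{K}$ defines a bijection between the set of almost Dirac structures in $\mathcal{Q}$ supported on $Z$ and the set of almost Dirac structures in $i^{++}\mathcal{Q}$.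
   Context: "Manifold" means a $C^\infty$, real analytic or complex manifold, with structure sheaf $\mathcal{O}_X$, vector fields $\mathcal{T}_X$, forms $\Omega^k_X$. A Courant algebroid on $X$ is an $\mathcal{O}_X$-module $\mathcal{Q}$ with a Leibniz $\mathbb{C}$-algebra bracket $\{\ ,\ \}$, an $\mathcal{O}_X$-linear map of Leibniz algebras $\pi\colon\mathcal{Q}\to\mathcal{T}_X$ (anchor), a symmetric $\mathcal{O}_X$-bilinear pairing $\langle\ ,\ \rangle$ (not assumed non-degenerate), and an $\mathcal{O}_X$-linear map $\pi^\dagger\colon\Omega^1_X\to\mathcal{Q}$ (co-anchor), satisfying $\pi\circ\pi^\dagger=0$; $\{q_1,fq_2\}=f\{q_1,q_2\}+\pi(q_1)(f)q_2$; $\langle\{q,q_1\},q_2\rangle+\langle q_1,\{q,q_2\}\rangle=L_{\pi(q)}\langle q_1,q_2\rangle$; $\{q,\pi^\dagger(\alpha)\}=\pi^\dagger(L_{\pi(q)}\alpha)$; $\langle q,\pi^\dagger(\alpha)\rangle=\iota_{\pi(q)}\alpha$; $\{q_1,q_2\}+\{q_2,q_1\}=\pi^\dagger(d\langle q_1,q_2\rangle)$. $\mathcal{N}^\vee_{Z|X}=\ker(i^*\Omega^1_X\to\Omega^1_Z)$ is the conormal bundle; $\pi^\dagger$ also denotes the induced map $i^*\Omega^1_X\to i^*\mathcal{Q}$. For the embedding $i$, the inverse image Courant algebroid on $Z$ is $i^{++}\mathcal{Q}=(\mathcal{T}_Z\times_{i^*\mathcal{T}_X}i^*\mathcal{Q})/\pi^\dagger(\mathcal{N}^\vee_{Z|X})$: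 the pairing is induced by that of $i^*\mathcal{Q}$, the anchor is the projection to $\mathcal{T}_Z$, the co-anchor sends the restriction to $Z$ of $\gamma\in i^*\Omega^1_X$ to the class of $\pi^\dagger(\gamma)$, and the bracket of the classes of $q|_Z,p|_Z$ (with $q,p\in\mathcal{Q}$ local sections whose anchors are tangent to $Z$ along $Z$) is the class of $\{q,p\}|_Z$. For $\mathcal{K}\subset i^*\mathcal{Q}$ let $\widetilde{\mathcal{K}}\subset\mathcal{Q}$ be the submodule of local sections whose image in $i_*i^*\mathcal{Q}$ lies in $i_*\mathcal{K}$. A Dirac structure in $\mathcal{Q}$ supported on $Z$ is a sub-bundle $\mathcal{K}\subset i^*\mathcal{Q}$ such that: (a) $\mathcal{K}$ is maximal isotropic with respect to the restriction of the symmetric pairing; (b) $\mathcal{K}$ is mapped to $\mathcal{T}_Z\subset i^*\mathcal{T}_X$ under the restriction of the anchor map; (c) $\widetilde{\mathcal{K}}$ is closed under the bracket of $\mathcal{Q}$. An almost Dirac structure supported on $Z$ is a sub-bundle satisfying (a) and (b). A(n almost) Dirac structure in a Courant algebroid on a manifold, with no support mentioned, is one supported on the whole manifold.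
   Formalization: Surjectivity in (2) is stated when the fibre product of T_Z and i^*Q over i^*T_X and the image of the conormal bundle under the co-anchor are sub-bundles of i^*Q; without this the bijection can fail. All else, including injectivity, is unconditional. *)

theory Defs
  imports "HOL-Analysis.Analysis" "HOL-Algebra.Module"
begin

section \<open>Manifolds as spaces with a sheaf of functions\<close>

text \<open>Sections of a structure sheaf over an open set \<open>U\<close> are complex-valued functions that are
  extensional on \<open>U\<close>, so that restriction of sections is \<^const>\<open>restrict\<close>.\<close>

type_synonym 'x fn = "'x \<Rightarrow> complex"

locale function_sheaf =
  fixes X :: "'x topology" and \<O> :: "'x set \<Rightarrow> 'x fn set"
  assumes extensional: "openin X U \<Longrightarrow> \<O> U \<subseteq> extensional U"
    and const: "openin X U \<Longrightarrow> (\<lambda>x\<in>U. c) \<in> \<O> U"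
    and add: "\<lbrakk>openin X U; f \<in> \<O> U; g \<in> \<O> U\<rbrakk> \<Longrightarrow> (\<lambda>x\<in>U. f x + g x) \<in> \<O> U"
    and mult: "\<lbrakk>openin X U; f \<in> \<O> U; g \<in> \<O> U\<rbrakk> \<Longrightarrow> (\<lambda>x\<in>U. f x * g x) \<in> \<O> U"
    and restr: "\<lbrakk>openin X U; openin X V; V \<subseteq> U; f \<in> \<O> U\<rbrakk> \<Longrightarrow> restrict f V \<in> \<O> V"
    and glue: "\<lbrakk>openin X U; f \<in> extensional U;
        \<And>x. x \<in> U \<Longrightarrow> \<exists>V. openin X V \<and> x \<in> V \<and> V \<subseteq> U \<and> restrict f V \<in> \<O> V\<rbrakk> \<Longrightarrow> f \<in> \<O> U"

datatype manifold_kind = Smooth | Real_Analytic | Holomorphic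

text \<open>The model space of dimension \<open>n\<close>: \<open>\<complex>\<^sup>n\<close> in the holomorphic case and \<open>\<real>\<^sup>n\<close>, as the real points of
  \<open>\<complex>\<^sup>n\<close>, otherwise. Coordinates are numbered from \<open>0\<close> and vanish from \<open>n\<close> on.\<close>

definition coord_space :: "manifold_kind \<Rightarrow> nat \<Rightarrow> (nat \<Rightarrow> complex) set" where
  "coord_space k n = {a. (\<forall>i\<ge>n. a i = 0) \<and> (k \<noteq> Holomorphic \<longrightarrow> (\<forall>i. a i \<in> \<real>))}"

text \<open>\<open>C_times n W r f\<close>: \<open>f\<close> is \<open>r\<close> times continuously differentiable on the open subset \<open>W\<close> of
  \<open>\<real>\<^sup>n\<close>; the difference quotient of the partial derivative is taken along the real axis.\<close>

primrec C_times :: "nat \<Rightarrow> (nat \<Rightarrow> complex) set \<Rightarrow> nat \<Rightarrow> ((nat \<Rightarrow> complex) \<Rightarrow> complex) \<Rightarrow> bool" where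
  "C_times n W 0 f \<longleftrightarrow> continuous_on W f"
| "C_times n W (Suc r) f \<longleftrightarrow> continuous_on W f \<and>
     (\<forall>i<n. \<exists>g. C_times n W r g \<and>
        (\<forall>a\<in>W. ((\<lambda>t. f (a(i := t))) has_field_derivative g a) (at (a i) within \<real>)))"

definition power_series_on ::
  "manifold_kind \<Rightarrow> nat \<Rightarrow> (nat \<Rightarrow> complex) set \<Rightarrow> ((nat \<Rightarrow> complex) \<Rightarrow> complex) \<Rightarrow> bool" where
  "power_series_on k n W f \<longleftrightarrow> (\<forall>a\<in>W. \<exists>(c :: (nat \<Rightarrow> nat) \<Rightarrow> complex) r. r > 0 \<and>
     (\<forall>b\<in>coord_space k n. (\<forall>i<n. norm (b i - a i) < r) \<longrightarrow>
        b \<in> W \<and> ((\<lambda>m. c m * (\<Prod>i<n. (b i - a i) ^ m i)) has_sum f b) {m. \<forall>i\<ge>n. m i = 0}))"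

definition regular ::
  "manifold_kind \<Rightarrow> nat \<Rightarrow> (nat \<Rightarrow> complex) set \<Rightarrow> ((nat \<Rightarrow> complex) \<Rightarrow> complex) \<Rightarrow> bool" where
  "regular k n W f \<longleftrightarrow>
     (if k = Smooth then \<forall>r. C_times n W r f else power_series_on k n W f)"

definition is_chart ::
  "manifold_kind \<Rightarrow> 'x topology \<Rightarrow> ('x set \<Rightarrow> 'x fn set) \<Rightarrow> nat \<Rightarrow> 'x set \<Rightarrow> ('x \<Rightarrow> nat \<Rightarrow> complex) \<Rightarrow> bool"
  where
  "is_chart k X \<O> n U \<phi> \<longleftrightarrow> openin X U \<and>
     (\<exists>W. openin (top_of_set (coord_space k n)) W \<and>
        homeomorphic_map (subtopology X U) (top_of_set W) \<phi>) \<and>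
     (\<forall>V. openin X V \<and> V \<subseteq> U \<longrightarrow> \<O> V = {(\<lambda>x\<in>V. g (\<phi> x)) | g. regular k n (\<phi> ` V) g})"

locale manifold = function_sheaf X \<O>
  for k :: manifold_kind and X :: "'x topology" and \<O> :: "'x set \<Rightarrow> 'x fn set" +
  assumes Hausdorff: "Hausdorff_space X"
    and second_countable: "second_countable X"
    and charts: "x \<in> topspace X \<Longrightarrow> \<exists>n U \<phi>. is_chart k X \<O> n U \<phi> \<and> x \<in> U"

text \<open>A submanifold is a subset \<open>Z\<close> of \<open>X\<close> with adapted charts; \<open>i : Z \<rightarrow> X\<close> is the inclusion, and the
  topology and the structure sheaf of \<open>Z\<close> are the induced ones, \<open>subtopology X Z\<close> and
  \<open>restr_sheaf X \<O> Z\<close>.\<close>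

definition submanifold ::
  "manifold_kind \<Rightarrow> 'x topology \<Rightarrow> ('x set \<Rightarrow> 'x fn set) \<Rightarrow> 'x set \<Rightarrow> bool" where
  "submanifold k X \<O> Z \<longleftrightarrow> Z \<subseteq> topspace X \<and>
     (\<forall>z\<in>Z. \<exists>n m U \<phi>. is_chart k X \<O> n U \<phi> \<and> z \<in> U \<and> m \<le> n \<and>
        \<phi> ` (U \<inter> Z) = {a \<in> \<phi> ` U. \<forall>i\<ge>m. a i = 0})"

definition restr_sheaf ::
  "'x topology \<Rightarrow> ('x set \<Rightarrow> 'x fn set) \<Rightarrow> 'x set \<Rightarrow> 'x set \<Rightarrow> 'x fn set" where
  "restr_sheaf X \<O> Z W = {f \<in> extensional W. \<forall>z\<in>W. \<exists>V g. openin X V \<and> z \<in> V \<and> V \<inter> Z \<subseteq> W \<and>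
     g \<in> \<O> V \<and> (\<forall>y\<in>V \<inter> Z. g y = f y)}"


section \<open>Sheaves of modules\<close>

definition fn_ring :: "'x set \<Rightarrow> 'x fn set \<Rightarrow> 'x fn ring" where
  "fn_ring U A = \<lparr>carrier = A, mult = (\<lambda>f g. \<lambda>x\<in>U. f x * g x), one = (\<lambda>x\<in>U. 1),
     zero = (\<lambda>x\<in>U. 0), add = (\<lambda>f g. \<lambda>x\<in>U. f x + g x)\<rparr>"

record ('x, 's) omodule =
  Mod :: "'x set \<Rightarrow> ('x fn, 's) module"
  Res :: "'x set \<Rightarrow> 'x set \<Rightarrow> 's \<Rightarrow> 's"

text \<open>\<open>Res M U V\<close> is the restriction of sections from \<open>U\<close> to \<open>V\<close>.\<close>

locale module_sheaf = function_sheaf X \<O>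
  for X :: "'x topology" and \<O> :: "'x set \<Rightarrow> 'x fn set" and M :: "('x, 's, 'm) omodule_scheme" +
  assumes module: "openin X U \<Longrightarrow> Module.module (fn_ring U (\<O> U)) (Mod M U)"
    and Res_closed: "\<lbrakk>openin X U; openin X V; V \<subseteq> U; s \<in> carrier (Mod M U)\<rbrakk>
      \<Longrightarrow> Res M U V s \<in> carrier (Mod M V)"
    and Res_add: "\<lbrakk>openin X U; openin X V; V \<subseteq> U; s \<in> carrier (Mod M U); t \<in> carrier (Mod M U)\<rbrakk>
      \<Longrightarrow> Res M U V (s \<oplus>\<^bsub>Mod M U\<^esub> t) = Res M U V s \<oplus>\<^bsub>Mod M V\<^esub> Res M U V t"
    and Res_smult: "\<lbrakk>openin X U; openin X V; V \<subseteq> U; f \<in> \<O> U; s \<in> carrier (Mod M U)\<rbrakk>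
      \<Longrightarrow> Res M U V (f \<odot>\<^bsub>Mod M U\<^esub> s) = restrict f V \<odot>\<^bsub>Mod M V\<^esub> Res M U V s"
    and Res_id: "\<lbrakk>openin X U; s \<in> carrier (Mod M U)\<rbrakk> \<Longrightarrow> Res M U U s = s"
    and Res_Res: "\<lbrakk>openin X U; openin X V; openin X W; W \<subseteq> V; V \<subseteq> U; s \<in> carrier (Mod M U)\<rbrakk>
      \<Longrightarrow> Res M V W (Res M U V s) = Res M U W s"
    and locality: "\<lbrakk>openin X U; s \<in> carrier (Mod M U); t \<in> carrier (Mod M U);
        \<And>x. x \<in> U \<Longrightarrow> \<exists>V. openin X V \<and> x \<in> V \<and> V \<subseteq> U \<and> Res M U V s = Res M U V t\<rbrakk> \<Longrightarrow> s = t"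
    and gluing: "\<lbrakk>\<And>V. V \<in> \<V> \<Longrightarrow> openin X V; \<And>V. V \<in> \<V> \<Longrightarrow> \<sigma> V \<in> carrier (Mod M V);
        \<And>V V'. \<lbrakk>V \<in> \<V>; V' \<in> \<V>\<rbrakk> \<Longrightarrow> Res M V (V \<inter> V') (\<sigma> V) = Res M V' (V \<inter> V') (\<sigma> V')\<rbrakk>
      \<Longrightarrow> \<exists>s\<in>carrier (Mod M (\<Union>\<V>)). \<forall>V\<in>\<V>. Res M (\<Union>\<V>) V s = \<sigma> V"

definition sheaf_hom ::
  "'x topology \<Rightarrow> ('x set \<Rightarrow> 'x fn set) \<Rightarrow> ('x, 's, 'm) omodule_scheme \<Rightarrow> ('x, 't, 'n) omodule_scheme
     \<Rightarrow> ('x set \<Rightarrow> 's \<Rightarrow> 't) \<Rightarrow> bool" where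
  "sheaf_hom X \<O> M N h \<longleftrightarrow> (\<forall>U. openin X U \<longrightarrow>
     (\<forall>s\<in>carrier (Mod M U). h U s \<in> carrier (Mod N U)) \<and>
     (\<forall>s\<in>carrier (Mod M U). \<forall>t\<in>carrier (Mod M U).
        h U (s \<oplus>\<^bsub>Mod M U\<^esub> t) = h U s \<oplus>\<^bsub>Mod N U\<^esub> h U t) \<and>
     (\<forall>f\<in>\<O> U. \<forall>s\<in>carrier (Mod M U). h U (f \<odot>\<^bsub>Mod M U\<^esub> s) = f \<odot>\<^bsub>Mod N U\<^esub> h U s) \<and>
     (\<forall>V. openin X V \<and> V \<subseteq> U \<longrightarrow>
        (\<forall>s\<in>carrier (Mod M U). h V (Res M U V s) = Res N U V (h U s))))"

definition locally_free_finite_rank ::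
  "'x topology \<Rightarrow> ('x set \<Rightarrow> 'x fn set) \<Rightarrow> ('x, 's, 'm) omodule_scheme \<Rightarrow> bool" where
  "locally_free_finite_rank X \<O> M \<longleftrightarrow> (\<forall>x\<in>topspace X. \<exists>U n e. openin X U \<and> x \<in> U \<and>
     (\<forall>j<n. e j \<in> carrier (Mod M U)) \<and>
     (\<forall>V. openin X V \<and> V \<subseteq> U \<longrightarrow> (\<forall>s\<in>carrier (Mod M V). \<exists>!c. c \<in> {..<n::nat} \<rightarrow>\<^sub>E \<O> V \<and>
        s = (\<Oplus>\<^bsub>Mod M V\<^esub>j\<in>{..<n}. c j \<odot>\<^bsub>Mod M V\<^esub> Res M U V (e j)))))"

definition subsheaf ::
  "'x topology \<Rightarrow> ('x set \<Rightarrow> 'x fn set) \<Rightarrow> ('x, 's, 'm) omodule_scheme \<Rightarrow> ('x set \<Rightarrow> 's set) \<Rightarrow> bool" where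
  "subsheaf X \<O> M K \<longleftrightarrow>
     (\<forall>U. openin X U \<longrightarrow> submodule (K U) (fn_ring U (\<O> U)) (Mod M U) \<and>
        (\<forall>V s. openin X V \<and> V \<subseteq> U \<and> s \<in> K U \<longrightarrow> Res M U V s \<in> K V) \<and>
        (\<forall>s\<in>carrier (Mod M U). (\<forall>x\<in>U. \<exists>V. openin X V \<and> x \<in> V \<and> V \<subseteq> U \<and> Res M U V s \<in> K V)
           \<longrightarrow> s \<in> K U)) \<and>
     (\<forall>U. \<not> openin X U \<longrightarrow> K U = {})"

text \<open>A sub-bundle is a submodule that is locally a direct summand. In a locally free module of
  finite rank this is the usual notion (the submodule and the quotient are then locally free); the
  definition also makes sense in modules, such as some inverse images below, that are not locally
  free.\<close>

definition subbundle ::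
  "'x topology \<Rightarrow> ('x set \<Rightarrow> 'x fn set) \<Rightarrow> ('x, 's, 'm) omodule_scheme \<Rightarrow> ('x set \<Rightarrow> 's set) \<Rightarrow> bool" where
  "subbundle X \<O> M K \<longleftrightarrow> subsheaf X \<O> M K \<and>
     (\<forall>x\<in>topspace X. \<exists>U C. openin X U \<and> x \<in> U \<and> subsheaf (subtopology X U) \<O> M C \<and>
        (\<forall>V. openin X V \<and> V \<subseteq> U \<longrightarrow> K V \<inter> C V = {\<zero>\<^bsub>Mod M V\<^esub>} \<and>
           (\<forall>s\<in>carrier (Mod M V). \<exists>a\<in>K V. \<exists>b\<in>C V. s = a \<oplus>\<^bsub>Mod M V\<^esub> b)))"

definition isotropic ::
  "'x topology \<Rightarrow> ('x set \<Rightarrow> 's \<Rightarrow> 's \<Rightarrow> 'x fn) \<Rightarrow> ('x set \<Rightarrow> 's set) \<Rightarrow> bool" where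
  "isotropic X p K \<longleftrightarrow> (\<forall>U. openin X U \<longrightarrow> (\<forall>s\<in>K U. \<forall>t\<in>K U. p U s t = (\<lambda>x\<in>U. 0)))"

text \<open>Maximality is among all isotropic submodules, not only among isotropic sub-bundles.\<close>

definition maximal_isotropic ::
  "'x topology \<Rightarrow> ('x set \<Rightarrow> 'x fn set) \<Rightarrow> ('x, 's, 'm) omodule_scheme \<Rightarrow> ('x set \<Rightarrow> 's \<Rightarrow> 's \<Rightarrow> 'x fn)
     \<Rightarrow> ('x set \<Rightarrow> 's set) \<Rightarrow> bool" where
  "maximal_isotropic X \<O> M p K \<longleftrightarrow> subsheaf X \<O> M K \<and> isotropic X p K \<and>
     (\<forall>K'. subsheaf X \<O> M K' \<and> isotropic X p K' \<and> K \<le> K' \<longrightarrow> K' = K)"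


section \<open>Vector fields and differential forms\<close>

text \<open>A vector field on \<open>U\<close> is a derivation of the sheaf \<open>\<O>\<close> on \<open>U\<close>, a form on \<open>U\<close> is a morphism from
  the sheaf of vector fields on \<open>U\<close> to \<open>\<O>\<close>. Both are families of maps indexed by the open \<open>V \<subseteq> U\<close>,
  undefined at all other sets; \<open>family X U D h\<close> is the family whose \<open>V\<close>-component sends \<open>a \<in> D V\<close> to
  the function \<open>h V a\<close> on \<open>V\<close>.\<close>

type_synonym 'x vfield = "'x set \<Rightarrow> 'x fn \<Rightarrow> 'x fn"
type_synonym 'x form = "'x set \<Rightarrow> 'x vfield \<Rightarrow> 'x fn"

definition family ::
  "'x topology \<Rightarrow> 'x set \<Rightarrow> ('x set \<Rightarrow> 'a set) \<Rightarrow> ('x set \<Rightarrow> 'a \<Rightarrow> 'x fn) \<Rightarrow> 'x set \<Rightarrow> 'a \<Rightarrow> 'x fn" where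
  "family X U D h = (\<lambda>V. if openin X V \<and> V \<subseteq> U then (\<lambda>a\<in>D V. restrict (h V a) V) else (\<lambda>_. undefined))"

definition family_res :: "'x topology \<Rightarrow> 'x set \<Rightarrow> ('x set \<Rightarrow> 'a \<Rightarrow> 'x fn) \<Rightarrow> 'x set \<Rightarrow> 'a \<Rightarrow> 'x fn" where
  "family_res X V v = (\<lambda>V'. if openin X V' \<and> V' \<subseteq> V then v V' else (\<lambda>_. undefined))"

text \<open>The fields \<open>mult\<close> and \<open>one\<close> of a module record carry no information.\<close>

definition family_module ::
  "'x topology \<Rightarrow> ('x set \<Rightarrow> 'a set) \<Rightarrow> ('x set \<Rightarrow> ('x set \<Rightarrow> 'a \<Rightarrow> 'x fn) set)
     \<Rightarrow> ('x, 'x set \<Rightarrow> 'a \<Rightarrow> 'x fn) omodule" where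
  "family_module X D C =
     \<lparr>Mod = (\<lambda>U. \<lparr>carrier = C U, mult = undefined, one = undefined,
        zero = family X U D (\<lambda>V a x. 0),
        add = (\<lambda>v w. family X U D (\<lambda>V a x. v V a x + w V a x)),
        smult = (\<lambda>f v. family X U D (\<lambda>V a x. f x * v V a x))\<rparr>),
      Res = (\<lambda>U V v. family_res X V v)\<rparr>"

definition vector_fields :: "'x topology \<Rightarrow> ('x set \<Rightarrow> 'x fn set) \<Rightarrow> 'x set \<Rightarrow> 'x vfield set" where
  "vector_fields X \<O> U = {v.
     (\<forall>V. openin X V \<and> V \<subseteq> U \<longrightarrow> v V \<in> \<O> V \<rightarrow>\<^sub>E \<O> V \<and>
        (\<forall>c. v V (\<lambda>x\<in>V. c) = (\<lambda>x\<in>V. 0)) \<and>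
        (\<forall>f\<in>\<O> V. \<forall>g\<in>\<O> V. v V (\<lambda>x\<in>V. f x + g x) = (\<lambda>x\<in>V. v V f x + v V g x) \<and>
           v V (\<lambda>x\<in>V. f x * g x) = (\<lambda>x\<in>V. v V f x * g x + f x * v V g x)) \<and>
        (\<forall>V' f. openin X V' \<and> V' \<subseteq> V \<and> f \<in> \<O> V \<longrightarrow>
           v V' (restrict f V') = restrict (v V f) V')) \<and>
     (\<forall>V. \<not> (openin X V \<and> V \<subseteq> U) \<longrightarrow> v V = (\<lambda>_. undefined))}"

definition lie_bracket ::
  "'x topology \<Rightarrow> ('x set \<Rightarrow> 'x fn set) \<Rightarrow> 'x set \<Rightarrow> 'x vfield \<Rightarrow> 'x vfield \<Rightarrow> 'x vfield" where
  "lie_bracket X \<O> U v w = family X U \<O> (\<lambda>V f x. v V (w V f) x - w V (v V f) x)"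

text \<open>\<open>lin_comb X \<O> U n g f\<close> is the form \<open>\<Sum>j<n. g j \<cdot> d (f j)\<close> on \<open>U\<close>.\<close>

definition lin_comb ::
  "'x topology \<Rightarrow> ('x set \<Rightarrow> 'x fn set) \<Rightarrow> 'x set \<Rightarrow> nat \<Rightarrow> (nat \<Rightarrow> 'x fn) \<Rightarrow> (nat \<Rightarrow> 'x fn) \<Rightarrow> 'x form" where
  "lin_comb X \<O> U n g f = family X U (vector_fields X \<O>)
     (\<lambda>V w x. \<Sum>j<n. g j x * w V (restrict (f j) V) x)"

definition differential ::
  "'x topology \<Rightarrow> ('x set \<Rightarrow> 'x fn set) \<Rightarrow> 'x set \<Rightarrow> 'x fn \<Rightarrow> 'x form" where
  "differential X \<O> U f = family X U (vector_fields X \<O>) (\<lambda>V w x. w V (restrict f V) x)"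

definition one_forms :: "'x topology \<Rightarrow> ('x set \<Rightarrow> 'x fn set) \<Rightarrow> 'x set \<Rightarrow> 'x form set" where
  "one_forms X \<O> U = {\<alpha>.
     (\<forall>V. openin X V \<and> V \<subseteq> U \<longrightarrow> \<alpha> V \<in> vector_fields X \<O> V \<rightarrow>\<^sub>E \<O> V \<and>
        (\<forall>V' w. openin X V' \<and> V' \<subseteq> V \<and> w \<in> vector_fields X \<O> V \<longrightarrow>
           \<alpha> V' (family_res X V' w) = restrict (\<alpha> V w) V')) \<and>
     (\<forall>V. \<not> (openin X V \<and> V \<subseteq> U) \<longrightarrow> \<alpha> V = (\<lambda>_. undefined)) \<and>
     (\<forall>x\<in>U. \<exists>V n g f. openin X V \<and> x \<in> V \<and> V \<subseteq> U \<and> (\<forall>j<n. g j \<in> \<O> V \<and> f j \<in> \<O> V) \<and>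
        family_res X V \<alpha> = lin_comb X \<O> V n g f)}"

text \<open>Cartan's formula \<open>(L\<^sub>v \<alpha>)(w) = v(\<alpha>(w)) - \<alpha>([v,w])\<close>.\<close>

definition lie_derivative ::
  "'x topology \<Rightarrow> ('x set \<Rightarrow> 'x fn set) \<Rightarrow> 'x set \<Rightarrow> 'x vfield \<Rightarrow> 'x form \<Rightarrow> 'x form" where
  "lie_derivative X \<O> U v \<alpha> = family X U (vector_fields X \<O>)
     (\<lambda>V w x. v V (\<alpha> V w) x - \<alpha> V (lie_bracket X \<O> V v w) x)"

definition tangent_sheaf :: "'x topology \<Rightarrow> ('x set \<Rightarrow> 'x fn set) \<Rightarrow> ('x, 'x vfield) omodule" where
  "tangent_sheaf X \<O> = family_module X \<O> (vector_fields X \<O>)"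

definition cotangent_sheaf :: "'x topology \<Rightarrow> ('x set \<Rightarrow> 'x fn set) \<Rightarrow> ('x, 'x form) omodule" where
  "cotangent_sheaf X \<O> = family_module X (vector_fields X \<O>) (one_forms X \<O>)"

text \<open>\<open>\<beta>\<close> on \<open>V \<inter> Z\<close> is the restriction \<open>i\<^sup>*\<alpha>\<close> of \<open>\<alpha>\<close> on \<open>V\<close>, by the formula
  \<open>i\<^sup>*(\<Sum>j. g j \<cdot> d (f j)) = \<Sum>j. i\<^sup>*(g j) \<cdot> d (i\<^sup>*(f j))\<close>.\<close>

definition form_restricts_to ::
  "'x topology \<Rightarrow> ('x set \<Rightarrow> 'x fn set) \<Rightarrow> 'x set \<Rightarrow> 'x set \<Rightarrow> 'x form \<Rightarrow> 'x form \<Rightarrow> bool" where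
  "form_restricts_to X \<O> Z V \<alpha> \<beta> \<longleftrightarrow> (\<forall>z\<in>V \<inter> Z. \<exists>V' n g f. openin X V' \<and> z \<in> V' \<and> V' \<subseteq> V \<and>
     (\<forall>j<n. g j \<in> \<O> V' \<and> f j \<in> \<O> V') \<and> family_res X V' \<alpha> = lin_comb X \<O> V' n g f \<and>
     family_res (subtopology X Z) (V' \<inter> Z) \<beta> =
       lin_comb (subtopology X Z) (restr_sheaf X \<O> Z) (V' \<inter> Z) n g f)"

text \<open>The forms on \<open>V\<close> whose class in \<open>i\<^sup>*\<Omega>\<^sup>1\<^sub>X\<close> is a section of the conormal bundle
  \<open>ker (i\<^sup>*\<Omega>\<^sup>1\<^sub>X \<rightarrow> \<Omega>\<^sup>1\<^sub>Z)\<close>.\<close>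

definition conormal_forms ::
  "'x topology \<Rightarrow> ('x set \<Rightarrow> 'x fn set) \<Rightarrow> 'x set \<Rightarrow> 'x set \<Rightarrow> 'x form set" where
  "conormal_forms X \<O> Z V = {\<gamma> \<in> one_forms X \<O> V. form_restricts_to X \<O> Z V \<gamma>
     \<zero>\<^bsub>Mod (cotangent_sheaf (subtopology X Z) (restr_sheaf X \<O> Z)) (V \<inter> Z)\<^esub>}"

text \<open>The image of \<open>v \<in> \<T>\<^sub>Z\<close> under the inclusion \<open>\<T>\<^sub>Z \<rightarrow> i\<^sup>*\<T>\<^sub>X\<close> is the class of \<open>u \<in> \<T>\<^sub>X\<close>. Sections of
  \<open>i\<^sup>*\<T>\<^sub>X\<close> are determined by their action \<open>\<O>\<^sub>X \<rightarrow> \<O>\<^sub>Z\<close>.\<close>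

definition field_restricts_to ::
  "'x topology \<Rightarrow> ('x set \<Rightarrow> 'x fn set) \<Rightarrow> 'x set \<Rightarrow> 'x set \<Rightarrow> 'x vfield \<Rightarrow> 'x vfield \<Rightarrow> bool" where
  "field_restricts_to X \<O> Z V u v \<longleftrightarrow> (\<forall>V' f. openin X V' \<and> V' \<subseteq> V \<and> f \<in> \<O> V' \<longrightarrow>
     restrict (u V' f) (V' \<inter> Z) = v (V' \<inter> Z) (restrict f (V' \<inter> Z)))"


section \<open>Inverse images and quotients of sheaves of modules\<close>

text \<open>For a family \<open>R\<close> of submodules \<open>R V\<close> of \<open>M(V)\<close> with \<open>\<I>\<^sub>Z M \<subseteq> R\<close>, \<open>restr_quot X \<O> M R Z\<close> is the
  \<open>\<O>\<^sub>Z\<close>-module \<open>i\<^sup>-\<^sup>1(M/R)\<close>, sheafified: a section assigns to each point an element of the stalk of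
  \<open>M/R\<close>, locally given by one section of \<open>M\<close>. Elements of the stalk at \<open>z\<close> are classes
  \<open>germ_class X M R z V s\<close> of sections \<open>s\<close> of \<open>M\<close> over neighbourhoods \<open>V\<close> of \<open>z\<close>.\<close>

definition germ_class ::
  "'x topology \<Rightarrow> ('x, 's, 'm) omodule_scheme \<Rightarrow> ('x set \<Rightarrow> 's set) \<Rightarrow> 'x \<Rightarrow> 'x set \<Rightarrow> 's \<Rightarrow> ('x set \<times> 's) set"
  where
  "germ_class X M R z V s = {(V', s'). openin X V' \<and> z \<in> V' \<and> s' \<in> carrier (Mod M V') \<and>
     (\<exists>V''. openin X V'' \<and> z \<in> V'' \<and> V'' \<subseteq> V \<inter> V' \<and>
        Res M V V'' s \<ominus>\<^bsub>Mod M V''\<^esub> Res M V' V'' s' \<in> R V'')}"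

definition germ_section ::
  "'x topology \<Rightarrow> ('x, 's, 'm) omodule_scheme \<Rightarrow> ('x set \<Rightarrow> 's set) \<Rightarrow> 'x set \<Rightarrow> 'x set \<Rightarrow> 's
     \<Rightarrow> 'x \<Rightarrow> ('x set \<times> 's) set" where
  "germ_section X M R Z V s = (\<lambda>z\<in>V \<inter> Z. germ_class X M R z V s)"

definition restr_quot ::
  "'x topology \<Rightarrow> ('x set \<Rightarrow> 'x fn set) \<Rightarrow> ('x, 's, 'm) omodule_scheme \<Rightarrow> ('x set \<Rightarrow> 's set) \<Rightarrow> 'x set
     \<Rightarrow> ('x, 'x \<Rightarrow> ('x set \<times> 's) set) omodule" where
  "restr_quot X \<O> M R Z =
     \<lparr>Mod = (\<lambda>W. \<lparr>carrier = {\<sigma> \<in> extensional W. \<forall>z\<in>W. \<exists>V s. openin X V \<and> z \<in> V \<and> V \<inter> Z \<subseteq> W \<and>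
          s \<in> carrier (Mod M V) \<and> restrict \<sigma> (V \<inter> Z) = germ_section X M R Z V s},
        mult = undefined, one = undefined,
        zero = (\<lambda>z\<in>W. germ_class X M R z (topspace X) \<zero>\<^bsub>Mod M (topspace X)\<^esub>),
        add = (\<lambda>\<sigma> \<tau>. \<lambda>z\<in>W. \<Union>{germ_class X M R z V (s \<oplus>\<^bsub>Mod M V\<^esub> t) | V s t.
          (V, s) \<in> \<sigma> z \<and> (V, t) \<in> \<tau> z}),
        smult = (\<lambda>f \<sigma>. \<lambda>z\<in>W. \<Union>{germ_class X M R z V (g \<odot>\<^bsub>Mod M V\<^esub> s) | V s g.
          (V, s) \<in> \<sigma> z \<and> V \<inter> Z \<subseteq> W \<and> g \<in> \<O> V \<and> (\<forall>y\<in>V \<inter> Z. g y = f y)})\<rparr>),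
      Res = (\<lambda>W W' \<sigma>. restrict \<sigma> W')\<rparr>"

text \<open>\<open>\<I>\<^sub>Z(V) \<cdot> M(V)\<close>, for the ideal \<open>\<I>\<^sub>Z\<close> of functions vanishing on \<open>Z\<close>.\<close>

definition ideal_multiples ::
  "('x set \<Rightarrow> 'x fn set) \<Rightarrow> ('x, 's, 'm) omodule_scheme \<Rightarrow> 'x set \<Rightarrow> 'x set \<Rightarrow> 's set" where
  "ideal_multiples \<O> M Z V = {(\<Oplus>\<^bsub>Mod M V\<^esub>j\<in>{..<n}. f j \<odot>\<^bsub>Mod M V\<^esub> s j) | (n::nat) f s.
     \<forall>j<n. f j \<in> \<O> V \<and> (\<forall>y\<in>V \<inter> Z. f j y = 0) \<and> s j \<in> carrier (Mod M V)}"

text \<open>\<open>i\<^sup>*M = \<O>\<^sub>Z \<otimes> i\<^sup>-\<^sup>1M = i\<^sup>-\<^sup>1(M/\<I>\<^sub>Z M)\<close>, and the class \<open>s|\<^sub>Z\<close> of a section \<open>s\<close> of \<open>M\<close> over \<open>V\<close>.\<close>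

definition inverse_image ::
  "'x topology \<Rightarrow> ('x set \<Rightarrow> 'x fn set) \<Rightarrow> ('x, 's, 'm) omodule_scheme \<Rightarrow> 'x set
     \<Rightarrow> ('x, 'x \<Rightarrow> ('x set \<times> 's) set) omodule" where
  "inverse_image X \<O> M Z = restr_quot X \<O> M (ideal_multiples \<O> M Z) Z"

definition restr_section ::
  "'x topology \<Rightarrow> ('x set \<Rightarrow> 'x fn set) \<Rightarrow> ('x, 's, 'm) omodule_scheme \<Rightarrow> 'x set \<Rightarrow> 'x set \<Rightarrow> 's
     \<Rightarrow> 'x \<Rightarrow> ('x set \<times> 's) set" where
  "restr_section X \<O> M Z V s = germ_section X M (ideal_multiples \<O> M Z) Z V s"


section \<open>Courant algebroids\<close>

record ('x, 's) courant = "('x, 's) omodule" +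
  bracket :: "'x set \<Rightarrow> 's \<Rightarrow> 's \<Rightarrow> 's"
  anchor :: "'x set \<Rightarrow> 's \<Rightarrow> 'x vfield"
  pairing :: "'x set \<Rightarrow> 's \<Rightarrow> 's \<Rightarrow> 'x fn"
  coanchor :: "'x set \<Rightarrow> 'x form \<Rightarrow> 's"

locale courant_algebroid = module_sheaf X \<O> Q
  for X :: "'x topology" and \<O> :: "'x set \<Rightarrow> 'x fn set" and Q :: "('x, 's) courant" +
  assumes bracket_closed: "\<lbrakk>openin X U; p \<in> carrier (Mod Q U); q \<in> carrier (Mod Q U)\<rbrakk>
      \<Longrightarrow> bracket Q U p q \<in> carrier (Mod Q U)"
    and bracket_Res: "\<lbrakk>openin X U; openin X V; V \<subseteq> U; p \<in> carrier (Mod Q U); q \<in> carrier (Mod Q U)\<rbrakk>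
      \<Longrightarrow> Res Q U V (bracket Q U p q) = bracket Q V (Res Q U V p) (Res Q U V q)"
    and bracket_add: "\<lbrakk>openin X U; p \<in> carrier (Mod Q U); q \<in> carrier (Mod Q U); r \<in> carrier (Mod Q U)\<rbrakk>
      \<Longrightarrow> bracket Q U (p \<oplus>\<^bsub>Mod Q U\<^esub> q) r = bracket Q U p r \<oplus>\<^bsub>Mod Q U\<^esub> bracket Q U q r \<and>
          bracket Q U r (p \<oplus>\<^bsub>Mod Q U\<^esub> q) = bracket Q U r p \<oplus>\<^bsub>Mod Q U\<^esub> bracket Q U r q"
    and bracket_const: "\<lbrakk>openin X U; p \<in> carrier (Mod Q U); q \<in> carrier (Mod Q U)\<rbrakk>
      \<Longrightarrow> bracket Q U ((\<lambda>x\<in>U. c) \<odot>\<^bsub>Mod Q U\<^esub> p) q = (\<lambda>x\<in>U. c) \<odot>\<^bsub>Mod Q U\<^esub> bracket Q U p q \<and>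
          bracket Q U p ((\<lambda>x\<in>U. c) \<odot>\<^bsub>Mod Q U\<^esub> q) = (\<lambda>x\<in>U. c) \<odot>\<^bsub>Mod Q U\<^esub> bracket Q U p q"
    and bracket_Leibniz:
      "\<lbrakk>openin X U; p \<in> carrier (Mod Q U); q \<in> carrier (Mod Q U); r \<in> carrier (Mod Q U)\<rbrakk>
      \<Longrightarrow> bracket Q U p (bracket Q U q r) =
          bracket Q U (bracket Q U p q) r \<oplus>\<^bsub>Mod Q U\<^esub> bracket Q U q (bracket Q U p r)"
    and anchor_hom: "sheaf_hom X \<O> Q (tangent_sheaf X \<O>) (anchor Q)"
    and anchor_bracket: "\<lbrakk>openin X U; p \<in> carrier (Mod Q U); q \<in> carrier (Mod Q U)\<rbrakk>
      \<Longrightarrow> anchor Q U (bracket Q U p q) = lie_bracket X \<O> U (anchor Q U p) (anchor Q U q)"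
    and pairing_closed: "\<lbrakk>openin X U; p \<in> carrier (Mod Q U); q \<in> carrier (Mod Q U)\<rbrakk>
      \<Longrightarrow> pairing Q U p q \<in> \<O> U"
    and pairing_Res: "\<lbrakk>openin X U; openin X V; V \<subseteq> U; p \<in> carrier (Mod Q U); q \<in> carrier (Mod Q U)\<rbrakk>
      \<Longrightarrow> restrict (pairing Q U p q) V = pairing Q V (Res Q U V p) (Res Q U V q)"
    and pairing_sym: "\<lbrakk>openin X U; p \<in> carrier (Mod Q U); q \<in> carrier (Mod Q U)\<rbrakk>
      \<Longrightarrow> pairing Q U p q = pairing Q U q p"
    and pairing_add: "\<lbrakk>openin X U; p \<in> carrier (Mod Q U); q \<in> carrier (Mod Q U); r \<in> carrier (Mod Q U)\<rbrakk>
      \<Longrightarrow> pairing Q U (p \<oplus>\<^bsub>Mod Q U\<^esub> q) r = (\<lambda>x\<in>U. pairing Q U p r x + pairing Q U q r x)"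
    and pairing_smult: "\<lbrakk>openin X U; f \<in> \<O> U; p \<in> carrier (Mod Q U); q \<in> carrier (Mod Q U)\<rbrakk>
      \<Longrightarrow> pairing Q U (f \<odot>\<^bsub>Mod Q U\<^esub> p) q = (\<lambda>x\<in>U. f x * pairing Q U p q x)"
    and coanchor_hom: "sheaf_hom X \<O> (cotangent_sheaf X \<O>) Q (coanchor Q)"
    and anchor_coanchor: "\<lbrakk>openin X U; \<alpha> \<in> one_forms X \<O> U\<rbrakk>
      \<Longrightarrow> anchor Q U (coanchor Q U \<alpha>) = \<zero>\<^bsub>Mod (tangent_sheaf X \<O>) U\<^esub>"
    and bracket_smult: "\<lbrakk>openin X U; f \<in> \<O> U; p \<in> carrier (Mod Q U); q \<in> carrier (Mod Q U)\<rbrakk>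
      \<Longrightarrow> bracket Q U p (f \<odot>\<^bsub>Mod Q U\<^esub> q) =
          f \<odot>\<^bsub>Mod Q U\<^esub> bracket Q U p q \<oplus>\<^bsub>Mod Q U\<^esub> anchor Q U p U f \<odot>\<^bsub>Mod Q U\<^esub> q"
    and pairing_invariant:
      "\<lbrakk>openin X U; p \<in> carrier (Mod Q U); q \<in> carrier (Mod Q U); r \<in> carrier (Mod Q U)\<rbrakk>
      \<Longrightarrow> (\<lambda>x\<in>U. pairing Q U (bracket Q U p q) r x + pairing Q U q (bracket Q U p r) x) =
          anchor Q U p U (pairing Q U q r)"
    and bracket_coanchor: "\<lbrakk>openin X U; p \<in> carrier (Mod Q U); \<alpha> \<in> one_forms X \<O> U\<rbrakk>
      \<Longrightarrow> bracket Q U p (coanchor Q U \<alpha>) =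
          coanchor Q U (lie_derivative X \<O> U (anchor Q U p) \<alpha>)"
    and pairing_coanchor: "\<lbrakk>openin X U; p \<in> carrier (Mod Q U); \<alpha> \<in> one_forms X \<O> U\<rbrakk>
      \<Longrightarrow> pairing Q U p (coanchor Q U \<alpha>) = \<alpha> U (anchor Q U p)"
    and bracket_sym: "\<lbrakk>openin X U; p \<in> carrier (Mod Q U); q \<in> carrier (Mod Q U)\<rbrakk>
      \<Longrightarrow> bracket Q U p q \<oplus>\<^bsub>Mod Q U\<^esub> bracket Q U q p =
          coanchor Q U (differential X \<O> U (pairing Q U p q))"


section \<open>The inverse image Courant algebroid\<close>

definition restr_pairing ::
  "'x topology \<Rightarrow> ('x, 's) courant \<Rightarrow> 'x set \<Rightarrow> ('x \<Rightarrow> ('x set \<times> 's) set) \<Rightarrow> ('x \<Rightarrow> ('x set \<times> 's) set)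
     \<Rightarrow> 'x fn" where
  "restr_pairing X Q W \<sigma> \<tau> =
     (\<lambda>z\<in>W. the_elem {pairing Q V p q z | V p q. (V, p) \<in> \<sigma> z \<and> (V, q) \<in> \<tau> z})"

text \<open>\<open>\<T>\<^sub>Z \<times>\<^bsub>i\<^sup>*\<T>\<^sub>X\<^esub> i\<^sup>*\<Q>\<close>, embedded in \<open>i\<^sup>*\<Q>\<close> by the second projection (which is injective because
  \<open>\<T>\<^sub>Z \<rightarrow> i\<^sup>*\<T>\<^sub>X\<close> is).\<close>

definition fibre_product ::
  "'x topology \<Rightarrow> ('x set \<Rightarrow> 'x fn set) \<Rightarrow> ('x, 's) courant \<Rightarrow> 'x set \<Rightarrow> 'x set
     \<Rightarrow> ('x \<Rightarrow> ('x set \<times> 's) set) set" where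
  "fibre_product X \<O> Q Z W = {\<sigma>. openin (subtopology X Z) W \<and>
     \<sigma> \<in> carrier (Mod (inverse_image X \<O> Q Z) W) \<and>
     (\<forall>z\<in>W. \<exists>V q v. openin X V \<and> z \<in> V \<and> V \<inter> Z \<subseteq> W \<and> q \<in> carrier (Mod Q V) \<and>
        restrict \<sigma> (V \<inter> Z) = restr_section X \<O> Q Z V q \<and>
        v \<in> vector_fields (subtopology X Z) (restr_sheaf X \<O> Z) (V \<inter> Z) \<and>
        field_restricts_to X \<O> Z V (anchor Q V q) v)}"

text \<open>The image of the conormal bundle under \<open>\<pi>\<^sup>\<dagger> : i\<^sup>*\<Omega>\<^sup>1\<^sub>X \<rightarrow> i\<^sup>*\<Q>\<close>.\<close>

definition conormal_image ::
  "'x topology \<Rightarrow> ('x set \<Rightarrow> 'x fn set) \<Rightarrow> ('x, 's) courant \<Rightarrow> 'x set \<Rightarrow> 'x set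
     \<Rightarrow> ('x \<Rightarrow> ('x set \<times> 's) set) set" where
  "conormal_image X \<O> Q Z W = {\<sigma>. openin (subtopology X Z) W \<and>
     \<sigma> \<in> carrier (Mod (inverse_image X \<O> Q Z) W) \<and>
     (\<forall>z\<in>W. \<exists>V \<gamma>. openin X V \<and> z \<in> V \<and> V \<inter> Z \<subseteq> W \<and> \<gamma> \<in> conormal_forms X \<O> Z V \<and>
        restrict \<sigma> (V \<inter> Z) = restr_section X \<O> Q Z V (coanchor Q V \<gamma>))}"

definition fibre_product_sheaf ::
  "'x topology \<Rightarrow> ('x set \<Rightarrow> 'x fn set) \<Rightarrow> ('x, 's) courant \<Rightarrow> 'x set
     \<Rightarrow> ('x, 'x \<Rightarrow> ('x set \<times> 's) set) omodule" where
  "fibre_product_sheaf X \<O> Q Z =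
     \<lparr>Mod = (\<lambda>W. (Mod (inverse_image X \<O> Q Z) W)\<lparr>carrier := fibre_product X \<O> Q Z W\<rparr>),
      Res = Res (inverse_image X \<O> Q Z)\<rparr>"

type_synonym ('x, 's) pullback_section = "'x \<Rightarrow> ('x set \<times> ('x \<Rightarrow> ('x set \<times> 's) set)) set"

definition pullback_module ::
  "'x topology \<Rightarrow> ('x set \<Rightarrow> 'x fn set) \<Rightarrow> ('x, 's) courant \<Rightarrow> 'x set
     \<Rightarrow> ('x, ('x, 's) pullback_section) omodule" where
  "pullback_module X \<O> Q Z = restr_quot (subtopology X Z) (restr_sheaf X \<O> Z)
     (fibre_product_sheaf X \<O> Q Z) (conormal_image X \<O> Q Z) Z"

text \<open>The class in the stalk of \<open>i\<^sup>+\<^sup>+\<Q>\<close> at \<open>z\<close> of the restriction to \<open>Z\<close> of a section \<open>q\<close> of \<open>\<Q>\<close> over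
  \<open>V\<close> whose anchor is tangent to \<open>Z\<close>.\<close>

definition pullback_class ::
  "'x topology \<Rightarrow> ('x set \<Rightarrow> 'x fn set) \<Rightarrow> ('x, 's) courant \<Rightarrow> 'x set \<Rightarrow> 'x \<Rightarrow> 'x set \<Rightarrow> 's
     \<Rightarrow> ('x set \<times> ('x \<Rightarrow> ('x set \<times> 's) set)) set" where
  "pullback_class X \<O> Q Z z V q = germ_class (subtopology X Z) (fibre_product_sheaf X \<O> Q Z)
     (conormal_image X \<O> Q Z) z (V \<inter> Z) (restr_section X \<O> Q Z V q)"

text \<open>\<open>q\<close> over the neighbourhood \<open>V\<close> of \<open>z\<close> restricts on \<open>Z\<close> to a section of
  \<open>\<T>\<^sub>Z \<times>\<^bsub>i\<^sup>*\<T>\<^sub>X\<^esub> i\<^sup>*\<Q>\<close> representing the element \<open>c\<close> of the stalk of \<open>i\<^sup>+\<^sup>+\<Q>\<close> at \<open>z\<close>.\<close>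

definition lifts_at ::
  "'x topology \<Rightarrow> ('x set \<Rightarrow> 'x fn set) \<Rightarrow> ('x, 's) courant \<Rightarrow> 'x set \<Rightarrow> 'x
     \<Rightarrow> ('x set \<times> ('x \<Rightarrow> ('x set \<times> 's) set)) set \<Rightarrow> 'x set \<Rightarrow> 's \<Rightarrow> bool" where
  "lifts_at X \<O> Q Z z c V q \<longleftrightarrow> openin X V \<and> z \<in> V \<and> q \<in> carrier (Mod Q V) \<and>
     (V \<inter> Z, restr_section X \<O> Q Z V q) \<in> c"

definition pullback_courant ::
  "'x topology \<Rightarrow> ('x set \<Rightarrow> 'x fn set) \<Rightarrow> ('x, 's) courant \<Rightarrow> 'x set
     \<Rightarrow> ('x, ('x, 's) pullback_section) courant" where
  "pullback_courant X \<O> Q Z =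
     \<lparr>Mod = Mod (pullback_module X \<O> Q Z),
      Res = Res (pullback_module X \<O> Q Z),
      bracket = (\<lambda>W s t. \<lambda>z\<in>W. \<Union>{pullback_class X \<O> Q Z z V (bracket Q V q p) | V q p.
        lifts_at X \<O> Q Z z (s z) V q \<and> lifts_at X \<O> Q Z z (t z) V p}),
      anchor = (\<lambda>W s. family (subtopology X Z) W (restr_sheaf X \<O> Z) (\<lambda>W' f z.
        the_elem {anchor Q V q V g z | V q g. lifts_at X \<O> Q Z z (s z) V q \<and> V \<inter> Z \<subseteq> W' \<and>
          g \<in> \<O> V \<and> (\<forall>y\<in>V \<inter> Z. g y = f y)})),
      pairing = (\<lambda>W s t. \<lambda>z\<in>W. the_elem {restr_pairing X Q V a b z | V a b.
        (V, a) \<in> s z \<and> (V, b) \<in> t z}),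
      coanchor = (\<lambda>W \<beta>. \<lambda>z\<in>W. \<Union>{pullback_class X \<O> Q Z z V (coanchor Q V \<gamma>) | V \<gamma>.
        openin X V \<and> z \<in> V \<and> V \<inter> Z \<subseteq> W \<and> \<gamma> \<in> one_forms X \<O> V \<and>
        form_restricts_to X \<O> Z V \<gamma> (family_res (subtopology X Z) (V \<inter> Z) \<beta>)})\<rparr>"


section \<open>Dirac structures\<close>

definition almost_dirac_supported ::
  "'x topology \<Rightarrow> ('x set \<Rightarrow> 'x fn set) \<Rightarrow> ('x, 's) courant \<Rightarrow> 'x set
     \<Rightarrow> ('x set \<Rightarrow> ('x \<Rightarrow> ('x set \<times> 's) set) set) \<Rightarrow> bool" where
  "almost_dirac_supported X \<O> Q Z K \<longleftrightarrow>
     subbundle (subtopology X Z) (restr_sheaf X \<O> Z) (inverse_image X \<O> Q Z) K \<and>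
     maximal_isotropic (subtopology X Z) (restr_sheaf X \<O> Z) (inverse_image X \<O> Q Z)
       (restr_pairing X Q) K \<and>
     (\<forall>W. openin (subtopology X Z) W \<longrightarrow> K W \<subseteq> fibre_product X \<O> Q Z W)"

definition lifted_sections ::
  "'x topology \<Rightarrow> ('x set \<Rightarrow> 'x fn set) \<Rightarrow> ('x, 's) courant \<Rightarrow> 'x set
     \<Rightarrow> ('x set \<Rightarrow> ('x \<Rightarrow> ('x set \<times> 's) set) set) \<Rightarrow> 'x set \<Rightarrow> 's set" where
  "lifted_sections X \<O> Q Z K V =
     {q \<in> carrier (Mod Q V). restr_section X \<O> Q Z V q \<in> K (V \<inter> Z)}"

definition dirac_supported ::
  "'x topology \<Rightarrow> ('x set \<Rightarrow> 'x fn set) \<Rightarrow> ('x, 's) courant \<Rightarrow> 'x set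
     \<Rightarrow> ('x set \<Rightarrow> ('x \<Rightarrow> ('x set \<times> 's) set) set) \<Rightarrow> bool" where
  "dirac_supported X \<O> Q Z K \<longleftrightarrow> almost_dirac_supported X \<O> Q Z K \<and>
     (\<forall>V. openin X V \<longrightarrow> (\<forall>p\<in>lifted_sections X \<O> Q Z K V. \<forall>q\<in>lifted_sections X \<O> Q Z K V.
        bracket Q V p q \<in> lifted_sections X \<O> Q Z K V))"

text \<open>Structures supported on the whole manifold. For \<open>Z = X\<close> one has \<open>i\<^sup>*\<Q> = \<Q>\<close>, the condition on the
  anchor is void, and the submodule of lifted sections is \<open>K\<close> itself.\<close>

definition almost_dirac ::
  "'x topology \<Rightarrow> ('x set \<Rightarrow> 'x fn set) \<Rightarrow> ('x, 's) courant \<Rightarrow> ('x set \<Rightarrow> 's set) \<Rightarrow> bool" where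
  "almost_dirac X \<O> Q K \<longleftrightarrow> subbundle X \<O> Q K \<and> maximal_isotropic X \<O> Q (pairing Q) K"

definition dirac ::
  "'x topology \<Rightarrow> ('x set \<Rightarrow> 'x fn set) \<Rightarrow> ('x, 's) courant \<Rightarrow> ('x set \<Rightarrow> 's set) \<Rightarrow> bool" where
  "dirac X \<O> Q K \<longleftrightarrow> almost_dirac X \<O> Q K \<and>
     (\<forall>U. openin X U \<longrightarrow> (\<forall>p\<in>K U. \<forall>q\<in>K U. bracket Q U p q \<in> K U))"

text \<open>\<open>i\<^sup>+\<^sup>+K = K / \<pi>\<^sup>\<dagger>(N\<^sup>\<or>)\<close>, as the image of \<open>K\<close> in \<open>i\<^sup>+\<^sup>+\<Q>\<close>.\<close>

definition pullback_dirac ::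
  "'x topology \<Rightarrow> ('x set \<Rightarrow> 'x fn set) \<Rightarrow> ('x, 's) courant \<Rightarrow> 'x set
     \<Rightarrow> ('x set \<Rightarrow> ('x \<Rightarrow> ('x set \<times> 's) set) set) \<Rightarrow> 'x set \<Rightarrow> ('x, 's) pullback_section set" where
  "pullback_dirac X \<O> Q Z K W = {s. openin (subtopology X Z) W \<and>
     s \<in> carrier (Mod (pullback_courant X \<O> Q Z) W) \<and> (\<forall>z\<in>W. \<exists>V a. (V, a) \<in> s z \<and> a \<in> K V)}"

end

theory Submission
  imports Defs
begin

text \<open>Write \<open>F\<close> for the fibre product \<open>\<T>\<^sub>Z \<times> i\<^sup>*\<Q> \<subseteq> i\<^sup>*\<Q>\<close> and \<open>N\<close> for the image of the conormal bundle in \<open>i\<^sup>*\<Q>\<close>, so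
  that the inverse image Courant algebroid is \<open>F/N\<close>. Everything rests on the fact that \<open>F\<close> is the
  orthogonal complement of \<open>N\<close>. The pairing of a section \<open>q\<close> with \<open>\<pi>\<^sup>\<dagger>(\<alpha>)\<close> is \<open>\<alpha>(\<pi>(q))\<close>, and a conormal form
  vanishes on fields tangent to \<open>Z\<close>; so \<open>N\<close> is orthogonal to \<open>F\<close> (\<open>restr_pairing_N_F\<close>) and the pairing descends
  to \<open>F/N\<close>. Conversely \<open>d h\<close> is conormal for every function \<open>h\<close> vanishing on \<open>Z\<close>, and its pairing with \<open>q\<close> is
  \<open>\<pi>(q)(h)\<close>; if \<open>q\<close> is orthogonal to \<open>N\<close>, then \<open>\<pi>(q)\<close> preserves the ideal of \<open>Z\<close>, hence acts on the functions on
  \<open>Z\<close>, and \<open>q\<close> is in \<open>F\<close> (\<open>F_if_orthogonal\<close>, \<open>tangent_field_restricts\<close>). In this form tangency is a matter of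
  derivations of the sheaf of functions and is treated without coordinates.

  The statements on almost Dirac structures are then those on subsheaves of \<open>i\<^sup>*\<Q>\<close> between \<open>N\<close> and \<open>F\<close> and
  their images in \<open>F/N\<close>, for an arbitrary quotient map of sheaves of modules (locales \<open>quotient_map\<close> and
  \<open>isotropic_quotient\<close>). If \<open>K \<subseteq> F\<close> is maximal isotropic, the preimage of its image is isotropic and contains
  \<open>K\<close> and \<open>N\<close>, so it is \<open>K\<close> (\<open>preimage_image_maximal_isotropic\<close>); this gives \<open>N \<subseteq> K\<close> and the injectivity. If \<open>L\<close> is
  maximal isotropic in \<open>F/N\<close>, an isotropic enlargement of its preimage contains \<open>N\<close>, hence lies in the
  orthogonal complement \<open>F\<close> of \<open>N\<close> and is the preimage of an isotropic enlargement of \<open>L\<close>. Local complements pass to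
  the quotient because the component of a lift along a complement of \<open>K \<supseteq> N\<close> does not depend on the lift
  (\<open>lift_along_complement\<close>), and from the quotient to \<open>i\<^sup>*\<Q>\<close> if \<open>F\<close> and \<open>N\<close> have complements themselves
  (\<open>complementary_preimage\<close>).

  For the bracket, sections that restrict to \<open>N\<close> form an ideal in those with tangent anchor: \<open>{p, \<pi>\<^sup>\<dagger>(\<alpha>)}\<close> is
  \<open>\<pi>\<^sup>\<dagger>\<close> of the Lie derivative of \<open>\<alpha>\<close>, whose restriction to \<open>Z\<close> is a Lie derivative of zero
  (\<open>lie_derivative_null_comb\<close>), and the bracket in the other order differs by \<open>\<pi>\<^sup>\<dagger>(d h)\<close> for a function \<open>h\<close>
  vanishing on \<open>Z\<close>. So the bracket of \<open>F/N\<close> may be computed from any lifts, in particular from lifts that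
  restrict to \<open>K\<close>, and these are closed under the bracket of \<open>\<Q>\<close>.

  Sections of \<open>i\<^sup>*\<Q>\<close> and of \<open>F/N\<close> are families of germs; both are instances of one construction, whose sheaf
  properties are established in the locale \<open>germ_quotient\<close>.\<close>

section \<open>Sheaves of functions and of modules\<close>

lemma (in abelian_group) r_neg3: "\<lbrakk>x \<in> carrier G; y \<in> carrier G\<rbrakk> \<Longrightarrow> x \<oplus> (y \<oplus> \<ominus> x) = y"
  by (simp add: a_lcomm[of x y] r_neg)

lemma (in abelian_group) minus_arith:
  shows "\<lbrakk>a \<in> carrier G; b \<in> carrier G\<rbrakk> \<Longrightarrow> (a \<ominus> b) \<oplus> b = a"
    and "\<lbrakk>a \<in> carrier G; b \<in> carrier G\<rbrakk> \<Longrightarrow> (a \<oplus> b) \<ominus> b = a"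
    and "\<lbrakk>a \<in> carrier G; b \<in> carrier G\<rbrakk> \<Longrightarrow> (a \<oplus> b) \<ominus> a = b"
    and "\<lbrakk>a \<in> carrier G; b \<in> carrier G\<rbrakk> \<Longrightarrow> b \<oplus> (a \<ominus> b) = a"
    and "\<lbrakk>a \<in> carrier G; b \<in> carrier G; c \<in> carrier G\<rbrakk> \<Longrightarrow> (a \<ominus> b) \<oplus> (b \<ominus> c) = a \<ominus> c"
    and "\<lbrakk>a \<in> carrier G; b \<in> carrier G\<rbrakk> \<Longrightarrow> \<ominus> (a \<ominus> b) = b \<ominus> a"
    and "\<lbrakk>a \<in> carrier G; b \<in> carrier G; c \<in> carrier G; d \<in> carrier G\<rbrakk> \<Longrightarrow> (a \<oplus> b) \<ominus> (c \<oplus> d) = (a \<ominus> c) \<oplus> (b \<ominus> d)"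
    and "\<lbrakk>a \<in> carrier G; b \<in> carrier G; c \<in> carrier G; d \<in> carrier G\<rbrakk> \<Longrightarrow> (a \<oplus> b) \<oplus> (c \<oplus> d) = (a \<oplus> c) \<oplus> (b \<oplus> d)"
    and "a \<in> carrier G \<Longrightarrow> a \<ominus> \<zero> = a"
    and "a \<in> carrier G \<Longrightarrow> a \<ominus> a = \<zero>"
    and "\<lbrakk>a \<in> carrier G; b \<in> carrier G; c \<in> carrier G\<rbrakk> \<Longrightarrow> (a \<ominus> b) \<oplus> (b \<oplus> c) = a \<oplus> c"
    and "\<lbrakk>a \<in> carrier G; b \<in> carrier G\<rbrakk> \<Longrightarrow> a \<ominus> b = \<zero> \<longleftrightarrow> a = b"
proof -
  show "a \<ominus> b = \<zero> \<longleftrightarrow> a = b" if "a \<in> carrier G" "b \<in> carrier G"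
    using minus_equality[of a "\<ominus> b"] that by (auto simp: a_minus_def r_neg)
qed (simp_all add: a_minus_def minus_add a_ac r_neg l_neg r_neg1 r_neg2 r_neg3)

lemma sum_split:
  fixes P :: "nat \<Rightarrow> complex"
  shows "(\<Sum>j<n + m. P j) = (\<Sum>j<n. P j) + (\<Sum>j<m. P (n + j))"
  by (induction m) (simp_all add: add.assoc)

lemma fn_ring_simps [simp]:
  "carrier (fn_ring U A) = A"
  "f \<otimes>\<^bsub>fn_ring U A\<^esub> g = (\<lambda>x\<in>U. f x * g x)"
  "\<one>\<^bsub>fn_ring U A\<^esub> = (\<lambda>x\<in>U. 1)"
  "\<zero>\<^bsub>fn_ring U A\<^esub> = (\<lambda>x\<in>U. 0)"
  "f \<oplus>\<^bsub>fn_ring U A\<^esub> g = (\<lambda>x\<in>U. f x + g x)"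
  by (simp_all add: fn_ring_def)

context function_sheaf
begin

lemma restrict_section [simp]: "\<lbrakk>openin X U; f \<in> \<O> U\<rbrakk> \<Longrightarrow> restrict f U = f"
  using extensional by (auto intro: extensional_restrict)

lemma uminus: "\<lbrakk>openin X U; f \<in> \<O> U\<rbrakk> \<Longrightarrow> (\<lambda>x\<in>U. - f x) \<in> \<O> U"
  using mult[OF _ const[of U "-1"], of f] by (simp cong: restrict_cong)

lemma diff: "\<lbrakk>openin X U; f \<in> \<O> U; g \<in> \<O> U\<rbrakk> \<Longrightarrow> (\<lambda>x\<in>U. f x - g x) \<in> \<O> U"
  using add[OF _ _ uminus, of U f g] by (simp cong: restrict_cong)

lemma sum:
  assumes U: "openin X U" and f: "\<And>j. j < (n::nat) \<Longrightarrow> f j \<in> \<O> U"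
  shows "(\<lambda>x\<in>U. \<Sum>j<n. f j x) \<in> \<O> U"
  using f
proof (induction n)
  case 0
  show ?case using const[OF U, of 0] by (simp add: restrict_def)
next
  case (Suc n)
  then show ?case using add[OF U Suc.IH, of "f n"] by (simp add: restrict_def cong: if_cong)
qed

lemma cring_sections:
  assumes U: "openin X U"
  shows "cring (fn_ring U (\<O> U))"
proof (rule cringI)
  show "abelian_group (fn_ring U (\<O> U))"
  proof (rule abelian_groupI)
    fix f assume f: "f \<in> carrier (fn_ring U (\<O> U))"
    then show "\<exists>g\<in>carrier (fn_ring U (\<O> U)). g \<oplus>\<^bsub>fn_ring U (\<O> U)\<^esub> f = \<zero>\<^bsub>fn_ring U (\<O> U)\<^esub>"
      using uminus[OF U, of f] by (intro bexI[of _ "\<lambda>x\<in>U. - f x"]) (auto cong: restrict_cong)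
    from f show "\<zero>\<^bsub>fn_ring U (\<O> U)\<^esub> \<oplus>\<^bsub>fn_ring U (\<O> U)\<^esub> f = f"
      using U by (simp cong: restrict_cong)
  qed (use U in \<open>auto simp: add const add_ac cong: restrict_cong\<close>)
  show "comm_monoid (fn_ring U (\<O> U))"
  proof (rule comm_monoidI)
    fix f assume f: "f \<in> carrier (fn_ring U (\<O> U))"
    then show "\<one>\<^bsub>fn_ring U (\<O> U)\<^esub> \<otimes>\<^bsub>fn_ring U (\<O> U)\<^esub> f = f"
      using U by (simp cong: restrict_cong)
  qed (use U in \<open>auto simp: mult const mult_ac cong: restrict_cong\<close>)
qed (use U in \<open>auto simp: algebra_simps cong: restrict_cong\<close>)

end

context module_sheaf
begin

lemma sections_abelian_group: "openin X U \<Longrightarrow> abelian_group (Mod M U)"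
  using module by (auto simp: module_def)

lemma section_simps [simp, intro]:
  assumes "openin X U"
  shows "\<zero>\<^bsub>Mod M U\<^esub> \<in> carrier (Mod M U)"
    and "\<lbrakk>s \<in> carrier (Mod M U); t \<in> carrier (Mod M U)\<rbrakk> \<Longrightarrow> s \<oplus>\<^bsub>Mod M U\<^esub> t \<in> carrier (Mod M U)"
    and "s \<in> carrier (Mod M U) \<Longrightarrow> \<ominus>\<^bsub>Mod M U\<^esub> s \<in> carrier (Mod M U)"
    and "\<lbrakk>s \<in> carrier (Mod M U); t \<in> carrier (Mod M U)\<rbrakk> \<Longrightarrow> s \<ominus>\<^bsub>Mod M U\<^esub> t \<in> carrier (Mod M U)"
    and "\<lbrakk>f \<in> \<O> U; s \<in> carrier (Mod M U)\<rbrakk> \<Longrightarrow> f \<odot>\<^bsub>Mod M U\<^esub> s \<in> carrier (Mod M U)"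
proof -
  interpret U: module "fn_ring U (\<O> U)" "Mod M U" using module assms .
  show "\<zero>\<^bsub>Mod M U\<^esub> \<in> carrier (Mod M U)"
    and "\<lbrakk>s \<in> carrier (Mod M U); t \<in> carrier (Mod M U)\<rbrakk> \<Longrightarrow> s \<oplus>\<^bsub>Mod M U\<^esub> t \<in> carrier (Mod M U)"
    and "s \<in> carrier (Mod M U) \<Longrightarrow> \<ominus>\<^bsub>Mod M U\<^esub> s \<in> carrier (Mod M U)"
    and "\<lbrakk>s \<in> carrier (Mod M U); t \<in> carrier (Mod M U)\<rbrakk> \<Longrightarrow> s \<ominus>\<^bsub>Mod M U\<^esub> t \<in> carrier (Mod M U)"
    and "\<lbrakk>f \<in> \<O> U; s \<in> carrier (Mod M U)\<rbrakk> \<Longrightarrow> f \<odot>\<^bsub>Mod M U\<^esub> s \<in> carrier (Mod M U)"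
    by auto
qed

lemma neg_eq_smult:
  assumes "openin X U" "s \<in> carrier (Mod M U)"
  shows "\<ominus>\<^bsub>Mod M U\<^esub> s = (\<lambda>x\<in>U. -1) \<odot>\<^bsub>Mod M U\<^esub> s"
proof -
  interpret U: module "fn_ring U (\<O> U)" "Mod M U" using module assms(1) .
  have c: "(\<lambda>x\<in>U. c) \<in> \<O> U" for c using const assms(1) .
  have "(\<lambda>x\<in>U. -1) \<odot>\<^bsub>Mod M U\<^esub> s \<oplus>\<^bsub>Mod M U\<^esub> s = (\<lambda>x\<in>U. 0) \<odot>\<^bsub>Mod M U\<^esub> s"
    using U.smult_l_distr[of "\<lambda>x\<in>U. -1" "\<lambda>x\<in>U. 1" s] U.smult_one[of s] assms(2) c
    by (simp cong: restrict_cong)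
  also have "\<dots> = \<zero>\<^bsub>Mod M U\<^esub>" using U.smult_l_null[of s] assms(2) by simp
  finally show ?thesis
    using assms(2) c U.smult_closed[of "\<lambda>x\<in>U. -1" s] by (intro U.M.minus_equality) auto
qed

lemma Res_zero [simp]:
  assumes "openin X U" "openin X V" "V \<subseteq> U"
  shows "Res M U V \<zero>\<^bsub>Mod M U\<^esub> = \<zero>\<^bsub>Mod M V\<^esub>"
proof -
  interpret U: abelian_group "Mod M U" using sections_abelian_group assms(1) .
  interpret V: abelian_group "Mod M V" using sections_abelian_group assms(2) .
  have "Res M U V \<zero>\<^bsub>Mod M U\<^esub> = Res M U V \<zero>\<^bsub>Mod M U\<^esub> \<oplus>\<^bsub>Mod M V\<^esub> Res M U V \<zero>\<^bsub>Mod M U\<^esub>"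
    using Res_add[of U V "\<zero>\<^bsub>Mod M U\<^esub>" "\<zero>\<^bsub>Mod M U\<^esub>"] assms by simp
  then show ?thesis using Res_closed[of U V "\<zero>\<^bsub>Mod M U\<^esub>"] assms by (simp add: V.add.r_cancel_one')
qed

lemma Res_neg:
  assumes "openin X U" "openin X V" "V \<subseteq> U" "s \<in> carrier (Mod M U)"
  shows "Res M U V (\<ominus>\<^bsub>Mod M U\<^esub> s) = \<ominus>\<^bsub>Mod M V\<^esub> Res M U V s"
  using assms Res_smult[of U V "\<lambda>x\<in>U. -1" s] const[of U "-1"] Res_closed[of U V s]
  by (simp add: neg_eq_smult Int_absorb1)

lemma Res_minus:
  assumes "openin X U" "openin X V" "V \<subseteq> U" "s \<in> carrier (Mod M U)" "t \<in> carrier (Mod M U)"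
  shows "Res M U V (s \<ominus>\<^bsub>Mod M U\<^esub> t) = Res M U V s \<ominus>\<^bsub>Mod M V\<^esub> Res M U V t"
  using assms by (simp add: a_minus_def Res_add Res_neg)

lemmas section_arith = abelian_group.minus_arith [OF sections_abelian_group]

lemma smult_add:
  assumes "openin X U" "f \<in> \<O> U" "a \<in> carrier (Mod M U)" "b \<in> carrier (Mod M U)"
  shows "f \<odot>\<^bsub>Mod M U\<^esub> (a \<oplus>\<^bsub>Mod M U\<^esub> b) = f \<odot>\<^bsub>Mod M U\<^esub> a \<oplus>\<^bsub>Mod M U\<^esub> f \<odot>\<^bsub>Mod M U\<^esub> b"
  using assms by (intro module.smult_r_distr[OF module]) auto

lemma smult_minus:
  assumes "openin X U" "f \<in> \<O> U" "a \<in> carrier (Mod M U)" "b \<in> carrier (Mod M U)"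
  shows "f \<odot>\<^bsub>Mod M U\<^esub> (a \<ominus>\<^bsub>Mod M U\<^esub> b) = f \<odot>\<^bsub>Mod M U\<^esub> a \<ominus>\<^bsub>Mod M U\<^esub> f \<odot>\<^bsub>Mod M U\<^esub> b"
proof -
  interpret U: module "fn_ring U (\<O> U)" "Mod M U" using module assms(1) .
  show ?thesis using assms by (simp add: a_minus_def U.smult_r_distr U.smult_r_minus)
qed

lemma smult_assoc:
  assumes "openin X U" "f \<in> \<O> U" "g \<in> \<O> U" "a \<in> carrier (Mod M U)"
  shows "f \<odot>\<^bsub>Mod M U\<^esub> (g \<odot>\<^bsub>Mod M U\<^esub> a) = (\<lambda>x\<in>U. f x * g x) \<odot>\<^bsub>Mod M U\<^esub> a"
  using module.smult_assoc1[OF module, OF assms(1), of f g a] assms by simp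

lemma smult_zero_left:
  assumes "openin X U" "a \<in> carrier (Mod M U)"
  shows "(\<lambda>x\<in>U. 0) \<odot>\<^bsub>Mod M U\<^esub> a = \<zero>\<^bsub>Mod M U\<^esub>"
  using module.smult_l_null[OF module, OF assms(1), of a] assms by simp

lemma smult_zero_right:
  assumes "openin X U" "f \<in> \<O> U"
  shows "f \<odot>\<^bsub>Mod M U\<^esub> \<zero>\<^bsub>Mod M U\<^esub> = \<zero>\<^bsub>Mod M U\<^esub>"
  using module.smult_r_null[OF module, OF assms(1), of f] assms by simp

lemma smult_diff_left:
  assumes "openin X U" "f \<in> \<O> U" "g \<in> \<O> U" "a \<in> carrier (Mod M U)"
  shows "f \<odot>\<^bsub>Mod M U\<^esub> a \<ominus>\<^bsub>Mod M U\<^esub> g \<odot>\<^bsub>Mod M U\<^esub> a = (\<lambda>x\<in>U. f x - g x) \<odot>\<^bsub>Mod M U\<^esub> a"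
proof -
  interpret U: module "fn_ring U (\<O> U)" "Mod M U" using module assms(1) .
  have d: "(\<lambda>x\<in>U. f x - g x) \<in> \<O> U" using diff assms by simp
  have "(\<lambda>x\<in>U. f x - g x) \<odot>\<^bsub>Mod M U\<^esub> a \<oplus>\<^bsub>Mod M U\<^esub> g \<odot>\<^bsub>Mod M U\<^esub> a = f \<odot>\<^bsub>Mod M U\<^esub> a"
    using U.smult_l_distr[of "\<lambda>x\<in>U. f x - g x" g a] assms d by (simp cong: restrict_cong)
  then show ?thesis
    using section_arith(2)[OF assms(1), of "(\<lambda>x\<in>U. f x - g x) \<odot>\<^bsub>Mod M U\<^esub> a" "g \<odot>\<^bsub>Mod M U\<^esub> a"] assms d
    by auto
qed

text \<open>Gluing in the form in which it is used: local sections that are singled out by some property agree on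
  overlaps by uniqueness, so no compatibility has to be checked.\<close>

lemma glue_unique:
  assumes U: "openin X U"
    and ex: "\<And>x. x \<in> U \<Longrightarrow> \<exists>V s. openin X V \<and> x \<in> V \<and> V \<subseteq> U \<and> s \<in> carrier (Mod M V) \<and> P V s"
    and P_Res: "\<And>V V' s. \<lbrakk>openin X V; openin X V'; V' \<subseteq> V; V \<subseteq> U; s \<in> carrier (Mod M V); P V s\<rbrakk>
      \<Longrightarrow> P V' (Res M V V' s)"
    and unique: "\<And>V s t. \<lbrakk>openin X V; V \<subseteq> U; s \<in> carrier (Mod M V); t \<in> carrier (Mod M V); P V s; P V t\<rbrakk>
      \<Longrightarrow> s = t"
  obtains s where "s \<in> carrier (Mod M U)"
    and "\<And>x. x \<in> U \<Longrightarrow> \<exists>V. openin X V \<and> x \<in> V \<and> V \<subseteq> U \<and> P V (Res M U V s)"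
proof -
  define \<V> where "\<V> = {V. openin X V \<and> V \<subseteq> U \<and> (\<exists>s\<in>carrier (Mod M V). P V s)}"
  define \<sigma> where "\<sigma> V = (SOME s. s \<in> carrier (Mod M V) \<and> P V s)" for V
  have \<sigma>: "\<sigma> V \<in> carrier (Mod M V) \<and> P V (\<sigma> V)" if "V \<in> \<V>" for V
    unfolding \<sigma>_def by (rule someI_ex) (use that \<V>_def in auto)
  have "\<exists>s\<in>carrier (Mod M (\<Union>\<V>)). \<forall>V\<in>\<V>. Res M (\<Union>\<V>) V s = \<sigma> V"
  proof (rule gluing)
    fix V V' assume VV': "V \<in> \<V>" "V' \<in> \<V>"
    then have o: "openin X V" "openin X V'" "openin X (V \<inter> V')" "V \<subseteq> U" "V' \<subseteq> U" by (auto simp: \<V>_def)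
    show "Res M V (V \<inter> V') (\<sigma> V) = Res M V' (V \<inter> V') (\<sigma> V')"
      using o VV'[THEN \<sigma>] by (intro unique[of "V \<inter> V'"] P_Res Res_closed) auto
  qed (use \<sigma> \<V>_def in auto)
  moreover have "\<Union>\<V> = U" using ex by (fastforce simp: \<V>_def)
  ultimately obtain s where s: "s \<in> carrier (Mod M U)" "\<And>V. V \<in> \<V> \<Longrightarrow> Res M U V s = \<sigma> V" by metis
  show ?thesis
  proof (rule that)
    fix x assume "x \<in> U"
    with ex obtain V where "V \<in> \<V>" "x \<in> V" unfolding \<V>_def by blast
    then show "\<exists>V. openin X V \<and> x \<in> V \<and> V \<subseteq> U \<and> P V (Res M U V s)"
      using s(2)[of V] \<sigma>[of V] by (auto simp: \<V>_def)
  qed (rule s)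
qed

lemma module_sheaf_open:
  assumes U: "openin X U"
  shows "module_sheaf (subtopology X U) \<O> M"
proof -
  have o: "openin (subtopology X U) V \<longleftrightarrow> openin X V \<and> V \<subseteq> U" for V
    using U by (rule openin_open_subtopology)
  show ?thesis
  proof (intro module_sheaf.intro function_sheaf.intro module_sheaf_axioms.intro)
    fix V f assume V: "openin (subtopology X U) V" "f \<in> extensional V"
      "\<And>x. x \<in> V \<Longrightarrow> \<exists>W. openin (subtopology X U) W \<and> x \<in> W \<and> W \<subseteq> V \<and> restrict f W \<in> \<O> W"
    show "f \<in> \<O> V" using V(1,2) V(3)[unfolded o] by (intro glue) (simp add: o, assumption, metis)
  next
    fix V s t assume V: "openin (subtopology X U) V" "s \<in> carrier (Mod M V)" "t \<in> carrier (Mod M V)"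
      "\<And>x. x \<in> V \<Longrightarrow> \<exists>W. openin (subtopology X U) W \<and> x \<in> W \<and> W \<subseteq> V \<and> Res M V W s = Res M V W t"
    show "s = t"
      using V(1,2,3) V(4)[unfolded o] by (intro locality[of V s t]) (simp add: o, assumption+, metis)
  next
    fix \<V> \<sigma> assume V: "\<And>V. V \<in> \<V> \<Longrightarrow> openin (subtopology X U) V"
      "\<And>V. V \<in> \<V> \<Longrightarrow> \<sigma> V \<in> carrier (Mod M V)"
      "\<And>V V'. \<lbrakk>V \<in> \<V>; V' \<in> \<V>\<rbrakk> \<Longrightarrow> Res M V (V \<inter> V') (\<sigma> V) = Res M V' (V \<inter> V') (\<sigma> V')"
    show "\<exists>s\<in>carrier (Mod M (\<Union>\<V>)). \<forall>V\<in>\<V>. Res M (\<Union>\<V>) V s = \<sigma> V"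
      by (rule gluing) (use V(1) o V(2,3) in \<open>simp_all\<close>)
  qed (simp_all add: o extensional const add mult module Res_closed Res_add Res_smult Res_id Res_Res,
    metis restr)
qed


end


section \<open>Subsheaves\<close>

lemma subsheafD:
  assumes "subsheaf X \<O> M K" "openin X U"
  shows "submodule (K U) (fn_ring U (\<O> U)) (Mod M U)"
    and "\<lbrakk>openin X V; V \<subseteq> U; s \<in> K U\<rbrakk> \<Longrightarrow> Res M U V s \<in> K V"
    and "\<lbrakk>s \<in> carrier (Mod M U);
        \<And>x. x \<in> U \<Longrightarrow> \<exists>V. openin X V \<and> x \<in> V \<and> V \<subseteq> U \<and> Res M U V s \<in> K V\<rbrakk> \<Longrightarrow> s \<in> K U"
  using assms by (simp_all add: subsheaf_def)

lemma subsheaf_openD: "\<lbrakk>subsheaf X \<O> M K; s \<in> K U\<rbrakk> \<Longrightarrow> openin X U"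
  unfolding subsheaf_def by blast

lemma subsheaf_eqI:
  assumes "subsheaf X \<O> M K" "subsheaf X \<O> M K'" "\<And>U. openin X U \<Longrightarrow> K U = K' U"
  shows "K = K'"
proof
  fix U show "K U = K' U" using assms by (cases "openin X U") (auto simp: subsheaf_def)
qed

text \<open>The restriction of a family to an open subset has to be empty on all other sets, like every subsheaf.\<close>

definition on_open :: "'x topology \<Rightarrow> 'x set \<Rightarrow> ('x set \<Rightarrow> 's set) \<Rightarrow> 'x set \<Rightarrow> 's set" where
  "on_open X U K W = (if openin X W \<and> W \<subseteq> U then K W else {})"

definition complementary ::
  "'x topology \<Rightarrow> ('x, 's, 'm) omodule_scheme \<Rightarrow> ('x set \<Rightarrow> 's set) \<Rightarrow> ('x set \<Rightarrow> 's set) \<Rightarrow> bool" where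
  "complementary X M K C \<longleftrightarrow> (\<forall>V. openin X V \<longrightarrow> K V \<inter> C V = {\<zero>\<^bsub>Mod M V\<^esub>} \<and>
     (\<forall>s\<in>carrier (Mod M V). \<exists>a\<in>K V. \<exists>b\<in>C V. s = a \<oplus>\<^bsub>Mod M V\<^esub> b))"

lemma subsheaf_on_open:
  assumes K: "subsheaf X \<O> M K" and U: "openin X U"
  shows "subsheaf (subtopology X U) \<O> M (on_open X U K)"
  unfolding subsheaf_def
proof (intro conjI allI impI ballI)
  have o: "openin (subtopology X U) V \<longleftrightarrow> openin X V \<and> V \<subseteq> U" for V
    using U by (rule openin_open_subtopology)
  fix W assume "openin (subtopology X U) W"
  then have W: "openin X W" "W \<subseteq> U" by (simp_all add: o)
  then show "submodule (on_open X U K W) (fn_ring W (\<O> W)) (Mod M W)"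
    using subsheafD(1)[OF K W(1)] by (simp add: on_open_def)
  show "Res M W V s \<in> on_open X U K V"
    if "openin (subtopology X U) V \<and> V \<subseteq> W \<and> s \<in> on_open X U K W" for V s
    using that subsheafD(2)[OF K W(1), of V s] W by (simp add: on_open_def o)
  show "s \<in> on_open X U K W" if s: "s \<in> carrier (Mod M W)"
    "\<forall>x\<in>W. \<exists>V. openin (subtopology X U) V \<and> x \<in> V \<and> V \<subseteq> W \<and> Res M W V s \<in> on_open X U K V" for s
  proof -
    have "s \<in> K W"
    proof (rule subsheafD(3)[OF K W(1) s(1)])
      fix x assume "x \<in> W"
      with s(2) obtain V where "openin (subtopology X U) V" "x \<in> V" "V \<subseteq> W" "Res M W V s \<in> on_open X U K V"
        by blast
      then show "\<exists>V. openin X V \<and> x \<in> V \<and> V \<subseteq> W \<and> Res M W V s \<in> K V"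
        unfolding on_open_def o by (intro exI[of _ V]) simp
    qed
    then show ?thesis using W by (simp add: on_open_def)
  qed
next
  fix W assume "\<not> openin (subtopology X U) W"
  then show "on_open X U K W = {}" using U by (auto simp: on_open_def openin_open_subtopology)
qed

text \<open>Being a direct summand becomes a statement about the whole of a smaller space, so that the arguments
  about complements below can be made globally and then applied on a small open set.\<close>

lemma subbundle_iff:
  "subbundle X \<O> M K \<longleftrightarrow> subsheaf X \<O> M K \<and> (\<forall>x\<in>topspace X. \<exists>U C. openin X U \<and> x \<in> U \<and>
     subsheaf (subtopology X U) \<O> M C \<and> complementary (subtopology X U) M (on_open X U K) C)"
proof -
  have "complementary (subtopology X U) M (on_open X U K) C \<longleftrightarrow>
     (\<forall>V. openin X V \<and> V \<subseteq> U \<longrightarrow> K V \<inter> C V = {\<zero>\<^bsub>Mod M V\<^esub>} \<and>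
           (\<forall>s\<in>carrier (Mod M V). \<exists>a\<in>K V. \<exists>b\<in>C V. s = a \<oplus>\<^bsub>Mod M V\<^esub> b))"
    if "openin X U" for U C
    using that by (auto simp: complementary_def on_open_def openin_open_subtopology)
  then show ?thesis unfolding subbundle_def by (intro conj_cong ball_cong ex_cong1 refl) simp
qed

context module_sheaf
begin

lemma submoduleI:
  assumes U: "openin X U" and H: "H \<subseteq> carrier (Mod M U)"
    and "\<zero>\<^bsub>Mod M U\<^esub> \<in> H"
    and "\<And>s t. \<lbrakk>s \<in> H; t \<in> H\<rbrakk> \<Longrightarrow> s \<oplus>\<^bsub>Mod M U\<^esub> t \<in> H"
    and smult: "\<And>f s. \<lbrakk>f \<in> \<O> U; s \<in> H\<rbrakk> \<Longrightarrow> f \<odot>\<^bsub>Mod M U\<^esub> s \<in> H"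
  shows "submodule H (fn_ring U (\<O> U)) (Mod M U)"
proof (rule module.submoduleI[OF module[OF U]])
  fix s assume "s \<in> H"
  then show "\<ominus>\<^bsub>Mod M U\<^esub> s \<in> H" using smult[of "\<lambda>x\<in>U. -1" s] const[OF U, of "-1"] H U
    by (subst neg_eq_smult) auto
qed (use assms in auto)

lemma submodule_simps:
  assumes U: "openin X U" and H: "submodule H (fn_ring U (\<O> U)) (Mod M U)"
  shows "s \<in> H \<Longrightarrow> s \<in> carrier (Mod M U)"
    and "\<zero>\<^bsub>Mod M U\<^esub> \<in> H"
    and "\<lbrakk>s \<in> H; t \<in> H\<rbrakk> \<Longrightarrow> s \<oplus>\<^bsub>Mod M U\<^esub> t \<in> H"
    and "s \<in> H \<Longrightarrow> \<ominus>\<^bsub>Mod M U\<^esub> s \<in> H"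
    and "\<lbrakk>s \<in> H; t \<in> H\<rbrakk> \<Longrightarrow> s \<ominus>\<^bsub>Mod M U\<^esub> t \<in> H"
    and "\<lbrakk>f \<in> \<O> U; s \<in> H\<rbrakk> \<Longrightarrow> f \<odot>\<^bsub>Mod M U\<^esub> s \<in> H"
proof -
  note E = module.submoduleE[OF module[OF U] H]
  show s: "s \<in> H \<Longrightarrow> s \<in> carrier (Mod M U)" using E(1) by blast
  show "\<lbrakk>s \<in> H; t \<in> H\<rbrakk> \<Longrightarrow> s \<oplus>\<^bsub>Mod M U\<^esub> t \<in> H" using E(5) .
  show "s \<in> H \<Longrightarrow> \<ominus>\<^bsub>Mod M U\<^esub> s \<in> H" using E(3) .
  show m: "\<lbrakk>s \<in> H; t \<in> H\<rbrakk> \<Longrightarrow> s \<ominus>\<^bsub>Mod M U\<^esub> t \<in> H" for s t using E(3,5) by (simp add: a_minus_def)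
  show "\<lbrakk>f \<in> \<O> U; s \<in> H\<rbrakk> \<Longrightarrow> f \<odot>\<^bsub>Mod M U\<^esub> s \<in> H" using E(4) by simp
  obtain t where "t \<in> H" using E(2) by blast
  then show "\<zero>\<^bsub>Mod M U\<^esub> \<in> H" using m[of t t] section_arith(10)[OF U, of t] E(1) by auto
qed

text \<open>Negation is multiplication by the constant \<open>-1\<close>, hence absent from the conditions.\<close>

lemma subsheafI:
  assumes carrier: "\<And>U s. \<lbrakk>openin X U; s \<in> K U\<rbrakk> \<Longrightarrow> s \<in> carrier (Mod M U)"
    and "\<And>U. openin X U \<Longrightarrow> \<zero>\<^bsub>Mod M U\<^esub> \<in> K U"
    and "\<And>U s t. \<lbrakk>openin X U; s \<in> K U; t \<in> K U\<rbrakk> \<Longrightarrow> s \<oplus>\<^bsub>Mod M U\<^esub> t \<in> K U"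
    and "\<And>U f s. \<lbrakk>openin X U; f \<in> \<O> U; s \<in> K U\<rbrakk> \<Longrightarrow> f \<odot>\<^bsub>Mod M U\<^esub> s \<in> K U"
    and "\<And>U V s. \<lbrakk>openin X U; openin X V; V \<subseteq> U; s \<in> K U\<rbrakk> \<Longrightarrow> Res M U V s \<in> K V"
    and "\<And>U s. \<lbrakk>openin X U; s \<in> carrier (Mod M U);
        \<And>x. x \<in> U \<Longrightarrow> \<exists>V. openin X V \<and> x \<in> V \<and> V \<subseteq> U \<and> Res M U V s \<in> K V\<rbrakk> \<Longrightarrow> s \<in> K U"
    and "\<And>U. \<not> openin X U \<Longrightarrow> K U = {}"
  shows "subsheaf X \<O> M K"
  unfolding subsheaf_def
proof (intro conjI allI impI ballI)
  fix U assume U: "openin X U"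
  show "submodule (K U) (fn_ring U (\<O> U)) (Mod M U)"
    using assms(1-4)[OF U] by (intro submoduleI U) blast+
qed (use assms in \<open>simp_all\<close>)

lemma subsheaf_simps:
  assumes K: "subsheaf X \<O> M K" and U: "openin X U"
  shows "s \<in> K U \<Longrightarrow> s \<in> carrier (Mod M U)"
    and "\<zero>\<^bsub>Mod M U\<^esub> \<in> K U"
    and "\<lbrakk>s \<in> K U; t \<in> K U\<rbrakk> \<Longrightarrow> s \<oplus>\<^bsub>Mod M U\<^esub> t \<in> K U"
    and "s \<in> K U \<Longrightarrow> \<ominus>\<^bsub>Mod M U\<^esub> s \<in> K U"
    and "\<lbrakk>s \<in> K U; t \<in> K U\<rbrakk> \<Longrightarrow> s \<ominus>\<^bsub>Mod M U\<^esub> t \<in> K U"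
    and "\<lbrakk>f \<in> \<O> U; s \<in> K U\<rbrakk> \<Longrightarrow> f \<odot>\<^bsub>Mod M U\<^esub> s \<in> K U"
  by (rule submodule_simps [OF U subsheafD(1) [OF K U]]; assumption?)+

text \<open>Quotients are formed from sheaves of modules; this is what allows to take a quotient of a subsheaf.\<close>

lemma module_sheaf_subsheaf:
  assumes K: "subsheaf X \<O> M K"
  shows "module_sheaf X \<O> \<lparr>Mod = (\<lambda>U. (Mod M U)\<lparr>carrier := K U\<rparr>), Res = Res M\<rparr>"
proof -
  note in_M = subsheaf_simps(1)[OF K]
  show ?thesis
  proof (intro module_sheaf.intro function_sheaf_axioms module_sheaf_axioms.intro)
    fix U assume U: "openin X U"
    then show "Module.module (fn_ring U (\<O> U))
        (Mod \<lparr>Mod = \<lambda>U. (Mod M U)\<lparr>carrier := K U\<rparr>, Res = Res M\<rparr> U)"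
      using submodule.submodule_is_module[OF subsheafD(1)[OF K U] module[OF U]] by simp
  next
    fix \<V> \<sigma>
    assume *: "\<And>V. V \<in> \<V> \<Longrightarrow> openin X V"
      "\<And>V. V \<in> \<V> \<Longrightarrow> \<sigma> V \<in> carrier (Mod \<lparr>Mod = \<lambda>U. (Mod M U)\<lparr>carrier := K U\<rparr>, Res = Res M\<rparr> V)"
      "\<And>V V'. \<lbrakk>V \<in> \<V>; V' \<in> \<V>\<rbrakk> \<Longrightarrow>
        Res \<lparr>Mod = \<lambda>U. (Mod M U)\<lparr>carrier := K U\<rparr>, Res = Res M\<rparr> V (V \<inter> V') (\<sigma> V) =
        Res \<lparr>Mod = \<lambda>U. (Mod M U)\<lparr>carrier := K U\<rparr>, Res = Res M\<rparr> V' (V \<inter> V') (\<sigma> V')"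
    have "\<exists>s\<in>carrier (Mod M (\<Union>\<V>)). \<forall>V\<in>\<V>. Res M (\<Union>\<V>) V s = \<sigma> V"
      by (rule gluing) (use * in_M in auto)
    then obtain s where s: "s \<in> carrier (Mod M (\<Union>\<V>))" "\<And>V. V \<in> \<V> \<Longrightarrow> Res M (\<Union>\<V>) V s = \<sigma> V"
      by blast
    have "s \<in> K (\<Union>\<V>)"
    proof (rule subsheafD(3)[OF K _ s(1)])
      fix x assume "x \<in> \<Union>\<V>"
      then obtain V where "V \<in> \<V>" "x \<in> V" by blast
      then show "\<exists>V. openin X V \<and> x \<in> V \<and> V \<subseteq> \<Union>\<V> \<and> Res M (\<Union>\<V>) V s \<in> K V"
        using *(1,2)[of V] s(2)[of V] by (intro exI[of _ V]) auto
    qed (use *(1) in blast)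
    then show "\<exists>s\<in>carrier (Mod \<lparr>Mod = \<lambda>U. (Mod M U)\<lparr>carrier := K U\<rparr>, Res = Res M\<rparr> (\<Union>\<V>)).
        \<forall>V\<in>\<V>. Res \<lparr>Mod = \<lambda>U. (Mod M U)\<lparr>carrier := K U\<rparr>, Res = Res M\<rparr> (\<Union>\<V>) V s = \<sigma> V"
      using s(2) by auto
  next
    fix U s t assume *: "openin X U"
      "s \<in> carrier (Mod \<lparr>Mod = \<lambda>U. (Mod M U)\<lparr>carrier := K U\<rparr>, Res = Res M\<rparr> U)"
      "t \<in> carrier (Mod \<lparr>Mod = \<lambda>U. (Mod M U)\<lparr>carrier := K U\<rparr>, Res = Res M\<rparr> U)"
      "\<And>x. x \<in> U \<Longrightarrow> \<exists>V. openin X V \<and> x \<in> V \<and> V \<subseteq> U \<and>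
        Res \<lparr>Mod = \<lambda>U. (Mod M U)\<lparr>carrier := K U\<rparr>, Res = Res M\<rparr> U V s =
        Res \<lparr>Mod = \<lambda>U. (Mod M U)\<lparr>carrier := K U\<rparr>, Res = Res M\<rparr> U V t"
    from *(2,3) have "s \<in> carrier (Mod M U)" "t \<in> carrier (Mod M U)" using in_M[OF *(1)] by auto
    then show "s = t" using *(4) by (intro locality[OF *(1)]) auto
  qed (simp_all add: in_M subsheafD(2)[OF K] Res_add Res_smult Res_id Res_Res)
qed

end

section \<open>Images and preimages of subsheaves under a quotient map\<close>

text \<open>A morphism \<open>p\<close> from a subsheaf \<open>F\<close> of \<open>A\<close> to \<open>B\<close> that is locally surjective and has kernel \<open>N\<close>, so that \<open>B\<close>
  is the sheaf quotient \<open>F/N\<close>. Sections of \<open>B\<close> lift to \<open>F\<close> only locally, which is the reason for the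
  local conditions in the image and for all the gluing below.\<close>

locale quotient_map = A: module_sheaf X \<O> A + B: module_sheaf X \<O> B
  for X :: "'x topology" and \<O> :: "'x set \<Rightarrow> 'x fn set"
    and A :: "('x, 'a, 'm) omodule_scheme" and B :: "('x, 'b, 'n) omodule_scheme" +
  fixes F N :: "'x set \<Rightarrow> 'a set" and p :: "'x set \<Rightarrow> 'a \<Rightarrow> 'b"
  assumes F: "subsheaf X \<O> A F"
    and N_subset_F: "openin X U \<Longrightarrow> N U \<subseteq> F U"
    and p_closed: "\<lbrakk>openin X U; a \<in> F U\<rbrakk> \<Longrightarrow> p U a \<in> carrier (Mod B U)"
    and p_add: "\<lbrakk>openin X U; a \<in> F U; b \<in> F U\<rbrakk> \<Longrightarrow> p U (a \<oplus>\<^bsub>Mod A U\<^esub> b) = p U a \<oplus>\<^bsub>Mod B U\<^esub> p U b"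
    and p_smult: "\<lbrakk>openin X U; f \<in> \<O> U; a \<in> F U\<rbrakk> \<Longrightarrow> p U (f \<odot>\<^bsub>Mod A U\<^esub> a) = f \<odot>\<^bsub>Mod B U\<^esub> p U a"
    and p_Res: "\<lbrakk>openin X U; openin X V; V \<subseteq> U; a \<in> F U\<rbrakk> \<Longrightarrow> Res B U V (p U a) = p V (Res A U V a)"
    and p_kernel: "\<lbrakk>openin X U; a \<in> F U\<rbrakk> \<Longrightarrow> p U a = \<zero>\<^bsub>Mod B U\<^esub> \<longleftrightarrow> a \<in> N U"
    and p_surj: "\<lbrakk>openin X U; s \<in> carrier (Mod B U); x \<in> U\<rbrakk>
      \<Longrightarrow> \<exists>V a. openin X V \<and> x \<in> V \<and> V \<subseteq> U \<and> a \<in> F V \<and> Res B U V s = p V a"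
begin

lemmas F_simps = A.subsheaf_simps [OF F] and F_Res = subsheafD(2) [OF F]

lemma p_neg: "\<lbrakk>openin X U; a \<in> F U\<rbrakk> \<Longrightarrow> p U (\<ominus>\<^bsub>Mod A U\<^esub> a) = \<ominus>\<^bsub>Mod B U\<^esub> p U a"
  using A.const[of U "-1"] by (simp add: A.neg_eq_smult B.neg_eq_smult F_simps p_smult p_closed)

lemma p_minus:
  "\<lbrakk>openin X U; a \<in> F U; b \<in> F U\<rbrakk> \<Longrightarrow> p U (a \<ominus>\<^bsub>Mod A U\<^esub> b) = p U a \<ominus>\<^bsub>Mod B U\<^esub> p U b"
  by (simp add: a_minus_def p_add p_neg F_simps)

lemma p_eq_iff:
  assumes "openin X U" "a \<in> F U" "b \<in> F U"
  shows "p U a = p U b \<longleftrightarrow> a \<ominus>\<^bsub>Mod A U\<^esub> b \<in> N U"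
  using assms p_kernel[of U "a \<ominus>\<^bsub>Mod A U\<^esub> b"] p_minus[of U a b] B.section_arith(12)[of U "p U a" "p U b"]
    p_closed F_simps(5) by auto

lemma p_zero: "openin X U \<Longrightarrow> p U \<zero>\<^bsub>Mod A U\<^esub> = \<zero>\<^bsub>Mod B U\<^esub>"
  using p_minus[of U "\<zero>\<^bsub>Mod A U\<^esub>" "\<zero>\<^bsub>Mod A U\<^esub>"] B.section_arith(10)[of U "p U \<zero>\<^bsub>Mod A U\<^esub>"]
    A.section_arith(10)[of U "\<zero>\<^bsub>Mod A U\<^esub>"] by (simp add: F_simps p_closed)

definition image_sheaf :: "('x set \<Rightarrow> 'a set) \<Rightarrow> 'x set \<Rightarrow> 'b set" where
  "image_sheaf K W = {b \<in> carrier (Mod B W). openin X W \<and>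
     (\<forall>x\<in>W. \<exists>V a. openin X V \<and> x \<in> V \<and> V \<subseteq> W \<and> a \<in> K V \<and> Res B W V b = p V a)}"

definition preimage_sheaf :: "('x set \<Rightarrow> 'b set) \<Rightarrow> 'x set \<Rightarrow> 'a set" where
  "preimage_sheaf L W = {a \<in> F W. p W a \<in> L W}"

lemma image_sheafD:
  assumes "b \<in> image_sheaf K W" "x \<in> W"
  obtains V a where "openin X V" "x \<in> V" "V \<subseteq> W" "a \<in> K V" "Res B W V b = p V a"
  using assms by (auto simp: image_sheaf_def)

lemma image_sheafI:
  assumes "openin X W" "b \<in> carrier (Mod B W)"
    "\<And>x. x \<in> W \<Longrightarrow> \<exists>V a. openin X V \<and> x \<in> V \<and> V \<subseteq> W \<and> a \<in> K V \<and> Res B W V b = p V a"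
  shows "b \<in> image_sheaf K W"
  using assms by (simp add: image_sheaf_def)

lemma image_p:
  assumes "openin X W" "a \<in> K W" "a \<in> F W"
  shows "p W a \<in> image_sheaf K W"
proof (rule image_sheafI)
  fix x assume "x \<in> W"
  then show "\<exists>V a'. openin X V \<and> x \<in> V \<and> V \<subseteq> W \<and> a' \<in> K V \<and> Res B W V (p W a) = p V a'"
    using assms B.Res_id[of W "p W a"] p_closed by blast
qed (use assms p_closed in auto)

lemma image_sheaf_mono:
  assumes "\<And>V. K V \<subseteq> K' V"
  shows "image_sheaf K U \<subseteq> image_sheaf K' U"
proof
  fix b assume b: "b \<in> image_sheaf K U"
  then show "b \<in> image_sheaf K' U"
  proof (intro image_sheafI)
    fix x assume x: "x \<in> U"
    show "\<exists>V a. openin X V \<and> x \<in> V \<and> V \<subseteq> U \<and> a \<in> K' V \<and> Res B U V b = p V a"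
      by (rule image_sheafD[OF b x]) (use assms in blast)
  qed (simp_all add: image_sheaf_def)
qed

text \<open>Pairs of sections of the image are handled by lifting both over one open set.\<close>

lemma image_sheaf_common:
  assumes K: "subsheaf X \<O> A K" and K_F: "\<And>U. openin X U \<Longrightarrow> K U \<subseteq> F U"
    and U: "openin X U" and s: "s \<in> image_sheaf K U" and t: "t \<in> image_sheaf K U" and x: "x \<in> U"
  obtains V a b where "openin X V" "x \<in> V" "V \<subseteq> U" "a \<in> K V" "b \<in> K V" "Res B U V s = p V a" "Res B U V t = p V b"
proof -
  have closed: "s \<in> carrier (Mod B U)" "t \<in> carrier (Mod B U)" using s t by (simp_all add: image_sheaf_def)
  obtain V a where V: "openin X V" "x \<in> V" "V \<subseteq> U" "a \<in> K V" "Res B U V s = p V a" by (rule image_sheafD[OF s x])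
  obtain W b where W: "openin X W" "x \<in> W" "W \<subseteq> U" "b \<in> K W" "Res B U W t = p W b" by (rule image_sheafD[OF t x])
  have o: "openin X (V \<inter> W)" using V W by auto
  have "Res B U (V \<inter> W) s = p (V \<inter> W) (Res A V (V \<inter> W) a)"
    using p_Res[OF V(1) o, of a] B.Res_Res[OF U V(1) o _ _ closed(1)] V K_F by auto
  moreover have "Res B U (V \<inter> W) t = p (V \<inter> W) (Res A W (V \<inter> W) b)"
    using p_Res[OF W(1) o, of b] B.Res_Res[OF U W(1) o _ _ closed(2)] W K_F by auto
  ultimately show ?thesis
    using subsheafD(2)[OF K V(1) o _ V(4)] subsheafD(2)[OF K W(1) o _ W(4)] o V(2,3) W(2)
    by (intro that[of "V \<inter> W" "Res A V (V \<inter> W) a" "Res A W (V \<inter> W) b"]) auto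
qed

lemma subsheaf_image:
  assumes K: "subsheaf X \<O> A K" and K_F: "\<And>U. openin X U \<Longrightarrow> K U \<subseteq> F U"
  shows "subsheaf X \<O> B (image_sheaf K)"
proof (rule B.subsheafI)
  note K_simps = A.subsheaf_simps[OF K]
  show closed: "s \<in> carrier (Mod B U)" if "openin X U" "s \<in> image_sheaf K U" for U s
    using that by (simp add: image_sheaf_def)
  show "\<zero>\<^bsub>Mod B U\<^esub> \<in> image_sheaf K U" if U: "openin X U" for U
    using image_p[OF U, of "\<zero>\<^bsub>Mod A U\<^esub>" K] K_simps(2)[OF U] F_simps(2)[OF U] p_zero[OF U] by simp
  show "s \<oplus>\<^bsub>Mod B U\<^esub> t \<in> image_sheaf K U" if U: "openin X U" and s: "s \<in> image_sheaf K U" and t: "t \<in> image_sheaf K U" for U s t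
  proof (rule image_sheafI[OF U])
    fix x assume x: "x \<in> U"
    obtain V a b where V: "openin X V" "x \<in> V" "V \<subseteq> U" "a \<in> K V" "b \<in> K V"
      "Res B U V s = p V a" "Res B U V t = p V b" by (rule image_sheaf_common[OF K K_F U s t x])
    then show "\<exists>V a. openin X V \<and> x \<in> V \<and> V \<subseteq> U \<and> a \<in> K V \<and> Res B U V (s \<oplus>\<^bsub>Mod B U\<^esub> t) = p V a"
      using K_F[OF V(1)] K_simps(3)[OF V(1), of a b] closed[OF U s] closed[OF U t] U
      by (intro exI[of _ V] exI[of _ "a \<oplus>\<^bsub>Mod A V\<^esub> b"]) (auto simp: B.Res_add p_add subsetD)
  qed (use closed[OF U] s t U in auto)
  show "f \<odot>\<^bsub>Mod B U\<^esub> s \<in> image_sheaf K U" if U: "openin X U" and f: "f \<in> \<O> U" and s: "s \<in> image_sheaf K U" for U f s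
  proof (rule image_sheafI[OF U])
    fix x assume x: "x \<in> U"
    obtain V a where V: "openin X V" "x \<in> V" "V \<subseteq> U" "a \<in> K V" "Res B U V s = p V a" by (rule image_sheafD[OF s x])
    then show "\<exists>V a. openin X V \<and> x \<in> V \<and> V \<subseteq> U \<and> a \<in> K V \<and> Res B U V (f \<odot>\<^bsub>Mod B U\<^esub> s) = p V a"
      using K_F[OF V(1)] K_simps(6)[OF V(1) A.restr[OF U V(1,3) f], of a] closed[OF U s] U f
      by (intro exI[of _ V] exI[of _ "restrict f V \<odot>\<^bsub>Mod A V\<^esub> a"]) (auto simp: B.Res_smult A.restr p_smult subsetD)
  qed (use closed[OF U] s f U in auto)
  show "Res B U V s \<in> image_sheaf K V" if U: "openin X U" and V: "openin X V" "V \<subseteq> U" and s: "s \<in> image_sheaf K U" for U V s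
  proof (rule image_sheafI[OF V(1)])
    fix x assume x: "x \<in> V"
    then have "x \<in> U" using V by auto
    obtain W a where W: "openin X W" "x \<in> W" "W \<subseteq> U" "a \<in> K W" "Res B U W s = p W a"
      by (rule image_sheafD[OF s \<open>x \<in> U\<close>])
    have o: "openin X (V \<inter> W)" using V W by auto
    have "Res B V (V \<inter> W) (Res B U V s) = p (V \<inter> W) (Res A W (V \<inter> W) a)"
      using p_Res[OF W(1) o, of a] B.Res_Res[OF U W(1) o _ _ closed[OF U s]]
        B.Res_Res[OF U V(1) o _ _ closed[OF U s]] W V K_F by auto
    then show "\<exists>W a. openin X W \<and> x \<in> W \<and> W \<subseteq> V \<and> a \<in> K W \<and> Res B V W (Res B U V s) = p W a"
      using subsheafD(2)[OF K W(1) o _ W(4)] o x W(2) by blast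
  qed (use B.Res_closed closed U V s in auto)
  show "s \<in> image_sheaf K U" if U: "openin X U" and s: "s \<in> carrier (Mod B U)"
    and loc: "\<And>x. x \<in> U \<Longrightarrow> \<exists>V. openin X V \<and> x \<in> V \<and> V \<subseteq> U \<and> Res B U V s \<in> image_sheaf K V" for U s
  proof (rule image_sheafI[OF U s])
    fix x assume "x \<in> U"
    with loc obtain V where V: "openin X V" "x \<in> V" "V \<subseteq> U" and im: "Res B U V s \<in> image_sheaf K V" by blast
    obtain W a where W: "openin X W" "x \<in> W" "W \<subseteq> V" "a \<in> K W" "Res B V W (Res B U V s) = p W a"
      by (rule image_sheafD[OF im V(2)])
    then show "\<exists>V a. openin X V \<and> x \<in> V \<and> V \<subseteq> U \<and> a \<in> K V \<and> Res B U V s = p V a"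
      using V B.Res_Res[OF U V(1) W(1) _ _ s] by (intro exI[of _ W] exI[of _ a]) auto
  qed
  show "image_sheaf K U = {}" if "\<not> openin X U" for U using that by (simp add: image_sheaf_def)
qed

lemma subsheaf_preimage:
  assumes L: "subsheaf X \<O> B L"
  shows "subsheaf X \<O> A (preimage_sheaf L)"
proof (rule A.subsheafI)
  show "s \<in> preimage_sheaf L U" if U: "openin X U" and s: "s \<in> carrier (Mod A U)"
    and loc: "\<And>x. x \<in> U \<Longrightarrow> \<exists>V. openin X V \<and> x \<in> V \<and> V \<subseteq> U \<and> Res A U V s \<in> preimage_sheaf L V" for U s
  proof -
    have sF: "s \<in> F U" using loc by (intro subsheafD(3)[OF F U s]) (auto simp: preimage_sheaf_def)
    moreover have "p U s \<in> L U"
    proof (rule subsheafD(3)[OF L U p_closed[OF U sF]])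
      fix x assume "x \<in> U"
      with loc obtain V where "openin X V" "x \<in> V" "V \<subseteq> U" "Res A U V s \<in> preimage_sheaf L V" by blast
      then show "\<exists>V. openin X V \<and> x \<in> V \<and> V \<subseteq> U \<and> Res B U V (p U s) \<in> L V"
        using p_Res[OF U _ _ sF, of V] by (auto simp: preimage_sheaf_def)
    qed
    ultimately show ?thesis by (simp add: preimage_sheaf_def)
  qed
  show "preimage_sheaf L U = {}" if "\<not> openin X U" for U
    using that subsheaf_openD[OF F] by (auto simp: preimage_sheaf_def)
  show "Res A U V s \<in> preimage_sheaf L V" if "openin X U" "openin X V" "V \<subseteq> U" "s \<in> preimage_sheaf L U" for U V s
    using that F_Res[of U V s] p_Res[of U V s] subsheafD(2)[OF L that(1-3), of "p U s"] by (simp add: preimage_sheaf_def)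
qed (auto simp: preimage_sheaf_def F_simps p_zero p_add p_smult B.subsheaf_simps[OF L])

lemma N_subset_preimage: "\<lbrakk>subsheaf X \<O> B L; openin X U\<rbrakk> \<Longrightarrow> N U \<subseteq> preimage_sheaf L U"
  using N_subset_F[of U] p_kernel[of U] B.subsheaf_simps(2)[of L U] by (fastforce simp: preimage_sheaf_def)

lemma preimage_subset_F: "preimage_sheaf L U \<subseteq> F U"
  by (auto simp: preimage_sheaf_def)

lemma subset_preimage_image:
  assumes "\<And>U. openin X U \<Longrightarrow> K U \<subseteq> F U" "openin X U"
  shows "K U \<subseteq> preimage_sheaf (image_sheaf K) U"
  using assms image_p[of U _ K] by (auto simp: preimage_sheaf_def)

text \<open>If \<open>p a\<close> lies in the image of \<open>K\<close>, then locally \<open>a\<close> differs from a section of \<open>K\<close> by one of \<open>N\<close>, which is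
  contained in \<open>K\<close>.\<close>

lemma preimage_image:
  assumes K: "subsheaf X \<O> A K" and N_K: "\<And>U. openin X U \<Longrightarrow> N U \<subseteq> K U"
    and K_F: "\<And>U. openin X U \<Longrightarrow> K U \<subseteq> F U"
  shows "preimage_sheaf (image_sheaf K) = K"
proof (rule subsheaf_eqI[OF subsheaf_preimage[OF subsheaf_image[OF K K_F]] K])
  fix U assume U: "openin X U"
  show "preimage_sheaf (image_sheaf K) U = K U"
  proof
    show "preimage_sheaf (image_sheaf K) U \<subseteq> K U"
    proof
      fix a assume "a \<in> preimage_sheaf (image_sheaf K) U"
      then have a: "a \<in> F U" "p U a \<in> image_sheaf K U" by (simp_all add: preimage_sheaf_def)
      show "a \<in> K U"
      proof (rule subsheafD(3)[OF K U F_simps(1)[OF U a(1)]])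
        fix x assume x: "x \<in> U"
        obtain V k where V: "openin X V" "x \<in> V" "V \<subseteq> U" "k \<in> K V" "Res B U V (p U a) = p V k"
          by (rule image_sheafD[OF a(2) x])
        have aV: "Res A U V a \<in> F V" and kF: "k \<in> F V" using F_Res[OF U V(1,3) a(1)] K_F[OF V(1)] V(4) by auto
        have "Res A U V a \<ominus>\<^bsub>Mod A V\<^esub> k \<in> K V"
          using p_eq_iff[OF V(1) aV kF] p_Res[OF U V(1,3) a(1)] V(5) N_K[OF V(1)] by auto
        then have "Res A U V a \<in> K V"
          using A.subsheaf_simps(3)[OF K V(1) _ V(4)] A.section_arith(1)[OF V(1), of "Res A U V a" k] F_simps(1)[OF V(1)] aV kF
          by fastforce
        then show "\<exists>V. openin X V \<and> x \<in> V \<and> V \<subseteq> U \<and> Res A U V a \<in> K V" using V by blast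
      qed
    qed
  qed (rule subset_preimage_image[OF K_F U])
qed

lemma image_preimage:
  assumes L: "subsheaf X \<O> B L"
  shows "image_sheaf (preimage_sheaf L) = L"
proof (rule subsheaf_eqI[OF subsheaf_image[OF subsheaf_preimage[OF L] preimage_subset_F] L])
  fix U assume U: "openin X U"
  show "image_sheaf (preimage_sheaf L) U = L U"
  proof (intro equalityI subsetI)
    fix b assume b: "b \<in> image_sheaf (preimage_sheaf L) U"
    then have "b \<in> carrier (Mod B U)" by (simp add: image_sheaf_def)
    then show "b \<in> L U"
    proof (rule subsheafD(3)[OF L U])
      fix x assume x: "x \<in> U"
      show "\<exists>V. openin X V \<and> x \<in> V \<and> V \<subseteq> U \<and> Res B U V b \<in> L V"
        by (rule image_sheafD[OF b x]) (auto simp: preimage_sheaf_def)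
    qed
  next
    fix b assume b: "b \<in> L U"
    show "b \<in> image_sheaf (preimage_sheaf L) U"
    proof (rule image_sheafI[OF U])
      show b_closed: "b \<in> carrier (Mod B U)" using B.subsheaf_simps(1)[OF L U b] .
      fix x assume x: "x \<in> U"
      obtain V a where V: "openin X V" "x \<in> V" "V \<subseteq> U" "a \<in> F V" "Res B U V b = p V a"
        using p_surj[OF U b_closed x] by blast
      then have "p V a \<in> L V" using subsheafD(2)[OF L U V(1,3) b] by simp
      then show "\<exists>V a. openin X V \<and> x \<in> V \<and> V \<subseteq> U \<and> a \<in> preimage_sheaf L V \<and> Res B U V b = p V a"
        using V by (auto simp: preimage_sheaf_def)
    qed
  qed
qed

end

section \<open>Complements of subsheaves\<close>

lemma on_open_simps:
  assumes "openin X U"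
  shows "openin (subtopology X U) V \<longleftrightarrow> openin X V \<and> V \<subseteq> U"
    and "\<lbrakk>openin X V; V \<subseteq> U\<rbrakk> \<Longrightarrow> on_open X U K V = K V"
  using assms by (auto simp: openin_open_subtopology on_open_def)

lemma subsheaf_on_smaller_open:
  assumes C: "subsheaf (subtopology X U) \<O> M C" and o: "openin X U" "openin X V" "V \<subseteq> U"
  shows "subsheaf (subtopology X V) \<O> M (on_open X V C)"
proof -
  have "on_open (subtopology X U) V C = on_open X V C"
    using o by (auto simp: on_open_def fun_eq_iff on_open_simps)
  moreover have "subtopology (subtopology X U) V = subtopology X V"
    using o by (simp add: subtopology_subtopology Int_absorb1)
  ultimately show ?thesis
    using subsheaf_on_open[OF C, of V] o by (simp add: on_open_simps)
qed

text \<open>The complement may be taken over arbitrarily small neighbourhoods, which allows to work with the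
  complements of several subbundles over a common open set.\<close>

lemma subbundle_complement:
  assumes "subbundle X \<O> M K" "x \<in> topspace X"
  obtains U where "openin X U" "x \<in> U"
    "\<And>V. \<lbrakk>openin X V; V \<subseteq> U\<rbrakk> \<Longrightarrow>
      \<exists>C. subsheaf (subtopology X V) \<O> M C \<and> complementary (subtopology X V) M (on_open X V K) C"
proof -
  obtain U C where U: "openin X U" "x \<in> U" and C: "subsheaf (subtopology X U) \<O> M C"
      "complementary (subtopology X U) M (on_open X U K) C"
    using assms unfolding subbundle_iff by blast
  show ?thesis
  proof (rule that[OF U])
    fix V assume V: "openin X V" "V \<subseteq> U"
    have "complementary (subtopology X V) M (on_open X V K) (on_open X V C)"
      unfolding complementary_def
    proof (intro allI impI)
      fix W assume "openin (subtopology X V) W"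
      then have W: "openin X W" "W \<subseteq> V" "W \<subseteq> U" using V by (auto simp: on_open_simps)
      then have "openin (subtopology X U) W" using U by (simp add: on_open_simps)
      then show "on_open X V K W \<inter> on_open X V C W = {\<zero>\<^bsub>Mod M W\<^esub>} \<and>
          (\<forall>s\<in>carrier (Mod M W). \<exists>a\<in>on_open X V K W. \<exists>b\<in>on_open X V C W. s = a \<oplus>\<^bsub>Mod M W\<^esub> b)"
        using C(2) W V(1) U(1) by (simp add: complementary_def on_open_simps)
    qed
    then show "\<exists>C. subsheaf (subtopology X V) \<O> M C \<and> complementary (subtopology X V) M (on_open X V K) C"
      using subsheaf_on_smaller_open[OF C(1) U(1) V] by blast
  qed
qed

lemma complementaryD:
  assumes "complementary X M K C" "openin X U"
  shows "\<lbrakk>s \<in> K U; s \<in> C U\<rbrakk> \<Longrightarrow> s = \<zero>\<^bsub>Mod M U\<^esub>"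
    and "s \<in> carrier (Mod M U) \<Longrightarrow> \<exists>a\<in>K U. \<exists>b\<in>C U. s = a \<oplus>\<^bsub>Mod M U\<^esub> b"
  using assms unfolding complementary_def by blast+

context module_sheaf
begin

lemma complementaryI:
  assumes "subsheaf X \<O> M K" "subsheaf X \<O> M C"
    and "\<And>U s. \<lbrakk>openin X U; s \<in> K U; s \<in> C U\<rbrakk> \<Longrightarrow> s = \<zero>\<^bsub>Mod M U\<^esub>"
    and "\<And>U s. \<lbrakk>openin X U; s \<in> carrier (Mod M U)\<rbrakk> \<Longrightarrow> \<exists>a\<in>K U. \<exists>b\<in>C U. s = a \<oplus>\<^bsub>Mod M U\<^esub> b"
  shows "complementary X M K C"
  unfolding complementary_def
proof (intro allI impI conjI)
  fix U assume U: "openin X U"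
  show "K U \<inter> C U = {\<zero>\<^bsub>Mod M U\<^esub>}"
    using assms(3)[OF U] subsheaf_simps(2)[OF assms(1) U] subsheaf_simps(2)[OF assms(2) U] by blast
qed (use assms(4) in blast)

lemma subsheaf_Int:
  assumes K: "subsheaf X \<O> M K" and C: "subsheaf X \<O> M C"
  shows "subsheaf X \<O> M (\<lambda>U. K U \<inter> C U)"
proof (rule subsheafI)
  show "s \<in> K U \<inter> C U" if U: "openin X U" "s \<in> carrier (Mod M U)"
    and loc: "\<And>x. x \<in> U \<Longrightarrow> \<exists>V. openin X V \<and> x \<in> V \<and> V \<subseteq> U \<and> Res M U V s \<in> K V \<inter> C V" for U s
    using loc subsheafD(3)[OF K U] subsheafD(3)[OF C U] by blast
  show "K U \<inter> C U = {}" if "\<not> openin X U" for U using that subsheaf_openD[OF K] by blast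
qed (use K C in \<open>auto simp: subsheaf_simps[OF K] subsheaf_simps[OF C] subsheafD(2)\<close>)

lemma complementary_unique:
  assumes KC: "complementary X M K C" and K: "subsheaf X \<O> M K" and C: "subsheaf X \<O> M C" and U: "openin X U"
    and ab: "a \<in> K U" "b \<in> C U" "a' \<in> K U" "b' \<in> C U" "a \<oplus>\<^bsub>Mod M U\<^esub> b = a' \<oplus>\<^bsub>Mod M U\<^esub> b'"
  shows "a = a'"
proof -
  note in_K = subsheaf_simps(1)[OF K U] and in_C = subsheaf_simps(1)[OF C U]
  interpret U: abelian_group "Mod M U" using sections_abelian_group[OF U] .
  have car: "a \<in> carrier (Mod M U)" "a' \<in> carrier (Mod M U)" "b \<in> carrier (Mod M U)" "b' \<in> carrier (Mod M U)"
    using ab in_K in_C by auto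
  have "\<zero>\<^bsub>Mod M U\<^esub> = (a \<oplus>\<^bsub>Mod M U\<^esub> b) \<ominus>\<^bsub>Mod M U\<^esub> (a' \<oplus>\<^bsub>Mod M U\<^esub> b')"
    using section_arith(10)[OF U] car ab(5) by simp
  also have "\<dots> = (a \<ominus>\<^bsub>Mod M U\<^esub> a') \<oplus>\<^bsub>Mod M U\<^esub> (b \<ominus>\<^bsub>Mod M U\<^esub> b')"
    using section_arith(7)[OF U] car by simp
  finally have "a \<ominus>\<^bsub>Mod M U\<^esub> a' = \<ominus>\<^bsub>Mod M U\<^esub> (b \<ominus>\<^bsub>Mod M U\<^esub> b')"
    using car by (metis U.minus_closed U.minus_equality)
  then have "a \<ominus>\<^bsub>Mod M U\<^esub> a' \<in> C U"
    using ab subsheaf_simps(4,5)[OF C U] by simp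
  then have "a \<ominus>\<^bsub>Mod M U\<^esub> a' = \<zero>\<^bsub>Mod M U\<^esub>"
    using complementaryD(1)[OF KC U] subsheaf_simps(5)[OF K U ab(1,3)] by blast
  then show ?thesis using section_arith(12)[OF U] car by simp
qed

end

context quotient_map
begin

lemma quotient_map_open:
  assumes U: "openin X U"
  shows "quotient_map (subtopology X U) \<O> A B (on_open X U F) (on_open X U N) p"
proof (intro quotient_map.intro quotient_map_axioms.intro A.module_sheaf_open B.module_sheaf_open U
    subsheaf_on_open[OF F U])
  fix V x s assume "openin (subtopology X U) V" "s \<in> carrier (Mod B V)" "x \<in> V"
  moreover from this obtain W a where "openin X W" "x \<in> W" "W \<subseteq> V" "a \<in> F W" "Res B V W s = p W a"
    using p_surj[of V s x] U by (auto simp: on_open_simps)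
  ultimately show "\<exists>W a. openin (subtopology X U) W \<and> x \<in> W \<and> W \<subseteq> V \<and> a \<in> on_open X U F W \<and> Res B V W s = p W a"
    using U by (intro exI[of _ W] exI[of _ a]) (auto simp: on_open_simps)
qed (use U N_subset_F p_kernel in \<open>auto simp: on_open_simps p_closed p_add p_smult p_Res\<close>)

lemma image_sheaf_open:
  assumes U: "openin X U"
  shows "quotient_map.image_sheaf (subtopology X U) B p (on_open X U K) = on_open X U (image_sheaf K)"
proof
  interpret U: quotient_map "subtopology X U" \<O> A B "on_open X U F" "on_open X U N" p
    using quotient_map_open[OF U] .
  fix W
  show "U.image_sheaf (on_open X U K) W = on_open X U (image_sheaf K) W"
  proof (cases "openin X W \<and> W \<subseteq> U")
    case True
    then have *: "openin (subtopology X U) V \<and> x \<in> V \<and> V \<subseteq> W \<and> a \<in> on_open X U K V \<and> P \<longleftrightarrow>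
        openin X V \<and> x \<in> V \<and> V \<subseteq> W \<and> a \<in> K V \<and> P" for V x a P
      unfolding on_open_def on_open_simps(1)[OF U] by (metis subset_trans)
    have "on_open X U (image_sheaf K) W = image_sheaf K W" using True by (simp add: on_open_def)
    moreover have "openin (subtopology X U) W" using True by (simp add: on_open_simps(1)[OF U])
    ultimately show ?thesis using True unfolding U.image_sheaf_def image_sheaf_def * by simp
  next
    case False
    then show ?thesis
      unfolding U.image_sheaf_def on_open_simps(1)[OF U] by (auto simp: on_open_def[of X U "image_sheaf K"])
  qed
qed

lemma preimage_sheaf_open:
  assumes U: "openin X U"
  shows "quotient_map.preimage_sheaf (on_open X U F) p (on_open X U L) = on_open X U (preimage_sheaf L)"
proof -
  interpret U: quotient_map "subtopology X U" \<O> A B "on_open X U F" "on_open X U N" p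
    using quotient_map_open[OF U] .
  show ?thesis by (auto simp: fun_eq_iff U.preimage_sheaf_def preimage_sheaf_def on_open_def)
qed

text \<open>A section of \<open>B\<close> has only local lifts to \<open>F\<close>, but the components of these lifts along \<open>D\<close> are independent
  of the choices, because two lifts differ by a section of \<open>N \<subseteq> K\<close>. They glue, and the remainder is in the
  image of \<open>K\<close>.\<close>

lemma lift_along_complement:
  assumes K: "subsheaf X \<O> A K" and N_K: "\<And>U. openin X U \<Longrightarrow> N U \<subseteq> K U"
    and K_F: "\<And>U. openin X U \<Longrightarrow> K U \<subseteq> F U"
    and D: "subsheaf X \<O> A D" and KD: "complementary X A K D"
    and W: "openin X W" and b: "b \<in> carrier (Mod B W)"
  obtains d where "d \<in> F W" "d \<in> D W" "b \<ominus>\<^bsub>Mod B W\<^esub> p W d \<in> image_sheaf K W"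
proof -
  define P where "P V d \<longleftrightarrow> d \<in> F V \<and> d \<in> D V \<and> (\<exists>k\<in>K V. Res B W V b = p V (k \<oplus>\<^bsub>Mod A V\<^esub> d))" for V d
  have P_ex: "\<exists>V d. openin X V \<and> x \<in> V \<and> V \<subseteq> W \<and> d \<in> carrier (Mod A V) \<and> P V d" if x: "x \<in> W" for x
  proof -
    obtain V a where V: "openin X V" "x \<in> V" "V \<subseteq> W" "a \<in> F V" "Res B W V b = p V a"
      using p_surj[OF W b x] by blast
    obtain k d where kd: "k \<in> K V" "d \<in> D V" "a = k \<oplus>\<^bsub>Mod A V\<^esub> d"
      using complementaryD(2)[OF KD V(1) F_simps(1)[OF V(1,4)]] by blast
    have car: "k \<in> carrier (Mod A V)" "d \<in> carrier (Mod A V)"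
      using A.subsheaf_simps(1)[OF K V(1) kd(1)] A.subsheaf_simps(1)[OF D V(1) kd(2)] by auto
    have "d = a \<ominus>\<^bsub>Mod A V\<^esub> k" using A.section_arith(3)[OF V(1) car] kd(3) by simp
    then have "d \<in> F V" using F_simps(5)[OF V(1,4)] K_F[OF V(1)] kd(1) by auto
    then show ?thesis using V kd car by (auto simp: P_def)
  qed
  have P_Res: "P V' (Res A V V' d)" if V: "openin X V" "openin X V'" "V' \<subseteq> V" "V \<subseteq> W" and d: "P V d" for V V' d
  proof -
    from d obtain k where k: "d \<in> F V" "d \<in> D V" "k \<in> K V" "Res B W V b = p V (k \<oplus>\<^bsub>Mod A V\<^esub> d)"
      by (auto simp: P_def)
    have kF: "k \<in> F V" using k(3) K_F[OF V(1)] by auto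
    have "Res B W V' b = Res B V V' (p V (k \<oplus>\<^bsub>Mod A V\<^esub> d))"
      using B.Res_Res[OF W V(1,2,3,4) b] k(4) by simp
    also have "\<dots> = p V' (Res A V V' k \<oplus>\<^bsub>Mod A V'\<^esub> Res A V V' d)"
      using V k(1) kF by (simp add: p_Res A.Res_add F_simps)
    finally show ?thesis
      using subsheafD(2)[OF K V(1-3) k(3)] subsheafD(2)[OF D V(1-3) k(2)] F_Res[OF V(1-3) k(1)]
      by (auto simp: P_def)
  qed
  have unique: "d = d'" if V: "openin X V" and d: "P V d" and d': "P V d'" for V d d'
  proof -
    from d obtain k where k: "d \<in> F V" "d \<in> D V" "k \<in> K V" "Res B W V b = p V (k \<oplus>\<^bsub>Mod A V\<^esub> d)"
      by (auto simp: P_def)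
    from d' obtain k' where k': "d' \<in> F V" "d' \<in> D V" "k' \<in> K V" "Res B W V b = p V (k' \<oplus>\<^bsub>Mod A V\<^esub> d')"
      by (auto simp: P_def)
    have kF: "k \<in> F V" "k' \<in> F V" using k(3) k'(3) K_F[OF V(1)] by auto
    have car: "k \<in> carrier (Mod A V)" "k' \<in> carrier (Mod A V)" "d \<in> carrier (Mod A V)" "d' \<in> carrier (Mod A V)"
      using F_simps(1)[OF V] kF k(1) k'(1) by auto
    have kk': "k \<ominus>\<^bsub>Mod A V\<^esub> k' \<in> K V" using A.subsheaf_simps(5)[OF K V k(3) k'(3)] .
    have "(k \<oplus>\<^bsub>Mod A V\<^esub> d) \<ominus>\<^bsub>Mod A V\<^esub> (k' \<oplus>\<^bsub>Mod A V\<^esub> d') \<in> K V"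
      using p_eq_iff[OF V F_simps(3)[OF V kF(1) k(1)] F_simps(3)[OF V kF(2) k'(1)]] k(4) k'(4) N_K[OF V] by auto
    then have sum: "(k \<ominus>\<^bsub>Mod A V\<^esub> k') \<oplus>\<^bsub>Mod A V\<^esub> (d \<ominus>\<^bsub>Mod A V\<^esub> d') \<in> K V"
      using A.section_arith(7)[OF V] car by simp
    have "d \<ominus>\<^bsub>Mod A V\<^esub> d' =
        ((k \<ominus>\<^bsub>Mod A V\<^esub> k') \<oplus>\<^bsub>Mod A V\<^esub> (d \<ominus>\<^bsub>Mod A V\<^esub> d')) \<ominus>\<^bsub>Mod A V\<^esub> (k \<ominus>\<^bsub>Mod A V\<^esub> k')"
      using A.section_arith(3)[OF V, of "k \<ominus>\<^bsub>Mod A V\<^esub> k'" "d \<ominus>\<^bsub>Mod A V\<^esub> d'"] car V by simp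
    then have "d \<ominus>\<^bsub>Mod A V\<^esub> d' \<in> K V" using A.subsheaf_simps(5)[OF K V sum kk'] by simp
    moreover have "d \<ominus>\<^bsub>Mod A V\<^esub> d' \<in> D V" using A.subsheaf_simps(5)[OF D V k(2) k'(2)] .
    ultimately have "d \<ominus>\<^bsub>Mod A V\<^esub> d' = \<zero>\<^bsub>Mod A V\<^esub>" by (rule complementaryD(1)[OF KD V])
    then show ?thesis using A.section_arith(12)[OF V] car by simp
  qed
  obtain d where d: "d \<in> carrier (Mod A W)"
    "\<And>x. x \<in> W \<Longrightarrow> \<exists>V. openin X V \<and> x \<in> V \<and> V \<subseteq> W \<and> P V (Res A W V d)"
    by (rule A.glue_unique[of W P, OF W P_ex P_Res unique]) auto
  have dF: "d \<in> F W" by (rule subsheafD(3)[OF F W d(1)]) (use d(2) in \<open>auto simp: P_def\<close>)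
  have dD: "d \<in> D W" by (rule subsheafD(3)[OF D W d(1)]) (use d(2) in \<open>auto simp: P_def\<close>)
  have "b \<ominus>\<^bsub>Mod B W\<^esub> p W d \<in> image_sheaf K W"
  proof (rule image_sheafI[OF W])
    show "b \<ominus>\<^bsub>Mod B W\<^esub> p W d \<in> carrier (Mod B W)" using b p_closed[OF W dF] W by simp
    fix x assume "x \<in> W"
    with d(2) obtain V k where V: "openin X V" "x \<in> V" "V \<subseteq> W" "Res A W V d \<in> F V" "k \<in> K V"
      "Res B W V b = p V (k \<oplus>\<^bsub>Mod A V\<^esub> Res A W V d)" unfolding P_def by blast
    have "Res B W V (b \<ominus>\<^bsub>Mod B W\<^esub> p W d) = (p V k \<oplus>\<^bsub>Mod B V\<^esub> p V (Res A W V d)) \<ominus>\<^bsub>Mod B V\<^esub> p V (Res A W V d)"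
      using V K_F[OF V(1)] b p_closed[OF W dF] W p_Res[OF W V(1,3) dF] by (simp add: B.Res_minus p_add subsetD)
    also have "\<dots> = p V k" using B.section_arith(2)[OF V(1)] V p_closed K_F by blast
    finally show "\<exists>V a. openin X V \<and> x \<in> V \<and> V \<subseteq> W \<and> a \<in> K V \<and> Res B W V (b \<ominus>\<^bsub>Mod B W\<^esub> p W d) = p V a"
      using V by blast
  qed
  with dF dD show ?thesis by (rule that)
qed

text \<open>The modular law gives \<open>F = K \<oplus> (F \<inter> C)\<close>, and dividing by \<open>N \<subseteq> K\<close> leaves the second summand unchanged.\<close>

lemma complementary_image:
  assumes K: "subsheaf X \<O> A K" and N_K: "\<And>U. openin X U \<Longrightarrow> N U \<subseteq> K U"
    and K_F: "\<And>U. openin X U \<Longrightarrow> K U \<subseteq> F U"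
    and C: "subsheaf X \<O> A C" and KC: "complementary X A K C"
  shows "complementary X B (image_sheaf K) (image_sheaf (\<lambda>U. F U \<inter> C U))"
proof (rule B.complementaryI[OF subsheaf_image subsheaf_image])
  show FC: "subsheaf X \<O> A (\<lambda>U. F U \<inter> C U)" by (rule A.subsheaf_Int[OF F C])
  fix U s assume U: "openin X U"
  show "s = \<zero>\<^bsub>Mod B U\<^esub>" if s: "s \<in> image_sheaf K U" "s \<in> image_sheaf (\<lambda>U. F U \<inter> C U) U"
  proof (rule B.locality[OF U])
    show sB: "s \<in> carrier (Mod B U)" using s by (simp add: image_sheaf_def)
    fix x assume x: "x \<in> U"
    obtain V a where V: "openin X V" "x \<in> V" "V \<subseteq> U" "a \<in> K V" "Res B U V s = p V a"
      by (rule image_sheafD[OF s(1) x])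
    obtain V' c where V': "openin X V'" "x \<in> V'" "V' \<subseteq> U" "c \<in> F V' \<inter> C V'" "Res B U V' s = p V' c"
      by (rule image_sheafD[OF s(2) x])
    define W where "W = V \<inter> V'"
    have W: "openin X W" "x \<in> W" "W \<subseteq> V" "W \<subseteq> V'" "W \<subseteq> U" using V V' by (auto simp: W_def)
    have aF: "a \<in> F V" using V K_F[OF V(1)] by auto
    have aW: "Res B U W s = p W (Res A V W a)" "Res A V W a \<in> K W" "Res A V W a \<in> F W"
      using p_Res[OF V(1) W(1,3) aF] B.Res_Res[OF U V(1) W(1,3) V(3) sB] V(5)
        subsheafD(2)[OF K V(1) W(1,3) V(4)] F_Res[OF V(1) W(1,3) aF] by auto
    have cW: "Res B U W s = p W (Res A V' W c)" "Res A V' W c \<in> C W" "Res A V' W c \<in> F W"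
      using p_Res[OF V'(1) W(1,4), of c] B.Res_Res[OF U V'(1) W(1,4) V'(3) sB] V'(4,5)
        subsheafD(2)[OF C V'(1) W(1,4), of c] F_Res[OF V'(1) W(1,4), of c] by auto
    have "Res A V W a \<ominus>\<^bsub>Mod A W\<^esub> Res A V' W c \<in> N W" using p_eq_iff[OF W(1) aW(3) cW(3)] aW(1) cW(1) by simp
    then have "Res A V W a \<ominus>\<^bsub>Mod A W\<^esub> (Res A V W a \<ominus>\<^bsub>Mod A W\<^esub> Res A V' W c) \<in> K W"
      using A.subsheaf_simps(5)[OF K W(1) aW(2)] N_K[OF W(1)] by auto
    moreover have "Res A V W a \<ominus>\<^bsub>Mod A W\<^esub> (Res A V W a \<ominus>\<^bsub>Mod A W\<^esub> Res A V' W c) = Res A V' W c"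
    proof -
      interpret W: abelian_group "Mod A W" using A.sections_abelian_group[OF W(1)] .
      show ?thesis using F_simps(1)[OF W(1) aW(3)] F_simps(1)[OF W(1) cW(3)]
        by (simp add: a_minus_def W.minus_add W.r_neg2)
    qed
    ultimately have "Res A V' W c = \<zero>\<^bsub>Mod A W\<^esub>" using complementaryD(1)[OF KC W(1) _ cW(2)] by simp
    then show "\<exists>V. openin X V \<and> x \<in> V \<and> V \<subseteq> U \<and> Res B U V s = Res B U V \<zero>\<^bsub>Mod B U\<^esub>"
      using W cW(1) p_zero[OF W(1)] U by (intro exI[of _ W]) simp
  qed (use U in simp)
  show "\<exists>a\<in>image_sheaf K U. \<exists>b\<in>image_sheaf (\<lambda>U. F U \<inter> C U) U. s = a \<oplus>\<^bsub>Mod B U\<^esub> b"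
    if s: "s \<in> carrier (Mod B U)"
  proof -
    obtain d where d: "d \<in> F U" "d \<in> C U" "s \<ominus>\<^bsub>Mod B U\<^esub> p U d \<in> image_sheaf K U"
      by (rule lift_along_complement[OF K N_K K_F C KC U s])
    then show ?thesis
      using image_p[OF U, of d "\<lambda>U. F U \<inter> C U"] B.section_arith(1)[OF U s p_closed[OF U d(1)]]
      by (metis IntI)
  qed
qed (use K K_F in auto)

lemma image_N_trivial:
  assumes U: "openin X U" and s: "s \<in> image_sheaf N U"
  shows "s = \<zero>\<^bsub>Mod B U\<^esub>"
proof (rule B.locality[OF U])
  show "s \<in> carrier (Mod B U)" using s by (simp add: image_sheaf_def)
  fix x assume x: "x \<in> U"
  obtain V a where V: "openin X V" "x \<in> V" "V \<subseteq> U" "a \<in> N V" "Res B U V s = p V a"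
    by (rule image_sheafD[OF s x])
  then show "\<exists>V. openin X V \<and> x \<in> V \<and> V \<subseteq> U \<and> Res B U V s = Res B U V \<zero>\<^bsub>Mod B U\<^esub>"
    using U p_kernel[OF V(1)] N_subset_F[OF V(1)] by (intro exI[of _ V]) (auto simp: subsetD)
qed (use U in simp)

text \<open>With \<open>A = F \<oplus> E = N \<oplus> D\<close> and \<open>B = L \<oplus> C\<close>, the summand \<open>F \<inter> D\<close> maps isomorphically to \<open>B\<close>, and
  \<open>A\<close> is the direct sum of the preimage of \<open>L\<close>, of the part of \<open>F \<inter> D\<close> over \<open>C\<close>, and of \<open>E\<close>.\<close>

lemma complementary_preimage:
  assumes N: "subsheaf X \<O> A N" and L: "subsheaf X \<O> B L"
    and E: "subsheaf X \<O> A E" and FE: "complementary X A F E"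
    and D: "subsheaf X \<O> A D" and ND: "complementary X A N D"
    and C: "subsheaf X \<O> B C" and LC: "complementary X B L C"
  obtains G where "subsheaf X \<O> A G" "complementary X A (preimage_sheaf L) G"
proof -
  define H where "H U = F U \<inter> D U \<inter> preimage_sheaf C U" for U
  define G where "G U = {a. openin X U \<and> (\<exists>h\<in>H U. \<exists>e\<in>E U. a = h \<oplus>\<^bsub>Mod A U\<^esub> e)}" for U
  have H: "subsheaf X \<O> A H"
    unfolding H_def by (intro A.subsheaf_Int F D subsheaf_preimage C)
  have H_F: "H U \<subseteq> F U" for U by (auto simp: H_def)
  note in_H = A.subsheaf_simps(1)[OF H] and in_E = A.subsheaf_simps(1)[OF E]
  have G: "subsheaf X \<O> A G"
  proof (rule A.subsheafI)
    show "s \<in> carrier (Mod A U)" if "openin X U" "s \<in> G U" for U s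
      using that in_H[OF that(1)] in_E[OF that(1)] by (auto simp: G_def)
    show "\<zero>\<^bsub>Mod A U\<^esub> \<in> G U" if U: "openin X U" for U
    proof -
      interpret U: abelian_group "Mod A U" using A.sections_abelian_group[OF U] .
      show ?thesis using A.subsheaf_simps(2)[OF H U] A.subsheaf_simps(2)[OF E U] U
        unfolding G_def by (auto intro!: bexI[of _ "\<zero>\<^bsub>Mod A U\<^esub>"])
    qed
    show "s \<oplus>\<^bsub>Mod A U\<^esub> t \<in> G U" if U: "openin X U" and s: "s \<in> G U" and t: "t \<in> G U" for U s t
    proof -
      from s obtain h e where he: "h \<in> H U" "e \<in> E U" "s = h \<oplus>\<^bsub>Mod A U\<^esub> e" by (auto simp: G_def)
      from t obtain h' e' where he': "h' \<in> H U" "e' \<in> E U" "t = h' \<oplus>\<^bsub>Mod A U\<^esub> e'" by (auto simp: G_def)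
      have "s \<oplus>\<^bsub>Mod A U\<^esub> t = (h \<oplus>\<^bsub>Mod A U\<^esub> h') \<oplus>\<^bsub>Mod A U\<^esub> (e \<oplus>\<^bsub>Mod A U\<^esub> e')"
        using he he' in_H[OF U] in_E[OF U] A.section_arith(8)[OF U, of h e h' e'] by simp
      then show ?thesis
        using U A.subsheaf_simps(3)[OF H U he(1) he'(1)] A.subsheaf_simps(3)[OF E U he(2) he'(2)]
        by (auto simp: G_def)
    qed
    show "f \<odot>\<^bsub>Mod A U\<^esub> s \<in> G U" if U: "openin X U" and f: "f \<in> \<O> U" and s: "s \<in> G U" for U f s
    proof -
      from s obtain h e where he: "h \<in> H U" "e \<in> E U" "s = h \<oplus>\<^bsub>Mod A U\<^esub> e" by (auto simp: G_def)
      then have "f \<odot>\<^bsub>Mod A U\<^esub> s = f \<odot>\<^bsub>Mod A U\<^esub> h \<oplus>\<^bsub>Mod A U\<^esub> f \<odot>\<^bsub>Mod A U\<^esub> e"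
        using A.smult_add[OF U f in_H[OF U] in_E[OF U]] by simp
      then show ?thesis
        using U A.subsheaf_simps(6)[OF H U f he(1)] A.subsheaf_simps(6)[OF E U f he(2)] by (auto simp: G_def)
    qed
    show "Res A U V s \<in> G V" if U: "openin X U" and V: "openin X V" "V \<subseteq> U" and s: "s \<in> G U" for U V s
    proof -
      from s obtain h e where he: "h \<in> H U" "e \<in> E U" "s = h \<oplus>\<^bsub>Mod A U\<^esub> e" by (auto simp: G_def)
      then have "Res A U V s = Res A U V h \<oplus>\<^bsub>Mod A V\<^esub> Res A U V e"
        using A.Res_add[OF U V in_H[OF U] in_E[OF U]] by simp
      then show ?thesis
        using V subsheafD(2)[OF H U V he(1)] subsheafD(2)[OF E U V he(2)] by (auto simp: G_def)
    qed
    show "s \<in> G U" if U: "openin X U" and s: "s \<in> carrier (Mod A U)"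
      and loc: "\<And>x. x \<in> U \<Longrightarrow> \<exists>V. openin X V \<and> x \<in> V \<and> V \<subseteq> U \<and> Res A U V s \<in> G V" for U s
    proof -
      obtain f e where fe: "f \<in> F U" "e \<in> E U" "s = f \<oplus>\<^bsub>Mod A U\<^esub> e"
        using complementaryD(2)[OF FE U s] by blast
      have "f \<in> H U"
      proof (rule subsheafD(3)[OF H U F_simps(1)[OF U fe(1)]])
        fix x assume "x \<in> U"
        with loc obtain V h e' where V: "openin X V" "x \<in> V" "V \<subseteq> U" "h \<in> H V" "e' \<in> E V"
          "Res A U V s = h \<oplus>\<^bsub>Mod A V\<^esub> e'" unfolding G_def by blast
        have "Res A U V f = h"
        proof (rule A.complementary_unique[OF FE F E V(1)])
          show "Res A U V f \<oplus>\<^bsub>Mod A V\<^esub> Res A U V e = h \<oplus>\<^bsub>Mod A V\<^esub> e'"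
            using A.Res_add[OF U V(1,3) F_simps(1)[OF U fe(1)] in_E[OF U fe(2)]] fe(3) V(6) by simp
        qed (use F_Res[OF U V(1,3) fe(1)] subsheafD(2)[OF E U V(1,3) fe(2)] V H_F in auto)
        then show "\<exists>V. openin X V \<and> x \<in> V \<and> V \<subseteq> U \<and> Res A U V f \<in> H V" using V by blast
      qed
      then show ?thesis using fe U by (auto simp: G_def)
    qed
    show "G U = {}" if "\<not> openin X U" for U using that by (simp add: G_def)
  qed
  have "complementary X A (preimage_sheaf L) G"
  proof (rule A.complementaryI[OF subsheaf_preimage[OF L] G])
    fix U s assume U: "openin X U"
    show "s = \<zero>\<^bsub>Mod A U\<^esub>" if s: "s \<in> preimage_sheaf L U" "s \<in> G U"
    proof -
      from s(2) obtain h e where he: "h \<in> H U" "e \<in> E U" "s = h \<oplus>\<^bsub>Mod A U\<^esub> e" by (auto simp: G_def)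
      have sF: "s \<in> F U" and pL: "p U s \<in> L U" using s by (auto simp: preimage_sheaf_def)
      interpret U: abelian_group "Mod A U" using A.sections_abelian_group[OF U] .
      have "s = h"
      proof (rule A.complementary_unique[OF FE F E U sF A.subsheaf_simps(2)[OF E U] _ he(2)])
        show "s \<oplus>\<^bsub>Mod A U\<^esub> \<zero>\<^bsub>Mod A U\<^esub> = h \<oplus>\<^bsub>Mod A U\<^esub> e" using F_simps(1)[OF U sF] he(3) by simp
      qed (use he H_F in auto)
      then have "s \<in> D U" "p U s \<in> C U" using he by (auto simp: H_def preimage_sheaf_def)
      then have "p U s = \<zero>\<^bsub>Mod B U\<^esub>" using complementaryD(1)[OF LC U pL] by simp
      then have "s \<in> N U" using p_kernel[OF U sF] by simp
      then show ?thesis using complementaryD(1)[OF ND U _ \<open>s \<in> D U\<close>] by simp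
    qed
    show "\<exists>a\<in>preimage_sheaf L U. \<exists>b\<in>G U. s = a \<oplus>\<^bsub>Mod A U\<^esub> b" if s: "s \<in> carrier (Mod A U)"
    proof -
      obtain f e where fe: "f \<in> F U" "e \<in> E U" "s = f \<oplus>\<^bsub>Mod A U\<^esub> e"
        using complementaryD(2)[OF FE U s] by blast
      obtain l c where lc: "l \<in> L U" "c \<in> C U" "p U f = l \<oplus>\<^bsub>Mod B U\<^esub> c"
        using complementaryD(2)[OF LC U p_closed[OF U fe(1)]] by blast
      have in_B: "l \<in> carrier (Mod B U)" "c \<in> carrier (Mod B U)"
        using B.subsheaf_simps(1)[OF L U lc(1)] B.subsheaf_simps(1)[OF C U lc(2)] by auto
      obtain d where d: "d \<in> F U" "d \<in> D U" "c \<ominus>\<^bsub>Mod B U\<^esub> p U d \<in> image_sheaf N U"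
        by (rule lift_along_complement[OF N subset_refl N_subset_F D ND U in_B(2)])
      have pd: "p U d = c"
        using image_N_trivial[OF U d(3)] B.section_arith(12)[OF U in_B(2) p_closed[OF U d(1)]] by simp
      then have "d \<in> H U" using d lc(2) by (auto simp: H_def preimage_sheaf_def)
      then have "d \<oplus>\<^bsub>Mod A U\<^esub> e \<in> G U" using fe(2) U by (auto simp: G_def)
      moreover have "f \<ominus>\<^bsub>Mod A U\<^esub> d \<in> preimage_sheaf L U"
        using p_minus[OF U fe(1) d(1)] pd lc B.section_arith(2)[OF U in_B] F_simps(5)[OF U fe(1) d(1)]
        by (simp add: preimage_sheaf_def)
      moreover have "s = (f \<ominus>\<^bsub>Mod A U\<^esub> d) \<oplus>\<^bsub>Mod A U\<^esub> (d \<oplus>\<^bsub>Mod A U\<^esub> e)"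
        using A.section_arith(11)[OF U] F_simps(1)[OF U] fe in_E[OF U] d(1) by simp
      ultimately show ?thesis by blast
    qed
  qed
  with G show ?thesis by (rule that)
qed

lemma subbundle_image:
  assumes K: "subbundle X \<O> A K" and N_K: "\<And>U. openin X U \<Longrightarrow> N U \<subseteq> K U"
    and K_F: "\<And>U. openin X U \<Longrightarrow> K U \<subseteq> F U"
  shows "subbundle X \<O> B (image_sheaf K)"
  unfolding subbundle_iff
proof (intro conjI ballI)
  have sub: "subsheaf X \<O> A K" using K by (simp add: subbundle_def)
  then show "subsheaf X \<O> B (image_sheaf K)" using K_F by (rule subsheaf_image)
  fix x assume "x \<in> topspace X"
  then obtain U C where U: "openin X U" "x \<in> U" and C: "subsheaf (subtopology X U) \<O> A C"
      "complementary (subtopology X U) A (on_open X U K) C"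
    using K unfolding subbundle_iff by blast
  interpret U: quotient_map "subtopology X U" \<O> A B "on_open X U F" "on_open X U N" p
    using quotient_map_open[OF U(1)] .
  have "complementary (subtopology X U) B (U.image_sheaf (on_open X U K)) (U.image_sheaf (\<lambda>V. on_open X U F V \<inter> C V))"
    using N_K K_F U(1) by (intro U.complementary_image subsheaf_on_open sub C) (auto simp: on_open_simps)
  moreover have "subsheaf (subtopology X U) \<O> B (U.image_sheaf (\<lambda>V. on_open X U F V \<inter> C V))"
    by (intro U.subsheaf_image U.A.subsheaf_Int U.F C) auto
  ultimately show "\<exists>U C. openin X U \<and> x \<in> U \<and> subsheaf (subtopology X U) \<O> B C \<and>
      complementary (subtopology X U) B (on_open X U (image_sheaf K)) C"
    using U by (auto simp: image_sheaf_open)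
qed

lemma subbundle_preimage:
  assumes F_sub: "subbundle X \<O> A F" and N_sub: "subbundle X \<O> A N" and L_sub: "subbundle X \<O> B L"
  shows "subbundle X \<O> A (preimage_sheaf L)"
  unfolding subbundle_iff
proof (intro conjI ballI)
  have L: "subsheaf X \<O> B L" and N: "subsheaf X \<O> A N" using L_sub N_sub by (simp_all add: subbundle_def)
  from L show "subsheaf X \<O> A (preimage_sheaf L)" by (rule subsheaf_preimage)
  fix x assume x: "x \<in> topspace X"
  obtain U1 where U1: "openin X U1" "x \<in> U1" "\<And>V. \<lbrakk>openin X V; V \<subseteq> U1\<rbrakk> \<Longrightarrow>
      \<exists>C. subsheaf (subtopology X V) \<O> A C \<and> complementary (subtopology X V) A (on_open X V F) C"
    using subbundle_complement[OF F_sub x] by blast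
  obtain U2 where U2: "openin X U2" "x \<in> U2" "\<And>V. \<lbrakk>openin X V; V \<subseteq> U2\<rbrakk> \<Longrightarrow>
      \<exists>C. subsheaf (subtopology X V) \<O> A C \<and> complementary (subtopology X V) A (on_open X V N) C"
    using subbundle_complement[OF N_sub x] by blast
  obtain U3 where U3: "openin X U3" "x \<in> U3" "\<And>V. \<lbrakk>openin X V; V \<subseteq> U3\<rbrakk> \<Longrightarrow>
      \<exists>C. subsheaf (subtopology X V) \<O> B C \<and> complementary (subtopology X V) B (on_open X V L) C"
    using subbundle_complement[OF L_sub x] by blast
  define U where "U = U1 \<inter> U2 \<inter> U3"
  have U: "openin X U" "x \<in> U" "U \<subseteq> U1" "U \<subseteq> U2" "U \<subseteq> U3"
    using U1 U2 U3 by (auto simp: U_def)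
  interpret U: quotient_map "subtopology X U" \<O> A B "on_open X U F" "on_open X U N" p
    using quotient_map_open[OF U(1)] .
  obtain E where E: "subsheaf (subtopology X U) \<O> A E" "complementary (subtopology X U) A (on_open X U F) E"
    using U1(3)[OF U(1,3)] by blast
  obtain D where D: "subsheaf (subtopology X U) \<O> A D" "complementary (subtopology X U) A (on_open X U N) D"
    using U2(3)[OF U(1,4)] by blast
  obtain C where C: "subsheaf (subtopology X U) \<O> B C" "complementary (subtopology X U) B (on_open X U L) C"
    using U3(3)[OF U(1,5)] by blast
  obtain G where "subsheaf (subtopology X U) \<O> A G"
      "complementary (subtopology X U) A (U.preimage_sheaf (on_open X U L)) G"
    using U.complementary_preimage[OF subsheaf_on_open[OF N U(1)] subsheaf_on_open[OF L U(1)] E D C] by blast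
  then show "\<exists>U C. openin X U \<and> x \<in> U \<and> subsheaf (subtopology X U) \<O> A C \<and>
      complementary (subtopology X U) A (on_open X U (preimage_sheaf L)) C"
    using U by (auto simp: preimage_sheaf_open)
qed

end

section \<open>Isotropic subsheaves of a quotient\<close>

text \<open>For bilinear pairings, that the one of \<open>A\<close> descends from \<open>F\<close> to \<open>B\<close> means that \<open>N\<close> is orthogonal to \<open>F\<close>; this
  is how orthogonality enters the correspondence of isotropic subsheaves.\<close>

locale isotropic_quotient = quotient_map X \<O> A B F N p
  for X :: "'x topology" and \<O> :: "'x set \<Rightarrow> 'x fn set"
    and A :: "('x, 'a, 'm) omodule_scheme" and B :: "('x, 'b, 'n) omodule_scheme"
    and F N :: "'x set \<Rightarrow> 'a set" and p :: "'x set \<Rightarrow> 'a \<Rightarrow> 'b" +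
  fixes pA :: "'x set \<Rightarrow> 'a \<Rightarrow> 'a \<Rightarrow> 'x fn" and pB :: "'x set \<Rightarrow> 'b \<Rightarrow> 'b \<Rightarrow> 'x fn"
  assumes pB_extensional: "pB U s t \<in> extensional U"
    and pB_Res: "\<lbrakk>openin X U; openin X V; V \<subseteq> U; s \<in> carrier (Mod B U); t \<in> carrier (Mod B U); x \<in> V\<rbrakk>
      \<Longrightarrow> pB V (Res B U V s) (Res B U V t) x = pB U s t x"
    and p_pairing: "\<lbrakk>openin X U; a \<in> F U; b \<in> F U\<rbrakk> \<Longrightarrow> pB U (p U a) (p U b) = pA U a b"
begin

lemma isotropic_image:
  assumes K: "subsheaf X \<O> A K" and K_F: "\<And>U. openin X U \<Longrightarrow> K U \<subseteq> F U" and iso: "isotropic X pA K"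
  shows "isotropic X pB (image_sheaf K)"
  unfolding isotropic_def
proof (intro allI impI ballI)
  fix U s t assume U: "openin X U" and s: "s \<in> image_sheaf K U" and t: "t \<in> image_sheaf K U"
  show "pB U s t = (\<lambda>x\<in>U. 0)"
  proof (rule extensionalityI[of _ U])
    fix x assume x: "x \<in> U"
    obtain V a b where V: "openin X V" "x \<in> V" "V \<subseteq> U" "a \<in> K V" "b \<in> K V" "Res B U V s = p V a" "Res B U V t = p V b"
      by (rule image_sheaf_common[OF K K_F U s t x])
    have "pB U s t x = pB V (p V a) (p V b) x"
      using pB_Res[OF U V(1,3) _ _ V(2), of s t] s t V(6,7) by (simp add: image_sheaf_def)
    also have "\<dots> = pA V a b x" using p_pairing[OF V(1)] V(4,5) K_F[OF V(1)] by (simp add: subsetD)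
    also have "\<dots> = 0" using iso V by (simp add: isotropic_def)
    finally show "pB U s t x = (\<lambda>x\<in>U. 0) x" using x by simp
  qed (simp_all add: pB_extensional)
qed

lemma isotropic_preimage: "isotropic X pB L \<Longrightarrow> isotropic X pA (preimage_sheaf L)"
  by (auto simp: isotropic_def preimage_sheaf_def simp flip: p_pairing)

text \<open>A maximal isotropic subsheaf of \<open>F\<close> contains \<open>N\<close>: the full preimage of its image in the quotient is
  isotropic as well.\<close>

lemma preimage_image_maximal_isotropic:
  assumes max: "maximal_isotropic X \<O> A pA K" and K_F: "\<And>U. openin X U \<Longrightarrow> K U \<subseteq> F U"
  shows "preimage_sheaf (image_sheaf K) = K"
proof -
  have K: "subsheaf X \<O> A K" and iso: "isotropic X pA K" using max by (simp_all add: maximal_isotropic_def)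
  have sub: "subsheaf X \<O> B (image_sheaf K)" using subsheaf_image[OF K K_F] .
  have "K \<le> preimage_sheaf (image_sheaf K)"
  proof (rule le_funI)
    fix U show "K U \<le> preimage_sheaf (image_sheaf K) U"
      using subset_preimage_image[OF K_F, of U] subsheaf_openD[OF K] by blast
  qed
  moreover have "isotropic X pA (preimage_sheaf (image_sheaf K))"
    by (rule isotropic_preimage[OF isotropic_image[OF K K_F iso]])
  ultimately show ?thesis using max subsheaf_preimage[OF sub] by (simp add: maximal_isotropic_def)
qed

lemma maximal_isotropic_contains_N:
  assumes "maximal_isotropic X \<O> A pA K" "\<And>U. openin X U \<Longrightarrow> K U \<subseteq> F U" "openin X U"
  shows "N U \<subseteq> K U"
  using N_subset_preimage[OF subsheaf_image[of K] assms(3)] preimage_image_maximal_isotropic[OF assms(1,2)] assms(1,2)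
  by (simp add: maximal_isotropic_def)

text \<open>An isotropic subsheaf \<open>L\<close> of \<open>B\<close> above the image of \<open>K\<close> has an isotropic preimage above \<open>K\<close>, which is \<open>K\<close>
  itself by maximality.\<close>

lemma maximal_isotropic_image:
  assumes max: "maximal_isotropic X \<O> A pA K" and K_F: "\<And>U. openin X U \<Longrightarrow> K U \<subseteq> F U"
  shows "maximal_isotropic X \<O> B pB (image_sheaf K)"
  unfolding maximal_isotropic_def
proof (intro conjI allI impI)
  have K: "subsheaf X \<O> A K" and iso: "isotropic X pA K" using max by (simp_all add: maximal_isotropic_def)
  show "subsheaf X \<O> B (image_sheaf K)" using subsheaf_image[OF K K_F] .
  show "isotropic X pB (image_sheaf K)" using isotropic_image[OF K K_F iso] .
  fix L assume L: "subsheaf X \<O> B L \<and> isotropic X pB L \<and> image_sheaf K \<le> L"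
  have eq: "preimage_sheaf (image_sheaf K) = K"
    by (rule preimage_image_maximal_isotropic[OF max K_F])
  have "K \<le> preimage_sheaf L"
  proof (rule le_funI, rule subsetI)
    fix U a assume "a \<in> K U"
    then have "a \<in> preimage_sheaf (image_sheaf K) U" by (simp only: eq)
    then show "a \<in> preimage_sheaf L U" using L by (auto simp: preimage_sheaf_def le_fun_def)
  qed
  then have "preimage_sheaf L = K"
    using max L subsheaf_preimage isotropic_preimage by (simp add: maximal_isotropic_def)
  then show "L = image_sheaf K" using image_preimage L by metis
qed

text \<open>In the other direction the isotropic enlargements of the preimage have to be confined to \<open>F\<close>; as they
  contain \<open>N\<close>, it is enough that the orthogonal complement of \<open>N\<close> is contained in \<open>F\<close>.\<close>

lemma maximal_isotropic_preimage:
  assumes max: "maximal_isotropic X \<O> B pB L"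
    and perp: "\<And>U a. \<lbrakk>openin X U; a \<in> carrier (Mod A U);
      \<And>V n. \<lbrakk>openin X V; V \<subseteq> U; n \<in> N V\<rbrakk> \<Longrightarrow> pA V (Res A U V a) n = (\<lambda>x\<in>V. 0)\<rbrakk> \<Longrightarrow> a \<in> F U"
  shows "maximal_isotropic X \<O> A pA (preimage_sheaf L)"
  unfolding maximal_isotropic_def
proof (intro conjI allI impI)
  have L: "subsheaf X \<O> B L" and iso: "isotropic X pB L" using max by (simp_all add: maximal_isotropic_def)
  show "subsheaf X \<O> A (preimage_sheaf L)" using subsheaf_preimage[OF L] .
  show "isotropic X pA (preimage_sheaf L)" using isotropic_preimage[OF iso] .
  fix K assume K: "subsheaf X \<O> A K \<and> isotropic X pA K \<and> preimage_sheaf L \<le> K"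
  then have K_sub: "subsheaf X \<O> A K" and K_iso: "isotropic X pA K" by auto
  have N_K: "N U \<subseteq> K U" if "openin X U" for U
    using N_subset_preimage[OF L that] K by (auto simp: le_fun_def)
  have K_F: "K U \<subseteq> F U" if U: "openin X U" for U
  proof
    fix a assume a: "a \<in> K U"
    show "a \<in> F U"
    proof (rule perp[OF U])
      fix V n assume V: "openin X V" "V \<subseteq> U" "n \<in> N V"
      then show "pA V (Res A U V a) n = (\<lambda>x\<in>V. 0)"
        using K_iso subsheafD(2)[OF K_sub U V(1,2) a] N_K[OF V(1)] by (auto simp: isotropic_def)
    qed (rule A.subsheaf_simps(1)[OF K_sub U a])
  qed
  have "L \<le> image_sheaf K"
  proof (rule le_funI, rule subsetI)
    fix U b assume b: "b \<in> L U"
    have "b \<in> image_sheaf (preimage_sheaf L) U" using b by (simp only: image_preimage[OF L])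
    then show "b \<in> image_sheaf K U" by (rule subsetD[OF image_sheaf_mono, rotated]) (use K in \<open>simp add: le_fun_def\<close>)
  qed
  then have "image_sheaf K = L"
    using max subsheaf_image[OF K_sub K_F] isotropic_image[OF K_sub K_F K_iso] by (simp add: maximal_isotropic_def)
  then show "K = preimage_sheaf L" using preimage_image[OF K_sub N_K K_F] by metis
qed

end

section \<open>Quotients of sheaves of modules, restricted to a subset\<close>

context function_sheaf
begin

lemma restr_sheaf_lift:
  assumes "f \<in> restr_sheaf X \<O> Z W" "z \<in> W"
  obtains V g where "openin X V" "z \<in> V" "V \<inter> Z \<subseteq> W" "g \<in> \<O> V" "\<And>y. y \<in> V \<inter> Z \<Longrightarrow> g y = f y"
proof -
  from assms have "\<exists>V g. openin X V \<and> z \<in> V \<and> V \<inter> Z \<subseteq> W \<and> g \<in> \<O> V \<and> (\<forall>y\<in>V \<inter> Z. g y = f y)"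
    unfolding restr_sheaf_def by blast
  then show ?thesis using that by blast
qed

lemma restr_sheaf_lift_within:
  assumes f: "f \<in> restr_sheaf X \<O> Z W" and z: "z \<in> W" and V: "openin X V" "z \<in> V"
  obtains V' g where "openin X V'" "z \<in> V'" "V' \<subseteq> V" "V' \<inter> Z \<subseteq> W" "g \<in> \<O> V'" "\<And>y. y \<in> V' \<inter> Z \<Longrightarrow> g y = f y"
proof -
  obtain U g where U: "openin X U" "z \<in> U" "U \<inter> Z \<subseteq> W" "g \<in> \<O> U" "\<And>y. y \<in> U \<inter> Z \<Longrightarrow> g y = f y"
    by (rule restr_sheaf_lift[OF f z]) blast
  show ?thesis
    by (rule that[of "U \<inter> V" "restrict g (U \<inter> V)"]) (use U V restr[of U "U \<inter> V" g] in auto)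
qed

lemma restr_sheaf_lift2:
  assumes f: "f \<in> restr_sheaf X \<O> Z W" "f' \<in> restr_sheaf X \<O> Z W" and z: "z \<in> W"
  obtains V g g' where "openin X V" "z \<in> V" "V \<inter> Z \<subseteq> W" "g \<in> \<O> V" "g' \<in> \<O> V"
    "\<And>y. y \<in> V \<inter> Z \<Longrightarrow> g y = f y" "\<And>y. y \<in> V \<inter> Z \<Longrightarrow> g' y = f' y"
proof -
  obtain V g where V: "openin X V" "z \<in> V" "V \<inter> Z \<subseteq> W" "g \<in> \<O> V" "\<And>y. y \<in> V \<inter> Z \<Longrightarrow> g y = f y"
    by (rule restr_sheaf_lift[OF f(1) z]) blast
  obtain V' g' where V': "openin X V'" "z \<in> V'" "V' \<inter> Z \<subseteq> W" "g' \<in> \<O> V'" "\<And>y. y \<in> V' \<inter> Z \<Longrightarrow> g' y = f' y"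
    by (rule restr_sheaf_lift[OF f(2) z]) blast
  show ?thesis
    by (rule that[of "V \<inter> V'" "restrict g (V \<inter> V')" "restrict g' (V \<inter> V')"])
      (use V V' restr[of V "V \<inter> V'" g] restr[of V' "V \<inter> V'" g'] in auto)
qed

lemma restr_sheafI:
  assumes "f \<in> extensional W"
    "\<And>z. z \<in> W \<Longrightarrow> \<exists>V g. openin X V \<and> z \<in> V \<and> V \<inter> Z \<subseteq> W \<and> g \<in> \<O> V \<and> (\<forall>y\<in>V \<inter> Z. g y = f y)"
  shows "f \<in> restr_sheaf X \<O> Z W"
  using assms by (simp add: restr_sheaf_def)

lemma restrict_in_restr_sheaf:
  assumes V: "openin X V" "g \<in> \<O> V" and W: "openin (subtopology X Z) W" "W \<subseteq> V"
  shows "restrict g W \<in> restr_sheaf X \<O> Z W"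
proof (rule restr_sheafI)
  fix z assume z: "z \<in> W"
  obtain V' where V': "openin X V'" "W = V' \<inter> Z" using W(1) by (auto simp: openin_subtopology)
  show "\<exists>U h. openin X U \<and> z \<in> U \<and> U \<inter> Z \<subseteq> W \<and> h \<in> \<O> U \<and> (\<forall>y\<in>U \<inter> Z. h y = restrict g W y)"
    using V V' W(2) z restr[of V "V \<inter> V'" g] by (intro exI[of _ "V \<inter> V'"] exI[of _ "restrict g (V \<inter> V')"]) auto
qed simp

lemma function_sheaf_restr_sheaf: "function_sheaf (subtopology X Z) (restr_sheaf X \<O> Z)"
proof
  show "restr_sheaf X \<O> Z W \<subseteq> extensional W" for W by (auto simp: restr_sheaf_def)
  fix W assume W: "openin (subtopology X Z) W"
  then obtain V where V: "openin X V" "W = V \<inter> Z" by (auto simp: openin_subtopology)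
  show "(\<lambda>x\<in>W. c) \<in> restr_sheaf X \<O> Z W" for c
    using restrict_in_restr_sheaf[OF V(1) const[OF V(1), of c] W] V(2) by (simp add: Int_absorb1)
  fix f g assume fg: "f \<in> restr_sheaf X \<O> Z W" "g \<in> restr_sheaf X \<O> Z W"
  show "(\<lambda>x\<in>W. f x + g x) \<in> restr_sheaf X \<O> Z W"
  proof (rule restr_sheafI)
    fix z assume "z \<in> W"
    obtain V f' g' where "openin X V" "z \<in> V" "V \<inter> Z \<subseteq> W" "f' \<in> \<O> V" "g' \<in> \<O> V"
      "\<And>y. y \<in> V \<inter> Z \<Longrightarrow> f' y = f y" "\<And>y. y \<in> V \<inter> Z \<Longrightarrow> g' y = g y"
      by (rule restr_sheaf_lift2[OF fg \<open>z \<in> W\<close>]) blast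
    then show "\<exists>V h. openin X V \<and> z \<in> V \<and> V \<inter> Z \<subseteq> W \<and> h \<in> \<O> V \<and> (\<forall>y\<in>V \<inter> Z. h y = (\<lambda>x\<in>W. f x + g x) y)"
      using add[of V f' g'] by (intro exI[of _ V] exI[of _ "\<lambda>x\<in>V. f' x + g' x"]) auto
  qed simp
  show "(\<lambda>x\<in>W. f x * g x) \<in> restr_sheaf X \<O> Z W"
  proof (rule restr_sheafI)
    fix z assume "z \<in> W"
    obtain V f' g' where "openin X V" "z \<in> V" "V \<inter> Z \<subseteq> W" "f' \<in> \<O> V" "g' \<in> \<O> V"
      "\<And>y. y \<in> V \<inter> Z \<Longrightarrow> f' y = f y" "\<And>y. y \<in> V \<inter> Z \<Longrightarrow> g' y = g y"
      by (rule restr_sheaf_lift2[OF fg \<open>z \<in> W\<close>]) blast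
    then show "\<exists>V h. openin X V \<and> z \<in> V \<and> V \<inter> Z \<subseteq> W \<and> h \<in> \<O> V \<and> (\<forall>y\<in>V \<inter> Z. h y = (\<lambda>x\<in>W. f x * g x) y)"
      using mult[of V f' g'] by (intro exI[of _ V] exI[of _ "\<lambda>x\<in>V. f' x * g' x"]) auto
  qed simp
next
  fix W W' f assume W: "openin (subtopology X Z) W" "openin (subtopology X Z) W'" "W' \<subseteq> W"
    and f: "f \<in> restr_sheaf X \<O> Z W"
  obtain V' where V': "openin X V'" "W' = V' \<inter> Z" using W(2) by (auto simp: openin_subtopology)
  show "restrict f W' \<in> restr_sheaf X \<O> Z W'"
  proof (rule restr_sheafI)
    fix z assume z: "z \<in> W'"
    then have "z \<in> W" using W by auto
    obtain V g where V: "openin X V" "z \<in> V" "V \<inter> Z \<subseteq> W" "g \<in> \<O> V" "\<And>y. y \<in> V \<inter> Z \<Longrightarrow> g y = f y"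
      by (rule restr_sheaf_lift[OF f \<open>z \<in> W\<close>]) blast
    then show "\<exists>V h. openin X V \<and> z \<in> V \<and> V \<inter> Z \<subseteq> W' \<and> h \<in> \<O> V \<and> (\<forall>y\<in>V \<inter> Z. h y = restrict f W' y)"
      using V' z restr[of V "V \<inter> V'" g] by (intro exI[of _ "V \<inter> V'"] exI[of _ "restrict g (V \<inter> V')"]) auto
  qed simp
next
  fix W f assume W: "openin (subtopology X Z) W" "f \<in> extensional W"
    and loc: "\<And>x. x \<in> W \<Longrightarrow> \<exists>V. openin (subtopology X Z) V \<and> x \<in> V \<and> V \<subseteq> W \<and> restrict f V \<in> restr_sheaf X \<O> Z V"
  show "f \<in> restr_sheaf X \<O> Z W"
  proof (rule restr_sheafI[OF W(2)])
    fix z assume "z \<in> W"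
    with loc obtain V where V: "z \<in> V" "V \<subseteq> W" and f: "restrict f V \<in> restr_sheaf X \<O> Z V" by blast
    obtain U g where "openin X U" "z \<in> U" "U \<inter> Z \<subseteq> V" "g \<in> \<O> U" "\<And>y. y \<in> U \<inter> Z \<Longrightarrow> g y = restrict f V y"
      by (rule restr_sheaf_lift[OF f V(1)]) blast
    then show "\<exists>V g. openin X V \<and> z \<in> V \<and> V \<inter> Z \<subseteq> W \<and> g \<in> \<O> V \<and> (\<forall>y\<in>V \<inter> Z. g y = f y)"
      using V(2) by (intro exI[of _ U] exI[of _ g]) auto
  qed
qed

lemma restr_sheaf_topspace: "openin X W \<Longrightarrow> restr_sheaf X \<O> (topspace X) W = \<O> W"
proof (intro equalityI subsetI)
  fix f assume W: "openin X W" and f: "f \<in> restr_sheaf X \<O> (topspace X) W"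
  then have "f \<in> extensional W" by (simp add: restr_sheaf_def)
  with W show "f \<in> \<O> W"
  proof (rule glue)
    fix x assume x: "x \<in> W"
    obtain V g where V: "openin X V" "x \<in> V" "V \<inter> topspace X \<subseteq> W" "g \<in> \<O> V" "\<And>y. y \<in> V \<inter> topspace X \<Longrightarrow> g y = f y"
      by (rule restr_sheaf_lift[OF f x]) blast
    then have "V \<subseteq> topspace X" using openin_subset by blast
    then have VW: "V \<subseteq> W" using V by auto
    have "restrict f V = g"
      by (rule extensionalityI[of _ V]) (use V extensional[OF V(1)] \<open>V \<subseteq> topspace X\<close> in auto)
    then show "\<exists>V. openin X V \<and> x \<in> V \<and> V \<subseteq> W \<and> restrict f V \<in> \<O> V" using V VW by auto
  qed
next
  fix f assume W: "openin X W" and f: "f \<in> \<O> W"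
  then show "f \<in> restr_sheaf X \<O> (topspace X) W"
    using restrict_in_restr_sheaf[OF W f, of "topspace X" W] by simp
qed

end

text \<open>Everything about \<^const>\<open>restr_quot\<close> follows from three properties of the family \<open>R\<close>: it consists of
  submodules, it is stable under restriction, and it contains the multiples by functions vanishing on
  \<open>Z\<close>. The last one makes the action of functions on \<open>Z\<close>, defined through extensions to open sets of the
  ambient space, independent of the extension.\<close>

locale germ_quotient = module_sheaf X \<O> M
  for X :: "'x topology" and \<O> :: "'x set \<Rightarrow> 'x fn set" and M :: "('x, 's, 'm) omodule_scheme" +
  fixes R :: "'x set \<Rightarrow> 's set" and Z :: "'x set"
  assumes Z_subset: "Z \<subseteq> topspace X"
    and R_submodule: "openin X V \<Longrightarrow> submodule (R V) (fn_ring V (\<O> V)) (Mod M V)"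
    and R_Res: "\<lbrakk>openin X V; openin X V'; V' \<subseteq> V; s \<in> R V\<rbrakk> \<Longrightarrow> Res M V V' s \<in> R V'"
    and R_ideal: "\<lbrakk>openin X V; f \<in> \<O> V; \<And>y. y \<in> V \<inter> Z \<Longrightarrow> f y = 0; s \<in> carrier (Mod M V)\<rbrakk>
      \<Longrightarrow> f \<odot>\<^bsub>Mod M V\<^esub> s \<in> R V"
begin

lemma R_simps:
  assumes "openin X V"
  shows "s \<in> R V \<Longrightarrow> s \<in> carrier (Mod M V)"
    and "\<zero>\<^bsub>Mod M V\<^esub> \<in> R V"
    and "\<lbrakk>s \<in> R V; t \<in> R V\<rbrakk> \<Longrightarrow> s \<oplus>\<^bsub>Mod M V\<^esub> t \<in> R V"
    and "s \<in> R V \<Longrightarrow> \<ominus>\<^bsub>Mod M V\<^esub> s \<in> R V"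
    and "\<lbrakk>s \<in> R V; t \<in> R V\<rbrakk> \<Longrightarrow> s \<ominus>\<^bsub>Mod M V\<^esub> t \<in> R V"
    and "\<lbrakk>f \<in> \<O> V; s \<in> R V\<rbrakk> \<Longrightarrow> f \<odot>\<^bsub>Mod M V\<^esub> s \<in> R V"
  by (rule submodule_simps [OF assms R_submodule [OF assms]]; assumption?)+

abbreviation "cls \<equiv> germ_class X M R"
abbreviation "gsec \<equiv> germ_section X M R Z"
abbreviation "Quo \<equiv> restr_quot X \<O> M R Z"
abbreviation "Y \<equiv> subtopology X Z"
abbreviation "\<O>Z \<equiv> restr_sheaf X \<O> Z"

definition germ_eq :: "'x \<Rightarrow> 'x set \<Rightarrow> 's \<Rightarrow> 'x set \<Rightarrow> 's \<Rightarrow> bool" where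
  "germ_eq z V s V' s' \<longleftrightarrow> (\<exists>V''. openin X V'' \<and> z \<in> V'' \<and> V'' \<subseteq> V \<inter> V' \<and>
     Res M V V'' s \<ominus>\<^bsub>Mod M V''\<^esub> Res M V' V'' s' \<in> R V'')"

lemma germ_eq_refl: "\<lbrakk>openin X V; z \<in> V; s \<in> carrier (Mod M V)\<rbrakk> \<Longrightarrow> germ_eq z V s V s"
  unfolding germ_eq_def by (intro exI[of _ V]) (simp add: Res_id section_arith(10) R_simps(2))

lemma germ_eq_sym:
  assumes V: "openin X V" "s \<in> carrier (Mod M V)" and V': "openin X V'" "s' \<in> carrier (Mod M V')"
    and eq: "germ_eq z V s V' s'"
  shows "germ_eq z V' s' V s"
proof -
  obtain W where W: "openin X W" "z \<in> W" "W \<subseteq> V \<inter> V'" "Res M V W s \<ominus>\<^bsub>Mod M W\<^esub> Res M V' W s' \<in> R W"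
    using eq by (auto simp: germ_eq_def)
  then have "Res M V' W s' \<ominus>\<^bsub>Mod M W\<^esub> Res M V W s \<in> R W"
    using R_simps(4)[OF W(1,4)] section_arith(6)[OF W(1), of "Res M V W s" "Res M V' W s'"] V V'
    by (simp add: Res_closed)
  then show ?thesis using W unfolding germ_eq_def by (intro exI[of _ W]) auto
qed

lemma germ_eq_trans:
  assumes V: "openin X V" "s \<in> carrier (Mod M V)" and V': "openin X V'" "s' \<in> carrier (Mod M V')"
    and V'': "openin X V''" "s'' \<in> carrier (Mod M V'')"
    and eq: "germ_eq z V s V' s'" "germ_eq z V' s' V'' s''"
  shows "germ_eq z V s V'' s''"
proof -
  obtain W where W: "openin X W" "z \<in> W" "W \<subseteq> V" "W \<subseteq> V'" "Res M V W s \<ominus>\<^bsub>Mod M W\<^esub> Res M V' W s' \<in> R W"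
    using eq(1) by (auto simp: germ_eq_def)
  obtain W' where W': "openin X W'" "z \<in> W'" "W' \<subseteq> V'" "W' \<subseteq> V''"
    "Res M V' W' s' \<ominus>\<^bsub>Mod M W'\<^esub> Res M V'' W' s'' \<in> R W'"
    using eq(2) by (auto simp: germ_eq_def)
  define T where "T = W \<inter> W'"
  have T: "openin X T" "z \<in> T" "T \<subseteq> W" "T \<subseteq> W'" "T \<subseteq> V" "T \<subseteq> V'" "T \<subseteq> V''" using W W' by (auto simp: T_def)
  have "Res M W T (Res M V W s \<ominus>\<^bsub>Mod M W\<^esub> Res M V' W s') \<in> R T"
    using R_Res[OF W(1) T(1,3) W(5)] .
  then have 1: "Res M V T s \<ominus>\<^bsub>Mod M T\<^esub> Res M V' T s' \<in> R T"
    using V V' W T by (simp add: Res_minus Res_closed Res_Res)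
  have "Res M W' T (Res M V' W' s' \<ominus>\<^bsub>Mod M W'\<^esub> Res M V'' W' s'') \<in> R T"
    using R_Res[OF W'(1) T(1,4) W'(5)] .
  then have 2: "Res M V' T s' \<ominus>\<^bsub>Mod M T\<^esub> Res M V'' T s'' \<in> R T"
    using V'' V' W' T by (simp add: Res_minus Res_closed Res_Res)
  have "Res M V T s \<ominus>\<^bsub>Mod M T\<^esub> Res M V'' T s'' \<in> R T"
    using R_simps(3)[OF T(1) 1 2] V V' V'' T by (simp add: section_arith(5) Res_closed)
  then show ?thesis using T by (auto simp: germ_eq_def)
qed

lemma mem_cls: "(V', s') \<in> cls z V s \<longleftrightarrow>
    openin X V' \<and> z \<in> V' \<and> s' \<in> carrier (Mod M V') \<and> germ_eq z V s V' s'"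
  by (auto simp: germ_class_def germ_eq_def)

lemma cls_eq_iff:
  assumes V: "openin X V" "z \<in> V" "s \<in> carrier (Mod M V)" and V': "openin X V'" "z \<in> V'" "s' \<in> carrier (Mod M V')"
  shows "cls z V s = cls z V' s' \<longleftrightarrow> germ_eq z V s V' s'"
proof
  assume "cls z V s = cls z V' s'"
  then show "germ_eq z V s V' s'" using germ_eq_refl[OF V'] mem_cls V' by blast
next
  assume "germ_eq z V s V' s'"
  note 1 = this and 2 = germ_eq_sym[OF V(1,3) V'(1,3) this]
  have "germ_eq z V s U u \<longleftrightarrow> germ_eq z V' s' U u" if u: "openin X U" "u \<in> carrier (Mod M U)" for U u
    using germ_eq_trans[OF V(1,3) V'(1,3) u 1] germ_eq_trans[OF V'(1,3) V(1,3) u 2] by blast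
  then show "cls z V s = cls z V' s'" by (auto simp: mem_cls)
qed

lemma mem_cls_iff:
  assumes "openin X V" "z \<in> V" "s \<in> carrier (Mod M V)"
  shows "(V', s') \<in> cls z V s \<longleftrightarrow>
    openin X V' \<and> z \<in> V' \<and> s' \<in> carrier (Mod M V') \<and> cls z V s = cls z V' s'"
  using cls_eq_iff[OF assms] by (auto simp: mem_cls)

lemma cls_eqE:
  assumes V: "openin X V" "z \<in> V" "s \<in> carrier (Mod M V)" and V': "openin X V'" "z \<in> V'" "s' \<in> carrier (Mod M V')"
    and eq: "cls z V s = cls z V' s'"
  obtains W where "openin X W" "z \<in> W" "W \<subseteq> V" "W \<subseteq> V'"
    "Res M V W s \<ominus>\<^bsub>Mod M W\<^esub> Res M V' W s' \<in> R W"
  using eq unfolding cls_eq_iff[OF V V'] germ_eq_def by blast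

lemma cls_eqI:
  assumes V: "openin X V" "z \<in> V" "s \<in> carrier (Mod M V)" and V': "openin X V'" "z \<in> V'" "s' \<in> carrier (Mod M V')"
    and "openin X W" "z \<in> W" "W \<subseteq> V" "W \<subseteq> V'" "Res M V W s \<ominus>\<^bsub>Mod M W\<^esub> Res M V' W s' \<in> R W"
  shows "cls z V s = cls z V' s'"
  using assms(7-) unfolding cls_eq_iff[OF V V'] germ_eq_def by blast

lemma cls_Res:
  assumes "openin X V" "openin X V'" "V' \<subseteq> V" "z \<in> V'" "s \<in> carrier (Mod M V)"
  shows "cls z V' (Res M V V' s) = cls z V s"
  using assms by (intro cls_eqI[of _ _ _ _ _ V']) (auto simp: Res_Res Res_id Res_closed section_arith(10) R_simps(2))

lemma cls_add:
  assumes V: "openin X V" "z \<in> V" "s \<in> carrier (Mod M V)" "t \<in> carrier (Mod M V)"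
    and V': "openin X V'" "z \<in> V'" "s' \<in> carrier (Mod M V')" "t' \<in> carrier (Mod M V')"
    and eq: "cls z V s = cls z V' s'" "cls z V t = cls z V' t'"
  shows "cls z V (s \<oplus>\<^bsub>Mod M V\<^esub> t) = cls z V' (s' \<oplus>\<^bsub>Mod M V'\<^esub> t')"
proof -
  obtain W where W: "openin X W" "z \<in> W" "W \<subseteq> V" "W \<subseteq> V'" "Res M V W s \<ominus>\<^bsub>Mod M W\<^esub> Res M V' W s' \<in> R W"
    by (rule cls_eqE[OF V(1,2,3) V'(1,2,3) eq(1)])
  obtain W' where W': "openin X W'" "z \<in> W'" "W' \<subseteq> V" "W' \<subseteq> V'" "Res M V W' t \<ominus>\<^bsub>Mod M W'\<^esub> Res M V' W' t' \<in> R W'"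
    by (rule cls_eqE[OF V(1,2,4) V'(1,2,4) eq(2)])
  define T where "T = W \<inter> W'"
  have T: "openin X T" "z \<in> T" "T \<subseteq> W" "T \<subseteq> W'" "T \<subseteq> V" "T \<subseteq> V'" using W W' by (auto simp: T_def)
  have 1: "Res M V T s \<ominus>\<^bsub>Mod M T\<^esub> Res M V' T s' \<in> R T"
    using R_Res[OF W(1) T(1,3) W(5)] V V' W T by (simp add: Res_minus Res_closed Res_Res)
  have 2: "Res M V T t \<ominus>\<^bsub>Mod M T\<^esub> Res M V' T t' \<in> R T"
    using R_Res[OF W'(1) T(1,4) W'(5)] V V' W' T by (simp add: Res_minus Res_closed Res_Res)
  show ?thesis
    using V V' T R_simps(3)[OF T(1) 1 2]
    by (intro cls_eqI[of _ _ _ _ _ T]) (auto simp: Res_add Res_closed section_arith(7))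
qed

text \<open>The difference of the two products is \<open>g (s - s') + (g - g') s'\<close>, and \<open>g - g'\<close> vanishes on \<open>Z\<close>.\<close>

lemma cls_smult:
  assumes V: "openin X V" "z \<in> V" "s \<in> carrier (Mod M V)" "g \<in> \<O> V"
    and V': "openin X V'" "z \<in> V'" "s' \<in> carrier (Mod M V')" "g' \<in> \<O> V'"
    and eq: "cls z V s = cls z V' s'" and gg': "\<And>y. y \<in> V \<inter> V' \<inter> Z \<Longrightarrow> g y = g' y"
  shows "cls z V (g \<odot>\<^bsub>Mod M V\<^esub> s) = cls z V' (g' \<odot>\<^bsub>Mod M V'\<^esub> s')"
proof -
  obtain W where W: "openin X W" "z \<in> W" "W \<subseteq> V" "W \<subseteq> V'" "Res M V W s \<ominus>\<^bsub>Mod M W\<^esub> Res M V' W s' \<in> R W"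
    by (rule cls_eqE[OF V(1,2,3) V'(1,2,3) eq])
  define h h' t t' where "h = restrict g W" and "h' = restrict g' W" and "t = Res M V W s" and "t' = Res M V' W s'"
  have h: "h \<in> \<O> W" "h' \<in> \<O> W" and t: "t \<in> carrier (Mod M W)" "t' \<in> carrier (Mod M W)"
    using V V' W by (auto simp: h_def h'_def t_def t'_def restr Res_closed)
  have "(\<lambda>x\<in>W. h x - h' x) \<odot>\<^bsub>Mod M W\<^esub> t' \<in> R W"
    using W V V' gg' t by (intro R_ideal diff h) (auto simp: h_def h'_def)
  moreover have "h \<odot>\<^bsub>Mod M W\<^esub> (t \<ominus>\<^bsub>Mod M W\<^esub> t') \<in> R W"
    using R_simps(6)[OF W(1) h(1)] W(5) by (simp add: t_def t'_def)
  ultimately have "(h \<odot>\<^bsub>Mod M W\<^esub> t \<ominus>\<^bsub>Mod M W\<^esub> h \<odot>\<^bsub>Mod M W\<^esub> t') \<oplus>\<^bsub>Mod M W\<^esub>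
      (h \<odot>\<^bsub>Mod M W\<^esub> t' \<ominus>\<^bsub>Mod M W\<^esub> h' \<odot>\<^bsub>Mod M W\<^esub> t') \<in> R W"
    using W(1) h t by (simp add: smult_minus smult_diff_left R_simps(3))
  then have "h \<odot>\<^bsub>Mod M W\<^esub> t \<ominus>\<^bsub>Mod M W\<^esub> h' \<odot>\<^bsub>Mod M W\<^esub> t' \<in> R W"
    using W(1) h t by (simp add: section_arith(5))
  then show ?thesis
    using V V' W by (intro cls_eqI[of _ _ _ _ _ W]) (auto simp: Res_smult h_def h'_def t_def t'_def)
qed

text \<open>The section \<open>\<sigma>\<close> over \<open>W\<close> is given on \<open>V \<inter> Z\<close> by the section \<open>s\<close> of \<open>M\<close> over \<open>V\<close>. All identities between sections
  of the quotient are read off from common representatives.\<close>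

definition rep :: "'x set \<Rightarrow> ('x \<Rightarrow> ('x set \<times> 's) set) \<Rightarrow> 'x set \<Rightarrow> 's \<Rightarrow> bool" where
  "rep W \<sigma> V s \<longleftrightarrow> openin X V \<and> V \<inter> Z \<subseteq> W \<and> s \<in> carrier (Mod M V) \<and> (\<forall>y\<in>V \<inter> Z. \<sigma> y = cls y V s)"

lemma restrict_eq_gsec_iff: "restrict \<sigma> (V \<inter> Z) = gsec V s \<longleftrightarrow> (\<forall>y\<in>V \<inter> Z. \<sigma> y = cls y V s)"
  by (auto simp: germ_section_def fun_eq_iff)

lemma Quo_carrier: "\<sigma> \<in> carrier (Mod Quo W) \<longleftrightarrow> \<sigma> \<in> extensional W \<and> (\<forall>z\<in>W. \<exists>V s. z \<in> V \<and> rep W \<sigma> V s)"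
proof -
  have "openin X V \<and> z \<in> V \<and> V \<inter> Z \<subseteq> W \<and> s \<in> carrier (Mod M V) \<and> restrict \<sigma> (V \<inter> Z) = gsec V s \<longleftrightarrow>
      z \<in> V \<and> rep W \<sigma> V s" for z V s
    unfolding rep_def restrict_eq_gsec_iff by metis
  then show ?thesis by (simp add: restr_quot_def) metis
qed

lemma Res_Quo [simp]: "Res Quo W W' \<sigma> = restrict \<sigma> W'"
  by (simp add: restr_quot_def)

lemma rep_Res:
  assumes "rep W \<sigma> V s" "openin X V'" "V' \<subseteq> V"
  shows "rep W \<sigma> V' (Res M V V' s)"
  using assms cls_Res[of V V' _ s] by (auto simp: rep_def Res_closed)

lemma rep_exists:
  assumes "\<sigma> \<in> carrier (Mod Quo W)" "z \<in> W"
  obtains V s where "z \<in> V" "rep W \<sigma> V s"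
  using assms by (auto simp: Quo_carrier)

lemma rep_exists2:
  assumes "\<sigma> \<in> carrier (Mod Quo W)" "\<tau> \<in> carrier (Mod Quo W)" "z \<in> W"
  obtains V s t where "z \<in> V" "rep W \<sigma> V s" "rep W \<tau> V t"
proof -
  obtain V s where V: "z \<in> V" "rep W \<sigma> V s" by (rule rep_exists[OF assms(1,3)])
  obtain V' t where V': "z \<in> V'" "rep W \<tau> V' t" by (rule rep_exists[OF assms(2,3)])
  have "openin X (V \<inter> V')" using V V' by (auto simp: rep_def)
  then show ?thesis
    using rep_Res[OF V(2), of "V \<inter> V'"] rep_Res[OF V'(2), of "V \<inter> V'"] V(1) V'(1) by (intro that[of "V \<inter> V'"]) auto
qed

lemma rep_exists3:
  assumes "\<sigma> \<in> carrier (Mod Quo W)" "\<tau> \<in> carrier (Mod Quo W)" "\<upsilon> \<in> carrier (Mod Quo W)" "z \<in> W"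
  obtains V s t u where "z \<in> V" "rep W \<sigma> V s" "rep W \<tau> V t" "rep W \<upsilon> V u"
proof -
  obtain V s t where V: "z \<in> V" "rep W \<sigma> V s" "rep W \<tau> V t" by (rule rep_exists2[OF assms(1,2,4)])
  obtain V' u where V': "z \<in> V'" "rep W \<upsilon> V' u" by (rule rep_exists[OF assms(3,4)])
  have "openin X (V \<inter> V')" using V V' by (auto simp: rep_def)
  then show ?thesis
    using rep_Res[OF V(2), of "V \<inter> V'"] rep_Res[OF V(3), of "V \<inter> V'"] rep_Res[OF V'(2), of "V \<inter> V'"] V(1) V'(1)
    by (intro that[of "V \<inter> V'"]) auto
qed

lemma rep_eqI:
  assumes "\<sigma> \<in> extensional W" "\<tau> \<in> extensional W" "W \<subseteq> Z"
    "\<And>z. z \<in> W \<Longrightarrow> \<exists>V s. z \<in> V \<and> rep W \<sigma> V s \<and> rep W \<tau> V s"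
  shows "\<sigma> = \<tau>"
  by (rule extensionalityI[OF assms(1,2)]) (use assms(3,4) in \<open>force simp: rep_def\<close>)

lemma Quo_add_eq:
  assumes "openin X V" "z \<in> V" "z \<in> W" "s \<in> carrier (Mod M V)" "t \<in> carrier (Mod M V)"
    "\<sigma> z = cls z V s" "\<tau> z = cls z V t"
  shows "(\<sigma> \<oplus>\<^bsub>Mod Quo W\<^esub> \<tau>) z = cls z V (s \<oplus>\<^bsub>Mod M V\<^esub> t)"
proof -
  have "{cls z V' (s' \<oplus>\<^bsub>Mod M V'\<^esub> t') | V' s' t'. (V', s') \<in> \<sigma> z \<and> (V', t') \<in> \<tau> z} = {cls z V (s \<oplus>\<^bsub>Mod M V\<^esub> t)}"
    (is "?L = ?R")
  proof
    show "?L \<subseteq> ?R"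
    proof
      fix c assume "c \<in> ?L"
      then obtain V' s' t' where c: "c = cls z V' (s' \<oplus>\<^bsub>Mod M V'\<^esub> t')" "(V', s') \<in> \<sigma> z" "(V', t') \<in> \<tau> z" by blast
      then show "c \<in> ?R"
        using assms mem_cls_iff[of V z s] mem_cls_iff[of V z t] cls_add[of V z s t V' s' t'] by simp
    qed
    show "?R \<subseteq> ?L" using assms mem_cls_iff[of V z s V s] mem_cls_iff[of V z t V t] by blast
  qed
  then show ?thesis using assms(3) by (simp add: restr_quot_def)
qed

lemma Quo_smult_eq:
  assumes "openin X V" "z \<in> V" "z \<in> W" "s \<in> carrier (Mod M V)" "g \<in> \<O> V" "V \<inter> Z \<subseteq> W" "\<And>y. y \<in> V \<inter> Z \<Longrightarrow> g y = f y"
    "\<sigma> z = cls z V s"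
  shows "(f \<odot>\<^bsub>Mod Quo W\<^esub> \<sigma>) z = cls z V (g \<odot>\<^bsub>Mod M V\<^esub> s)"
proof -
  have "{cls z V' (g' \<odot>\<^bsub>Mod M V'\<^esub> s') | V' s' g'. (V', s') \<in> \<sigma> z \<and> V' \<inter> Z \<subseteq> W \<and> g' \<in> \<O> V' \<and> (\<forall>y\<in>V' \<inter> Z. g' y = f y)}
      = {cls z V (g \<odot>\<^bsub>Mod M V\<^esub> s)}" (is "?L = ?R")
  proof
    show "?L \<subseteq> ?R"
    proof
      fix c assume "c \<in> ?L"
      then obtain V' s' g' where c: "c = cls z V' (g' \<odot>\<^bsub>Mod M V'\<^esub> s')" "(V', s') \<in> \<sigma> z" "g' \<in> \<O> V'"
        "\<And>y. y \<in> V' \<inter> Z \<Longrightarrow> g' y = f y" by blast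
      then show "c \<in> ?R" using assms mem_cls_iff[of V z s] cls_smult[of V z s g V' s' g'] by auto
    qed
    show "?R \<subseteq> ?L" using assms mem_cls_iff[of V z s V s] by blast
  qed
  then show ?thesis using assms(3) by (simp add: restr_quot_def)
qed

lemma rep_add: "\<lbrakk>rep W \<sigma> V s; rep W \<tau> V t\<rbrakk> \<Longrightarrow> rep W (\<sigma> \<oplus>\<^bsub>Mod Quo W\<^esub> \<tau>) V (s \<oplus>\<^bsub>Mod M V\<^esub> t)"
  unfolding rep_def using Quo_add_eq[of V _ W s t \<sigma> \<tau>] by (simp add: subset_iff)

lemma rep_smult:
  assumes "rep W \<sigma> V s" "g \<in> \<O> V" "\<And>y. y \<in> V \<inter> Z \<Longrightarrow> g y = f y"
  shows "rep W (f \<odot>\<^bsub>Mod Quo W\<^esub> \<sigma>) V (g \<odot>\<^bsub>Mod M V\<^esub> s)"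
  using assms Quo_smult_eq[of V _ W s g f \<sigma>] unfolding rep_def by (simp add: subset_iff)

lemma rep_zero: "\<lbrakk>openin X V; V \<inter> Z \<subseteq> W\<rbrakk> \<Longrightarrow> rep W \<zero>\<^bsub>Mod Quo W\<^esub> V \<zero>\<^bsub>Mod M V\<^esub>"
  using cls_Res[of "topspace X" V _ "\<zero>\<^bsub>Mod M (topspace X)\<^esub>"] openin_subset[of X V]
  by (auto simp: rep_def restr_quot_def subset_iff)

lemma Quo_extensional:
  "\<zero>\<^bsub>Mod Quo W\<^esub> \<in> extensional W" "\<sigma> \<oplus>\<^bsub>Mod Quo W\<^esub> \<tau> \<in> extensional W" "f \<odot>\<^bsub>Mod Quo W\<^esub> \<sigma> \<in> extensional W"
  by (auto simp: restr_quot_def)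

lemma open_in_Z: "openin Y W \<Longrightarrow> W \<subseteq> Z"
  by (auto simp: openin_subtopology)

sublocale Z: function_sheaf Y \<O>Z
  by (rule function_sheaf_restr_sheaf)

lemma Quo_closed:
  assumes W: "openin Y W"
  shows "\<zero>\<^bsub>Mod Quo W\<^esub> \<in> carrier (Mod Quo W)"
    and "\<lbrakk>\<sigma> \<in> carrier (Mod Quo W); \<tau> \<in> carrier (Mod Quo W)\<rbrakk> \<Longrightarrow> \<sigma> \<oplus>\<^bsub>Mod Quo W\<^esub> \<tau> \<in> carrier (Mod Quo W)"
    and "\<lbrakk>f \<in> \<O>Z W; \<sigma> \<in> carrier (Mod Quo W)\<rbrakk> \<Longrightarrow> f \<odot>\<^bsub>Mod Quo W\<^esub> \<sigma> \<in> carrier (Mod Quo W)"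
proof -
  show "\<zero>\<^bsub>Mod Quo W\<^esub> \<in> carrier (Mod Quo W)"
  proof -
    obtain V where "openin X V" "W = V \<inter> Z" using W by (auto simp: openin_subtopology)
    then show ?thesis using rep_zero[of V W] by (auto simp: Quo_carrier Quo_extensional)
  qed
  show "\<sigma> \<oplus>\<^bsub>Mod Quo W\<^esub> \<tau> \<in> carrier (Mod Quo W)" if st: "\<sigma> \<in> carrier (Mod Quo W)" "\<tau> \<in> carrier (Mod Quo W)"
    unfolding Quo_carrier
  proof (intro conjI ballI Quo_extensional)
    fix z assume z: "z \<in> W"
    obtain V s t where "z \<in> V" "rep W \<sigma> V s" "rep W \<tau> V t" by (rule rep_exists2[OF st z])
    then show "\<exists>V s. z \<in> V \<and> rep W (\<sigma> \<oplus>\<^bsub>Mod Quo W\<^esub> \<tau>) V s" using rep_add by blast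
  qed
  show "f \<odot>\<^bsub>Mod Quo W\<^esub> \<sigma> \<in> carrier (Mod Quo W)" if f: "f \<in> \<O>Z W" and s: "\<sigma> \<in> carrier (Mod Quo W)"
    unfolding Quo_carrier
  proof (intro conjI ballI Quo_extensional)
    fix z assume z: "z \<in> W"
    obtain V s where V: "z \<in> V" "rep W \<sigma> V s" by (rule rep_exists[OF s z])
    then have o: "openin X V" by (simp add: rep_def)
    obtain V' g where V': "openin X V'" "z \<in> V'" "V' \<subseteq> V" "V' \<inter> Z \<subseteq> W" "g \<in> \<O> V'" "\<And>y. y \<in> V' \<inter> Z \<Longrightarrow> g y = f y"
      by (rule restr_sheaf_lift_within[OF f z o V(1)]) blast
    then show "\<exists>V s. z \<in> V \<and> rep W (f \<odot>\<^bsub>Mod Quo W\<^esub> \<sigma>) V s"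
      using rep_smult[OF rep_Res[OF V(2) V'(1,3)] V'(5,6)] by blast
  qed
qed

text \<open>Each law holds for representatives over a common open set.\<close>

lemma Quo_module:
  assumes W: "openin Y W"
  shows "Module.module (fn_ring W (\<O>Z W)) (Mod Quo W)"
proof (rule moduleI)
  note W_Z = open_in_Z[OF W]
  have in_M: "s \<in> carrier (Mod M V)" "openin X V" if "rep W \<sigma> V s" for \<sigma> V s using that by (auto simp: rep_def)
  have rep_smult_ex: "\<exists>V s g h. z \<in> V \<and> rep W \<sigma> V s \<and> g \<in> \<O> V \<and> h \<in> \<O> V \<and> (\<forall>y\<in>V \<inter> Z. g y = f y) \<and> (\<forall>y\<in>V \<inter> Z. h y = e y)"
    if f: "f \<in> \<O>Z W" and e: "e \<in> \<O>Z W" and \<sigma>: "\<sigma> \<in> carrier (Mod Quo W)" and z: "z \<in> W" for f e \<sigma> z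
  proof -
    obtain V s where V: "z \<in> V" "rep W \<sigma> V s" by (rule rep_exists[OF \<sigma> z])
    obtain V' g where V': "openin X V'" "z \<in> V'" "V' \<subseteq> V" "g \<in> \<O> V'" "\<And>y. y \<in> V' \<inter> Z \<Longrightarrow> g y = f y"
      by (rule restr_sheaf_lift_within[OF f z in_M(2)[OF V(2)] V(1)]) blast
    obtain V'' h where V'': "openin X V''" "z \<in> V''" "V'' \<subseteq> V'" "h \<in> \<O> V''" "\<And>y. y \<in> V'' \<inter> Z \<Longrightarrow> h y = e y"
      by (rule restr_sheaf_lift_within[OF e z V'(1,2)]) blast
    show ?thesis
      using V' V'' rep_Res[OF V(2), of V''] restr[of V' V'' g]
      by (intro exI[of _ V''] exI[of _ "Res M V V'' s"] exI[of _ "restrict g V''"] exI[of _ h]) auto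
  qed
  show "cring (fn_ring W (\<O>Z W))" by (rule Z.cring_sections[OF W])
  show "abelian_group (Mod Quo W)"
  proof (rule abelian_groupI)
    fix \<sigma> \<tau> \<upsilon>
    assume \<sigma>: "\<sigma> \<in> carrier (Mod Quo W)"
    show "\<zero>\<^bsub>Mod Quo W\<^esub> \<oplus>\<^bsub>Mod Quo W\<^esub> \<sigma> = \<sigma>"
    proof (rule rep_eqI[OF Quo_extensional(2) _ W_Z])
      fix z assume z: "z \<in> W"
      obtain V s where V: "z \<in> V" "rep W \<sigma> V s" by (rule rep_exists[OF \<sigma> z])
      have "rep W \<zero>\<^bsub>Mod Quo W\<^esub> V \<zero>\<^bsub>Mod M V\<^esub>" using V(2) by (intro rep_zero) (auto simp: rep_def)
      from rep_add[OF this V(2)] show "\<exists>V s. z \<in> V \<and> rep W (\<zero>\<^bsub>Mod Quo W\<^esub> \<oplus>\<^bsub>Mod Quo W\<^esub> \<sigma>) V s \<and> rep W \<sigma> V s"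
        using V in_M[OF V(2)] abelian_monoid.l_zero[OF abelian_group.axioms(1)[OF sections_abelian_group]] by fastforce
    qed (use \<sigma> in \<open>simp add: Quo_carrier\<close>)
    show "\<exists>\<tau>\<in>carrier (Mod Quo W). \<tau> \<oplus>\<^bsub>Mod Quo W\<^esub> \<sigma> = \<zero>\<^bsub>Mod Quo W\<^esub>"
    proof (rule bexI)
      show "(\<lambda>x\<in>W. -1) \<odot>\<^bsub>Mod Quo W\<^esub> \<sigma> \<in> carrier (Mod Quo W)" using Quo_closed(3)[OF W Z.const[OF W] \<sigma>] .
      show "(\<lambda>x\<in>W. -1) \<odot>\<^bsub>Mod Quo W\<^esub> \<sigma> \<oplus>\<^bsub>Mod Quo W\<^esub> \<sigma> = \<zero>\<^bsub>Mod Quo W\<^esub>"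
      proof (rule rep_eqI[OF Quo_extensional(2,1) W_Z])
        fix z assume z: "z \<in> W"
        obtain V s where V: "z \<in> V" "rep W \<sigma> V s" by (rule rep_exists[OF \<sigma> z])
        have o: "openin X V" and VZ: "V \<inter> Z \<subseteq> W" using V(2) by (auto simp: rep_def)
        interpret V: abelian_group "Mod M V" using sections_abelian_group[OF o] .
        have "rep W ((\<lambda>x\<in>W. -1) \<odot>\<^bsub>Mod Quo W\<^esub> \<sigma>) V ((\<lambda>x\<in>V. -1) \<odot>\<^bsub>Mod M V\<^esub> s)"
          using VZ by (intro rep_smult V const o) auto
        from rep_add[OF this V(2)] rep_zero[OF o VZ] in_M[OF V(2)] V(1)
        show "\<exists>V s. z \<in> V \<and> rep W ((\<lambda>x\<in>W. -1) \<odot>\<^bsub>Mod Quo W\<^esub> \<sigma> \<oplus>\<^bsub>Mod Quo W\<^esub> \<sigma>) V s \<and> rep W \<zero>\<^bsub>Mod Quo W\<^esub> V s"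
          by (auto simp: neg_eq_smult[symmetric] V.l_neg)
      qed
    qed
    assume \<tau>: "\<tau> \<in> carrier (Mod Quo W)"
    show "\<sigma> \<oplus>\<^bsub>Mod Quo W\<^esub> \<tau> \<in> carrier (Mod Quo W)" using Quo_closed(2)[OF W \<sigma> \<tau>] .
    show "\<sigma> \<oplus>\<^bsub>Mod Quo W\<^esub> \<tau> = \<tau> \<oplus>\<^bsub>Mod Quo W\<^esub> \<sigma>"
    proof (rule rep_eqI[OF Quo_extensional(2,2) W_Z])
      fix z assume z: "z \<in> W"
      obtain V s t where V: "z \<in> V" "rep W \<sigma> V s" "rep W \<tau> V t" by (rule rep_exists2[OF \<sigma> \<tau> z])
      interpret V: abelian_group "Mod M V" using sections_abelian_group in_M(2)[OF V(2)] .
      show "\<exists>V s. z \<in> V \<and> rep W (\<sigma> \<oplus>\<^bsub>Mod Quo W\<^esub> \<tau>) V s \<and> rep W (\<tau> \<oplus>\<^bsub>Mod Quo W\<^esub> \<sigma>) V s"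
        using rep_add[OF V(2,3)] rep_add[OF V(3,2)] V in_M V.a_comm by metis
    qed
    assume \<upsilon>: "\<upsilon> \<in> carrier (Mod Quo W)"
    show "(\<sigma> \<oplus>\<^bsub>Mod Quo W\<^esub> \<tau>) \<oplus>\<^bsub>Mod Quo W\<^esub> \<upsilon> = \<sigma> \<oplus>\<^bsub>Mod Quo W\<^esub> (\<tau> \<oplus>\<^bsub>Mod Quo W\<^esub> \<upsilon>)"
    proof (rule rep_eqI[OF Quo_extensional(2,2) W_Z])
      fix z assume z: "z \<in> W"
      obtain V s t u where V: "z \<in> V" "rep W \<sigma> V s" "rep W \<tau> V t" "rep W \<upsilon> V u" by (rule rep_exists3[OF \<sigma> \<tau> \<upsilon> z])
      interpret V: abelian_group "Mod M V" using sections_abelian_group in_M(2)[OF V(2)] .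
      show "\<exists>V s. z \<in> V \<and> rep W ((\<sigma> \<oplus>\<^bsub>Mod Quo W\<^esub> \<tau>) \<oplus>\<^bsub>Mod Quo W\<^esub> \<upsilon>) V s \<and>
          rep W (\<sigma> \<oplus>\<^bsub>Mod Quo W\<^esub> (\<tau> \<oplus>\<^bsub>Mod Quo W\<^esub> \<upsilon>)) V s"
        using rep_add[OF rep_add[OF V(2,3)] V(4)] rep_add[OF V(2) rep_add[OF V(3,4)]] V in_M V.a_assoc by metis
    qed
  qed (rule Quo_closed(1)[OF W])
  fix \<sigma> assume \<sigma>: "\<sigma> \<in> carrier (Mod Quo W)"
  show "\<one>\<^bsub>fn_ring W (\<O>Z W)\<^esub> \<odot>\<^bsub>Mod Quo W\<^esub> \<sigma> = \<sigma>"
  proof (rule rep_eqI[OF Quo_extensional(3) _ W_Z])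
    fix z assume z: "z \<in> W"
    obtain V s where V: "z \<in> V" "rep W \<sigma> V s" by (rule rep_exists[OF \<sigma> z])
    have o: "openin X V" and VZ: "V \<inter> Z \<subseteq> W" using V(2) by (auto simp: rep_def)
    have "rep W ((\<lambda>x\<in>W. 1) \<odot>\<^bsub>Mod Quo W\<^esub> \<sigma>) V ((\<lambda>x\<in>V. 1) \<odot>\<^bsub>Mod M V\<^esub> s)"
      using VZ by (intro rep_smult V const o) auto
    moreover have "(\<lambda>x\<in>V. 1) \<odot>\<^bsub>Mod M V\<^esub> s = s" using module.smult_one[OF module[OF o] in_M(1)[OF V(2)]] by simp
    ultimately show "\<exists>V s. z \<in> V \<and> rep W (\<one>\<^bsub>fn_ring W (\<O>Z W)\<^esub> \<odot>\<^bsub>Mod Quo W\<^esub> \<sigma>) V s \<and> rep W \<sigma> V s"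
      using V by auto
  qed (use \<sigma> in \<open>simp add: Quo_carrier\<close>)
  fix f assume f': "f \<in> carrier (fn_ring W (\<O>Z W))"
  then have f: "f \<in> \<O>Z W" by simp
  show "f \<odot>\<^bsub>Mod Quo W\<^esub> \<sigma> \<in> carrier (Mod Quo W)" using Quo_closed(3)[OF W f \<sigma>] .
  show "f \<odot>\<^bsub>Mod Quo W\<^esub> (\<sigma> \<oplus>\<^bsub>Mod Quo W\<^esub> \<tau>) = f \<odot>\<^bsub>Mod Quo W\<^esub> \<sigma> \<oplus>\<^bsub>Mod Quo W\<^esub> f \<odot>\<^bsub>Mod Quo W\<^esub> \<tau>"
    if \<tau>: "\<tau> \<in> carrier (Mod Quo W)" for \<tau>
  proof (rule rep_eqI[OF Quo_extensional(3,2) W_Z])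
    fix z assume z: "z \<in> W"
    obtain V s t where V: "z \<in> V" "rep W \<sigma> V s" "rep W \<tau> V t" by (rule rep_exists2[OF \<sigma> \<tau> z])
    obtain V' g where V': "openin X V'" "z \<in> V'" "V' \<subseteq> V" "g \<in> \<O> V'" "\<And>y. y \<in> V' \<inter> Z \<Longrightarrow> g y = f y"
      by (rule restr_sheaf_lift_within[OF f z in_M(2)[OF V(2)] V(1)]) blast
    note s = rep_Res[OF V(2) V'(1,3)] and t = rep_Res[OF V(3) V'(1,3)]
    show "\<exists>V s. z \<in> V \<and> rep W (f \<odot>\<^bsub>Mod Quo W\<^esub> (\<sigma> \<oplus>\<^bsub>Mod Quo W\<^esub> \<tau>)) V s \<and>
        rep W (f \<odot>\<^bsub>Mod Quo W\<^esub> \<sigma> \<oplus>\<^bsub>Mod Quo W\<^esub> f \<odot>\<^bsub>Mod Quo W\<^esub> \<tau>) V s"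
      using rep_smult[OF rep_add[OF s t] V'(4,5)] rep_add[OF rep_smult[OF s V'(4,5)] rep_smult[OF t V'(4,5)]]
        smult_add[OF V'(1,4) in_M(1)[OF s] in_M(1)[OF t]] V'(2) by auto
  qed
  fix e assume e': "e \<in> carrier (fn_ring W (\<O>Z W))"
  then have e: "e \<in> \<O>Z W" by simp
  show "(f \<oplus>\<^bsub>fn_ring W (\<O>Z W)\<^esub> e) \<odot>\<^bsub>Mod Quo W\<^esub> \<sigma> = f \<odot>\<^bsub>Mod Quo W\<^esub> \<sigma> \<oplus>\<^bsub>Mod Quo W\<^esub> e \<odot>\<^bsub>Mod Quo W\<^esub> \<sigma>"
  proof (rule rep_eqI[OF Quo_extensional(3,2) W_Z])
    fix z assume z: "z \<in> W"
    obtain V s g h where V: "z \<in> V" "rep W \<sigma> V s" "g \<in> \<O> V" "h \<in> \<O> V"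
      and gh: "\<And>y. y \<in> V \<inter> Z \<Longrightarrow> g y = f y" "\<And>y. y \<in> V \<inter> Z \<Longrightarrow> h y = e y"
      using rep_smult_ex[OF f e \<sigma> z] by blast
    have o: "openin X V" "V \<inter> Z \<subseteq> W" using V(2) by (auto simp: rep_def)
    have "rep W ((\<lambda>x\<in>W. f x + e x) \<odot>\<^bsub>Mod Quo W\<^esub> \<sigma>) V ((\<lambda>x\<in>V. g x + h x) \<odot>\<^bsub>Mod M V\<^esub> s)"
      using o gh V by (intro rep_smult V add) auto
    moreover have "(\<lambda>x\<in>V. g x + h x) \<odot>\<^bsub>Mod M V\<^esub> s = g \<odot>\<^bsub>Mod M V\<^esub> s \<oplus>\<^bsub>Mod M V\<^esub> h \<odot>\<^bsub>Mod M V\<^esub> s"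
      using module.smult_l_distr[OF module[OF o(1)], of g h s] V in_M[OF V(2)] by simp
    ultimately show "\<exists>V s. z \<in> V \<and> rep W ((f \<oplus>\<^bsub>fn_ring W (\<O>Z W)\<^esub> e) \<odot>\<^bsub>Mod Quo W\<^esub> \<sigma>) V s \<and>
        rep W (f \<odot>\<^bsub>Mod Quo W\<^esub> \<sigma> \<oplus>\<^bsub>Mod Quo W\<^esub> e \<odot>\<^bsub>Mod Quo W\<^esub> \<sigma>) V s"
      using rep_add[OF rep_smult[OF V(2,3) gh(1)] rep_smult[OF V(2,4) gh(2)]] V(1) by auto
  qed
  show "(f \<otimes>\<^bsub>fn_ring W (\<O>Z W)\<^esub> e) \<odot>\<^bsub>Mod Quo W\<^esub> \<sigma> = f \<odot>\<^bsub>Mod Quo W\<^esub> (e \<odot>\<^bsub>Mod Quo W\<^esub> \<sigma>)"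
  proof (rule rep_eqI[OF Quo_extensional(3,3) W_Z])
    fix z assume z: "z \<in> W"
    obtain V s g h where V: "z \<in> V" "rep W \<sigma> V s" "g \<in> \<O> V" "h \<in> \<O> V"
      and gh: "\<And>y. y \<in> V \<inter> Z \<Longrightarrow> g y = f y" "\<And>y. y \<in> V \<inter> Z \<Longrightarrow> h y = e y"
      using rep_smult_ex[OF f e \<sigma> z] by blast
    have o: "openin X V" "V \<inter> Z \<subseteq> W" using V(2) by (auto simp: rep_def)
    have "rep W ((\<lambda>x\<in>W. f x * e x) \<odot>\<^bsub>Mod Quo W\<^esub> \<sigma>) V ((\<lambda>x\<in>V. g x * h x) \<odot>\<^bsub>Mod M V\<^esub> s)"
      using o gh V by (intro rep_smult V mult) auto
    then show "\<exists>V s. z \<in> V \<and> rep W ((f \<otimes>\<^bsub>fn_ring W (\<O>Z W)\<^esub> e) \<odot>\<^bsub>Mod Quo W\<^esub> \<sigma>) V s \<and>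
        rep W (f \<odot>\<^bsub>Mod Quo W\<^esub> (e \<odot>\<^bsub>Mod Quo W\<^esub> \<sigma>)) V s"
      using rep_smult[OF rep_smult[OF V(2,4) gh(2)] V(3) gh(1)] V(1)
        smult_assoc[OF o(1) V(3,4) in_M(1)[OF V(2)]] by auto
  qed
qed

lemma rep_restrict:
  assumes "openin Y W'" "W' \<subseteq> W" "rep W \<sigma> V s" "z \<in> V" "z \<in> W'"
  shows "\<exists>V' s'. z \<in> V' \<and> V' \<subseteq> V \<and> s' = Res M V V' s \<and> rep W' (restrict \<sigma> W') V' s'"
proof -
  obtain U where U: "openin X U" "W' = U \<inter> Z" using assms(1) by (auto simp: openin_subtopology)
  have "rep W \<sigma> (V \<inter> U) (Res M V (V \<inter> U) s)"
    using assms(3) U by (intro rep_Res) (auto simp: rep_def)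
  then show ?thesis using U assms(4,5) by (intro exI[of _ "V \<inter> U"]) (auto simp: rep_def)
qed

lemma Quo_restrict_closed:
  assumes W: "openin Y W'" "W' \<subseteq> W" and \<sigma>: "\<sigma> \<in> carrier (Mod Quo W)"
  shows "restrict \<sigma> W' \<in> carrier (Mod Quo W')"
  unfolding Quo_carrier
proof (intro conjI ballI)
  fix z assume z: "z \<in> W'"
  then have "z \<in> W" using W by auto
  obtain V s where "z \<in> V" "rep W \<sigma> V s" by (rule rep_exists[OF \<sigma> \<open>z \<in> W\<close>])
  then show "\<exists>V s. z \<in> V \<and> rep W' (restrict \<sigma> W') V s" using rep_restrict[OF W _ _ z] by blast
qed simp

text \<open>Sections are functions on points, so that restriction is restriction of functions and gluing is done
  pointwise.\<close>

sublocale Q: module_sheaf Y \<O>Z Quo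
proof (intro module_sheaf.intro function_sheaf_restr_sheaf module_sheaf_axioms.intro)
  show "Module.module (fn_ring W (\<O>Z W)) (Mod Quo W)" if "openin Y W" for W using Quo_module that .
  fix W W' \<sigma> assume W: "openin Y W" "openin Y W'" "W' \<subseteq> W" and \<sigma>: "\<sigma> \<in> carrier (Mod Quo W)"
  show "Res Quo W W' \<sigma> \<in> carrier (Mod Quo W')"
    using Quo_restrict_closed[OF W(2,3) \<sigma>] by simp
  show "Res Quo W W' (\<sigma> \<oplus>\<^bsub>Mod Quo W\<^esub> \<tau>) = Res Quo W W' \<sigma> \<oplus>\<^bsub>Mod Quo W'\<^esub> Res Quo W W' \<tau>" for \<tau>
    using W(3) by (auto simp: restr_quot_def fun_eq_iff)
  fix f assume f: "f \<in> \<O>Z W"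
  have "restrict (f \<odot>\<^bsub>Mod Quo W\<^esub> \<sigma>) W' = restrict f W' \<odot>\<^bsub>Mod Quo W'\<^esub> restrict \<sigma> W'"
  proof (rule rep_eqI[OF restrict_extensional Quo_extensional(3) open_in_Z[OF W(2)]])
    fix z assume z: "z \<in> W'"
    then have "z \<in> W" using W by auto
    obtain V s where V: "z \<in> V" "rep W \<sigma> V s" by (rule rep_exists[OF \<sigma> \<open>z \<in> W\<close>])
    have o: "openin X V" using V(2) by (auto simp: rep_def)
    obtain V1 g where V1: "openin X V1" "z \<in> V1" "V1 \<subseteq> V" "V1 \<inter> Z \<subseteq> W" "g \<in> \<O> V1" "\<And>y. y \<in> V1 \<inter> Z \<Longrightarrow> g y = f y"
      by (rule restr_sheaf_lift_within[OF f \<open>z \<in> W\<close> o V(1)]) blast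
    obtain U where U: "openin X U" "W' = U \<inter> Z" using W(2) by (auto simp: openin_subtopology)
    define V' where "V' = V1 \<inter> U"
    have V': "openin X V'" "z \<in> V'" "V' \<subseteq> V" "V' \<inter> Z \<subseteq> W'" "restrict g V' \<in> \<O> V'"
      using V1 U z restr[OF V1(1) _ _ V1(5), of V'] by (auto simp: V'_def)
    define s' where "s' = Res M V V' s"
    have s': "rep W \<sigma> V' s'" unfolding s'_def by (rule rep_Res[OF V(2) V'(1,3)])
    then have s'': "rep W' (restrict \<sigma> W') V' s'" using V'(4) by (auto simp: rep_def)
    have "rep W (f \<odot>\<^bsub>Mod Quo W\<^esub> \<sigma>) V' (restrict g V' \<odot>\<^bsub>Mod M V'\<^esub> s')"
      using V1 V' by (intro rep_smult s') (auto simp: V'_def)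
    then have "rep W' (restrict (f \<odot>\<^bsub>Mod Quo W\<^esub> \<sigma>) W') V' (restrict g V' \<odot>\<^bsub>Mod M V'\<^esub> s')"
      using V'(4) by (auto simp: rep_def)
    moreover have "rep W' (restrict f W' \<odot>\<^bsub>Mod Quo W'\<^esub> restrict \<sigma> W') V' (restrict g V' \<odot>\<^bsub>Mod M V'\<^esub> s')"
      using V1 V' by (intro rep_smult s'') (auto simp: V'_def)
    ultimately show "\<exists>V s. z \<in> V \<and> rep W' (restrict (f \<odot>\<^bsub>Mod Quo W\<^esub> \<sigma>) W') V s \<and>
        rep W' (restrict f W' \<odot>\<^bsub>Mod Quo W'\<^esub> restrict \<sigma> W') V s" using V'(2) by blast
  qed
  then show "Res Quo W W' (f \<odot>\<^bsub>Mod Quo W\<^esub> \<sigma>) = restrict f W' \<odot>\<^bsub>Mod Quo W'\<^esub> Res Quo W W' \<sigma>" by simp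
next
  fix W \<sigma> assume "\<sigma> \<in> carrier (Mod Quo W)"
  then show "Res Quo W W \<sigma> = \<sigma>" by (simp add: Quo_carrier extensional_restrict)
next
  fix W W' W'' :: "'x set" and \<sigma> assume "W'' \<subseteq> W'"
  then show "Res Quo W' W'' (Res Quo W W' \<sigma>) = Res Quo W W'' \<sigma>" by (simp add: Int_absorb1)
next
  fix W \<sigma> \<tau> assume *: "\<sigma> \<in> carrier (Mod Quo W)" "\<tau> \<in> carrier (Mod Quo W)"
    and loc: "\<And>x. x \<in> W \<Longrightarrow> \<exists>V. openin Y V \<and> x \<in> V \<and> V \<subseteq> W \<and> Res Quo W V \<sigma> = Res Quo W V \<tau>"
  show "\<sigma> = \<tau>"
  proof (rule extensionalityI[of _ W])
    fix x assume "x \<in> W"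
    with loc obtain V where "x \<in> V" "restrict \<sigma> V = restrict \<tau> V" by auto
    then show "\<sigma> x = \<tau> x" by (metis restrict_apply')
  qed (use * in \<open>simp_all add: Quo_carrier\<close>)
next
  fix \<V> \<sigma>
  assume V: "\<And>V. V \<in> \<V> \<Longrightarrow> openin Y V" and \<sigma>: "\<And>V. V \<in> \<V> \<Longrightarrow> \<sigma> V \<in> carrier (Mod Quo V)"
    and compat: "\<And>V V'. \<lbrakk>V \<in> \<V>; V' \<in> \<V>\<rbrakk> \<Longrightarrow> Res Quo V (V \<inter> V') (\<sigma> V) = Res Quo V' (V \<inter> V') (\<sigma> V')"
  define \<tau> where "\<tau> = (\<lambda>z\<in>\<Union>\<V>. \<sigma> (SOME V. V \<in> \<V> \<and> z \<in> V) z)"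
  have \<tau>: "\<tau> z = \<sigma> V z" if "V \<in> \<V>" "z \<in> V" for V z
  proof -
    have *: "(SOME V. V \<in> \<V> \<and> z \<in> V) \<in> \<V> \<and> z \<in> (SOME V. V \<in> \<V> \<and> z \<in> V)"
      by (rule someI[of _ V]) (use that in simp)
    have "restrict (\<sigma> (SOME V. V \<in> \<V> \<and> z \<in> V)) ((SOME V. V \<in> \<V> \<and> z \<in> V) \<inter> V) z =
        restrict (\<sigma> V) ((SOME V. V \<in> \<V> \<and> z \<in> V) \<inter> V) z"
      using compat[of "SOME V. V \<in> \<V> \<and> z \<in> V" V] * that by simp
    then show ?thesis using * that by (auto simp: \<tau>_def)
  qed
  have "\<tau> \<in> carrier (Mod Quo (\<Union>\<V>))"
    unfolding Quo_carrier
  proof (intro conjI ballI)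
    fix z assume "z \<in> \<Union>\<V>"
    then obtain V where "V \<in> \<V>" "z \<in> V" by blast
    moreover obtain U s where "z \<in> U" "rep V (\<sigma> V) U s" by (rule rep_exists[OF \<sigma>[OF \<open>V \<in> \<V>\<close>] \<open>z \<in> V\<close>])
    ultimately show "\<exists>U s. z \<in> U \<and> rep (\<Union>\<V>) \<tau> U s" using \<tau> unfolding rep_def by (intro exI[of _ U] exI[of _ s]) auto
  qed (simp add: \<tau>_def)
  moreover have "restrict \<tau> V = \<sigma> V" if "V \<in> \<V>" for V
    by (rule extensionalityI[of _ V]) (use \<tau> \<sigma>[OF that] that in \<open>simp_all add: Quo_carrier\<close>)
  ultimately show "\<exists>s\<in>carrier (Mod Quo (\<Union>\<V>)). \<forall>V\<in>\<V>. Res Quo (\<Union>\<V>) V s = \<sigma> V" by auto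
qed

end

section \<open>Sections of the quotient represented by sections of the module\<close>

context germ_quotient
begin

lemma rep_gsec:
  assumes "openin X V" "s \<in> carrier (Mod M V)"
  shows "rep (V \<inter> Z) (gsec V s) V s"
  using assms by (auto simp: rep_def germ_section_def)

lemma openin_Int_Z: "openin X V \<Longrightarrow> openin Y (V \<inter> Z)"
  by (auto simp: openin_subtopology)

lemma gsec_closed:
  assumes "openin X V" "s \<in> carrier (Mod M V)"
  shows "gsec V s \<in> carrier (Mod Quo (V \<inter> Z))"
  using rep_gsec[OF assms] by (auto simp: Quo_carrier germ_section_def)

lemma gsec_eqI:
  assumes V: "openin X V" and s: "s \<in> carrier (Mod M V)" and \<sigma>: "\<sigma> \<in> extensional (V \<inter> Z)" and "rep (V \<inter> Z) \<sigma> V s"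
  shows "\<sigma> = gsec V s"
  using assms rep_gsec[OF V s] by (intro rep_eqI[of _ "V \<inter> Z"]) (auto simp: germ_section_def)

lemma gsec_add:
  assumes "openin X V" "s \<in> carrier (Mod M V)" "t \<in> carrier (Mod M V)"
  shows "gsec V (s \<oplus>\<^bsub>Mod M V\<^esub> t) = gsec V s \<oplus>\<^bsub>Mod Quo (V \<inter> Z)\<^esub> gsec V t"
  by (rule gsec_eqI[symmetric]) (use assms rep_add[OF rep_gsec rep_gsec] Quo_extensional in auto)

lemma gsec_smult:
  assumes "openin X V" "g \<in> \<O> V" "s \<in> carrier (Mod M V)" "\<And>y. y \<in> V \<inter> Z \<Longrightarrow> g y = f y"
  shows "gsec V (g \<odot>\<^bsub>Mod M V\<^esub> s) = f \<odot>\<^bsub>Mod Quo (V \<inter> Z)\<^esub> gsec V s"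
  by (rule gsec_eqI[symmetric]) (use assms rep_smult[OF rep_gsec] Quo_extensional in auto)

lemma gsec_zero: "openin X V \<Longrightarrow> gsec V \<zero>\<^bsub>Mod M V\<^esub> = \<zero>\<^bsub>Mod Quo (V \<inter> Z)\<^esub>"
  by (rule gsec_eqI[symmetric]) (use rep_zero Quo_extensional in auto)

lemma gsec_minus:
  assumes "openin X V" "s \<in> carrier (Mod M V)" "t \<in> carrier (Mod M V)"
  shows "gsec V (s \<ominus>\<^bsub>Mod M V\<^esub> t) = gsec V s \<ominus>\<^bsub>Mod Quo (V \<inter> Z)\<^esub> gsec V t"
proof -
  have o: "openin Y (V \<inter> Z)" using assms(1) by (rule openin_Int_Z)
  have "gsec V s = gsec V (s \<ominus>\<^bsub>Mod M V\<^esub> t) \<oplus>\<^bsub>Mod Quo (V \<inter> Z)\<^esub> gsec V t"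
    using gsec_add[of V "s \<ominus>\<^bsub>Mod M V\<^esub> t" t] assms section_arith(1)[of V s t] by simp
  then show ?thesis
    using Q.section_arith(2)[OF o, of "gsec V (s \<ominus>\<^bsub>Mod M V\<^esub> t)" "gsec V t"] assms gsec_closed by simp
qed

lemma gsec_Res:
  assumes "openin X V" "openin X V'" "V' \<subseteq> V" "s \<in> carrier (Mod M V)"
  shows "gsec V' (Res M V V' s) = restrict (gsec V s) (V' \<inter> Z)"
proof (rule gsec_eqI[symmetric])
  show "rep (V' \<inter> Z) (restrict (gsec V s) (V' \<inter> Z)) V' (Res M V V' s)"
    using rep_Res[OF rep_gsec[OF assms(1,4)] assms(2,3)] assms(3) by (auto simp: rep_def)
qed (use assms Res_closed in auto)

lemma gsec_exists:
  assumes W: "openin Y W" and \<sigma>: "\<sigma> \<in> carrier (Mod Quo W)" and z: "z \<in> W" and U: "openin X U" "z \<in> U"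
  obtains V s where "openin X V" "z \<in> V" "V \<subseteq> U" "V \<inter> Z \<subseteq> W" "s \<in> carrier (Mod M V)"
    "restrict \<sigma> (V \<inter> Z) = gsec V s"
proof -
  obtain V s where V: "z \<in> V" "rep W \<sigma> V s" by (rule rep_exists[OF \<sigma> z])
  have "rep W \<sigma> (V \<inter> U) (Res M V (V \<inter> U) s)" using V U by (intro rep_Res) (auto simp: rep_def)
  then show ?thesis
    using V U by (intro that[of "V \<inter> U" "Res M V (V \<inter> U) s"]) (auto simp: rep_def restrict_eq_gsec_iff)
qed

lemma gsec_eq_zero_iff:
  assumes V: "openin X V" and s: "s \<in> carrier (Mod M V)"
  shows "gsec V s = \<zero>\<^bsub>Mod Quo (V \<inter> Z)\<^esub> \<longleftrightarrow>
    (\<forall>z\<in>V \<inter> Z. \<exists>V'. openin X V' \<and> z \<in> V' \<and> V' \<subseteq> V \<and> Res M V V' s \<in> R V')"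
proof -
  have "gsec V s = gsec V \<zero>\<^bsub>Mod M V\<^esub> \<longleftrightarrow> (\<forall>z\<in>V \<inter> Z. cls z V s = cls z V \<zero>\<^bsub>Mod M V\<^esub>)"
    by (auto simp: germ_section_def fun_eq_iff restrict_def)
  moreover have "cls z V s = cls z V \<zero>\<^bsub>Mod M V\<^esub> \<longleftrightarrow> (\<exists>V'. openin X V' \<and> z \<in> V' \<and> V' \<subseteq> V \<and> Res M V V' s \<in> R V')"
    if z: "z \<in> V \<inter> Z" for z
  proof -
    have "Res M V V' s \<ominus>\<^bsub>Mod M V'\<^esub> Res M V V' \<zero>\<^bsub>Mod M V\<^esub> = Res M V V' s" if "openin X V'" "V' \<subseteq> V" for V'
      using that V s by (simp add: section_arith(9) Res_closed)
    then show ?thesis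
      using z V s by (subst cls_eq_iff) (auto simp: germ_eq_def)
  qed
  ultimately show ?thesis using gsec_zero[OF V] by simp
qed

lemma gsec_in_zero:
  assumes V: "openin X V" and s: "s \<in> R V"
  shows "gsec V s = \<zero>\<^bsub>Mod Quo (V \<inter> Z)\<^esub>"
  using gsec_eq_zero_iff[OF V R_simps(1)[OF V s]] V s by (auto simp: Res_id R_simps(1) intro!: exI[of _ V])

lemma gsec_eq_iff:
  assumes V: "openin X V" and s: "s \<in> carrier (Mod M V)" "t \<in> carrier (Mod M V)"
  shows "gsec V s = gsec V t \<longleftrightarrow>
    (\<forall>z\<in>V \<inter> Z. \<exists>V'. openin X V' \<and> z \<in> V' \<and> V' \<subseteq> V \<and> Res M V V' (s \<ominus>\<^bsub>Mod M V\<^esub> t) \<in> R V')"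
  using gsec_eq_zero_iff[of V "s \<ominus>\<^bsub>Mod M V\<^esub> t"] gsec_minus[OF V s] V s gsec_closed
    Q.section_arith(12)[OF openin_Int_Z[OF V], of "gsec V s" "gsec V t"] by simp

text \<open>Both \<open>\<T>\<^sub>Z \<times> i\<^sup>*\<Q>\<close> and the image of the conormal bundle arise in this way, for the sections of \<open>\<Q>\<close> with
  tangent anchor and for the co-anchors of conormal forms.\<close>

definition represented :: "('x set \<Rightarrow> 's set) \<Rightarrow> 'x set \<Rightarrow> ('x \<Rightarrow> ('x set \<times> 's) set) set" where
  "represented P W = {\<sigma>. openin Y W \<and> \<sigma> \<in> carrier (Mod Quo W) \<and>
     (\<forall>z\<in>W. \<exists>V s. openin X V \<and> z \<in> V \<and> V \<inter> Z \<subseteq> W \<and> s \<in> P V \<and> restrict \<sigma> (V \<inter> Z) = gsec V s)}"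

lemma representedE:
  assumes "\<sigma> \<in> represented P W" "z \<in> W"
  obtains V s where "openin X V" "z \<in> V" "V \<inter> Z \<subseteq> W" "s \<in> P V" "restrict \<sigma> (V \<inter> Z) = gsec V s"
  using assms by (auto simp: represented_def)

lemma representedI:
  assumes "openin Y W" "\<sigma> \<in> carrier (Mod Quo W)"
    "\<And>z. z \<in> W \<Longrightarrow> \<exists>V s. openin X V \<and> z \<in> V \<and> V \<inter> Z \<subseteq> W \<and> s \<in> P V \<and> restrict \<sigma> (V \<inter> Z) = gsec V s"
  shows "\<sigma> \<in> represented P W"
  using assms by (simp add: represented_def)

definition subpresheaf :: "('x set \<Rightarrow> 's set) \<Rightarrow> bool" where
  "subpresheaf P \<longleftrightarrow> (\<forall>V. openin X V \<longrightarrow> submodule (P V) (fn_ring V (\<O> V)) (Mod M V) \<and>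
     (\<forall>V' s. openin X V' \<and> V' \<subseteq> V \<and> s \<in> P V \<longrightarrow> Res M V V' s \<in> P V'))"

context
  fixes P :: "'x set \<Rightarrow> 's set"
  assumes P: "subpresheaf P"
begin

lemma P_Res: "\<lbrakk>openin X V; openin X V'; V' \<subseteq> V; s \<in> P V\<rbrakk> \<Longrightarrow> Res M V V' s \<in> P V'"
  using P by (simp add: subpresheaf_def)

lemma P_simps:
  assumes "openin X V"
  shows "s \<in> P V \<Longrightarrow> s \<in> carrier (Mod M V)"
    and "\<zero>\<^bsub>Mod M V\<^esub> \<in> P V"
    and "\<lbrakk>s \<in> P V; t \<in> P V\<rbrakk> \<Longrightarrow> s \<oplus>\<^bsub>Mod M V\<^esub> t \<in> P V"
    and "\<lbrakk>f \<in> \<O> V; s \<in> P V\<rbrakk> \<Longrightarrow> f \<odot>\<^bsub>Mod M V\<^esub> s \<in> P V"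
  using submodule_simps[OF assms, of "P V"] P assms by (auto simp: subpresheaf_def)

lemma represented_restrict:
  assumes \<sigma>: "\<sigma> \<in> represented P W" and z: "z \<in> W" and U: "openin X U" "z \<in> U"
  obtains V s where "openin X V" "z \<in> V" "V \<subseteq> U" "V \<inter> Z \<subseteq> W" "s \<in> P V" "restrict \<sigma> (V \<inter> Z) = gsec V s"
proof -
  obtain V s where V: "openin X V" "z \<in> V" "V \<inter> Z \<subseteq> W" "s \<in> P V" "restrict \<sigma> (V \<inter> Z) = gsec V s"
    by (rule representedE[OF \<sigma> z])
  have o: "openin X (V \<inter> U)" "V \<inter> U \<subseteq> V" using V U by auto
  have "restrict \<sigma> (V \<inter> U \<inter> Z) = restrict (restrict \<sigma> (V \<inter> Z)) (V \<inter> U \<inter> Z)"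
    by (auto simp: fun_eq_iff restrict_def)
  also have "\<dots> = gsec (V \<inter> U) (Res M V (V \<inter> U) s)"
    using gsec_Res[OF V(1) o P_simps(1)[OF V(1,4)]] V(5) by simp
  finally show ?thesis
    using V U o P_Res[OF V(1) o V(4)] by (intro that[of "V \<inter> U" "Res M V (V \<inter> U) s"]) auto
qed

lemma gsec_represented:
  assumes V: "openin X V" "s \<in> P V"
  shows "gsec V s \<in> represented P (V \<inter> Z)"
proof (rule representedI)
  fix z assume "z \<in> V \<inter> Z"
  then show "\<exists>V' s'. openin X V' \<and> z \<in> V' \<and> V' \<inter> Z \<subseteq> V \<inter> Z \<and> s' \<in> P V' \<and> restrict (gsec V s) (V' \<inter> Z) = gsec V' s'"
    using V by (intro exI[of _ V] exI[of _ s]) (auto simp: germ_section_def)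
qed (use V P_simps(1) gsec_closed openin_Int_Z in auto)

lemma subsheaf_represented: "subsheaf Y \<O>Z Quo (represented P)"
proof (rule Q.subsheafI)
  show closed: "s \<in> carrier (Mod Quo U)" if "s \<in> represented P U" for U s using that by (simp add: represented_def)
  show "\<zero>\<^bsub>Mod Quo W\<^esub> \<in> represented P W" if W: "openin Y W" for W
  proof -
    obtain V where "openin X V" "W = V \<inter> Z" using W by (auto simp: openin_subtopology)
    then show ?thesis using gsec_represented[of V "\<zero>\<^bsub>Mod M V\<^esub>"] gsec_zero[of V] P_simps(2)[of V] by simp
  qed
  show "\<sigma> \<oplus>\<^bsub>Mod Quo W\<^esub> \<tau> \<in> represented P W" if W: "openin Y W" and \<sigma>: "\<sigma> \<in> represented P W" and \<tau>: "\<tau> \<in> represented P W"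
    for W \<sigma> \<tau>
  proof (rule representedI[OF W])
    fix z assume z: "z \<in> W"
    obtain U s where U: "openin X U" "z \<in> U" "U \<inter> Z \<subseteq> W" "s \<in> P U" "restrict \<sigma> (U \<inter> Z) = gsec U s"
      by (rule representedE[OF \<sigma> z])
    obtain V t where V: "openin X V" "z \<in> V" "V \<subseteq> U" "V \<inter> Z \<subseteq> W" "t \<in> P V" "restrict \<tau> (V \<inter> Z) = gsec V t"
      by (rule represented_restrict[OF \<tau> z U(1,2)])
    define s' where "s' = Res M U V s"
    have s': "s' \<in> P V" "restrict \<sigma> (V \<inter> Z) = gsec V s'"
    proof -
      show "s' \<in> P V" unfolding s'_def using P_Res[OF U(1) V(1,3) U(4)] .
      have "restrict \<sigma> (V \<inter> Z) = restrict (restrict \<sigma> (U \<inter> Z)) (V \<inter> Z)" using V(3) by (auto simp: fun_eq_iff restrict_def)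
      then show "restrict \<sigma> (V \<inter> Z) = gsec V s'"
        unfolding s'_def using gsec_Res[OF U(1) V(1,3) P_simps(1)[OF U(1,4)]] U(5) by simp
    qed
    have "restrict (\<sigma> \<oplus>\<^bsub>Mod Quo W\<^esub> \<tau>) (V \<inter> Z) = restrict \<sigma> (V \<inter> Z) \<oplus>\<^bsub>Mod Quo (V \<inter> Z)\<^esub> restrict \<tau> (V \<inter> Z)"
      using Q.Res_add[OF W openin_Int_Z[OF V(1)] V(4) closed[OF \<sigma>] closed[OF \<tau>]] by simp
    also have "\<dots> = gsec V (s' \<oplus>\<^bsub>Mod M V\<^esub> t)"
      using gsec_add[OF V(1) P_simps(1)[OF V(1) s'(1)] P_simps(1)[OF V(1,5)]] s'(2) V(6) by simp
    finally show "\<exists>V s. openin X V \<and> z \<in> V \<and> V \<inter> Z \<subseteq> W \<and> s \<in> P V \<and>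
        restrict (\<sigma> \<oplus>\<^bsub>Mod Quo W\<^esub> \<tau>) (V \<inter> Z) = gsec V s"
      using V P_simps(3)[OF V(1) s'(1) V(5)] by blast
  qed (use W closed \<sigma> \<tau> in auto)
  show "f \<odot>\<^bsub>Mod Quo W\<^esub> \<sigma> \<in> represented P W" if W: "openin Y W" and f: "f \<in> \<O>Z W" and \<sigma>: "\<sigma> \<in> represented P W" for W f \<sigma>
  proof (rule representedI[OF W])
    fix z assume z: "z \<in> W"
    obtain U g where U: "openin X U" "z \<in> U" "U \<inter> Z \<subseteq> W" "g \<in> \<O> U" "\<And>y. y \<in> U \<inter> Z \<Longrightarrow> g y = f y"
      by (rule restr_sheaf_lift[OF f z]) blast
    obtain V s where V: "openin X V" "z \<in> V" "V \<subseteq> U" "V \<inter> Z \<subseteq> W" "s \<in> P V" "restrict \<sigma> (V \<inter> Z) = gsec V s"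
      by (rule represented_restrict[OF \<sigma> z U(1,2)])
    have g: "restrict g V \<in> \<O> V" using restr[OF U(1) V(1,3) U(4)] .
    have "restrict (f \<odot>\<^bsub>Mod Quo W\<^esub> \<sigma>) (V \<inter> Z) = restrict f (V \<inter> Z) \<odot>\<^bsub>Mod Quo (V \<inter> Z)\<^esub> restrict \<sigma> (V \<inter> Z)"
      using Q.Res_smult[OF W openin_Int_Z[OF V(1)] V(4) f closed[OF \<sigma>]] by simp
    also have "\<dots> = gsec V (restrict g V \<odot>\<^bsub>Mod M V\<^esub> s)"
      unfolding V(6) by (rule gsec_smult[OF V(1) g P_simps(1)[OF V(1,5)], symmetric]) (use V(3) U(5) in auto)
    finally show "\<exists>V s. openin X V \<and> z \<in> V \<and> V \<inter> Z \<subseteq> W \<and> s \<in> P V \<and>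
        restrict (f \<odot>\<^bsub>Mod Quo W\<^esub> \<sigma>) (V \<inter> Z) = gsec V s"
      using V P_simps(4)[OF V(1) g V(5)] by blast
  qed (use W closed f \<sigma> in auto)
  show "Res Quo W W' \<sigma> \<in> represented P W'" if W: "openin Y W" "openin Y W'" "W' \<subseteq> W" and \<sigma>: "\<sigma> \<in> represented P W" for W W' \<sigma>
  proof (rule representedI[OF W(2)])
    obtain U where U: "openin X U" "W' = U \<inter> Z" using W(2) by (auto simp: openin_subtopology)
    fix z assume "z \<in> W'"
    then have z: "z \<in> W" "z \<in> U" using W U by auto
    obtain V s where V: "openin X V" "z \<in> V" "V \<subseteq> U" "V \<inter> Z \<subseteq> W" "s \<in> P V" "restrict \<sigma> (V \<inter> Z) = gsec V s"
      by (rule represented_restrict[OF \<sigma> z(1) U(1) z(2)])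
    moreover have "restrict (Res Quo W W' \<sigma>) (V \<inter> Z) = restrict \<sigma> (V \<inter> Z)"
      using V(3) U(2) by (auto simp: fun_eq_iff restrict_def)
    ultimately show "\<exists>V s. openin X V \<and> z \<in> V \<and> V \<inter> Z \<subseteq> W' \<and> s \<in> P V \<and> restrict (Res Quo W W' \<sigma>) (V \<inter> Z) = gsec V s"
      using U(2) by (intro exI[of _ V] exI[of _ s]) auto
  qed (rule Q.Res_closed[OF W closed[OF \<sigma>]])
  show "\<sigma> \<in> represented P W" if W: "openin Y W" and \<sigma>: "\<sigma> \<in> carrier (Mod Quo W)"
    and loc: "\<And>x. x \<in> W \<Longrightarrow> \<exists>V. openin Y V \<and> x \<in> V \<and> V \<subseteq> W \<and> Res Quo W V \<sigma> \<in> represented P V" for W \<sigma>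
  proof (rule representedI[OF W \<sigma>])
    fix z assume "z \<in> W"
    with loc obtain W' where W': "z \<in> W'" "W' \<subseteq> W" and r: "restrict \<sigma> W' \<in> represented P W'" by auto
    obtain V s where V: "openin X V" "z \<in> V" "V \<inter> Z \<subseteq> W'" "s \<in> P V" "restrict (restrict \<sigma> W') (V \<inter> Z) = gsec V s"
      by (rule representedE[OF r W'(1)])
    moreover have "restrict (restrict \<sigma> W') (V \<inter> Z) = restrict \<sigma> (V \<inter> Z)"
      using V(3) by (auto simp: fun_eq_iff restrict_def)
    ultimately show "\<exists>V s. openin X V \<and> z \<in> V \<and> V \<inter> Z \<subseteq> W \<and> s \<in> P V \<and> restrict \<sigma> (V \<inter> Z) = gsec V s"
      using W'(2) by (intro exI[of _ V] exI[of _ s]) auto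
  qed
  show "represented P W = {}" if "\<not> openin Y W" for W using that by (simp add: represented_def)
qed

text \<open>The description of such subsheaves by sections of \<open>M\<close> upstairs: up to shrinking, membership means to lie
  in \<open>P + R\<close>.\<close>

lemma gsec_represented_split:
  assumes V: "openin X V" and q: "q \<in> carrier (Mod M V)" and rep: "gsec V q \<in> represented P (V \<inter> Z)" and z: "z \<in> V" "z \<in> Z"
  obtains V' s r where "openin X V'" "z \<in> V'" "V' \<subseteq> V" "s \<in> P V'" "r \<in> R V'" "Res M V V' q = s \<oplus>\<^bsub>Mod M V'\<^esub> r"
proof -
  have zVZ: "z \<in> V \<inter> Z" using z by simp
  obtain U s where U: "openin X U" "z \<in> U" "U \<subseteq> V" "U \<inter> Z \<subseteq> V \<inter> Z" "s \<in> P U" "restrict (gsec V q) (U \<inter> Z) = gsec U s"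
    by (rule represented_restrict[OF rep zVZ V z(1)])
  have s: "s \<in> carrier (Mod M U)" using P_simps(1)[OF U(1,5)] .
  have q': "Res M V U q \<in> carrier (Mod M U)" using Res_closed[OF V U(1,3) q] .
  have "gsec U (Res M V U q) = gsec U s" using gsec_Res[OF V U(1,3) q] U(6) by simp
  then obtain V' where V': "openin X V'" "z \<in> V'" "V' \<subseteq> U" "Res M U V' (Res M V U q \<ominus>\<^bsub>Mod M U\<^esub> s) \<in> R V'"
    using gsec_eq_iff[OF U(1) q' s] U(2) z(2) by blast
  have s': "Res M U V' s \<in> carrier (Mod M V')" using Res_closed[OF U(1) V'(1,3) s] .
  have q'': "Res M V V' q \<in> carrier (Mod M V')" using Res_closed[OF V V'(1) _ q] V'(3) U(3) by auto
  have "Res M V V' q \<ominus>\<^bsub>Mod M V'\<^esub> Res M U V' s \<in> R V'"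
    using V'(4) Res_minus[OF U(1) V'(1,3) q' s] Res_Res[OF V U(1) V'(1,3) U(3) q] by simp
  moreover have "Res M V V' q = Res M U V' s \<oplus>\<^bsub>Mod M V'\<^esub> (Res M V V' q \<ominus>\<^bsub>Mod M V'\<^esub> Res M U V' s)"
    using section_arith(4)[OF V'(1) q'' s'] by simp
  ultimately show ?thesis
    using V' U(3) P_Res[OF U(1) V'(1,3) U(5)] by (intro that[of V' "Res M U V' s"]) auto
qed

lemma gsec_representedI:
  assumes V: "openin X V" and q: "q \<in> carrier (Mod M V)"
    and loc: "\<And>z. z \<in> V \<inter> Z \<Longrightarrow> \<exists>V' s r. openin X V' \<and> z \<in> V' \<and> V' \<subseteq> V \<and> s \<in> P V' \<and> r \<in> R V' \<and>
      Res M V V' q = s \<oplus>\<^bsub>Mod M V'\<^esub> r"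
  shows "gsec V q \<in> represented P (V \<inter> Z)"
proof (rule representedI[OF openin_Int_Z[OF V] gsec_closed[OF V q]])
  fix z assume "z \<in> V \<inter> Z"
  with loc obtain V' s r where V': "openin X V'" "z \<in> V'" "V' \<subseteq> V" "s \<in> P V'" "r \<in> R V'"
    "Res M V V' q = s \<oplus>\<^bsub>Mod M V'\<^esub> r" by blast
  have s: "s \<in> carrier (Mod M V')" and r: "r \<in> carrier (Mod M V')" using P_simps(1) R_simps(1) V' by auto
  have "restrict (gsec V q) (V' \<inter> Z) = gsec V' s \<oplus>\<^bsub>Mod Quo (V' \<inter> Z)\<^esub> gsec V' r"
    using gsec_Res[OF V V'(1,3) q] gsec_add[OF V'(1) s r] V'(6) by simp
  also have "\<dots> = gsec V' s"
  proof -
    interpret V': abelian_group "Mod Quo (V' \<inter> Z)" using Q.sections_abelian_group[OF openin_Int_Z[OF V'(1)]] .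
    show ?thesis using gsec_in_zero[OF V'(1,5)] gsec_closed[OF V'(1) s] by simp
  qed
  finally show "\<exists>V' s. openin X V' \<and> z \<in> V' \<and> V' \<inter> Z \<subseteq> V \<inter> Z \<and> s \<in> P V' \<and> restrict (gsec V q) (V' \<inter> Z) = gsec V' s"
    using V' by (intro exI[of _ V'] exI[of _ s]) auto
qed

end

end

lemma module_sheaf_cong:
  assumes M: "module_sheaf X \<O> M" and eq: "\<And>U. openin X U \<Longrightarrow> \<O>' U = \<O> U"
    and M': "Mod M' = Mod M" "Res M' = Res M" and ext: "function_sheaf X \<O>'"
  shows "module_sheaf X \<O>' M'"
proof -
  interpret M: module_sheaf X \<O> M by (rule M)
  show ?thesis
  proof (intro module_sheaf.intro ext module_sheaf_axioms.intro)
    fix U s t assume "openin X U" "s \<in> carrier (Mod M' U)" "t \<in> carrier (Mod M' U)"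
      "\<And>x. x \<in> U \<Longrightarrow> \<exists>V. openin X V \<and> x \<in> V \<and> V \<subseteq> U \<and> Res M' U V s = Res M' U V t"
    then show "s = t" unfolding M' by (rule M.locality)
  next
    fix \<V> \<sigma> assume "\<And>V. V \<in> \<V> \<Longrightarrow> openin X V" "\<And>V. V \<in> \<V> \<Longrightarrow> \<sigma> V \<in> carrier (Mod M' V)"
      "\<And>V V'. \<lbrakk>V \<in> \<V>; V' \<in> \<V>\<rbrakk> \<Longrightarrow> Res M' V (V \<inter> V') (\<sigma> V) = Res M' V' (V \<inter> V') (\<sigma> V')"
    then show "\<exists>s\<in>carrier (Mod M' (\<Union>\<V>)). \<forall>V\<in>\<V>. Res M' (\<Union>\<V>) V s = \<sigma> V" unfolding M' by (rule M.gluing)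
  qed (use M.module in \<open>simp_all add: M' eq M.Res_closed M.Res_add M.Res_smult M.Res_id M.Res_Res\<close>)
qed

lemma quotient_map_cong:
  assumes q: "quotient_map X \<O> A B F N p" and B': "Mod B' = Mod B" "Res B' = Res B"
  shows "quotient_map X \<O> A B' F N p"
proof -
  interpret q: quotient_map X \<O> A B F N p by (rule q)
  have "module_sheaf X \<O> B'"
    by (rule module_sheaf_cong[OF q.B.module_sheaf_axioms refl B' q.A.function_sheaf_axioms])
  then show ?thesis
    using q.quotient_map_axioms q.A.module_sheaf_axioms
    unfolding quotient_map_def quotient_map_axioms_def B' by simp
qed

text \<open>This is the construction above with the whole space in place of \<open>Z\<close>: no function but \<open>0\<close> vanishes there,
  so that every subsheaf \<open>N\<close> of \<open>F\<close> qualifies for \<open>R\<close>.\<close>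

lemma (in module_sheaf) quotient_map_subsheaves:
  fixes F N
  defines "MF \<equiv> \<lparr>Mod = (\<lambda>U. (Mod M U)\<lparr>carrier := F U\<rparr>), Res = Res M\<rparr>"
  defines "B \<equiv> restr_quot X \<O> MF N (topspace X)"
  assumes F: "subsheaf X \<O> M F" and N: "subsheaf X \<O> M N" and N_F: "\<And>U. openin X U \<Longrightarrow> N U \<subseteq> F U"
  shows "germ_quotient X \<O> MF N (topspace X)"
    and "quotient_map X \<O> M B F N (germ_section X MF N (topspace X))"
proof -
  interpret MF: module_sheaf X \<O> MF unfolding MF_def by (rule module_sheaf_subsheaf[OF F])
  have MF [simp]: "carrier (Mod MF U) = F U" "a \<oplus>\<^bsub>Mod MF U\<^esub> b = a \<oplus>\<^bsub>Mod M U\<^esub> b" "\<zero>\<^bsub>Mod MF U\<^esub> = \<zero>\<^bsub>Mod M U\<^esub>"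
    "f \<odot>\<^bsub>Mod MF U\<^esub> a = f \<odot>\<^bsub>Mod M U\<^esub> a" "Res MF = Res M" for U a b f
    by (simp_all add: MF_def)
  show gq: "germ_quotient X \<O> MF N (topspace X)"
  proof (intro germ_quotient.intro MF.module_sheaf_axioms germ_quotient_axioms.intro)
    fix V assume V: "openin X V"
    show "submodule (N V) (fn_ring V (\<O> V)) (Mod MF V)"
      using subsheaf_simps[OF N V] N_F[OF V] by (intro MF.submoduleI V) auto
    show "Res MF V V' s \<in> N V'" if "openin X V'" "V' \<subseteq> V" "s \<in> N V" for V' s
      using subsheafD(2)[OF N V that] by simp
    fix f s assume f: "f \<in> \<O> V" "\<And>y. y \<in> V \<inter> topspace X \<Longrightarrow> f y = 0" and s: "s \<in> carrier (Mod MF V)"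
    have "f = (\<lambda>x\<in>V. 0)"
      by (rule extensionalityI[of _ V]) (use f extensional[OF V] openin_subset[OF V] in auto)
    then show "f \<odot>\<^bsub>Mod MF V\<^esub> s \<in> N V"
      using smult_zero_left[OF V, of s] s subsheaf_simps(1)[OF F V] subsheaf_simps(2)[OF N V] by simp
  qed simp
  interpret G: germ_quotient X \<O> MF N "topspace X" by (rule gq)
  have top: "subtopology X (topspace X) = X" "\<And>U. openin X U \<Longrightarrow> U \<inter> topspace X = U"
    using openin_subset by auto
  have "module_sheaf X (restr_sheaf X \<O> (topspace X)) B"
    using G.Q.module_sheaf_axioms by (simp add: B_def)
  then have B: "module_sheaf X \<O> B"
    by (rule module_sheaf_cong[OF _ _ refl refl function_sheaf_axioms]) (simp add: restr_sheaf_topspace)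
  show "quotient_map X \<O> M B F N (germ_section X MF N (topspace X))"
  proof (intro quotient_map.intro module_sheaf_axioms B quotient_map_axioms.intro F N_F)
    fix U a assume U: "openin X U" and a: "a \<in> F U"
    note [simp] = top(2)[OF U]
    show "germ_section X MF N (topspace X) U a \<in> carrier (Mod B U)"
      using G.gsec_closed[OF U, of a] a by (simp add: B_def)
    show "germ_section X MF N (topspace X) U (a \<oplus>\<^bsub>Mod M U\<^esub> b) =
        germ_section X MF N (topspace X) U a \<oplus>\<^bsub>Mod B U\<^esub> germ_section X MF N (topspace X) U b" if "b \<in> F U" for b
      using G.gsec_add[OF U, of a b] a that by (simp add: B_def)
    show "germ_section X MF N (topspace X) U (f \<odot>\<^bsub>Mod M U\<^esub> a) =
        f \<odot>\<^bsub>Mod B U\<^esub> germ_section X MF N (topspace X) U a" if "f \<in> \<O> U" for f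
      using G.gsec_smult[OF U, of f a f] a that by (simp add: B_def)
    show "Res B U V (germ_section X MF N (topspace X) U a) = germ_section X MF N (topspace X) V (Res M U V a)"
      if V: "openin X V" "V \<subseteq> U" for V
      using G.gsec_Res[OF U V, of a] a top(2)[OF V(1)] by (simp add: B_def)
    show "germ_section X MF N (topspace X) U a = \<zero>\<^bsub>Mod B U\<^esub> \<longleftrightarrow> a \<in> N U"
    proof -
      have "(\<forall>z\<in>U. \<exists>V'. openin X V' \<and> z \<in> V' \<and> V' \<subseteq> U \<and> Res M U V' a \<in> N V') \<longleftrightarrow> a \<in> N U"
        using subsheafD(3)[OF N U subsheaf_simps(1)[OF F U a]] subsheafD(2)[OF N U U, of a] U by blast
      then show ?thesis using G.gsec_eq_zero_iff[OF U, of a] a by (simp add: B_def)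
    qed
  next
    fix U s x assume U: "openin X U" and s: "s \<in> carrier (Mod B U)" and x: "x \<in> U"
    have "openin (subtopology X (topspace X)) U" "s \<in> carrier (Mod G.Quo U)" using U s by (simp_all add: B_def)
    then obtain V a where V: "openin X V" "x \<in> V" "V \<subseteq> U" "a \<in> carrier (Mod MF V)"
      "restrict s (V \<inter> topspace X) = germ_section X MF N (topspace X) V a"
      by (rule G.gsec_exists[OF _ _ x U x]) blast
    then show "\<exists>V a. openin X V \<and> x \<in> V \<and> V \<subseteq> U \<and> a \<in> F V \<and> Res B U V s = germ_section X MF N (topspace X) V a"
      using top(2)[OF V(1)] by (intro exI[of _ V] exI[of _ a]) (simp add: B_def)
  qed
qed

section \<open>Vector fields and forms along a subset\<close>

context function_sheaf
begin

lemma vector_fieldD: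
  assumes u: "u \<in> vector_fields X \<O> U" and V: "openin X V" "V \<subseteq> U"
  shows "f \<in> \<O> V \<Longrightarrow> u V f \<in> \<O> V"
    and "u V \<in> extensional (\<O> V)"
    and "u V (\<lambda>x\<in>V. c) = (\<lambda>x\<in>V. 0)"
    and "\<lbrakk>f \<in> \<O> V; g \<in> \<O> V\<rbrakk> \<Longrightarrow> u V (\<lambda>x\<in>V. f x + g x) = (\<lambda>x\<in>V. u V f x + u V g x)"
    and "\<lbrakk>f \<in> \<O> V; g \<in> \<O> V\<rbrakk> \<Longrightarrow> u V (\<lambda>x\<in>V. f x * g x) = (\<lambda>x\<in>V. u V f x * g x + f x * u V g x)"
    and "\<lbrakk>openin X V'; V' \<subseteq> V; f \<in> \<O> V\<rbrakk> \<Longrightarrow> u V' (restrict f V') = restrict (u V f) V'"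
  using u V unfolding vector_fields_def PiE_def by auto

lemma vector_field_diff:
  assumes u: "u \<in> vector_fields X \<O> U" and V: "openin X V" "V \<subseteq> U" and fg: "f \<in> \<O> V" "g \<in> \<O> V" and x: "x \<in> V"
  shows "u V (\<lambda>x\<in>V. f x - g x) x = u V f x - u V g x"
proof -
  have d: "(\<lambda>x\<in>V. f x - g x) \<in> \<O> V" using diff V fg by simp
  have "(\<lambda>x\<in>V. (\<lambda>x\<in>V. f x - g x) x + g x) = f"
    by (rule extensionalityI[of _ V]) (use fg extensional[OF V(1)] in auto)
  then have "u V f x = u V (\<lambda>x\<in>V. f x - g x) x + u V g x"
    using vector_fieldD(4)[OF u V d fg(2)] x by simp
  then show ?thesis by simp
qed

lemma vector_field_sum:
  assumes u: "u \<in> vector_fields X \<O> U" and V: "openin X V" "V \<subseteq> U"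
    and f: "\<And>j. j < (n::nat) \<Longrightarrow> f j \<in> \<O> V" and x: "x \<in> V"
  shows "u V (\<lambda>x\<in>V. \<Sum>j<n. f j x) x = (\<Sum>j<n. u V (f j) x)"
  using f
proof (induction n)
  case 0
  show ?case using vector_fieldD(3)[OF u V, of 0] x by (simp add: restrict_def)
next
  case (Suc n)
  have s: "(\<lambda>x\<in>V. \<Sum>j<n. f j x) \<in> \<O> V" using Suc.prems by (intro sum V) auto
  have "(\<lambda>x\<in>V. \<Sum>j<Suc n. f j x) = (\<lambda>x\<in>V. (\<lambda>x\<in>V. \<Sum>j<n. f j x) x + f n x)"
    by (rule restrict_ext) simp
  then have "u V (\<lambda>x\<in>V. \<Sum>j<Suc n. f j x) x = u V (\<lambda>x\<in>V. \<Sum>j<n. f j x) x + u V (f n) x"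
    using vector_fieldD(4)[OF u V s, of "f n"] Suc.prems x by simp
  moreover have "u V (\<lambda>x\<in>V. \<Sum>j<n. f j x) x = (\<Sum>j<n. u V (f j) x)"
    by (rule Suc.IH) (use Suc.prems in auto)
  ultimately show ?case by (simp only: sum.lessThan_Suc)
qed

lemma vector_field_restrict:
  assumes u: "u \<in> vector_fields X \<O> U" and V: "openin X V" "V \<subseteq> U" "openin X V'" "V' \<subseteq> V" and f: "f \<in> \<O> V" and x: "x \<in> V'"
  shows "u V' (restrict f V') x = u V f x"
  using vector_fieldD(6)[OF u V f] x by simp

lemma vector_fieldI:
  assumes "\<And>V f. \<lbrakk>openin X V; V \<subseteq> U; f \<in> \<O> V\<rbrakk> \<Longrightarrow> u V f \<in> \<O> V"
    and "\<And>V. \<lbrakk>openin X V; V \<subseteq> U\<rbrakk> \<Longrightarrow> u V \<in> extensional (\<O> V)"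
    and "\<And>V c. \<lbrakk>openin X V; V \<subseteq> U\<rbrakk> \<Longrightarrow> u V (\<lambda>x\<in>V. c) = (\<lambda>x\<in>V. 0)"
    and "\<And>V f g. \<lbrakk>openin X V; V \<subseteq> U; f \<in> \<O> V; g \<in> \<O> V\<rbrakk> \<Longrightarrow> u V (\<lambda>x\<in>V. f x + g x) = (\<lambda>x\<in>V. u V f x + u V g x)"
    and "\<And>V f g. \<lbrakk>openin X V; V \<subseteq> U; f \<in> \<O> V; g \<in> \<O> V\<rbrakk> \<Longrightarrow>
      u V (\<lambda>x\<in>V. f x * g x) = (\<lambda>x\<in>V. u V f x * g x + f x * u V g x)"
    and "\<And>V V' f. \<lbrakk>openin X V; V \<subseteq> U; openin X V'; V' \<subseteq> V; f \<in> \<O> V\<rbrakk> \<Longrightarrow> u V' (restrict f V') = restrict (u V f) V'"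
    and "\<And>V. \<not> (openin X V \<and> V \<subseteq> U) \<Longrightarrow> u V = (\<lambda>_. undefined)"
  shows "u \<in> vector_fields X \<O> U"
  using assms unfolding vector_fields_def PiE_def by simp

lemma vector_fields_family_res:
  assumes u: "u \<in> vector_fields X \<O> U" and V: "openin X V" "V \<subseteq> U"
  shows "family_res X V u \<in> vector_fields X \<O> V"
proof (rule vector_fieldI)
  fix W assume W: "openin X W" "W \<subseteq> V"
  then have eq: "family_res X V u W = u W" by (simp add: family_res_def)
  note D = vector_fieldD[OF u W(1) subset_trans[OF W(2) V(2)]]
  show "family_res X V u W \<in> extensional (\<O> W)" using D(2) by (simp only: eq)
  show "family_res X V u W (\<lambda>x\<in>W. c) = (\<lambda>x\<in>W. 0)" for c using D(3) by (simp only: eq)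
  fix f assume f: "f \<in> \<O> W"
  show "family_res X V u W f \<in> \<O> W" using D(1)[OF f] by (simp only: eq)
  show "family_res X V u W' (restrict f W') = restrict (family_res X V u W f) W'" if W': "openin X W'" "W' \<subseteq> W" for W'
  proof -
    have "family_res X V u W' = u W'" using W W' by (auto simp: family_res_def)
    then show ?thesis using D(6)[OF W' f] by (simp only: eq)
  qed
  fix g assume g: "g \<in> \<O> W"
  show "family_res X V u W (\<lambda>x\<in>W. f x + g x) = (\<lambda>x\<in>W. family_res X V u W f x + family_res X V u W g x)"
    using D(4)[OF f g] by (simp only: eq)
  show "family_res X V u W (\<lambda>x\<in>W. f x * g x) = (\<lambda>x\<in>W. family_res X V u W f x * g x + f x * family_res X V u W g x)"
    using D(5)[OF f g] by (simp only: eq)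
qed (auto simp: family_res_def)

lemma lie_bracket_vector_field:
  assumes u: "u \<in> vector_fields X \<O> U" and w: "w \<in> vector_fields X \<O> V" and V: "openin X V" "V \<subseteq> U"
  shows "lie_bracket X \<O> V u w \<in> vector_fields X \<O> V"
proof (rule vector_fieldI)
  fix W assume W: "openin X W" "W \<subseteq> V"
  then have WU: "W \<subseteq> U" using V by auto
  note uD = vector_fieldD[OF u W(1) WU] and wD = vector_fieldD[OF w W]
  have br: "lie_bracket X \<O> V u w W f = (\<lambda>x\<in>W. u W (w W f) x - w W (u W f) x)" if "f \<in> \<O> W" for f
    using W that by (simp add: lie_bracket_def family_def)
  show "lie_bracket X \<O> V u w W \<in> extensional (\<O> W)"
    using W by (simp add: lie_bracket_def family_def)
  show "lie_bracket X \<O> V u w W (\<lambda>x\<in>W. c) = (\<lambda>x\<in>W. 0)" for c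
    using br[OF const[OF W(1)]] wD(3)[of 0] uD(3)[of 0] wD(3)[of c] uD(3)[of c] by (simp add: restrict_def cong: if_cong)
  fix f assume f: "f \<in> \<O> W"
  show "lie_bracket X \<O> V u w W f \<in> \<O> W"
    using br[OF f] diff[OF W(1)] uD(1) wD(1) f by simp
  show "lie_bracket X \<O> V u w W' (restrict f W') = restrict (lie_bracket X \<O> V u w W f) W'"
    if W': "openin X W'" "W' \<subseteq> W" for W'
  proof (rule extensionalityI[of _ W'])
    have f': "restrict f W' \<in> \<O> W'" using restr[OF W(1) W' f] .
    have br': "lie_bracket X \<O> V u w W' (restrict f W') = (\<lambda>x\<in>W'. u W' (w W' (restrict f W')) x - w W' (u W' (restrict f W')) x)"
      using W W' f' subset_trans[OF W'(2) W(2)] by (simp add: lie_bracket_def family_def)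
    then show "lie_bracket X \<O> V u w W' (restrict f W') \<in> extensional W'" by simp
    fix x assume "x \<in> W'"
    then show "lie_bracket X \<O> V u w W' (restrict f W') x = restrict (lie_bracket X \<O> V u w W f) W' x"
      using br' br[OF f] uD(6)[OF W'] wD(6)[OF W'] uD(1) wD(1) f W' by auto
  qed simp
  fix g assume g: "g \<in> \<O> W"
  show "lie_bracket X \<O> V u w W (\<lambda>x\<in>W. f x + g x) =
      (\<lambda>x\<in>W. lie_bracket X \<O> V u w W f x + lie_bracket X \<O> V u w W g x)"
    using br[OF add[OF W(1) f g]] br[OF f] br[OF g] uD(4)[OF f g] wD(4)[OF f g] uD(4)[OF wD(1) wD(1), OF f g] wD(4)[OF uD(1) uD(1), OF f g]
    by (auto intro!: restrict_ext)
  show "lie_bracket X \<O> V u w W (\<lambda>x\<in>W. f x * g x) =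
      (\<lambda>x\<in>W. lie_bracket X \<O> V u w W f x * g x + f x * lie_bracket X \<O> V u w W g x)"
  proof (rule extensionalityI[of _ W])
    fix x assume x: "x \<in> W"
    have uw: "u W (w W (\<lambda>x\<in>W. f x * g x)) x = (u W (w W f) x * g x + w W f x * u W g x) + (u W f x * w W g x + f x * u W (w W g) x)"
    proof -
      have "u W (\<lambda>x\<in>W. (\<lambda>x\<in>W. w W f x * g x) x + (\<lambda>x\<in>W. f x * w W g x) x) x =
          u W (\<lambda>x\<in>W. w W f x * g x) x + u W (\<lambda>x\<in>W. f x * w W g x) x"
        using uD(4)[OF mult[OF W(1) wD(1)[OF f] g] mult[OF W(1) f wD(1)[OF g]]] x by simp
      moreover have "(\<lambda>x\<in>W. (\<lambda>x\<in>W. w W f x * g x) x + (\<lambda>x\<in>W. f x * w W g x) x) = w W (\<lambda>x\<in>W. f x * g x)"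
        using wD(5)[OF f g] by (auto intro!: restrict_ext)
      ultimately show ?thesis using uD(5)[OF wD(1)[OF f] g] uD(5)[OF f wD(1)[OF g]] x by simp
    qed
    have wu: "w W (u W (\<lambda>x\<in>W. f x * g x)) x = (w W (u W f) x * g x + u W f x * w W g x) + (w W f x * u W g x + f x * w W (u W g) x)"
    proof -
      have "w W (\<lambda>x\<in>W. (\<lambda>x\<in>W. u W f x * g x) x + (\<lambda>x\<in>W. f x * u W g x) x) x =
          w W (\<lambda>x\<in>W. u W f x * g x) x + w W (\<lambda>x\<in>W. f x * u W g x) x"
        using wD(4)[OF mult[OF W(1) uD(1)[OF f] g] mult[OF W(1) f uD(1)[OF g]]] x by simp
      moreover have "(\<lambda>x\<in>W. (\<lambda>x\<in>W. u W f x * g x) x + (\<lambda>x\<in>W. f x * u W g x) x) = u W (\<lambda>x\<in>W. f x * g x)"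
        using uD(5)[OF f g] by (auto intro!: restrict_ext)
      ultimately show ?thesis using wD(5)[OF uD(1)[OF f] g] wD(5)[OF f uD(1)[OF g]] x by simp
    qed
    show "lie_bracket X \<O> V u w W (\<lambda>x\<in>W. f x * g x) x =
        (\<lambda>x\<in>W. lie_bracket X \<O> V u w W f x * g x + f x * lie_bracket X \<O> V u w W g x) x"
      using br[OF mult[OF W(1) f g]] br[OF f] br[OF g] x uw wu by (simp add: algebra_simps)
  qed (use br[OF mult[OF W(1) f g]] in simp_all)
qed (auto simp: lie_bracket_def family_def)

text \<open>Cartan's formula for \<open>L\<^sub>u (\<Sum>j. g j \<cdot> d (f j))\<close>: it is \<open>\<Sum>j. u (g j) \<cdot> d (f j) + g j \<cdot> d (u (f j))\<close>, because the second
  derivatives \<open>u (w (f j))\<close> cancel. It is used both on the ambient space and on \<open>Z\<close>.\<close>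

lemma lie_derivative_comb:
  assumes u: "u \<in> vector_fields X \<O> U" and w: "w \<in> vector_fields X \<O> V" and V: "openin X V" "V \<subseteq> U"
    and gf: "\<And>j. j < (n::nat) \<Longrightarrow> g j \<in> \<O> V" "\<And>j. j < n \<Longrightarrow> f j \<in> \<O> V" and x: "x \<in> V"
  shows "u V (\<lambda>x\<in>V. \<Sum>j<n. g j x * w V (f j) x) x - (\<Sum>j<n. g j x * lie_bracket X \<O> V u w V (f j) x) =
    (\<Sum>j<n. u V (g j) x * w V (f j) x) + (\<Sum>j<n. g j x * w V (u V (f j)) x)"
proof -
  have P: "(\<lambda>x\<in>V. g j x * w V (f j) x) \<in> \<O> V" if "j < n" for j
    using mult[OF V(1) gf(1)[OF that]] vector_fieldD(1)[OF w V(1) subset_refl gf(2)[OF that]] .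
  have "(\<lambda>x\<in>V. \<Sum>j<n. g j x * w V (f j) x) = (\<lambda>x\<in>V. \<Sum>j<n. (\<lambda>x\<in>V. g j x * w V (f j) x) x)"
    by (rule restrict_ext) simp
  then have "u V (\<lambda>x\<in>V. \<Sum>j<n. g j x * w V (f j) x) x = (\<Sum>j<n. u V (\<lambda>x\<in>V. g j x * w V (f j) x) x)"
    using vector_field_sum[OF u V P x] by simp
  also have "\<dots> = (\<Sum>j<n. u V (g j) x * w V (f j) x + g j x * u V (w V (f j)) x)"
  proof (rule sum.cong[OF refl])
    fix j assume "j \<in> {..<n}"
    then have j: "j < n" by simp
    show "u V (\<lambda>x\<in>V. g j x * w V (f j) x) x = u V (g j) x * w V (f j) x + g j x * u V (w V (f j)) x"
      using vector_fieldD(5)[OF u V gf(1)[OF j] vector_fieldD(1)[OF w V(1) subset_refl gf(2)[OF j]]] x by simp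
  qed
  moreover have "(\<Sum>j<n. g j x * lie_bracket X \<O> V u w V (f j) x) =
      (\<Sum>j<n. g j x * (u V (w V (f j)) x - w V (u V (f j)) x))"
    using x V gf(2) by (intro sum.cong refl) (simp add: lie_bracket_def family_def)
  ultimately show ?thesis by (simp add: sum_subtractf sum.distrib algebra_simps)
qed

text \<open>Tangency to \<open>Z\<close> in terms of functions only: the ideal of functions vanishing on \<open>Z\<close> is preserved.\<close>

definition tangent_field :: "'x set \<Rightarrow> 'x set \<Rightarrow> 'x vfield \<Rightarrow> bool" where
  "tangent_field Z V u \<longleftrightarrow> (\<forall>V' h. openin X V' \<and> V' \<subseteq> V \<and> h \<in> \<O> V' \<and> (\<forall>y\<in>V' \<inter> Z. h y = 0) \<longrightarrow>
     (\<forall>y\<in>V' \<inter> Z. u V' h y = 0))"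

lemma field_restricts_toD:
  assumes "field_restricts_to X \<O> Z V u v" "openin X V'" "V' \<subseteq> V" "f \<in> \<O> V'" "y \<in> V' \<inter> Z"
  shows "v (V' \<inter> Z) (restrict f (V' \<inter> Z)) y = u V' f y"
  using assms unfolding field_restricts_to_def by (metis restrict_apply')

lemma tangent_field_if_restricts:
  assumes v: "v \<in> vector_fields (subtopology X Z) (restr_sheaf X \<O> Z) (V \<inter> Z)" and res: "field_restricts_to X \<O> Z V u v"
  shows "tangent_field Z V u"
  unfolding tangent_field_def
proof (intro allI impI ballI)
  interpret Z: function_sheaf "subtopology X Z" "restr_sheaf X \<O> Z" by (rule function_sheaf_restr_sheaf)
  fix V' h y assume V': "openin X V' \<and> V' \<subseteq> V \<and> h \<in> \<O> V' \<and> (\<forall>y\<in>V' \<inter> Z. h y = 0)" and y: "y \<in> V' \<inter> Z"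
  have "restrict h (V' \<inter> Z) = (\<lambda>x\<in>V' \<inter> Z. 0)" using V' by (intro restrict_ext) auto
  moreover have "openin (subtopology X Z) (V' \<inter> Z)" "V' \<inter> Z \<subseteq> V \<inter> Z" using V' by (auto simp: openin_subtopology)
  ultimately show "u V' h y = 0"
    using field_restricts_toD[OF res, of V' h y] Z.vector_fieldD(3)[OF v, of "V' \<inter> Z" 0] V' y by simp
qed

text \<open>The value at \<open>z\<close> of the restricted field on a function \<open>f\<close> on \<open>Z\<close> is \<open>u(g)(z)\<close> for any local extension \<open>g\<close> of \<open>f\<close>.
  Two extensions differ by a function vanishing on \<open>Z\<close>, which \<open>u\<close> maps to a function vanishing on \<open>Z\<close>.\<close>

lemma tangent_field_restricts:
  assumes u: "u \<in> vector_fields X \<O> V" and V: "openin X V" and tan: "tangent_field Z V u"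
  obtains v where "v \<in> vector_fields (subtopology X Z) (restr_sheaf X \<O> Z) (V \<inter> Z)" "field_restricts_to X \<O> Z V u v"
proof -
  let ?Y = "subtopology X Z" and ?O = "restr_sheaf X \<O> Z"
  interpret Z: function_sheaf ?Y ?O by (rule function_sheaf_restr_sheaf)
  define lifts where "lifts W f z V' g \<longleftrightarrow> openin X V' \<and> z \<in> V' \<and> V' \<subseteq> V \<and> V' \<inter> Z \<subseteq> W \<and> g \<in> \<O> V' \<and> (\<forall>y\<in>V' \<inter> Z. g y = f y)"
    for W f z V' g
  define D where "D W f z = (let (V', g) = SOME (V', g). lifts W f z V' g in u V' g z)" for W f z
  \<comment> \<open>The difference of two extensions vanishes on \<open>Z\<close>.\<close>
  have well: "u V1 g1 z = u V2 g2 z" if l: "lifts W f z V1 g1" "lifts W f z V2 g2" and z: "z \<in> Z" for W f z V1 g1 V2 g2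
  proof -
    define T where "T = V1 \<inter> V2"
    have T: "openin X T" "z \<in> T" "T \<subseteq> V1" "T \<subseteq> V2" "T \<subseteq> V" using l by (auto simp: T_def lifts_def)
    define h1 h2 where "h1 = restrict g1 T" and "h2 = restrict g2 T"
    have h: "h1 \<in> \<O> T" "h2 \<in> \<O> T" using l T restr by (auto simp: h1_def h2_def lifts_def)
    have "(\<lambda>x\<in>T. h1 x - h2 x) \<in> \<O> T" using diff[OF T(1) h] .
    moreover have "\<forall>y\<in>T \<inter> Z. (\<lambda>x\<in>T. h1 x - h2 x) y = 0" using l by (auto simp: h1_def h2_def lifts_def T_def)
    ultimately have "u T (\<lambda>x\<in>T. h1 x - h2 x) z = 0" using tan T z unfolding tangent_field_def by blast
    then have "u T h1 z = u T h2 z" using vector_field_diff[OF u T(1,5) h T(2)] by simp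
    then show ?thesis
      using vector_field_restrict[OF u, of V1 T g1 z] vector_field_restrict[OF u, of V2 T g2 z] l T
      by (auto simp: h1_def h2_def lifts_def)
  qed
  have D: "D W f z = u V' g z" if l: "lifts W f z V' g" and z: "z \<in> Z" for W f z V' g
  proof -
    have "case (SOME (V', g). lifts W f z V' g) of (V', g) \<Rightarrow> lifts W f z V' g"
      by (rule someI[of "\<lambda>(V', g). lifts W f z V' g" "(V', g)"]) (use l in simp)
    then show ?thesis using well[OF _ l z] unfolding D_def by (auto split: prod.splits)
  qed
  have lift_ex: "\<exists>V' g. lifts W f z V' g" if f: "f \<in> ?O W" and z: "z \<in> W" and W: "W \<subseteq> V \<inter> Z" for W f z
  proof -
    have "z \<in> V" using z W by auto
    then obtain V' g where "openin X V'" "z \<in> V'" "V' \<subseteq> V" "V' \<inter> Z \<subseteq> W" "g \<in> \<O> V'" "\<And>y. y \<in> V' \<inter> Z \<Longrightarrow> g y = f y"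
      by (rule restr_sheaf_lift_within[OF f z V]) blast
    then have "lifts W f z V' g" by (simp add: lifts_def)
    then show ?thesis by blast
  qed
  have lift_ex2: "\<exists>V' g1 g2. lifts W f1 z V' g1 \<and> lifts W f2 z V' g2"
    if f: "f1 \<in> ?O W" "f2 \<in> ?O W" and z: "z \<in> W" and W: "W \<subseteq> V \<inter> Z" for W f1 f2 z
  proof -
    obtain V1 g1 where 1: "lifts W f1 z V1 g1" using lift_ex[OF f(1) z W] by blast
    then have "openin X V1" "z \<in> V1" by (auto simp: lifts_def)
    then obtain V2 g2 where 2: "openin X V2" "z \<in> V2" "V2 \<subseteq> V1" "V2 \<inter> Z \<subseteq> W" "g2 \<in> \<O> V2" "\<And>y. y \<in> V2 \<inter> Z \<Longrightarrow> g2 y = f2 y"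
      by (rule restr_sheaf_lift_within[OF f(2) z]) blast
    have "lifts W f1 z V2 (restrict g1 V2)" "lifts W f2 z V2 g2"
      using 1 2 restr[of V1 V2 g1] by (auto simp: lifts_def)
    then show ?thesis by blast
  qed
  define v where "v = family ?Y (V \<inter> Z) ?O D"
  have v: "v W f = restrict (D W f) W" if "openin ?Y W" "W \<subseteq> V \<inter> Z" "f \<in> ?O W" for W f
    using that by (simp add: v_def family_def)
  have "v \<in> vector_fields ?Y ?O (V \<inter> Z)"
  proof (rule Z.vector_fieldI)
    fix W assume W: "openin ?Y W" "W \<subseteq> V \<inter> Z"
    show "v W \<in> extensional (?O W)" using W by (simp add: v_def family_def)
    show "v W (\<lambda>x\<in>W. c) = (\<lambda>x\<in>W. 0)" for c
    proof -
      have "D W (\<lambda>x\<in>W. c) z = 0" if z: "z \<in> W" for z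
      proof -
        obtain U where U: "openin X U" "W = U \<inter> Z" using W(1) by (auto simp: openin_subtopology)
        have T: "openin X (U \<inter> V)" "U \<inter> V \<subseteq> V" using U V by auto
        have "lifts W (\<lambda>x\<in>W. c) z (U \<inter> V) (\<lambda>x\<in>U \<inter> V. c)"
          using U V z W(2) const[OF T(1)] by (auto simp: lifts_def)
        then have "D W (\<lambda>x\<in>W. c) z = u (U \<inter> V) (\<lambda>x\<in>U \<inter> V. c) z" by (rule D) (use z W in auto)
        then show ?thesis using vector_fieldD(3)[OF u T] U(2) z W(2) by auto
      qed
      then show ?thesis using v[OF W Z.const[OF W(1)]] by (auto intro!: restrict_ext)
    qed
    fix f assume f: "f \<in> ?O W"
    show "v W f \<in> ?O W"
    proof (rule restr_sheafI)
      fix z assume z: "z \<in> W"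
      obtain V' g where l: "lifts W f z V' g" using lift_ex[OF f z W(2)] by blast
      then have V': "openin X V'" "z \<in> V'" "V' \<subseteq> V" "V' \<inter> Z \<subseteq> W" "g \<in> \<O> V'" by (auto simp: lifts_def)
      have "u V' g y = v W f y" if y: "y \<in> V' \<inter> Z" for y
      proof -
        have "lifts W f y V' g" using l y by (auto simp: lifts_def)
        then show ?thesis using D[of W f y V' g] y V'(4) v[OF W f] by auto
      qed
      then show "\<exists>V' h. openin X V' \<and> z \<in> V' \<and> V' \<inter> Z \<subseteq> W \<and> h \<in> \<O> V' \<and> (\<forall>y\<in>V' \<inter> Z. h y = v W f y)"
        using V' vector_fieldD(1)[OF u V'(1,3,5)] by blast
    qed (use v[OF W f] in simp)
    show "v W' (restrict f W') = restrict (v W f) W'" if W': "openin ?Y W'" "W' \<subseteq> W" for W'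
    proof (rule extensionalityI[of _ W'])
      have f': "restrict f W' \<in> ?O W'" using Z.restr[OF W(1) W' f] .
      have W'V: "W' \<subseteq> V \<inter> Z" using W W' by auto
      show "v W' (restrict f W') \<in> extensional W'" using v[OF W'(1) W'V f'] by simp
      fix z assume z: "z \<in> W'"
      obtain V' g where l: "lifts W' (restrict f W') z V' g" using lift_ex[OF f' z W'V] by blast
      then have l': "lifts W f z V' g" using W'(2) by (auto simp: lifts_def)
      show "v W' (restrict f W') z = restrict (v W f) W' z"
        using D[OF l] D[OF l'] v[OF W'(1) W'V f'] v[OF W f] z W' W'V by auto
    qed simp
    fix g assume g: "g \<in> ?O W"
    have at: "D W (\<lambda>x\<in>W. f x + g x) z = D W f z + D W g z \<and> D W (\<lambda>x\<in>W. f x * g x) z = D W f z * g z + f z * D W g z"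
      if z: "z \<in> W" for z
    proof -
      obtain V' f' g' where l: "lifts W f z V' f'" "lifts W g z V' g'" using lift_ex2[OF f g z W(2)] by blast
      then have V': "openin X V'" "z \<in> V'" "V' \<subseteq> V" "V' \<inter> Z \<subseteq> W" and fg: "f' \<in> \<O> V'" "g' \<in> \<O> V'" by (auto simp: lifts_def)
      have zZ: "z \<in> Z" using z W by auto
      have val: "f' z = f z" "g' z = g z" using l V' zZ by (auto simp: lifts_def)
      have la: "lifts W (\<lambda>x\<in>W. f x + g x) z V' (\<lambda>x\<in>V'. f' x + g' x)"
        using l add[OF V'(1) fg] by (auto simp: lifts_def)
      have lm: "lifts W (\<lambda>x\<in>W. f x * g x) z V' (\<lambda>x\<in>V'. f' x * g' x)"
        using l mult[OF V'(1) fg] by (auto simp: lifts_def)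
      show ?thesis
        using D[OF la zZ] D[OF lm zZ] D[OF l(1) zZ] D[OF l(2) zZ] val V'(2)
          vector_fieldD(4)[OF u V'(1,3) fg] vector_fieldD(5)[OF u V'(1,3) fg] by simp
    qed
    show "v W (\<lambda>x\<in>W. f x + g x) = (\<lambda>x\<in>W. v W f x + v W g x)"
      using at v[OF W Z.add[OF W(1) f g]] v[OF W f] v[OF W g] by (auto intro!: restrict_ext)
    show "v W (\<lambda>x\<in>W. f x * g x) = (\<lambda>x\<in>W. v W f x * g x + f x * v W g x)"
      using at v[OF W Z.mult[OF W(1) f g]] v[OF W f] v[OF W g] by (auto intro!: restrict_ext)
  next
    fix W assume "\<not> (openin ?Y W \<and> W \<subseteq> V \<inter> Z)"
    then show "v W = (\<lambda>_. undefined)" by (auto simp: v_def family_def)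
  qed
  moreover have "field_restricts_to X \<O> Z V u v"
    unfolding field_restricts_to_def
  proof (intro allI impI)
    fix V' f assume V': "openin X V' \<and> V' \<subseteq> V \<and> f \<in> \<O> V'"
    then have W: "openin ?Y (V' \<inter> Z)" "V' \<inter> Z \<subseteq> V \<inter> Z" by (auto simp: openin_subtopology)
    have f: "restrict f (V' \<inter> Z) \<in> ?O (V' \<inter> Z)" using restrict_in_restr_sheaf[of V' f Z "V' \<inter> Z"] V' W by auto
    have "D (V' \<inter> Z) (restrict f (V' \<inter> Z)) z = u V' f z" if "z \<in> V' \<inter> Z" for z
      by (rule D) (use that V' in \<open>auto simp: lifts_def\<close>)
    then show "restrict (u V' f) (V' \<inter> Z) = v (V' \<inter> Z) (restrict f (V' \<inter> Z))"
      using v[OF W f] by (auto intro!: restrict_ext)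
  qed
  ultimately show ?thesis by (rule that)
qed

lemma lin_comb_apply:
  assumes "openin X V" "V \<subseteq> U" "w \<in> vector_fields X \<O> V"
  shows "lin_comb X \<O> U n g f V w = (\<lambda>x\<in>V. \<Sum>j<n. g j x * w V (restrict (f j) V) x)"
  using assms by (simp add: lin_comb_def family_def)

lemma family_res_family:
  "V \<subseteq> U \<Longrightarrow> family_res X V (family X U D h) = family X V D h"
  by (auto simp: family_res_def family_def fun_eq_iff)

lemma family_eqI:
  assumes "\<And>V a x. \<lbrakk>openin X V; V \<subseteq> U; a \<in> D V; x \<in> V\<rbrakk> \<Longrightarrow> h V a x = h' V a x"
  shows "family X U D h = family X U D h'"
  using assms by (fastforce simp: family_def fun_eq_iff restrict_def)

lemma family_eqD:
  assumes "family X U D h = family X U D h'" "openin X V" "V \<subseteq> U" "a \<in> D V" "x \<in> V"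
  shows "h V a x = h' V a x"
proof -
  have "family X U D h V a x = family X U D h' V a x" using assms(1) by simp
  then show ?thesis using assms(2-) by (simp add: family_def)
qed

text \<open>Every form is locally of this kind, so that forms are handled through such combinations.\<close>

lemma lin_comb_one_form:
  assumes U: "openin X U" and g: "\<And>j. j < n \<Longrightarrow> g j \<in> \<O> U" and f: "\<And>j. j < n \<Longrightarrow> f j \<in> \<O> U"
  shows "lin_comb X \<O> U n g f \<in> one_forms X \<O> U"
  unfolding one_forms_def
proof (intro CollectI conjI allI impI ballI)
  fix V assume V: "openin X V \<and> V \<subseteq> U"
  have gV: "restrict (g j) V \<in> \<O> V" and fV: "restrict (f j) V \<in> \<O> V" if "j < n" for j
    using restr[OF U, of V] V that f g by auto
  show "lin_comb X \<O> U n g f V \<in> vector_fields X \<O> V \<rightarrow>\<^sub>E \<O> V"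
  proof (rule PiE_I)
    fix w assume w: "w \<in> vector_fields X \<O> V"
    have "(\<lambda>x\<in>V. restrict (g j) V x * w V (restrict (f j) V) x) \<in> \<O> V" if j: "j < n" for j
      by (rule mult[OF _ gV[OF j] vector_fieldD(1)[OF w _ _ fV[OF j]]]) (use V in auto)
    then have "(\<lambda>x\<in>V. \<Sum>j<n. (\<lambda>x\<in>V. restrict (g j) V x * w V (restrict (f j) V) x) x) \<in> \<O> V"
      by (rule sum[OF conjunct1[OF V]])
    moreover have "(\<lambda>x\<in>V. \<Sum>j<n. (\<lambda>x\<in>V. restrict (g j) V x * w V (restrict (f j) V) x) x) = lin_comb X \<O> U n g f V w"
      using lin_comb_apply[of V U w n g f] V w by (auto intro!: restrict_ext)
    ultimately show "lin_comb X \<O> U n g f V w \<in> \<O> V" by simp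
  qed (use V in \<open>simp add: lin_comb_def family_def\<close>)
  fix V' w assume w: "openin X V' \<and> V' \<subseteq> V \<and> w \<in> vector_fields X \<O> V"
  have "family_res X V' w \<in> vector_fields X \<O> V'" using w V by (intro vector_fields_family_res[of w V]) auto
  moreover have "family_res X V' w V' (restrict (f j) V') = restrict (w V (restrict (f j) V)) V'" if "j < n" for j
    using vector_fieldD(6)[of w V V V' "restrict (f j) V"] w V fV[OF that] by (auto simp: family_res_def Int_absorb1)
  ultimately show "lin_comb X \<O> U n g f V' (family_res X V' w) = restrict (lin_comb X \<O> U n g f V w) V'"
    using lin_comb_apply[of V' U "family_res X V' w" n g f] lin_comb_apply[of V U w n g f] V w
    by (auto simp: restrict_def fun_eq_iff intro!: sum.cong)
next
  fix V assume "\<not> (openin X V \<and> V \<subseteq> U)"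
  then show "lin_comb X \<O> U n g f V = (\<lambda>_. undefined)" by (auto simp: lin_comb_def family_def)
next
  fix x assume "x \<in> U"
  then show "\<exists>V n' g' f'. openin X V \<and> x \<in> V \<and> V \<subseteq> U \<and> (\<forall>j<n'. g' j \<in> \<O> V \<and> f' j \<in> \<O> V) \<and>
      family_res X V (lin_comb X \<O> U n g f) = lin_comb X \<O> V n' g' f'"
    using U g f by (intro exI[of _ U] exI[of _ n] exI[of _ g] exI[of _ f]) (auto simp: lin_comb_def family_res_family)
qed

lemma lin_comb_restrict:
  assumes "openin X V" "V \<subseteq> U"
  shows "family_res X V (lin_comb X \<O> U n g f) = lin_comb X \<O> V n (\<lambda>j. restrict (g j) V) (\<lambda>j. restrict (f j) V)"
  unfolding lin_comb_def family_res_family[OF assms(2)]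
proof (rule family_eqI)
  fix V' a x assume "V' \<subseteq> V" "x \<in> V'"
  then show "(\<Sum>j<n. g j x * a V' (restrict (f j) V') x) =
      (\<Sum>j<n. restrict (g j) V x * a V' (restrict (restrict (f j) V) V') x)"
    by (intro sum.cong refl) (simp add: Int_absorb1 subsetD)
qed

end

section \<open>Multiples of the ideal of a subset\<close>

context module_sheaf
begin

lemma ideal_multiples_zero: "\<zero>\<^bsub>Mod M V\<^esub> \<in> ideal_multiples \<O> M Z V" if V: "openin X V"
proof -
  interpret V: abelian_group "Mod M V" using sections_abelian_group[OF V] .
  show ?thesis unfolding ideal_multiples_def by (intro CollectI exI[of _ 0]) simp
qed

lemma finsum_Suc_smult:
  assumes V: "openin X V" and fs: "\<And>j. j < Suc n \<Longrightarrow> f j \<in> \<O> V \<and> s j \<in> carrier (Mod M V)"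
  shows "(\<Oplus>\<^bsub>Mod M V\<^esub>j\<in>{..<Suc n}. f j \<odot>\<^bsub>Mod M V\<^esub> s j) =
    (\<Oplus>\<^bsub>Mod M V\<^esub>j\<in>{..<n}. f j \<odot>\<^bsub>Mod M V\<^esub> s j) \<oplus>\<^bsub>Mod M V\<^esub> f n \<odot>\<^bsub>Mod M V\<^esub> s n"
    and "(\<Oplus>\<^bsub>Mod M V\<^esub>j\<in>{..<n}. f j \<odot>\<^bsub>Mod M V\<^esub> s j) \<in> carrier (Mod M V)"
proof -
  interpret V: abelian_group "Mod M V" using sections_abelian_group[OF V] .
  have c: "(\<lambda>j. f j \<odot>\<^bsub>Mod M V\<^esub> s j) \<in> {..<n} \<rightarrow> carrier (Mod M V)" using fs V by auto
  then show c': "(\<Oplus>\<^bsub>Mod M V\<^esub>j\<in>{..<n}. f j \<odot>\<^bsub>Mod M V\<^esub> s j) \<in> carrier (Mod M V)" by (rule V.finsum_closed)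
  have "f n \<odot>\<^bsub>Mod M V\<^esub> s n \<in> carrier (Mod M V)" using fs[of n] V by auto
  then show "(\<Oplus>\<^bsub>Mod M V\<^esub>j\<in>{..<Suc n}. f j \<odot>\<^bsub>Mod M V\<^esub> s j) =
    (\<Oplus>\<^bsub>Mod M V\<^esub>j\<in>{..<n}. f j \<odot>\<^bsub>Mod M V\<^esub> s j) \<oplus>\<^bsub>Mod M V\<^esub> f n \<odot>\<^bsub>Mod M V\<^esub> s n"
    using c c' by (simp add: lessThan_Suc V.finsum_insert V.a_comm)
qed

lemma ideal_multiples_add_one:
  assumes V: "openin X V" and x: "x \<in> ideal_multiples \<O> M Z V"
    and f: "f \<in> \<O> V" "\<And>y. y \<in> V \<inter> Z \<Longrightarrow> f y = 0" and s: "s \<in> carrier (Mod M V)"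
  shows "x \<oplus>\<^bsub>Mod M V\<^esub> f \<odot>\<^bsub>Mod M V\<^esub> s \<in> ideal_multiples \<O> M Z V"
proof -
  interpret V: abelian_group "Mod M V" using sections_abelian_group[OF V] .
  obtain n g t where x_eq: "x = (\<Oplus>\<^bsub>Mod M V\<^esub>j\<in>{..<n::nat}. g j \<odot>\<^bsub>Mod M V\<^esub> t j)"
    and gt: "\<And>j. j < n \<Longrightarrow> g j \<in> \<O> V \<and> (\<forall>y\<in>V \<inter> Z. g j y = 0) \<and> t j \<in> carrier (Mod M V)"
    using x unfolding ideal_multiples_def by blast
  define g' t' where "g' = g(n := f)" and "t' = t(n := s)"
  have g't': "g' j \<in> \<O> V \<and> (\<forall>y\<in>V \<inter> Z. g' j y = 0) \<and> t' j \<in> carrier (Mod M V)" if "j < Suc n" for j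
    using that gt f s by (cases "j = n") (auto simp: g'_def t'_def)
  have "(\<Oplus>\<^bsub>Mod M V\<^esub>j\<in>{..<n}. g' j \<odot>\<^bsub>Mod M V\<^esub> t' j) = x"
    unfolding x_eq by (rule V.finsum_cong') (use gt V in \<open>auto simp: g'_def t'_def\<close>)
  then have "x \<oplus>\<^bsub>Mod M V\<^esub> f \<odot>\<^bsub>Mod M V\<^esub> s = (\<Oplus>\<^bsub>Mod M V\<^esub>j\<in>{..<Suc n}. g' j \<odot>\<^bsub>Mod M V\<^esub> t' j)"
    using finsum_Suc_smult(1)[OF V, of n g' t'] g't' by (simp add: g'_def t'_def)
  then show ?thesis unfolding ideal_multiples_def using g't' by blast
qed

text \<open>The multiples of the ideal are finite sums; statements about them are reduced to one summand at a time.\<close>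

lemma ideal_multiples_induct [consumes 2, case_names zero add]:
  assumes V: "openin X V" and x: "x \<in> ideal_multiples \<O> M Z V"
    and zero: "P \<zero>\<^bsub>Mod M V\<^esub>"
    and step: "\<And>x f s. \<lbrakk>x \<in> carrier (Mod M V); P x; f \<in> \<O> V; \<And>y. y \<in> V \<inter> Z \<Longrightarrow> f y = 0; s \<in> carrier (Mod M V)\<rbrakk>
      \<Longrightarrow> P (x \<oplus>\<^bsub>Mod M V\<^esub> f \<odot>\<^bsub>Mod M V\<^esub> s)"
  shows "P x"
proof -
  interpret V: abelian_group "Mod M V" using sections_abelian_group[OF V] .
  obtain n f s where x_eq: "x = (\<Oplus>\<^bsub>Mod M V\<^esub>j\<in>{..<n::nat}. f j \<odot>\<^bsub>Mod M V\<^esub> s j)"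
    and fs: "\<And>j. j < n \<Longrightarrow> f j \<in> \<O> V \<and> (\<forall>y\<in>V \<inter> Z. f j y = 0) \<and> s j \<in> carrier (Mod M V)"
    using x unfolding ideal_multiples_def by blast
  have "P (\<Oplus>\<^bsub>Mod M V\<^esub>j\<in>{..<n}. f j \<odot>\<^bsub>Mod M V\<^esub> s j)"
    using fs
  proof (induction n)
    case 0
    then show ?case using zero by simp
  next
    case (Suc n)
    have "P ((\<Oplus>\<^bsub>Mod M V\<^esub>j\<in>{..<n}. f j \<odot>\<^bsub>Mod M V\<^esub> s j) \<oplus>\<^bsub>Mod M V\<^esub> f n \<odot>\<^bsub>Mod M V\<^esub> s n)"
    proof (rule step)
      show "(\<Oplus>\<^bsub>Mod M V\<^esub>j\<in>{..<n}. f j \<odot>\<^bsub>Mod M V\<^esub> s j) \<in> carrier (Mod M V)"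
        using finsum_Suc_smult(2)[OF V, of n f s] Suc.prems by blast
    qed (use Suc in auto)
    then show ?case using finsum_Suc_smult(1)[OF V, of n f s] Suc.prems by simp
  qed
  then show ?thesis using x_eq by simp
qed

lemma germ_quotient_ideal_multiples:
  assumes Z: "Z \<subseteq> topspace X"
  shows "germ_quotient X \<O> M (ideal_multiples \<O> M Z) Z"
proof (intro germ_quotient.intro module_sheaf_axioms germ_quotient_axioms.intro Z)
  let ?I = "ideal_multiples \<O> M Z"
  have zero_left: "\<zero>\<^bsub>Mod M V\<^esub> \<oplus>\<^bsub>Mod M V\<^esub> s = s" if "openin X V" "s \<in> carrier (Mod M V)" for V s
    using that abelian_monoid.l_zero[OF abelian_group.axioms(1)[OF sections_abelian_group]] by blast
  have gen: "f \<odot>\<^bsub>Mod M V\<^esub> s \<in> ?I V"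
    if "openin X V" "f \<in> \<O> V" "\<And>y. y \<in> V \<inter> Z \<Longrightarrow> f y = 0" "s \<in> carrier (Mod M V)" for V f s
    using ideal_multiples_add_one[OF that(1) ideal_multiples_zero[OF that(1)] that(2,3,4)] zero_left[OF that(1)] that by simp
  then show "\<lbrakk>openin X V; f \<in> \<O> V; \<And>y. y \<in> V \<inter> Z \<Longrightarrow> f y = 0; s \<in> carrier (Mod M V)\<rbrakk>
      \<Longrightarrow> f \<odot>\<^bsub>Mod M V\<^esub> s \<in> ?I V" for V f s .
  fix V assume V: "openin X V"
  have closed: "x \<in> carrier (Mod M V)" if "x \<in> ?I V" for x
    using V that by (induction rule: ideal_multiples_induct) (use V in auto)
  show "submodule (?I V) (fn_ring V (\<O> V)) (Mod M V)"
  proof (rule submoduleI[OF V])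
    show "\<zero>\<^bsub>Mod M V\<^esub> \<in> ?I V" by (rule ideal_multiples_zero[OF V])
    show "s \<oplus>\<^bsub>Mod M V\<^esub> t \<in> ?I V" if s: "s \<in> ?I V" and t: "t \<in> ?I V" for s t
      using V t
    proof (induction rule: ideal_multiples_induct)
      case zero
      then show ?case using s closed[OF s] V abelian_monoid.r_zero[OF abelian_group.axioms(1)[OF sections_abelian_group]] by metis
    next
      case (add x f u)
      then show ?case
        using ideal_multiples_add_one[OF V add.IH add.hyps(2,3,4)] V add.hyps closed[OF s]
          abelian_monoid.a_assoc[OF abelian_group.axioms(1)[OF sections_abelian_group[OF V]], of s x "f \<odot>\<^bsub>Mod M V\<^esub> u"] by simp
    qed
    show "f \<odot>\<^bsub>Mod M V\<^esub> s \<in> ?I V" if f: "f \<in> \<O> V" and s: "s \<in> ?I V" for f s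
      using V s
    proof (induction rule: ideal_multiples_induct)
      case zero
      then show ?case using smult_zero_right[OF V f] ideal_multiples_zero[OF V] by simp
    next
      case (add x g u)
      have "f \<odot>\<^bsub>Mod M V\<^esub> (x \<oplus>\<^bsub>Mod M V\<^esub> g \<odot>\<^bsub>Mod M V\<^esub> u) = f \<odot>\<^bsub>Mod M V\<^esub> x \<oplus>\<^bsub>Mod M V\<^esub> (\<lambda>y\<in>V. f y * g y) \<odot>\<^bsub>Mod M V\<^esub> u"
        using smult_add[OF V f add.hyps(1), of "g \<odot>\<^bsub>Mod M V\<^esub> u"] smult_assoc[OF V f add.hyps(2,4)] V add.hyps by simp
      then show ?case
        using ideal_multiples_add_one[OF V add.IH mult[OF V f add.hyps(2)] _ add.hyps(4)] add.hyps(3) by auto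
    qed
  qed (use closed in auto)
  show "Res M V V' s \<in> ?I V'" if V': "openin X V'" "V' \<subseteq> V" and s: "s \<in> ?I V" for V' s
    using V s
  proof (induction rule: ideal_multiples_induct)
    case zero
    then show ?case using V V' ideal_multiples_zero[OF V'(1)] by simp
  next
    case (add x f u)
    have "Res M V V' (x \<oplus>\<^bsub>Mod M V\<^esub> f \<odot>\<^bsub>Mod M V\<^esub> u) = Res M V V' x \<oplus>\<^bsub>Mod M V'\<^esub> restrict f V' \<odot>\<^bsub>Mod M V'\<^esub> Res M V V' u"
      using V V' add.hyps by (simp add: Res_add Res_smult)
    then show ?case
      using ideal_multiples_add_one[OF V'(1) add.IH restr[OF V V' add.hyps(2)] _ Res_closed[OF V V' add.hyps(4)]] add.hyps(3) V'(2) by auto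
  qed
qed

end

section \<open>Tangent and conormal sections of a Courant algebroid\<close>

locale courant_restriction = courant_algebroid X \<O> Q
  for X :: "'x topology" and \<O> :: "'x set \<Rightarrow> 'x fn set" and Q :: "('x, 's) courant" +
  fixes Z :: "'x set"
  assumes Z_topspace: "Z \<subseteq> topspace X"
begin

sublocale A: germ_quotient X \<O> Q "ideal_multiples \<O> Q Z" Z
  by (rule germ_quotient_ideal_multiples[OF Z_topspace])

abbreviation "Y \<equiv> subtopology X Z"
abbreviation "\<O>Z \<equiv> restr_sheaf X \<O> Z"
abbreviation "iQ \<equiv> inverse_image X \<O> Q Z"
abbreviation "rsec \<equiv> restr_section X \<O> Q Z"
abbreviation "F \<equiv> fibre_product X \<O> Q Z"
abbreviation "N \<equiv> conormal_image X \<O> Q Z"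

lemma iQ_eq: "iQ = A.Quo" and rsec_eq: "rsec = A.gsec"
  by (simp_all add: inverse_image_def restr_section_def fun_eq_iff)

lemma anchor_simps:
  assumes U: "openin X U"
  shows "q \<in> carrier (Mod Q U) \<Longrightarrow> anchor Q U q \<in> vector_fields X \<O> U"
    and "\<lbrakk>p \<in> carrier (Mod Q U); q \<in> carrier (Mod Q U); openin X V; V \<subseteq> U; f \<in> \<O> V; x \<in> V\<rbrakk>
      \<Longrightarrow> anchor Q U (p \<oplus>\<^bsub>Mod Q U\<^esub> q) V f x = anchor Q U p V f x + anchor Q U q V f x"
    and "\<lbrakk>g \<in> \<O> U; q \<in> carrier (Mod Q U); openin X V; V \<subseteq> U; f \<in> \<O> V; x \<in> V\<rbrakk>
      \<Longrightarrow> anchor Q U (g \<odot>\<^bsub>Mod Q U\<^esub> q) V f x = g x * anchor Q U q V f x"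
    and "\<lbrakk>q \<in> carrier (Mod Q U); openin X V; V \<subseteq> U\<rbrakk> \<Longrightarrow> anchor Q V (Res Q U V q) = family_res X V (anchor Q U q)"
    and "\<lbrakk>\<alpha> \<in> one_forms X \<O> U; openin X V; V \<subseteq> U; f \<in> \<O> V; x \<in> V\<rbrakk> \<Longrightarrow> anchor Q U (coanchor Q U \<alpha>) V f x = 0"
  using anchor_hom U anchor_coanchor[OF U, of \<alpha>]
  by (simp_all add: sheaf_hom_def tangent_sheaf_def family_module_def family_def)

lemma anchor_Res_apply:
  assumes "openin X U" "q \<in> carrier (Mod Q U)" "openin X V" "V \<subseteq> U" "openin X W" "W \<subseteq> V"
  shows "anchor Q V (Res Q U V q) W = anchor Q U q W"
  using anchor_simps(4)[OF assms(1-4)] assms(5,6) by (simp add: family_res_def)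

lemma coanchor_simps:
  assumes U: "openin X U"
  shows "\<alpha> \<in> one_forms X \<O> U \<Longrightarrow> coanchor Q U \<alpha> \<in> carrier (Mod Q U)"
    and "\<lbrakk>\<alpha> \<in> one_forms X \<O> U; \<beta> \<in> one_forms X \<O> U\<rbrakk> \<Longrightarrow>
      coanchor Q U (family X U (vector_fields X \<O>) (\<lambda>V w x. \<alpha> V w x + \<beta> V w x)) = coanchor Q U \<alpha> \<oplus>\<^bsub>Mod Q U\<^esub> coanchor Q U \<beta>"
    and "\<lbrakk>f \<in> \<O> U; \<alpha> \<in> one_forms X \<O> U\<rbrakk> \<Longrightarrow>
      coanchor Q U (family X U (vector_fields X \<O>) (\<lambda>V w x. f x * \<alpha> V w x)) = f \<odot>\<^bsub>Mod Q U\<^esub> coanchor Q U \<alpha>"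
    and "\<lbrakk>\<alpha> \<in> one_forms X \<O> U; openin X V; V \<subseteq> U\<rbrakk> \<Longrightarrow> coanchor Q V (family_res X V \<alpha>) = Res Q U V (coanchor Q U \<alpha>)"
  using coanchor_hom U by (simp_all add: sheaf_hom_def cotangent_sheaf_def family_module_def)

definition tangent_sections :: "'x set \<Rightarrow> 's set" where
  "tangent_sections V = {q \<in> carrier (Mod Q V). tangent_field Z V (anchor Q V q)}"

text \<open>The combination \<open>\<Sum>j. g j \<cdot> d (f j)\<close> restricts to the zero form on \<open>Z\<close>, spelled out on vector fields of \<open>Z\<close>. Conormal
  forms have such expressions locally, which are easier to add and to multiply than the forms.\<close>

definition null_comb :: "'x set \<Rightarrow> nat \<Rightarrow> (nat \<Rightarrow> 'x fn) \<Rightarrow> (nat \<Rightarrow> 'x fn) \<Rightarrow> bool" where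
  "null_comb V n g f \<longleftrightarrow> openin X V \<and> (\<forall>j<n. g j \<in> \<O> V \<and> f j \<in> \<O> V) \<and>
     (\<forall>W w x. openin Y W \<and> W \<subseteq> V \<inter> Z \<and> w \<in> vector_fields Y \<O>Z W \<and> x \<in> W \<longrightarrow>
       (\<Sum>j<n. g j x * w W (restrict (f j) W) x) = 0)"

definition conormal_sections :: "'x set \<Rightarrow> 's set" where
  "conormal_sections V = {s \<in> carrier (Mod Q V). \<forall>z\<in>V \<inter> Z. \<exists>V' n g f. z \<in> V' \<and> V' \<subseteq> V \<and> null_comb V' n g f \<and>
     Res Q V V' s = coanchor Q V' (lin_comb X \<O> V' n g f)}"

lemma tangent_sectionsD:
  assumes "q \<in> tangent_sections V" "openin X V'" "V' \<subseteq> V" "h \<in> \<O> V'" "\<And>y. y \<in> V' \<inter> Z \<Longrightarrow> h y = 0" "y \<in> V'" "y \<in> Z"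
  shows "anchor Q V q V' h y = 0"
  using assms by (auto simp: tangent_sections_def tangent_field_def)

lemma tangent_sectionsI:
  assumes "q \<in> carrier (Mod Q V)"
    "\<And>V' h y. \<lbrakk>openin X V'; V' \<subseteq> V; h \<in> \<O> V'; \<And>y. y \<in> V' \<inter> Z \<Longrightarrow> h y = 0; y \<in> V'; y \<in> Z\<rbrakk> \<Longrightarrow> anchor Q V q V' h y = 0"
  shows "q \<in> tangent_sections V"
  using assms by (simp add: tangent_sections_def tangent_field_def)

lemma submodule_tangent_sections:
  assumes V: "openin X V"
  shows "submodule (tangent_sections V) (fn_ring V (\<O> V)) (Mod Q V)"
proof (rule submoduleI[OF V])
  show sub: "tangent_sections V \<subseteq> carrier (Mod Q V)" by (auto simp: tangent_sections_def)
  have add: "s \<oplus>\<^bsub>Mod Q V\<^esub> t \<in> tangent_sections V" if "s \<in> tangent_sections V" "t \<in> tangent_sections V" for s t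
  proof (rule tangent_sectionsI)
    have st: "s \<in> carrier (Mod Q V)" "t \<in> carrier (Mod Q V)" using that sub by auto
    then show "s \<oplus>\<^bsub>Mod Q V\<^esub> t \<in> carrier (Mod Q V)" using V by simp
    fix W h y assume W: "openin X W" "W \<subseteq> V" "h \<in> \<O> W" "\<And>y. y \<in> W \<inter> Z \<Longrightarrow> h y = 0" "y \<in> W" "y \<in> Z"
    then show "anchor Q V (s \<oplus>\<^bsub>Mod Q V\<^esub> t) W h y = 0"
      using anchor_simps(2)[OF V st W(1,2,3,5)] tangent_sectionsD[OF that(1) W] tangent_sectionsD[OF that(2) W] by simp
  qed
  then show "\<And>s t. \<lbrakk>s \<in> tangent_sections V; t \<in> tangent_sections V\<rbrakk> \<Longrightarrow> s \<oplus>\<^bsub>Mod Q V\<^esub> t \<in> tangent_sections V" .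
  show "f \<odot>\<^bsub>Mod Q V\<^esub> s \<in> tangent_sections V" if "f \<in> \<O> V" "s \<in> tangent_sections V" for f s
  proof (rule tangent_sectionsI)
    have sQ: "s \<in> carrier (Mod Q V)" using that sub by auto
    then show "f \<odot>\<^bsub>Mod Q V\<^esub> s \<in> carrier (Mod Q V)" using that V by simp
    fix W h y assume W: "openin X W" "W \<subseteq> V" "h \<in> \<O> W" "\<And>y. y \<in> W \<inter> Z \<Longrightarrow> h y = 0" "y \<in> W" "y \<in> Z"
    then show "anchor Q V (f \<odot>\<^bsub>Mod Q V\<^esub> s) W h y = 0"
      using anchor_simps(3)[OF V that(1) sQ W(1,2,3,5)] tangent_sectionsD[OF that(2) W] by simp
  qed
  \<comment> \<open>Written as a multiple, the zero section is covered by the linearity of the anchor over functions.\<close>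
  have "(\<lambda>x\<in>V. 0) \<odot>\<^bsub>Mod Q V\<^esub> \<zero>\<^bsub>Mod Q V\<^esub> \<in> tangent_sections V"
    using V const[OF V, of 0] by (intro tangent_sectionsI) (auto simp: anchor_simps(3)[OF V] subsetD)
  then show "\<zero>\<^bsub>Mod Q V\<^esub> \<in> tangent_sections V" using smult_zero_left[OF V, of "\<zero>\<^bsub>Mod Q V\<^esub>"] V by simp
qed

lemma tangent_sections_Res:
  assumes V: "openin X V" "openin X V'" "V' \<subseteq> V" and s: "s \<in> tangent_sections V"
  shows "Res Q V V' s \<in> tangent_sections V'"
proof (rule tangent_sectionsI)
  have sQ: "s \<in> carrier (Mod Q V)" using s by (simp add: tangent_sections_def)
  show "Res Q V V' s \<in> carrier (Mod Q V')" using Res_closed[OF V sQ] .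
  fix W h y assume "openin X W" "W \<subseteq> V'" "h \<in> \<O> W" "\<And>y. y \<in> W \<inter> Z \<Longrightarrow> h y = 0" "y \<in> W" "y \<in> Z"
  then show "anchor Q V' (Res Q V V' s) W h y = 0"
    using anchor_Res_apply[OF V(1) sQ V(2,3), of W] tangent_sectionsD[OF s, of W h y] V(3) by auto
qed

text \<open>By the two lemmas on tangent fields, the vector field on \<open>Z\<close> in the fibre product exists as soon as the
  anchor preserves the ideal of \<open>Z\<close>, and may be forgotten.\<close>

lemma fibre_product_eq: "F = A.represented tangent_sections"
proof -
  have *: "(\<exists>v. q \<in> carrier (Mod Q V) \<and> P \<and> v \<in> vector_fields Y \<O>Z (V \<inter> Z) \<and> field_restricts_to X \<O> Z V (anchor Q V q) v) \<longleftrightarrow>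
      q \<in> tangent_sections V \<and> P" if V: "openin X V" for V q P
  proof
    assume "\<exists>v. q \<in> carrier (Mod Q V) \<and> P \<and> v \<in> vector_fields Y \<O>Z (V \<inter> Z) \<and> field_restricts_to X \<O> Z V (anchor Q V q) v"
    then show "q \<in> tangent_sections V \<and> P" using tangent_field_if_restricts by (auto simp: tangent_sections_def)
  next
    assume q: "q \<in> tangent_sections V \<and> P"
    then have "anchor Q V q \<in> vector_fields X \<O> V" "tangent_field Z V (anchor Q V q)"
      using anchor_simps(1)[OF V] by (auto simp: tangent_sections_def)
    then obtain v where "v \<in> vector_fields Y \<O>Z (V \<inter> Z)" "field_restricts_to X \<O> Z V (anchor Q V q) v"
      using V by (rule_tac tangent_field_restricts) auto
    then show "\<exists>v. q \<in> carrier (Mod Q V) \<and> P \<and> v \<in> vector_fields Y \<O>Z (V \<inter> Z) \<and> field_restricts_to X \<O> Z V (anchor Q V q) v"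
      using q by (auto simp: tangent_sections_def)
  qed
  have "(\<exists>V q v. openin X V \<and> z \<in> V \<and> V \<inter> Z \<subseteq> W \<and> q \<in> carrier (Mod Q V) \<and> restrict \<sigma> (V \<inter> Z) = rsec V q \<and>
      v \<in> vector_fields Y \<O>Z (V \<inter> Z) \<and> field_restricts_to X \<O> Z V (anchor Q V q) v) \<longleftrightarrow>
    (\<exists>V q. openin X V \<and> z \<in> V \<and> V \<inter> Z \<subseteq> W \<and> q \<in> tangent_sections V \<and> restrict \<sigma> (V \<inter> Z) = A.gsec V q)" for z W \<sigma>
    using * unfolding rsec_eq by (metis (no_types, lifting))
  then show ?thesis unfolding fibre_product_def A.represented_def iQ_eq by (intro ext) simp
qed

lemma null_comb_restrict:
  assumes "null_comb V n g f" "openin X V'" "V' \<subseteq> V"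
  shows "null_comb V' n (\<lambda>j. restrict (g j) V') (\<lambda>j. restrict (f j) V')"
  unfolding null_comb_def
proof (intro conjI allI impI)
  have V: "openin X V" "\<And>j. j < n \<Longrightarrow> g j \<in> \<O> V \<and> f j \<in> \<O> V" using assms(1) by (auto simp: null_comb_def)
  show "restrict (g j) V' \<in> \<O> V'" "restrict (f j) V' \<in> \<O> V'" if "j < n" for j
    using V(2)[OF that] restr[OF V(1) assms(2,3)] by auto
  fix W w x assume W: "openin Y W \<and> W \<subseteq> V' \<inter> Z \<and> w \<in> vector_fields Y \<O>Z W \<and> x \<in> W"
  then have "(\<Sum>j<n. g j x * w W (restrict (f j) W) x) = 0"
    using assms unfolding null_comb_def by blast
  moreover have "V' \<inter> W = W" "x \<in> V'" using W by auto
  ultimately show "(\<Sum>j<n. restrict (g j) V' x * w W (restrict (restrict (f j) V') W) x) = 0" by simp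
qed (rule assms(2))

lemma null_comb_one_form: "null_comb V n g f \<Longrightarrow> lin_comb X \<O> V n g f \<in> one_forms X \<O> V"
  by (rule lin_comb_one_form) (auto simp: null_comb_def)

lemma lin_comb_null_iff:
  assumes "openin Y W" and W_U: "W \<subseteq> U"
  shows "family_res Y W (family Y U (vector_fields Y \<O>Z) (\<lambda>V a x. 0)) = lin_comb Y \<O>Z W n g f \<longleftrightarrow>
    (\<forall>W' w x. openin Y W' \<and> W' \<subseteq> W \<and> w \<in> vector_fields Y \<O>Z W' \<and> x \<in> W' \<longrightarrow>
       (\<Sum>j<n. g j x * w W' (restrict (f j) W') x) = 0)"
proof -
  show ?thesis
    unfolding lin_comb_def A.Z.family_res_family[OF W_U]
  proof
    assume *: "family Y W (vector_fields Y \<O>Z) (\<lambda>V a x. 0) =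
      family Y W (vector_fields Y \<O>Z) (\<lambda>V w x. \<Sum>j<n. g j x * w V (restrict (f j) V) x)"
    show "\<forall>W' w x. openin Y W' \<and> W' \<subseteq> W \<and> w \<in> vector_fields Y \<O>Z W' \<and> x \<in> W' \<longrightarrow>
       (\<Sum>j<n. g j x * w W' (restrict (f j) W') x) = 0"
      using A.Z.family_eqD[OF *] by simp
  next
    assume "\<forall>W' w x. openin Y W' \<and> W' \<subseteq> W \<and> w \<in> vector_fields Y \<O>Z W' \<and> x \<in> W' \<longrightarrow>
       (\<Sum>j<n. g j x * w W' (restrict (f j) W') x) = 0"
    then show "family Y W (vector_fields Y \<O>Z) (\<lambda>V a x. 0) =
      family Y W (vector_fields Y \<O>Z) (\<lambda>V w x. \<Sum>j<n. g j x * w V (restrict (f j) V) x)"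
      by (intro A.Z.family_eqI) simp
  qed
qed

lemma conormal_forms_iff:
  "\<gamma> \<in> conormal_forms X \<O> Z V \<longleftrightarrow> \<gamma> \<in> one_forms X \<O> V \<and>
    (\<forall>z\<in>V \<inter> Z. \<exists>V' n g f. z \<in> V' \<and> V' \<subseteq> V \<and> null_comb V' n g f \<and> family_res X V' \<gamma> = lin_comb X \<O> V' n g f)"
proof -
  have zero: "\<zero>\<^bsub>Mod (cotangent_sheaf Y \<O>Z) (V \<inter> Z)\<^esub> = family Y (V \<inter> Z) (vector_fields Y \<O>Z) (\<lambda>V a x. 0)"
    by (simp add: cotangent_sheaf_def family_module_def)
  have *: "(openin X V' \<and> z \<in> V' \<and> V' \<subseteq> V \<and> (\<forall>j<n. g j \<in> \<O> V' \<and> f j \<in> \<O> V') \<and>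
      family_res X V' \<gamma> = lin_comb X \<O> V' n g f \<and>
      family_res Y (V' \<inter> Z) (family Y (V \<inter> Z) (vector_fields Y \<O>Z) (\<lambda>V a x. 0)) = lin_comb Y \<O>Z (V' \<inter> Z) n g f) \<longleftrightarrow>
    (z \<in> V' \<and> V' \<subseteq> V \<and> null_comb V' n g f \<and> family_res X V' \<gamma> = lin_comb X \<O> V' n g f)" for z V' n g f
  proof (cases "openin X V' \<and> V' \<subseteq> V")
    case True
    then have "openin Y (V' \<inter> Z)" "V' \<inter> Z \<subseteq> V \<inter> Z" by (auto simp: openin_subtopology)
    from lin_comb_null_iff[OF this, of n g f] show ?thesis using True unfolding null_comb_def by blast
  qed (auto simp: null_comb_def)
  then show ?thesis unfolding conormal_forms_def form_restricts_to_def zero by (simp only: mem_Collect_eq *)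
qed

lemma coanchor_null_comb:
  assumes nc: "null_comb V n g f"
  shows "coanchor Q V (lin_comb X \<O> V n g f) \<in> conormal_sections V"
    and "lin_comb X \<O> V n g f \<in> conormal_forms X \<O> Z V"
proof -
  have V: "openin X V" using nc by (simp add: null_comb_def)
  note one = null_comb_one_form[OF nc]
  have r: "family_res X V (lin_comb X \<O> V n g f) = lin_comb X \<O> V n g f"
    by (simp add: lin_comb_def family_res_family)
  show "lin_comb X \<O> V n g f \<in> conormal_forms X \<O> Z V"
    unfolding conormal_forms_iff using one nc r by blast
  have "Res Q V V (coanchor Q V (lin_comb X \<O> V n g f)) = coanchor Q V (lin_comb X \<O> V n g f)"
    using Res_id[OF V coanchor_simps(1)[OF V one]] .
  then show "coanchor Q V (lin_comb X \<O> V n g f) \<in> conormal_sections V"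
    unfolding conormal_sections_def using coanchor_simps(1)[OF V one] nc by blast
qed

lemma conormal_sections_Res:
  assumes V: "openin X V" "openin X V'" "V' \<subseteq> V" and s: "s \<in> conormal_sections V"
  shows "Res Q V V' s \<in> conormal_sections V'"
  unfolding conormal_sections_def
proof (intro CollectI conjI ballI)
  have sQ: "s \<in> carrier (Mod Q V)" using s by (simp add: conormal_sections_def)
  show "Res Q V V' s \<in> carrier (Mod Q V')" using Res_closed[OF V sQ] .
  fix z assume z: "z \<in> V' \<inter> Z"
  then obtain U n g f where U: "z \<in> U" "U \<subseteq> V" "null_comb U n g f" "Res Q V U s = coanchor Q U (lin_comb X \<O> U n g f)"
    using s V(3) unfolding conormal_sections_def by blast
  have oU: "openin X U" using U(3) by (simp add: null_comb_def)
  define T where "T = U \<inter> V'"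
  have T: "openin X T" "T \<subseteq> U" "T \<subseteq> V'" "z \<in> T" using oU V U z by (auto simp: T_def)
  have "Res Q V' T (Res Q V V' s) = Res Q U T (Res Q V U s)"
    using Res_Res[OF V(1,2) T(1,3) V(3) sQ] Res_Res[OF V(1) oU T(1,2) U(2) sQ] by simp
  also have "\<dots> = coanchor Q T (lin_comb X \<O> T n (\<lambda>j. restrict (g j) T) (\<lambda>j. restrict (f j) T))"
    using coanchor_simps(4)[OF oU null_comb_one_form[OF U(3)] T(1,2)] lin_comb_restrict[OF T(1,2)] U(4) by simp
  finally show "\<exists>V'' n g f. z \<in> V'' \<and> V'' \<subseteq> V' \<and> null_comb V'' n g f \<and>
      Res Q V' V'' (Res Q V V' s) = coanchor Q V'' (lin_comb X \<O> V'' n g f)"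
    using null_comb_restrict[OF U(3) T(1,2)] T by blast
qed

lemma conormal_sections_rep:
  assumes V: "openin X V" and s: "s \<in> conormal_sections V" and z: "z \<in> V" "z \<in> Z" and U: "openin X U" "z \<in> U"
  obtains V' n g f where "openin X V'" "z \<in> V'" "V' \<subseteq> V" "V' \<subseteq> U" "null_comb V' n g f"
    "Res Q V V' s = coanchor Q V' (lin_comb X \<O> V' n g f)"
proof -
  have o: "openin X (V \<inter> U)" "V \<inter> U \<subseteq> V" using V U by auto
  have sQ: "s \<in> carrier (Mod Q V)" using s by (simp add: conormal_sections_def)
  obtain V' n g f where V': "z \<in> V'" "V' \<subseteq> V \<inter> U" "null_comb V' n g f"
    "Res Q (V \<inter> U) V' (Res Q V (V \<inter> U) s) = coanchor Q V' (lin_comb X \<O> V' n g f)"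
    using conormal_sections_Res[OF V o s] z U unfolding conormal_sections_def by blast
  have "openin X V'" using V'(3) by (simp add: null_comb_def)
  then show ?thesis
    using V' Res_Res[OF V o(1) _ V'(2) o(2) sQ] by (intro that[of V' n g f]) auto
qed

text \<open>Sums are formed by concatenating the lists of coefficients, products by scaling the coefficients \<open>g j\<close>;
  the zero section comes from the empty combination.\<close>

lemma submodule_conormal_sections:
  assumes V: "openin X V"
  shows "submodule (conormal_sections V) (fn_ring V (\<O> V)) (Mod Q V)"
proof (rule submoduleI[OF V])
  show sub: "conormal_sections V \<subseteq> carrier (Mod Q V)" by (auto simp: conormal_sections_def)
  show add: "s \<oplus>\<^bsub>Mod Q V\<^esub> t \<in> conormal_sections V" if s: "s \<in> conormal_sections V" and t: "t \<in> conormal_sections V" for s t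
    unfolding conormal_sections_def
  proof (intro CollectI conjI ballI)
    have st: "s \<in> carrier (Mod Q V)" "t \<in> carrier (Mod Q V)" using sub s t by auto
    then show "s \<oplus>\<^bsub>Mod Q V\<^esub> t \<in> carrier (Mod Q V)" using V by simp
    fix z assume "z \<in> V \<inter> Z"
    then have z: "z \<in> V" "z \<in> Z" by auto
    obtain U n g f where U: "openin X U" "z \<in> U" "U \<subseteq> V" "null_comb U n g f" "Res Q V U s = coanchor Q U (lin_comb X \<O> U n g f)"
      by (rule conormal_sections_rep[OF V s z V z(1)]) blast
    obtain W m h e where W: "openin X W" "z \<in> W" "W \<subseteq> V" "W \<subseteq> U" "null_comb W m h e" "Res Q V W t = coanchor Q W (lin_comb X \<O> W m h e)"
      by (rule conormal_sections_rep[OF V t z U(1,2)]) blast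
    define g' f' where "g' = (\<lambda>j. restrict (g j) W)" and "f' = (\<lambda>j. restrict (f j) W)"
    have nc: "null_comb W n g' f'" unfolding g'_def f'_def by (rule null_comb_restrict[OF U(4) W(1,4)])
    have "Res Q V W s = Res Q U W (Res Q V U s)" using Res_Res[OF V U(1) W(1,4) U(3) st(1)] by simp
    then have s_eq: "Res Q V W s = coanchor Q W (lin_comb X \<O> W n g' f')"
      using coanchor_simps(4)[OF U(1) null_comb_one_form[OF U(4)] W(1,4)] lin_comb_restrict[OF W(1,4)] U(5)
      by (simp add: g'_def f'_def)
    define G where "G j = (if j < n then g' j else h (j - n))" for j
    define E where "E j = (if j < n then f' j else e (j - n))" for j
    have split: "(\<Sum>j<n + m. G j x * w (E j)) = (\<Sum>j<n. g' j x * w (f' j)) + (\<Sum>j<m. h j x * w (e j))"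
      for x and w :: "'x fn \<Rightarrow> complex"
    proof -
      have "(\<Sum>j<n + m. P j) = (\<Sum>j<n. P j) + (\<Sum>j<m. P (n + j))" for P :: "nat \<Rightarrow> complex"
        by (induction m) (simp_all add: add.assoc)
      then show ?thesis by (simp add: G_def E_def)
    qed
    have "null_comb W (n + m) G E"
      unfolding null_comb_def
    proof (intro conjI allI impI)
      show "G j \<in> \<O> W" "E j \<in> \<O> W" if "j < n + m" for j
        using that nc W(5) by (auto simp: G_def E_def null_comb_def)
      fix W' w x assume W': "openin Y W' \<and> W' \<subseteq> W \<inter> Z \<and> w \<in> vector_fields Y \<O>Z W' \<and> x \<in> W'"
      then have "(\<Sum>j<n. g' j x * w W' (restrict (f' j) W') x) = 0" "(\<Sum>j<m. h j x * w W' (restrict (e j) W') x) = 0"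
        using nc W(5) unfolding null_comb_def by blast+
      then show "(\<Sum>j<n + m. G j x * w W' (restrict (E j) W') x) = 0"
        using split[of x "\<lambda>f. w W' (restrict f W') x"] by simp
    qed (rule W(1))
    moreover have "Res Q V W (s \<oplus>\<^bsub>Mod Q V\<^esub> t) = coanchor Q W (lin_comb X \<O> W (n + m) G E)"
    proof -
      have "lin_comb X \<O> W (n + m) G E =
          family X W (vector_fields X \<O>) (\<lambda>V w x. lin_comb X \<O> W n g' f' V w x + lin_comb X \<O> W m h e V w x)"
        unfolding lin_comb_def[of _ _ _ "n + m"]
      proof (rule family_eqI)
        fix V' w x assume "openin X V'" "V' \<subseteq> W" "w \<in> vector_fields X \<O> V'" "x \<in> V'"
        then show "(\<Sum>j<n + m. G j x * w V' (restrict (E j) V') x) =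
            lin_comb X \<O> W n g' f' V' w x + lin_comb X \<O> W m h e V' w x"
          using split[of x "\<lambda>f. w V' (restrict f V') x"] by (simp add: lin_comb_apply)
      qed
      then show ?thesis
        using coanchor_simps(2)[OF W(1) null_comb_one_form[OF nc] null_comb_one_form[OF W(5)]] s_eq W(6)
          Res_add[OF V W(1,3) st] by simp
    qed
    ultimately show "\<exists>V' n g f. z \<in> V' \<and> V' \<subseteq> V \<and> null_comb V' n g f \<and>
        Res Q V V' (s \<oplus>\<^bsub>Mod Q V\<^esub> t) = coanchor Q V' (lin_comb X \<O> V' n g f)"
      using W(2,3) by blast
  qed
  show "h \<odot>\<^bsub>Mod Q V\<^esub> s \<in> conormal_sections V" if h: "h \<in> \<O> V" and s: "s \<in> conormal_sections V" for h s
    unfolding conormal_sections_def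
  proof (intro CollectI conjI ballI)
    have sQ: "s \<in> carrier (Mod Q V)" using sub s by auto
    then show "h \<odot>\<^bsub>Mod Q V\<^esub> s \<in> carrier (Mod Q V)" using V h by simp
    fix z assume "z \<in> V \<inter> Z"
    then have z: "z \<in> V" "z \<in> Z" by auto
    obtain U n g f where U: "openin X U" "z \<in> U" "U \<subseteq> V" "null_comb U n g f" "Res Q V U s = coanchor Q U (lin_comb X \<O> U n g f)"
      by (rule conormal_sections_rep[OF V s z V z(1)]) blast
    have hU: "restrict h U \<in> \<O> U" using restr[OF V U(1,3) h] .
    define G where "G j = (\<lambda>x\<in>U. restrict h U x * g j x)" for j
    have sumG: "(\<Sum>j<n. G j x * w j) = h x * (\<Sum>j<n. g j x * w j)" if "x \<in> U" for x w
      using that by (simp add: G_def sum_distrib_left mult.assoc)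
    have "null_comb U n G f"
      unfolding null_comb_def
    proof (intro conjI allI impI)
      show "G j \<in> \<O> U" "f j \<in> \<O> U" if "j < n" for j
        using that U(4) mult[OF U(1) hU, of "g j"] unfolding G_def null_comb_def by auto
      fix W w x assume W: "openin Y W \<and> W \<subseteq> U \<inter> Z \<and> w \<in> vector_fields Y \<O>Z W \<and> x \<in> W"
      then have "(\<Sum>j<n. g j x * w W (restrict (f j) W) x) = 0" using U(4) unfolding null_comb_def by blast
      then show "(\<Sum>j<n. G j x * w W (restrict (f j) W) x) = 0" using sumG[of x "\<lambda>j. w W (restrict (f j) W) x"] W by auto
    qed (rule U(1))
    moreover have "Res Q V U (h \<odot>\<^bsub>Mod Q V\<^esub> s) = coanchor Q U (lin_comb X \<O> U n G f)"
    proof -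
      have "lin_comb X \<O> U n G f = family X U (vector_fields X \<O>) (\<lambda>V w x. restrict h U x * lin_comb X \<O> U n g f V w x)"
        unfolding lin_comb_def[of _ _ _ _ G]
      proof (rule family_eqI)
        fix V w x assume "openin X V" "V \<subseteq> U" "w \<in> vector_fields X \<O> V" "x \<in> V"
        then show "(\<Sum>j<n. G j x * w V (restrict (f j) V) x) = restrict h U x * lin_comb X \<O> U n g f V w x"
          using sumG[of x "\<lambda>j. w V (restrict (f j) V) x"] by (auto simp: lin_comb_apply)
      qed
      then show ?thesis
        using coanchor_simps(3)[OF U(1) hU null_comb_one_form[OF U(4)]] U(5) Res_smult[OF V U(1,3) h sQ] by simp
    qed
    ultimately show "\<exists>V' n g f. z \<in> V' \<and> V' \<subseteq> V \<and> null_comb V' n g f \<and>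
        Res Q V V' (h \<odot>\<^bsub>Mod Q V\<^esub> s) = coanchor Q V' (lin_comb X \<O> V' n g f)"
      using U by blast
  qed
  show "\<zero>\<^bsub>Mod Q V\<^esub> \<in> conormal_sections V"
  proof -
    have nc: "null_comb V 0 (\<lambda>_. undefined) (\<lambda>_. undefined)" using V by (simp add: null_comb_def)
    let ?\<alpha> = "lin_comb X \<O> V 0 (\<lambda>_. undefined) (\<lambda>_. undefined)"
    have "family X V (vector_fields X \<O>) (\<lambda>V w x. (\<lambda>x\<in>V. 0) x * ?\<alpha> V w x) = ?\<alpha>"
      unfolding lin_comb_def[of _ _ _ 0] by (intro family_eqI) simp
    moreover have "family X V (vector_fields X \<O>) (\<lambda>W w x. (\<lambda>x\<in>V. 0) x * ?\<alpha> W w x) =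
        family X V (vector_fields X \<O>) (\<lambda>V w x. (\<lambda>x\<in>V. 0) x * ?\<alpha> V w x)"
      by (rule family_eqI) auto
    ultimately have "coanchor Q V ?\<alpha> = (\<lambda>x\<in>V. 0) \<odot>\<^bsub>Mod Q V\<^esub> coanchor Q V ?\<alpha>"
      using coanchor_simps(3)[OF V const[OF V, of 0] null_comb_one_form[OF nc]] by simp
    also have "\<dots> = \<zero>\<^bsub>Mod Q V\<^esub>" using smult_zero_left[OF V coanchor_simps(1)[OF V null_comb_one_form[OF nc]]] .
    finally show ?thesis using coanchor_null_comb(1)[OF nc] by simp
  qed
qed

lemma conormal_image_eq: "N = A.represented conormal_sections"
proof (rule HOL.ext, rule equalityI; rule subsetI)
  fix W \<sigma>
  assume \<sigma>: "\<sigma> \<in> N W"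
  show "\<sigma> \<in> A.represented conormal_sections W"
  proof (rule A.representedI)
    show "openin Y W" "\<sigma> \<in> carrier (Mod A.Quo W)" using \<sigma> by (auto simp: conormal_image_def iQ_eq)
    fix z assume "z \<in> W"
    then obtain V \<gamma> where V: "openin X V" "z \<in> V" "V \<inter> Z \<subseteq> W" "\<gamma> \<in> conormal_forms X \<O> Z V"
      "restrict \<sigma> (V \<inter> Z) = A.gsec V (coanchor Q V \<gamma>)"
      using \<sigma> unfolding conormal_image_def rsec_eq by blast
    have \<gamma>: "\<gamma> \<in> one_forms X \<O> V" using V(4) by (simp add: conormal_forms_iff)
    have "coanchor Q V \<gamma> \<in> conormal_sections V"
      unfolding conormal_sections_def
    proof (intro CollectI conjI ballI coanchor_simps(1)[OF V(1) \<gamma>])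
      fix y assume "y \<in> V \<inter> Z"
      then obtain V' n g f where V': "y \<in> V'" "V' \<subseteq> V" "null_comb V' n g f" "family_res X V' \<gamma> = lin_comb X \<O> V' n g f"
        using V(4) unfolding conormal_forms_iff by blast
      moreover have "openin X V'" using V'(3) by (simp add: null_comb_def)
      ultimately show "\<exists>V' n g f. y \<in> V' \<and> V' \<subseteq> V \<and> null_comb V' n g f \<and>
          Res Q V V' (coanchor Q V \<gamma>) = coanchor Q V' (lin_comb X \<O> V' n g f)"
        using coanchor_simps(4)[OF V(1) \<gamma>, of V'] by metis
    qed
    then show "\<exists>V s. openin X V \<and> z \<in> V \<and> V \<inter> Z \<subseteq> W \<and> s \<in> conormal_sections V \<and> restrict \<sigma> (V \<inter> Z) = A.gsec V s"
      using V by blast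
  qed
next
  fix W \<sigma>
  assume \<sigma>: "\<sigma> \<in> A.represented conormal_sections W"
  then have W: "openin Y W" "\<sigma> \<in> carrier (Mod A.Quo W)" by (auto simp: A.represented_def)
  have "\<exists>V \<gamma>. openin X V \<and> z \<in> V \<and> V \<inter> Z \<subseteq> W \<and> \<gamma> \<in> conormal_forms X \<O> Z V \<and>
      restrict \<sigma> (V \<inter> Z) = A.gsec V (coanchor Q V \<gamma>)" if z: "z \<in> W" for z
  proof -
    obtain V s where V: "openin X V" "z \<in> V" "V \<inter> Z \<subseteq> W" "s \<in> conormal_sections V" "restrict \<sigma> (V \<inter> Z) = A.gsec V s"
      by (rule A.representedE[OF \<sigma> z])
    have zZ: "z \<in> Z" using A.open_in_Z[OF W(1)] z by auto
    obtain V' n g f where V': "openin X V'" "z \<in> V'" "V' \<subseteq> V" "null_comb V' n g f"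
      "Res Q V V' s = coanchor Q V' (lin_comb X \<O> V' n g f)"
      by (rule conormal_sections_rep[OF V(1,4,2) zZ V(1,2)]) blast
    have sQ: "s \<in> carrier (Mod Q V)" using V(4) by (simp add: conormal_sections_def)
    have "restrict \<sigma> (V' \<inter> Z) = restrict (restrict \<sigma> (V \<inter> Z)) (V' \<inter> Z)" using V'(3) by (auto simp: fun_eq_iff restrict_def)
    also have "\<dots> = A.gsec V' (coanchor Q V' (lin_comb X \<O> V' n g f))"
      using A.gsec_Res[OF V(1) V'(1,3) sQ] V(5) V'(5) by simp
    finally show ?thesis
      using V' V(3) coanchor_null_comb(2)[OF V'(4)]
      by (intro exI[of _ V'] exI[of _ "lin_comb X \<O> V' n g f"]) auto
  qed
  then show "\<sigma> \<in> N W" using W by (simp add: conormal_image_def iQ_eq rsec_eq)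
qed

text \<open>The anchor of a co-anchor vanishes.\<close>

lemma conormal_subset_tangent:
  assumes V: "openin X V" and s: "s \<in> conormal_sections V"
  shows "s \<in> tangent_sections V"
proof (rule tangent_sectionsI)
  show sQ: "s \<in> carrier (Mod Q V)" using s by (simp add: conormal_sections_def)
  fix U h y assume U: "openin X U" "U \<subseteq> V" and h: "h \<in> \<O> U" and y: "y \<in> U" "y \<in> Z"
  have yV: "y \<in> V" using U y by auto
  obtain V' n g f where V': "openin X V'" "y \<in> V'" "V' \<subseteq> V" "V' \<subseteq> U" "null_comb V' n g f"
      "Res Q V V' s = coanchor Q V' (lin_comb X \<O> V' n g f)"
    by (rule conormal_sections_rep[OF V s yV y(2) U(1) y(1)])
  have "anchor Q V s U h y = anchor Q V s V' (restrict h V') y"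
    using vector_field_restrict[OF anchor_simps(1)[OF V sQ] U V'(1,4) h V'(2)] by simp
  also have "\<dots> = anchor Q V' (Res Q V V' s) V' (restrict h V') y"
    using anchor_Res_apply[OF V sQ V'(1,3), of V'] V'(1) by simp
  also have "\<dots> = 0"
    using anchor_simps(5)[OF V'(1) null_comb_one_form[OF V'(5)] V'(1) subset_refl restr[OF U(1) V'(1,4) h] V'(2)] V'(6) by simp
  finally show "anchor Q V s U h y = 0" .
qed

section \<open>Brackets of tangent and conormal sections\<close>

lemma tangent_restricts:
  assumes "openin X V" "q \<in> tangent_sections V"
  obtains v where "v \<in> vector_fields Y \<O>Z (V \<inter> Z)" "field_restricts_to X \<O> Z V (anchor Q V q) v"
  using assms tangent_field_restricts[OF anchor_simps(1)[OF assms(1)] assms(1)]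
  by (auto simp: tangent_sections_def)

text \<open>The Lie derivative of a conormal form along a field \<open>u\<close> tangent to \<open>Z\<close> is conormal: with \<open>v\<close> the restriction of
  \<open>u\<close> to \<open>Z\<close>, Cartan's formula on \<open>Z\<close> identifies its restriction with the Lie derivative along \<open>v\<close> of the zero
  form.\<close>

lemma lie_derivative_null_comb:
  assumes nc: "null_comb V n g f" and p: "p \<in> tangent_sections V"
  obtains m h e where "null_comb V m h e"
    "lie_derivative X \<O> V (anchor Q V p) (lin_comb X \<O> V n g f) = lin_comb X \<O> V m h e"
proof -
  define u where "u = anchor Q V p"
  have V: "openin X V" and gf: "\<And>j. j < n \<Longrightarrow> g j \<in> \<O> V" "\<And>j. j < n \<Longrightarrow> f j \<in> \<O> V" using nc by (auto simp: null_comb_def)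
  have pQ: "p \<in> carrier (Mod Q V)" using p by (simp add: tangent_sections_def)
  have u: "u \<in> vector_fields X \<O> V" unfolding u_def using anchor_simps(1)[OF V pQ] .
  note uD = vector_fieldD[OF u V subset_refl]
  obtain v where v: "v \<in> vector_fields Y \<O>Z (V \<inter> Z)" and res: "field_restricts_to X \<O> Z V u v"
    unfolding u_def by (rule tangent_restricts[OF V p])
  \<comment> \<open>The combination in Cartan's formula: coefficients \<open>u (g j)\<close> and \<open>g j\<close>, functions \<open>f j\<close> and \<open>u (f j)\<close>.\<close>
  define G where "G j = (if j < n then u V (g j) else g (j - n))" for j
  define E where "E j = (if j < n then f j else u V (f (j - n)))" for j
  have GE: "(\<Sum>j<n + n. G j x * w (E j)) = (\<Sum>j<n. u V (g j) x * w (f j)) + (\<Sum>j<n. g j x * w (u V (f j)))"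
    for x and w :: "'x fn \<Rightarrow> complex"
    by (simp add: sum_split G_def E_def)
  have "null_comb V (n + n) G E"
    unfolding null_comb_def
  proof (intro conjI allI impI V)
    show "G j \<in> \<O> V" "E j \<in> \<O> V" if "j < n + n" for j
      using that gf uD(1) by (auto simp: G_def E_def)
    fix W w x assume *: "openin Y W \<and> W \<subseteq> V \<inter> Z \<and> w \<in> vector_fields Y \<O>Z W \<and> x \<in> W"
    then have W: "openin Y W" "W \<subseteq> V \<inter> Z" "W \<subseteq> V" and w: "w \<in> vector_fields Y \<O>Z W" and x: "x \<in> W" by auto
    have VZ: "openin Y (V \<inter> Z)" by (rule A.openin_Int_Z[OF V])
    have rW: "restrict h W \<in> \<O>Z W" if "h \<in> \<O> V" for h
      using restrict_in_restr_sheaf[OF V that W(1,3)] .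
    have vu: "v W (restrict h W) = restrict (u V h) W" if h: "h \<in> \<O> V" for h
    proof -
      have "v W (restrict (restrict h (V \<inter> Z)) W) = restrict (v (V \<inter> Z) (restrict h (V \<inter> Z))) W"
        using A.Z.vector_fieldD(6)[OF v VZ subset_refl W(1,2) restrict_in_restr_sheaf[OF V h VZ Int_lower1]] .
      moreover have "v (V \<inter> Z) (restrict h (V \<inter> Z)) = restrict (u V h) (V \<inter> Z)"
        using res V h unfolding field_restricts_to_def by auto
      ultimately show ?thesis using W(2) by (simp add: Int_absorb1)
    qed
    have null: "(\<Sum>j<n. g j y * w' W (restrict (f j) W) y) = 0" if "w' \<in> vector_fields Y \<O>Z W" "y \<in> W" for w' y
      using nc W that unfolding null_comb_def by blast
    \<comment> \<open>The form vanishes both on \<open>w\<close> and on the commutator of \<open>v\<close> and \<open>w\<close>, the two terms of Cartan's formula.\<close>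
    have null_w: "(\<lambda>y\<in>W. \<Sum>j<n. restrict (g j) W y * w W (restrict (f j) W) y) = (\<lambda>y\<in>W. 0)"
      using null[OF w] by (intro restrict_ext) simp
    have br: "lie_bracket Y \<O>Z W v w \<in> vector_fields Y \<O>Z W"
      using A.Z.lie_bracket_vector_field[OF v w W(1,2)] .
    have "0 - 0 = (\<Sum>j<n. v W (restrict (g j) W) x * w W (restrict (f j) W) x) +
        (\<Sum>j<n. restrict (g j) W x * w W (v W (restrict (f j) W)) x)"
      using A.Z.lie_derivative_comb[OF v w W(1,2) rW[OF gf(1)] rW[OF gf(2)] x, of n "\<lambda>j. j" "\<lambda>j. j"]
        null_w A.Z.vector_fieldD(3)[OF v W(1,2), of 0] null[OF br x] x by simp
    also have "\<dots> = (\<Sum>j<n. u V (g j) x * w W (restrict (f j) W) x) + (\<Sum>j<n. g j x * w W (restrict (u V (f j)) W) x)"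
      using vu gf x by simp
    also have "\<dots> = (\<Sum>j<n + n. G j x * w W (restrict (E j) W) x)"
      using GE[of x "\<lambda>h. w W (restrict h W) x"] by simp
    finally show "(\<Sum>j<n + n. G j x * w W (restrict (E j) W) x) = 0" by simp
  qed
  moreover have "lie_derivative X \<O> V u (lin_comb X \<O> V n g f) = lin_comb X \<O> V (n + n) G E"
    unfolding lie_derivative_def lin_comb_def[of _ _ _ "n + n"]
  proof (rule family_eqI)
    fix W w x assume W: "openin X W" "W \<subseteq> V" and w: "w \<in> vector_fields X \<O> W" and x: "x \<in> W"
    have rW: "restrict h W \<in> \<O> W" if "h \<in> \<O> V" for h using restr[OF V W that] .
    have uW: "u W (restrict h W) = restrict (u V h) W" if "h \<in> \<O> V" for h using uD(6)[OF W that] .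
    have br: "lie_bracket X \<O> W u w \<in> vector_fields X \<O> W" using lie_bracket_vector_field[OF u w W] .
    have "lin_comb X \<O> V n g f W w = (\<lambda>x\<in>W. \<Sum>j<n. restrict (g j) W x * w W (restrict (f j) W) x)"
      using lin_comb_apply[OF W w, of n g f] by (auto intro!: restrict_ext)
    moreover have "lin_comb X \<O> V n g f W (lie_bracket X \<O> W u w) x =
        (\<Sum>j<n. restrict (g j) W x * lie_bracket X \<O> W u w W (restrict (f j) W) x)"
      using lin_comb_apply[OF W br, of n g f] x by simp
    ultimately have "u W (lin_comb X \<O> V n g f W w) x - lin_comb X \<O> V n g f W (lie_bracket X \<O> W u w) x =
        (\<Sum>j<n. u W (restrict (g j) W) x * w W (restrict (f j) W) x) +
        (\<Sum>j<n. restrict (g j) W x * w W (u W (restrict (f j) W)) x)"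
      using lie_derivative_comb[OF u w W rW[OF gf(1)] rW[OF gf(2)] x, of n "\<lambda>j. j" "\<lambda>j. j"] by simp
    also have "\<dots> = (\<Sum>j<n. u V (g j) x * w W (restrict (f j) W) x) + (\<Sum>j<n. g j x * w W (restrict (u V (f j)) W) x)"
      using uW gf x by simp
    also have "\<dots> = (\<Sum>j<n + n. G j x * w W (restrict (E j) W) x)"
      using GE[of x "\<lambda>h. w W (restrict h W) x"] by simp
    finally show "u W (lin_comb X \<O> V n g f W w) x - lin_comb X \<O> V n g f W (lie_bracket X \<O> W u w) x =
      (\<Sum>j<n + n. G j x * w W (restrict (E j) W) x)" .
  qed
  ultimately show ?thesis unfolding u_def by (rule that)
qed

text \<open>In \<open>{p, f s} = f {p, s} + \<pi>(p)(f) s\<close> both coefficients \<open>f\<close> and \<open>\<pi>(p)(f)\<close> vanish on \<open>Z\<close>.\<close>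

lemma bracket_ideal_multiples:
  assumes V: "openin X V" and p: "p \<in> tangent_sections V" and r: "r \<in> ideal_multiples \<O> Q Z V"
  shows "bracket Q V p r \<in> ideal_multiples \<O> Q Z V"
proof -
  have pQ: "p \<in> carrier (Mod Q V)" using p by (simp add: tangent_sections_def)
  interpret V: abelian_group "Mod Q V" using sections_abelian_group[OF V] .
  show ?thesis
    using V r
  proof (induction rule: ideal_multiples_induct)
    case zero
    have "bracket Q V p \<zero>\<^bsub>Mod Q V\<^esub> = bracket Q V p \<zero>\<^bsub>Mod Q V\<^esub> \<oplus>\<^bsub>Mod Q V\<^esub> bracket Q V p \<zero>\<^bsub>Mod Q V\<^esub>"
      using bracket_add[OF V, of "\<zero>\<^bsub>Mod Q V\<^esub>" "\<zero>\<^bsub>Mod Q V\<^esub>" p] pQ V by simp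
    then have "bracket Q V p \<zero>\<^bsub>Mod Q V\<^esub> = \<zero>\<^bsub>Mod Q V\<^esub>"
      using bracket_closed[OF V pQ, of "\<zero>\<^bsub>Mod Q V\<^esub>"] V by simp
    then show ?case using ideal_multiples_zero[OF V] by simp
  next
    case (add x f s)
    have xr: "f \<odot>\<^bsub>Mod Q V\<^esub> s \<in> carrier (Mod Q V)" using V add.hyps by simp
    have pf: "anchor Q V p V f \<in> \<O> V" using vector_fieldD(1)[OF anchor_simps(1)[OF V pQ] V subset_refl add.hyps(2)] .
    have pf0: "anchor Q V p V f y = 0" if "y \<in> V \<inter> Z" for y
      by (rule tangent_sectionsD[OF p V subset_refl add.hyps(2)]) (use add.hyps(3) that in auto)
    have "bracket Q V p (x \<oplus>\<^bsub>Mod Q V\<^esub> f \<odot>\<^bsub>Mod Q V\<^esub> s) = bracket Q V p x \<oplus>\<^bsub>Mod Q V\<^esub> bracket Q V p (f \<odot>\<^bsub>Mod Q V\<^esub> s)"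
      using bracket_add[OF V add.hyps(1) xr pQ] by simp
    also have "bracket Q V p (f \<odot>\<^bsub>Mod Q V\<^esub> s) = f \<odot>\<^bsub>Mod Q V\<^esub> bracket Q V p s \<oplus>\<^bsub>Mod Q V\<^esub> anchor Q V p V f \<odot>\<^bsub>Mod Q V\<^esub> s"
      using bracket_smult[OF V add.hyps(2) pQ add.hyps(4)] .
    finally show ?case
      using A.R_simps(3)[OF V add.IH] A.R_simps(3)[OF V] A.R_ideal[OF V add.hyps(2,3) bracket_closed[OF V pQ add.hyps(4)]]
        A.R_ideal[OF V pf pf0 add.hyps(4)] by simp
  qed
qed

lemma represented_conormal [simp]: "A.represented conormal_sections = N"
  and represented_tangent [simp]: "A.represented tangent_sections = F"
  by (simp_all add: conormal_image_eq fibre_product_eq)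

lemma subpresheaf_conormal: "A.subpresheaf conormal_sections"
  by (simp add: A.subpresheaf_def submodule_conormal_sections conormal_sections_Res)

lemma subpresheaf_tangent: "A.subpresheaf tangent_sections"
  by (simp add: A.subpresheaf_def submodule_tangent_sections tangent_sections_Res)

lemmas gsec_NI = A.gsec_representedI [OF subpresheaf_conormal, unfolded represented_conormal]
lemmas gsec_N_split = A.gsec_represented_split [OF subpresheaf_conormal, unfolded represented_conormal]
lemmas gsec_F_split = A.gsec_represented_split [OF subpresheaf_tangent, unfolded represented_tangent]
lemmas gsec_N = A.gsec_represented [OF subpresheaf_conormal, unfolded represented_conormal]
lemmas gsec_F = A.gsec_represented [OF subpresheaf_tangent, unfolded represented_tangent]
lemmas subsheaf_N = A.subsheaf_represented [OF subpresheaf_conormal, unfolded represented_conormal]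
lemmas subsheaf_F = A.subsheaf_represented [OF subpresheaf_tangent, unfolded represented_tangent]

text \<open>Upstairs, \<open>n\<close> is locally the sum of \<open>\<pi>\<^sup>\<dagger>(\<alpha>)\<close> with \<open>\<alpha>\<close> conormal and of a multiple of the ideal of \<open>Z\<close>. The bracket with
  the first is \<open>\<pi>\<^sup>\<dagger>\<close> of a Lie derivative, and multiples of the ideal are preserved.\<close>

lemma bracket_tangent_conormal:
  assumes V: "openin X V" and p: "p \<in> tangent_sections V" and n: "n \<in> carrier (Mod Q V)" "A.gsec V n \<in> N (V \<inter> Z)"
  shows "A.gsec V (bracket Q V p n) \<in> N (V \<inter> Z)"
proof (rule gsec_NI[OF V])
  have pQ: "p \<in> carrier (Mod Q V)" using p by (simp add: tangent_sections_def)
  show "bracket Q V p n \<in> carrier (Mod Q V)" using bracket_closed[OF V pQ n(1)] .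
  fix z assume "z \<in> V \<inter> Z"
  then have z: "z \<in> V" "z \<in> Z" by auto
  obtain V' s r where V': "openin X V'" "z \<in> V'" "V' \<subseteq> V" "s \<in> conormal_sections V'" "r \<in> ideal_multiples \<O> Q Z V'"
    "Res Q V V' n = s \<oplus>\<^bsub>Mod Q V'\<^esub> r"
    by (rule gsec_N_split[OF V n z])
  obtain T m g f where T: "openin X T" "z \<in> T" "T \<subseteq> V'" "null_comb T m g f"
    "Res Q V' T s = coanchor Q T (lin_comb X \<O> T m g f)"
    by (rule conormal_sections_rep[OF V'(1,4,2) z(2) V'(1,2)]) blast
  have TV: "T \<subseteq> V" using T V' by auto
  define pT rT \<alpha> where "pT = Res Q V T p" and "rT = Res Q V' T r" and "\<alpha> = lin_comb X \<O> T m g f"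
  have pT: "pT \<in> tangent_sections T" "pT \<in> carrier (Mod Q T)"
    unfolding pT_def using tangent_sections_Res[OF V T(1) TV p] Res_closed[OF V T(1) TV pQ] by auto
  have rT: "rT \<in> ideal_multiples \<O> Q Z T" unfolding rT_def using A.R_Res[OF V'(1) T(1,3) V'(5)] .
  have \<alpha>: "\<alpha> \<in> one_forms X \<O> T" unfolding \<alpha>_def by (rule null_comb_one_form[OF T(4)])
  have sr: "s \<in> carrier (Mod Q V')" "r \<in> carrier (Mod Q V')"
    using V'(4) A.R_simps(1)[OF V'(1,5)] by (auto simp: conormal_sections_def)
  have "Res Q V T n = Res Q V' T (Res Q V V' n)" using Res_Res[OF V V'(1) T(1,3) V'(3) n(1)] by simp
  also have "\<dots> = coanchor Q T \<alpha> \<oplus>\<^bsub>Mod Q T\<^esub> rT"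
    using Res_add[OF V'(1) T(1,3) sr] V'(6) T(5) by (simp add: \<alpha>_def rT_def)
  finally have nT: "Res Q V T n = coanchor Q T \<alpha> \<oplus>\<^bsub>Mod Q T\<^esub> rT" .
  have "Res Q V T (bracket Q V p n) = bracket Q T pT (coanchor Q T \<alpha> \<oplus>\<^bsub>Mod Q T\<^esub> rT)"
    using bracket_Res[OF V T(1) TV pQ n(1)] nT by (simp add: pT_def)
  also have "\<dots> = coanchor Q T (lie_derivative X \<O> T (anchor Q T pT) \<alpha>) \<oplus>\<^bsub>Mod Q T\<^esub> bracket Q T pT rT"
    using bracket_add[OF T(1) coanchor_simps(1)[OF T(1) \<alpha>] A.R_simps(1)[OF T(1) rT] pT(2)] bracket_coanchor[OF T(1) pT(2) \<alpha>] by simp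
  finally have eq: "Res Q V T (bracket Q V p n) =
      coanchor Q T (lie_derivative X \<O> T (anchor Q T pT) \<alpha>) \<oplus>\<^bsub>Mod Q T\<^esub> bracket Q T pT rT" .
  obtain k h e where "null_comb T k h e" "lie_derivative X \<O> T (anchor Q T pT) \<alpha> = lin_comb X \<O> T k h e"
    unfolding \<alpha>_def by (rule lie_derivative_null_comb[OF T(4) pT(1)])
  then have "coanchor Q T (lie_derivative X \<O> T (anchor Q T pT) \<alpha>) \<in> conormal_sections T"
    using coanchor_null_comb(1) by simp
  then show "\<exists>V' s r. openin X V' \<and> z \<in> V' \<and> V' \<subseteq> V \<and> s \<in> conormal_sections V' \<and> r \<in> ideal_multiples \<O> Q Z V' \<and>
      Res Q V V' (bracket Q V p n) = s \<oplus>\<^bsub>Mod Q V'\<^esub> r"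
    using T TV eq bracket_ideal_multiples[OF T(1) pT(1) rT] by blast
qed

lemma ideal_multiples_tangent:
  assumes V: "openin X V" and r: "r \<in> ideal_multiples \<O> Q Z V"
  shows "r \<in> tangent_sections V"
  using V r
proof (induction rule: ideal_multiples_induct)
  case zero
  then show ?case using submodule_simps(2)[OF V submodule_tangent_sections[OF V]] .
next
  case (add x f s)
  have "f \<odot>\<^bsub>Mod Q V\<^esub> s \<in> tangent_sections V"
  proof (rule tangent_sectionsI)
    show "f \<odot>\<^bsub>Mod Q V\<^esub> s \<in> carrier (Mod Q V)" using V add.hyps by simp
    fix W h y assume W: "openin X W" "W \<subseteq> V" "h \<in> \<O> W" "y \<in> W" "y \<in> Z"
    have "f y = 0" by (rule add.hyps(3)) (use W in auto)
    then show "anchor Q V (f \<odot>\<^bsub>Mod Q V\<^esub> s) W h y = 0"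
      using anchor_simps(3)[OF V add.hyps(2,4) W(1-4)] by simp
  qed
  then show ?case using submodule_simps(3)[OF V submodule_tangent_sections[OF V] add.IH] by simp
qed

text \<open>Tangency of the anchor depends only on the class in \<open>i\<^sup>*\<Q>\<close>, because multiples of the ideal of \<open>Z\<close> have tangent
  anchor.\<close>

lemma tangent_if_gsec_F:
  assumes V: "openin X V" and q: "q \<in> carrier (Mod Q V)" and qF: "A.gsec V q \<in> F (V \<inter> Z)"
  shows "q \<in> tangent_sections V"
proof (rule tangent_sectionsI[OF q])
  fix W h y assume W: "openin X W" "W \<subseteq> V" "h \<in> \<O> W" "\<And>y. y \<in> W \<inter> Z \<Longrightarrow> h y = 0" "y \<in> W" "y \<in> Z"
  have yV: "y \<in> V" using W by auto
  obtain V' s r where V': "openin X V'" "y \<in> V'" "V' \<subseteq> V" "s \<in> tangent_sections V'" "r \<in> ideal_multiples \<O> Q Z V'"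
    "Res Q V V' q = s \<oplus>\<^bsub>Mod Q V'\<^esub> r"
    by (rule gsec_F_split[OF V q qF yV W(6)])
  then have t: "Res Q V V' q \<in> tangent_sections V'"
    using submodule_simps(3)[OF V'(1) submodule_tangent_sections[OF V'(1)] V'(4) ideal_multiples_tangent[OF V'(1,5)]] by simp
  define T where "T = V' \<inter> W"
  have T: "openin X T" "y \<in> T" "T \<subseteq> V'" "T \<subseteq> W" using V' W by (auto simp: T_def)
  have "anchor Q V q W h y = anchor Q V q T (restrict h T) y"
    using vector_field_restrict[OF anchor_simps(1)[OF V q] W(1,2) T(1,4) W(3) T(2)] by simp
  also have "\<dots> = anchor Q V' (Res Q V V' q) T (restrict h T) y"
    using anchor_Res_apply[OF V q V'(1,3) T(1,3)] by simp
  also have "\<dots> = 0"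
    by (rule tangent_sectionsD[OF t T(1,3) restr[OF W(1) T(1,4) W(3)]]) (use W(4,6) T in auto)
  finally show "anchor Q V q W h y = 0" .
qed

lemma bracket_tangent:
  assumes V: "openin X V" and p: "p \<in> tangent_sections V" and q: "q \<in> tangent_sections V"
  shows "bracket Q V p q \<in> tangent_sections V"
proof (rule tangent_sectionsI)
  have pq: "p \<in> carrier (Mod Q V)" "q \<in> carrier (Mod Q V)" using p q by (auto simp: tangent_sections_def)
  show "bracket Q V p q \<in> carrier (Mod Q V)" using bracket_closed[OF V pq] .
  fix W h y assume W: "openin X W" "W \<subseteq> V" "h \<in> \<O> W" "\<And>y. y \<in> W \<inter> Z \<Longrightarrow> h y = 0" "y \<in> W" "y \<in> Z"
  have "anchor Q V p W (anchor Q V q W h) y = 0"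
    by (rule tangent_sectionsD[OF p W(1,2) vector_fieldD(1)[OF anchor_simps(1)[OF V pq(2)] W(1-3)] _ W(5,6)])
      (use tangent_sectionsD[OF q W(1-4)] in auto)
  moreover have "anchor Q V q W (anchor Q V p W h) y = 0"
    by (rule tangent_sectionsD[OF q W(1,2) vector_fieldD(1)[OF anchor_simps(1)[OF V pq(1)] W(1-3)] _ W(5,6)])
      (use tangent_sectionsD[OF p W(1-4)] in auto)
  ultimately show "anchor Q V (bracket Q V p q) W h y = 0"
    using anchor_bracket[OF V pq] W by (simp add: lie_bracket_def family_def)
qed

lemma differential_null_comb:
  assumes V: "openin X V" and h: "h \<in> \<O> V" "\<And>y. y \<in> V \<inter> Z \<Longrightarrow> h y = 0"
  shows "null_comb V 1 (\<lambda>_. \<lambda>x\<in>V. 1) (\<lambda>_. h)"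
    and "differential X \<O> V h = lin_comb X \<O> V 1 (\<lambda>_. \<lambda>x\<in>V. 1) (\<lambda>_. h)"
proof -
  show "null_comb V 1 (\<lambda>_. \<lambda>x\<in>V. 1) (\<lambda>_. h)"
    unfolding null_comb_def
  proof (intro conjI allI impI V)
    fix W w x assume W: "openin Y W \<and> W \<subseteq> V \<inter> Z \<and> w \<in> vector_fields Y \<O>Z W \<and> x \<in> W"
    have "restrict h W = (\<lambda>x\<in>W. 0)" by (rule restrict_ext) (use W h(2) in auto)
    then show "(\<Sum>j<1. (\<lambda>x\<in>V. 1) x * w W (restrict h W) x) = 0"
      using A.Z.vector_fieldD(3)[of w W W 0] W by auto
  qed (use const[OF V] h in auto)
  show "differential X \<O> V h = lin_comb X \<O> V 1 (\<lambda>_. \<lambda>x\<in>V. 1) (\<lambda>_. h)"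
    unfolding differential_def lin_comb_def by (rule family_eqI) auto
qed

section \<open>Orthogonality of tangent and conormal sections\<close>

lemma pairing_zero:
  assumes V: "openin X V" "p \<in> carrier (Mod Q V)" "z \<in> V"
  shows "pairing Q V \<zero>\<^bsub>Mod Q V\<^esub> p z = 0"
proof -
  have "pairing Q V \<zero>\<^bsub>Mod Q V\<^esub> p = (\<lambda>x\<in>V. (\<lambda>x\<in>V. 0) x * pairing Q V \<zero>\<^bsub>Mod Q V\<^esub> p x)"
    using pairing_smult[OF V(1) const[OF V(1), of 0] section_simps(1)[OF V(1)] V(2)]
      smult_zero_left[OF V(1) section_simps(1)[OF V(1)]] by simp
  from arg_cong[where f = "\<lambda>f. f z", OF this] show ?thesis using V(3) by simp
qed

lemma pairing_ideal_multiples: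
  assumes V: "openin X V" and r: "r \<in> ideal_multiples \<O> Q Z V" and p: "p \<in> carrier (Mod Q V)" and z: "z \<in> V" "z \<in> Z"
  shows "pairing Q V r p z = 0"
  using V r
proof (induction rule: ideal_multiples_induct)
  case zero
  then show ?case using pairing_zero[OF V p z(1)] .
next
  case (add x f s)
  have "f z = 0" by (rule add.hyps(3)) (use z in auto)
  then show ?case
    using pairing_add[OF V add.hyps(1) _ p, of "f \<odot>\<^bsub>Mod Q V\<^esub> s"] pairing_smult[OF V add.hyps(2,4) p] add.IH add.hyps V z by simp
qed

lemma pairing_minus:
  assumes V: "openin X V" and "p \<in> carrier (Mod Q V)" "q \<in> carrier (Mod Q V)" "r \<in> carrier (Mod Q V)" and z: "z \<in> V"
  shows "pairing Q V (p \<ominus>\<^bsub>Mod Q V\<^esub> q) r z = pairing Q V p r z - pairing Q V q r z"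
  using pairing_add[OF V, of "p \<ominus>\<^bsub>Mod Q V\<^esub> q" q r] section_arith(1)[OF V, of p q] assms by simp

lemma pairing_Res_at:
  assumes "openin X U" "openin X V" "V \<subseteq> U" "p \<in> carrier (Mod Q U)" "q \<in> carrier (Mod Q U)" "z \<in> V"
  shows "pairing Q V (Res Q U V p) (Res Q U V q) z = pairing Q U p q z"
  using pairing_Res[OF assms(1-5)] assms(6) by (metis restrict_apply')

text \<open>Two representatives differ by a multiple of the ideal of \<open>Z\<close>, whose pairings vanish on \<open>Z\<close>.\<close>

lemma pairing_cls_left:
  assumes V: "openin X V" "z \<in> V" "p \<in> carrier (Mod Q V)" "q \<in> carrier (Mod Q V)"
    and V': "openin X V'" "z \<in> V'" "p' \<in> carrier (Mod Q V')" "q' \<in> carrier (Mod Q V')" and z: "z \<in> Z"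
    and T: "openin X T" "z \<in> T" "T \<subseteq> V" "T \<subseteq> V'" and q: "Res Q V T q = Res Q V' T q'"
    and eq: "A.cls z V p = A.cls z V' p'"
  shows "pairing Q V p q z = pairing Q V' p' q' z"
proof -
  obtain W where W: "openin X W" "z \<in> W" "W \<subseteq> V" "W \<subseteq> V'"
      "Res Q V W p \<ominus>\<^bsub>Mod Q W\<^esub> Res Q V' W p' \<in> ideal_multiples \<O> Q Z W"
    by (rule A.cls_eqE[OF V(1-3) V'(1-3) eq])
  define S where "S = T \<inter> W"
  have S: "openin X S" "z \<in> S" "S \<subseteq> T" "S \<subseteq> W" "S \<subseteq> V" "S \<subseteq> V'" using T W by (auto simp: S_def)
  have "Res Q V S p \<ominus>\<^bsub>Mod Q S\<^esub> Res Q V' S p' \<in> ideal_multiples \<O> Q Z S"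
    using A.R_Res[OF W(1) S(1,4) W(5)] V V' W S by (simp add: Res_minus Res_closed Res_Res)
  then have "pairing Q S (Res Q V S p \<ominus>\<^bsub>Mod Q S\<^esub> Res Q V' S p') (Res Q V S q) z = 0"
    using S V z by (intro pairing_ideal_multiples) (auto simp: Res_closed)
  moreover have "Res Q V S q = Res Q V' S q'"
    using Res_Res[OF V(1) T(1) S(1,3) T(3) V(4)] Res_Res[OF V'(1) T(1) S(1,3) T(4) V'(4)] q by simp
  ultimately have "pairing Q S (Res Q V S p) (Res Q V S q) z = pairing Q S (Res Q V' S p') (Res Q V' S q') z"
    using pairing_minus[OF S(1), of "Res Q V S p" "Res Q V' S p'" "Res Q V S q" z] V V' S by (simp add: Res_closed)
  then show ?thesis using pairing_Res_at V V' S by simp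
qed

lemma pairing_cls:
  assumes V: "openin X V" "z \<in> V" "p \<in> carrier (Mod Q V)" "q \<in> carrier (Mod Q V)"
    and V': "openin X V'" "z \<in> V'" "p' \<in> carrier (Mod Q V')" "q' \<in> carrier (Mod Q V')" and z: "z \<in> Z"
    and eq: "A.cls z V p = A.cls z V' p'" "A.cls z V q = A.cls z V' q'"
  shows "pairing Q V p q z = pairing Q V' p' q' z"
proof -
  define T where "T = V \<inter> V'"
  have T: "openin X T" "z \<in> T" "T \<subseteq> V" "T \<subseteq> V'" using V V' by (auto simp: T_def)
  have c: "Res Q V' T p' \<in> carrier (Mod Q T)" "Res Q V T q \<in> carrier (Mod Q T)" using V V' T by (auto simp: Res_closed)
  have "pairing Q V p q z = pairing Q T (Res Q V' T p') (Res Q V T q) z"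
    using c V V' T eq(1) z by (intro pairing_cls_left[of _ _ _ _ _ _ _ T]) (auto simp: A.cls_Res Res_id)
  also have "\<dots> = pairing Q T (Res Q V T q) (Res Q V' T p') z" using pairing_sym[OF T(1) c] by simp
  also have "\<dots> = pairing Q V' q' p' z"
    using c V V' T eq(2) z by (intro pairing_cls_left[of _ _ _ _ _ _ _ T]) (auto simp: A.cls_Res Res_id)
  also have "\<dots> = pairing Q V' p' q' z" using pairing_sym[OF V'(1,4,3)] by simp
  finally show ?thesis .
qed

lemma restr_pairing_eq:
  assumes "openin X V" "z \<in> V" "p \<in> carrier (Mod Q V)" "q \<in> carrier (Mod Q V)" "z \<in> W" "z \<in> Z"
    "\<sigma> z = A.cls z V p" "\<tau> z = A.cls z V q"
  shows "restr_pairing X Q W \<sigma> \<tau> z = pairing Q V p q z"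
proof -
  have "{pairing Q V p q z | V p q. (V, p) \<in> \<sigma> z \<and> (V, q) \<in> \<tau> z} = {pairing Q V p q z}" (is "?L = ?R")
  proof
    show "?L \<subseteq> ?R"
    proof
      fix c assume "c \<in> ?L"
      then obtain V' p' q' where c: "c = pairing Q V' p' q' z" "(V', p') \<in> \<sigma> z" "(V', q') \<in> \<tau> z" by blast
      then show "c \<in> ?R"
        using assms A.mem_cls_iff[of V z p] A.mem_cls_iff[of V z q] pairing_cls[of V z p q V' p' q'] by simp
    qed
    show "?R \<subseteq> ?L" using assms A.mem_cls_iff[of V z p V p] A.mem_cls_iff[of V z q V q] by blast
  qed
  then show ?thesis using assms(5) by (simp add: restr_pairing_def)
qed

lemma restr_pairing_rep:
  assumes "A.rep W \<sigma> V p" "A.rep W \<tau> V q" "z \<in> V" "z \<in> W" "z \<in> Z"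
  shows "restr_pairing X Q W \<sigma> \<tau> z = pairing Q V p q z"
  using assms by (intro restr_pairing_eq) (auto simp: A.rep_def)

lemma restr_pairing_sym:
  assumes W: "openin Y W" and st: "\<sigma> \<in> carrier (Mod A.Quo W)" "\<tau> \<in> carrier (Mod A.Quo W)" and z: "z \<in> W"
  shows "restr_pairing X Q W \<sigma> \<tau> z = restr_pairing X Q W \<tau> \<sigma> z"
proof -
  have zZ: "z \<in> Z" using A.open_in_Z[OF W] z by auto
  obtain V s t where V: "z \<in> V" "A.rep W \<sigma> V s" "A.rep W \<tau> V t" by (rule A.rep_exists2[OF st z])
  then have c: "openin X V" "s \<in> carrier (Mod Q V)" "t \<in> carrier (Mod Q V)" by (auto simp: A.rep_def)
  show ?thesis
    using restr_pairing_rep[OF V(2,3,1) z zZ] restr_pairing_rep[OF V(3,2,1) z zZ] pairing_sym[OF c] by simp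
qed

lemma restr_pairing_add:
  assumes W: "openin Y W" and st: "\<sigma> \<in> carrier (Mod A.Quo W)" "\<tau> \<in> carrier (Mod A.Quo W)" "\<upsilon> \<in> carrier (Mod A.Quo W)" and z: "z \<in> W"
  shows "restr_pairing X Q W (\<sigma> \<oplus>\<^bsub>Mod A.Quo W\<^esub> \<tau>) \<upsilon> z = restr_pairing X Q W \<sigma> \<upsilon> z + restr_pairing X Q W \<tau> \<upsilon> z"
proof -
  have zZ: "z \<in> Z" using A.open_in_Z[OF W] z by auto
  obtain V s t u where V: "z \<in> V" "A.rep W \<sigma> V s" "A.rep W \<tau> V t" "A.rep W \<upsilon> V u" by (rule A.rep_exists3[OF st z])
  then have c: "openin X V" "s \<in> carrier (Mod Q V)" "t \<in> carrier (Mod Q V)" "u \<in> carrier (Mod Q V)" by (auto simp: A.rep_def)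
  show ?thesis
    using restr_pairing_rep[OF A.rep_add[OF V(2,3)] V(4,1) z zZ] restr_pairing_rep[OF V(2,4,1) z zZ] restr_pairing_rep[OF V(3,4,1) z zZ]
      pairing_add[OF c] V(1) by simp
qed

text \<open>The pairing with \<open>\<pi>\<^sup>\<dagger>(\<alpha>)\<close> is \<open>\<alpha>(\<pi>(q))\<close>, and on \<open>Z\<close> this is the value of the restriction of \<open>\<alpha>\<close>, which is zero, on the
  restriction of \<open>\<pi>(q)\<close>.\<close>

lemma pairing_conormal_tangent:
  assumes V: "openin X V" and q: "q \<in> tangent_sections V" and s: "s \<in> conormal_sections V" and z: "z \<in> V" "z \<in> Z"
  shows "pairing Q V s q z = 0"
proof -
  have qs: "q \<in> carrier (Mod Q V)" "s \<in> carrier (Mod Q V)" using q s by (auto simp: tangent_sections_def conormal_sections_def)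
  obtain T n g f where T: "openin X T" "z \<in> T" "T \<subseteq> V" "null_comb T n g f" "Res Q V T s = coanchor Q T (lin_comb X \<O> T n g f)"
    by (rule conormal_sections_rep[OF V s z V z(1)]) blast
  have qT: "Res Q V T q \<in> tangent_sections T" "Res Q V T q \<in> carrier (Mod Q T)"
    using tangent_sections_Res[OF V T(1,3) q] Res_closed[OF V T(1,3) qs(1)] by auto
  define u where "u = anchor Q T (Res Q V T q)"
  have u: "u \<in> vector_fields X \<O> T" unfolding u_def by (rule anchor_simps(1)[OF T(1) qT(2)])
  obtain v where v: "v \<in> vector_fields Y \<O>Z (T \<inter> Z)" and res: "field_restricts_to X \<O> Z T u v"
    unfolding u_def by (rule tangent_restricts[OF T(1) qT(1)])
  have fO: "f j \<in> \<O> T" if "j < n" for j using T(4) that by (simp add: null_comb_def)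
  have "pairing Q V s q z = pairing Q T (Res Q V T q) (Res Q V T s) z"
    using pairing_Res_at[OF V T(1,3) qs T(2)] pairing_sym[OF V qs] by simp
  also have "\<dots> = lin_comb X \<O> T n g f T u z"
    using pairing_coanchor[OF T(1) qT(2) null_comb_one_form[OF T(4)]] T(5) by (simp add: u_def)
  also have "\<dots> = (\<Sum>j<n. g j z * u T (f j) z)"
    using lin_comb_apply[OF T(1) subset_refl u, of n g f] T(1,2) fO by simp
  also have "\<dots> = (\<Sum>j<n. g j z * v (T \<inter> Z) (restrict (f j) (T \<inter> Z)) z)"
    using field_restricts_toD[OF res T(1) subset_refl fO, of _ z] T(2) z(2) by (intro sum.cong) auto
  also have "\<dots> = 0"
    using T(4) v A.openin_Int_Z[OF T(1)] T(2) z(2) unfolding null_comb_def by blast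
  finally show ?thesis .
qed

lemma restr_pairing_N_F:
  assumes W: "openin Y W" and n: "n \<in> N W" and a: "a \<in> F W" and z: "z \<in> W"
  shows "restr_pairing X Q W n a z = 0"
proof -
  have zZ: "z \<in> Z" using A.open_in_Z[OF W] z by auto
  have n': "n \<in> A.represented conormal_sections W" and a': "a \<in> A.represented tangent_sections W" using n a by simp_all
  obtain U q where U: "openin X U" "z \<in> U" "U \<inter> Z \<subseteq> W" "q \<in> tangent_sections U" "restrict a (U \<inter> Z) = A.gsec U q"
    by (rule A.representedE[OF a' z])
  obtain V s where V: "openin X V" "z \<in> V" "V \<subseteq> U" "V \<inter> Z \<subseteq> W" "s \<in> conormal_sections V" "restrict n (V \<inter> Z) = A.gsec V s"
    by (rule A.represented_restrict[OF subpresheaf_conormal n' z U(1,2)])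
  have q: "q \<in> carrier (Mod Q U)" using U(4) by (simp add: tangent_sections_def)
  have s: "s \<in> carrier (Mod Q V)" using V(5) by (simp add: conormal_sections_def)
  have az: "a z = A.cls z V (Res Q U V q)"
    using U(5) A.cls_Res[OF U(1) V(1,3,2) q] U(2) zZ unfolding A.restrict_eq_gsec_iff by simp
  have nz: "n z = A.cls z V s" using V(6,2) zZ unfolding A.restrict_eq_gsec_iff by simp
  show ?thesis
    using restr_pairing_eq[OF V(1,2) s Res_closed[OF U(1) V(1,3) q] z zZ, of n a] az nz
      pairing_conormal_tangent[OF V(1) tangent_sections_Res[OF U(1) V(1,3) U(4)] V(5,2) zZ] by simp
qed

text \<open>For a function \<open>h\<close> vanishing on \<open>Z\<close> the form \<open>d h\<close> is conormal, and the pairing of \<open>q\<close> with \<open>\<pi>\<^sup>\<dagger>(d h)\<close> is \<open>\<pi>(q)(h)\<close>.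
  Orthogonality to all these sections says that \<open>\<pi>(q)\<close> preserves the ideal of \<open>Z\<close>.\<close>

lemma F_if_orthogonal:
  assumes U: "openin Y U" and a: "a \<in> carrier (Mod A.Quo U)"
    and perp: "\<And>V n. \<lbrakk>openin Y V; V \<subseteq> U; n \<in> N V\<rbrakk> \<Longrightarrow> restr_pairing X Q V (restrict a V) n = (\<lambda>x\<in>V. 0)"
  shows "a \<in> F U"
proof -
  have "a \<in> A.represented tangent_sections U"
  proof (rule A.representedI[OF U a])
    fix z assume z: "z \<in> U"
    have top: "openin X (topspace X)" "z \<in> topspace X" using z A.open_in_Z[OF U] Z_topspace by auto
    obtain V q where V: "openin X V" "z \<in> V" "V \<inter> Z \<subseteq> U" "q \<in> carrier (Mod Q V)" "restrict a (V \<inter> Z) = A.gsec V q"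
      by (rule A.gsec_exists[OF U a z top]) blast
    have "q \<in> tangent_sections V"
    proof (rule tangent_sectionsI[OF V(4)])
      fix W h y assume W: "openin X W" "W \<subseteq> V" and h: "h \<in> \<O> W" "\<And>y. y \<in> W \<inter> Z \<Longrightarrow> h y = 0" and y: "y \<in> W" "y \<in> Z"
      \<comment> \<open>The form \<open>d h\<close>, which is conormal.\<close>
      define \<alpha> where "\<alpha> = lin_comb X \<O> W 1 (\<lambda>_. \<lambda>x\<in>W. 1) (\<lambda>_. h)"
      have nc: "null_comb W 1 (\<lambda>_. \<lambda>x\<in>W. 1) (\<lambda>_. h)" by (rule differential_null_comb(1)[OF W(1) h])
      have \<alpha>: "\<alpha> \<in> one_forms X \<O> W" unfolding \<alpha>_def by (rule null_comb_one_form[OF nc])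
      have c\<alpha>: "coanchor Q W \<alpha> \<in> conormal_sections W" "coanchor Q W \<alpha> \<in> carrier (Mod Q W)"
        using coanchor_null_comb(1)[OF nc] coanchor_simps(1)[OF W(1) \<alpha>] by (auto simp: \<alpha>_def)
      have n: "A.gsec W (coanchor Q W \<alpha>) \<in> N (W \<inter> Z)" by (rule gsec_N[OF W(1) c\<alpha>(1)])
      have qW: "Res Q V W q \<in> carrier (Mod Q W)" using Res_closed[OF V(1) W V(4)] .
      have u: "anchor Q W (Res Q V W q) \<in> vector_fields X \<O> W" by (rule anchor_simps(1)[OF W(1) qW])
      have "restrict a (W \<inter> Z) = restrict (restrict a (V \<inter> Z)) (W \<inter> Z)" using W(2) by (auto simp: fun_eq_iff restrict_def)
      then have aW: "restrict a (W \<inter> Z) = A.gsec W (Res Q V W q)"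
        using A.gsec_Res[OF V(1) W V(4)] V(5) by simp
      have WU: "W \<inter> Z \<subseteq> U" using W(2) V(3) by auto
      have "restr_pairing X Q (W \<inter> Z) (restrict a (W \<inter> Z)) (A.gsec W (coanchor Q W \<alpha>)) y = 0"
        using fun_cong[OF perp[OF A.openin_Int_Z[OF W(1)] WU n], of y] y by simp
      then have "pairing Q W (Res Q V W q) (coanchor Q W \<alpha>) y = 0"
        using restr_pairing_rep[OF A.rep_gsec[OF W(1) qW] A.rep_gsec[OF W(1) c\<alpha>(2)] y(1) _ y(2)] y aW by simp
      then have "anchor Q W (Res Q V W q) W h y = 0"
        using pairing_coanchor[OF W(1) qW \<alpha>] lin_comb_apply[OF W(1) subset_refl u, of 1 "\<lambda>_. \<lambda>x\<in>W. 1" "\<lambda>_. h"] y W(1) h(1)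
        by (simp add: \<alpha>_def)
      then show "anchor Q V q W h y = 0" using anchor_Res_apply[OF V(1,4) W W(1) subset_refl] by simp
    qed
    then show "\<exists>V s. openin X V \<and> z \<in> V \<and> V \<inter> Z \<subseteq> U \<and> s \<in> tangent_sections V \<and> restrict a (V \<inter> Z) = A.gsec V s"
      using V by blast
  qed
  then show ?thesis by simp
qed

section \<open>The inverse image Courant algebroid as a quotient\<close>

abbreviation "FS \<equiv> fibre_product_sheaf X \<O> Q Z"
abbreviation "PC \<equiv> pullback_courant X \<O> Q Z"
abbreviation "proj \<equiv> germ_section Y FS N Z"

lemma topspace_Y: "topspace Y = Z"
  using Z_topspace by auto

lemma FS_eq: "FS = \<lparr>Mod = (\<lambda>W. (Mod A.Quo W)\<lparr>carrier := F W\<rparr>), Res = Res A.Quo\<rparr>"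
  by (simp add: fibre_product_sheaf_def iQ_eq)

lemma N_subset_F: "N W \<subseteq> F W"
proof
  fix \<sigma> assume \<sigma>: "\<sigma> \<in> N W"
  then have \<sigma>': "\<sigma> \<in> A.represented conormal_sections W" by simp
  have "\<sigma> \<in> A.represented tangent_sections W"
  proof (rule A.representedI)
    show "openin Y W" "\<sigma> \<in> carrier (Mod A.Quo W)" using \<sigma> by (auto simp: conormal_image_def iQ_eq)
    fix z assume z: "z \<in> W"
    obtain V s where "openin X V" "z \<in> V" "V \<inter> Z \<subseteq> W" "s \<in> conormal_sections V" "restrict \<sigma> (V \<inter> Z) = A.gsec V s"
      by (rule A.representedE[OF \<sigma>' z])
    then show "\<exists>V s. openin X V \<and> z \<in> V \<and> V \<inter> Z \<subseteq> W \<and> s \<in> tangent_sections V \<and> restrict \<sigma> (V \<inter> Z) = A.gsec V s"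
      using conormal_subset_tangent by blast
  qed
  then show "\<sigma> \<in> F W" by simp
qed

sublocale G: germ_quotient Y \<O>Z FS N Z
  using A.Q.quotient_map_subsheaves(1)[OF subsheaf_F subsheaf_N N_subset_F]
  by (simp only: FS_eq topspace_Y)

lemma PC_simps:
  "Mod PC = Mod (restr_quot Y \<O>Z FS N Z)" "Res PC = Res (restr_quot Y \<O>Z FS N Z)"
  by (simp_all add: pullback_courant_def pullback_module_def)

lemma quotient_map_PC: "quotient_map Y \<O>Z A.Quo PC F N proj"
proof (rule quotient_map_cong[OF _ PC_simps])
  show "quotient_map Y \<O>Z A.Quo (restr_quot Y \<O>Z FS N Z) F N proj"
    using A.Q.quotient_map_subsheaves(2)[OF subsheaf_F subsheaf_N N_subset_F]
    by (simp only: FS_eq topspace_Y)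
qed

lemma FS_simps [simp]:
  "carrier (Mod FS W) = F W" "a \<oplus>\<^bsub>Mod FS W\<^esub> b = a \<oplus>\<^bsub>Mod A.Quo W\<^esub> b" "Res FS W W' a = restrict a W'"
  by (simp_all add: FS_eq)

text \<open>The opposite of a section is defined by the carrier of the module, so that differences in the fibre
  product have to be compared with those in \<open>i\<^sup>*\<Q>\<close>.\<close>

lemma FS_minus:
  assumes W: "openin Y W" and a: "a \<in> F W" and b: "b \<in> F W"
  shows "a \<ominus>\<^bsub>Mod FS W\<^esub> b = a \<ominus>\<^bsub>Mod A.Quo W\<^esub> b"
proof -
  define d where "d = a \<ominus>\<^bsub>Mod FS W\<^esub> b"
  have d: "d \<in> F W" using G.section_simps(4)[OF W, of a b] a b by (simp add: d_def)
  have "d \<oplus>\<^bsub>Mod A.Quo W\<^esub> b = a" using G.section_arith(1)[OF W, of a b] a b by (simp add: d_def)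
  then have "a \<ominus>\<^bsub>Mod A.Quo W\<^esub> b = d"
    using A.Q.section_arith(2)[OF W, of d b] A.Q.subsheaf_simps(1)[OF subsheaf_F W] d b by auto
  then show ?thesis by (simp add: d_def)
qed

lemma PC_pairing: "pairing PC W s t = (\<lambda>z\<in>W. the_elem {restr_pairing X Q V a b z | V a b. (V, a) \<in> s z \<and> (V, b) \<in> t z})"
  by (simp add: pullback_courant_def)

lemma restr_pairing_cls:
  assumes V: "openin Y V" "z \<in> V" "a \<in> F V" "b \<in> F V" and V': "openin Y V'" "z \<in> V'" "a' \<in> F V'"
    and eq: "G.cls z V a = G.cls z V' a'" and T: "openin Y T" "z \<in> T" "T \<subseteq> V" "T \<subseteq> V'" "b' \<in> F V'" "restrict b T = restrict b' T"
  shows "restr_pairing X Q V a b z = restr_pairing X Q V' a' b' z"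
proof -
  obtain W where W: "openin Y W" "z \<in> W" "W \<subseteq> V" "W \<subseteq> V'" "Res FS V W a \<ominus>\<^bsub>Mod FS W\<^esub> Res FS V' W a' \<in> N W"
    by (rule G.cls_eqE[OF V(1,2) _ V'(1,2) _ eq]) (use V V' in auto)
  define n where "n = restrict a W \<ominus>\<^bsub>Mod FS W\<^esub> restrict a' W"
  have n: "n \<in> N W" using W(5) by (simp add: n_def)
  have Fr: "restrict a W \<in> F W" "restrict a' W \<in> F W" "restrict b W \<in> F W"
    using subsheafD(2)[OF subsheaf_F V(1) W(1,3) V(3)] subsheafD(2)[OF subsheaf_F V'(1) W(1,4) V'(3)]
      subsheafD(2)[OF subsheaf_F V(1) W(1,3) V(4)] by auto
  note in_A = A.Q.subsheaf_simps(1)[OF subsheaf_F W(1)] A.Q.subsheaf_simps(1)[OF subsheaf_N W(1)]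
  have "restrict a W = n \<oplus>\<^bsub>Mod A.Quo W\<^esub> restrict a' W"
    using G.section_arith(1)[OF W(1), of "restrict a W" "restrict a' W"] Fr by (simp add: n_def)
  then have "restr_pairing X Q W (restrict a W) (restrict b W) z = restr_pairing X Q W (restrict a' W) (restrict b W) z"
    using restr_pairing_add[OF W(1) in_A(2)[OF n] in_A(1)[OF Fr(2)] in_A(1)[OF Fr(3)] W(2)]
      restr_pairing_N_F[OF W(1) n Fr(3) W(2)] by simp
  moreover have "b z = b' z" using T(2,6) by (metis restrict_apply')
  ultimately show ?thesis using W V V' by (simp add: restr_pairing_def)
qed

text \<open>Representatives of a class in \<open>F/N\<close> differ by sections of \<open>N\<close>, which are orthogonal to \<open>F\<close>. They are exchanged
  one argument at a time.\<close>

lemma PC_pairing_proj: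
  assumes W: "openin Y W" and a: "a \<in> F W" and b: "b \<in> F W"
  shows "pairing PC W (proj W a) (proj W b) = restr_pairing X Q W a b"
proof (rule extensionalityI[of _ W])
  show "restr_pairing X Q W a b \<in> extensional W" by (simp add: restr_pairing_def)
  fix z assume z: "z \<in> W"
  have zZ: "z \<in> Z" using A.open_in_Z[OF W] z by auto
  note in_A = A.Q.subsheaf_simps(1)[OF subsheaf_F]
  have pr: "proj W c z = G.cls z W c" for c using z zZ by (simp add: germ_section_def)
  have "{restr_pairing X Q V a' b' z | V a' b'. (V, a') \<in> proj W a z \<and> (V, b') \<in> proj W b z} = {restr_pairing X Q W a b z}" (is "?L = ?R")
  proof
    show "?L \<subseteq> ?R"
    proof
      fix c assume "c \<in> ?L"
      then obtain V a' b' where c: "c = restr_pairing X Q V a' b' z" and m: "(V, a') \<in> G.cls z W a" "(V, b') \<in> G.cls z W b"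
        unfolding pr by blast
      have V: "openin Y V" "z \<in> V" "a' \<in> F V" "b' \<in> F V" "G.cls z W a = G.cls z V a'" "G.cls z W b = G.cls z V b'"
        using m G.mem_cls_iff[of W z a V a'] G.mem_cls_iff[of W z b V b'] W z a b by auto
      define T where "T = V \<inter> W"
      have T: "openin Y T" "z \<in> T" "T \<subseteq> V" "T \<subseteq> W" using V W z by (auto simp: T_def)
      have bT: "restrict b T \<in> F T" and aT: "restrict a' T \<in> F T"
        using subsheafD(2)[OF subsheaf_F W T(1,4) b] subsheafD(2)[OF subsheaf_F V(1) T(1,3) V(3)] by auto
      have "G.cls z T (restrict a' T) = G.cls z V a'" using G.cls_Res[OF V(1) T(1,3,2), of a'] V(3) by simp
      then have "restr_pairing X Q W a b z = restr_pairing X Q T (restrict a' T) (restrict b T) z"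
        using W z a b T bT aT V by (intro restr_pairing_cls[of _ _ _ _ _ _ T]) (auto simp: Int_absorb1)
      also have "\<dots> = restr_pairing X Q T (restrict b T) (restrict a' T) z"
        using restr_pairing_sym[OF T(1) in_A[OF T(1) aT] in_A[OF T(1) bT] T(2)] .
      also have "\<dots> = restr_pairing X Q V b' a' z"
      proof (rule restr_pairing_cls[of _ _ _ _ _ _ T])
        show "G.cls z T (restrict b T) = G.cls z V b'" using G.cls_Res[OF W T(1,4,2), of b] b V(6) by simp
      qed (use T V aT bT in auto)
      also have "\<dots> = restr_pairing X Q V a' b' z"
        using restr_pairing_sym[OF V(1) in_A[OF V(1,4)] in_A[OF V(1,3)] V(2)] .
      finally show "c \<in> ?R" using c by simp
    qed
    have "(W, a) \<in> proj W a z" "(W, b) \<in> proj W b z"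
      using W z a b G.mem_cls_iff[of W z a W a] G.mem_cls_iff[of W z b W b] unfolding pr by auto
    then show "?R \<subseteq> ?L" by blast
  qed
  then show "pairing PC W (proj W a) (proj W b) z = restr_pairing X Q W a b z" using z by (simp add: PC_pairing)
qed (simp add: PC_pairing)

sublocale P: isotropic_quotient Y \<O>Z A.Quo PC F N proj "restr_pairing X Q" "pairing PC"
proof (intro isotropic_quotient.intro isotropic_quotient_axioms.intro quotient_map_PC PC_pairing_proj)
  show "pairing PC U s t \<in> extensional U" for U s t by (simp add: PC_pairing)
  show "pairing PC V (Res PC U V s) (Res PC U V t) x = pairing PC U s t x" if "V \<subseteq> U" "x \<in> V" for U V s t x
    using that by (auto simp: PC_pairing PC_simps)
qed

text \<open>A representative in \<open>K\<close> of one germ represents the section in a whole neighbourhood, since equality of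
  germs is an equality of sections near the point.\<close>

lemma pullback_dirac_eq:
  assumes K: "subsheaf Y \<O>Z A.Quo K" and K_F: "\<And>U. openin Y U \<Longrightarrow> K U \<subseteq> F U"
  shows "pullback_dirac X \<O> Q Z K = P.image_sheaf K"
proof (rule HOL.ext, rule equalityI; rule subsetI)
  fix W s
  have pr: "proj V c z = G.cls z V c" if "openin Y V" "z \<in> V" for V c z
    using that A.open_in_Z[OF that(1)] by (auto simp: germ_section_def)
  {
    assume "s \<in> pullback_dirac X \<O> Q Z K W"
    then have W: "openin Y W" and s: "s \<in> carrier (Mod PC W)" and ex: "\<And>z. z \<in> W \<Longrightarrow> \<exists>V a. (V, a) \<in> s z \<and> a \<in> K V"
      by (auto simp: pullback_dirac_def)
    show "s \<in> P.image_sheaf K W"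
    proof (rule P.image_sheafI[OF W s])
      fix z assume z: "z \<in> W"
      obtain V a where a: "(V, a) \<in> s z" "a \<in> K V" using ex[OF z] by blast
      obtain U b where U: "openin Y U" "z \<in> U" "U \<subseteq> W" "b \<in> F U" "Res PC W U s = proj U b"
        using P.p_surj[OF W s z] by blast
      have sy: "s y = G.cls y U b" if y: "y \<in> U" for y
      proof -
        have "restrict s U y = proj U b y" using U(5) by (simp add: PC_simps)
        then show ?thesis using y pr[OF U(1) y] by simp
      qed
      have V: "openin Y V" "z \<in> V" "a \<in> F V" "G.cls z U b = G.cls z V a"
        using a(1) sy[OF U(2)] G.mem_cls_iff[of U z b V a] U by auto
      obtain T where T: "openin Y T" "z \<in> T" "T \<subseteq> U" "T \<subseteq> V" "Res FS U T b \<ominus>\<^bsub>Mod FS T\<^esub> Res FS V T a \<in> N T"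
        by (rule G.cls_eqE[OF U(1,2) _ V(1,2) _ V(4)]) (use U V in auto)
      have bT: "restrict b T \<in> F T" and aT: "restrict a T \<in> F T" and aK: "restrict a T \<in> K T"
        using subsheafD(2)[OF subsheaf_F U(1) T(1,3) U(4)] subsheafD(2)[OF subsheaf_F V(1) T(1,4) V(3)]
          subsheafD(2)[OF K V(1) T(1,4) a(2)] by auto
      have "proj T (restrict b T) = proj T (restrict a T)"
        using P.p_eq_iff[OF T(1) bT aT] T(5) FS_minus[OF T(1) bT aT] by simp
      moreover have "Res PC W T s = proj T (restrict b T)"
        using P.p_Res[OF U(1) T(1,3) U(4)] U(5) P.B.Res_Res[OF W U(1) T(1,3) U(3) s] by simp
      ultimately show "\<exists>V a. openin Y V \<and> z \<in> V \<and> V \<subseteq> W \<and> a \<in> K V \<and> Res PC W V s = proj V a"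
        using T U(3) aK by (intro exI[of _ T] exI[of _ "restrict a T"]) auto
    qed
  }
  assume s: "s \<in> P.image_sheaf K W"
  have "\<exists>V a. (V, a) \<in> s z \<and> a \<in> K V" if z: "z \<in> W" for z
  proof -
    obtain V a where V: "openin Y V" "z \<in> V" "V \<subseteq> W" "a \<in> K V" "Res PC W V s = proj V a"
      by (rule P.image_sheafD[OF s z])
    have "restrict s V z = proj V a z" using V(5) by (simp add: PC_simps)
    then have "s z = G.cls z V a" using V(2) pr[OF V(1,2)] by simp
    moreover have "a \<in> F V" using V(4) K_F[OF V(1)] by auto
    ultimately have "(V, a) \<in> s z" using G.mem_cls_iff[of V z a V a] V by simp
    then show ?thesis using V(4) by blast
  qed
  then show "s \<in> pullback_dirac X \<O> Q Z K W"
    using s by (simp add: pullback_dirac_def P.image_sheaf_def)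
qed

lemma almost_dirac_supportedD:
  assumes "almost_dirac_supported X \<O> Q Z K"
  shows "subbundle Y \<O>Z A.Quo K" "subsheaf Y \<O>Z A.Quo K" "maximal_isotropic Y \<O>Z A.Quo (restr_pairing X Q) K"
    "\<And>U. openin Y U \<Longrightarrow> K U \<subseteq> F U" "pullback_dirac X \<O> Q Z K = P.image_sheaf K"
proof -
  show "subbundle Y \<O>Z A.Quo K" "maximal_isotropic Y \<O>Z A.Quo (restr_pairing X Q) K"
    and K_F: "\<And>U. openin Y U \<Longrightarrow> K U \<subseteq> F U" and K: "subsheaf Y \<O>Z A.Quo K"
    using assms by (auto simp: almost_dirac_supported_def iQ_eq subbundle_def)
  show "pullback_dirac X \<O> Q Z K = P.image_sheaf K" by (rule pullback_dirac_eq[OF K K_F])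
qed

lemma conormal_image_subset:
  assumes K: "almost_dirac_supported X \<O> Q Z K"
  shows "N W \<subseteq> K W \<and> K W \<subseteq> F W"
proof (cases "openin Y W")
  case True
  then show ?thesis
    using P.maximal_isotropic_contains_N[OF almost_dirac_supportedD(3,4)[OF K] True] almost_dirac_supportedD(4)[OF K] by blast
next
  case False
  then show ?thesis using subsheaf_openD[OF almost_dirac_supportedD(2)[OF K]] by (auto simp: conormal_image_def)
qed

lemma almost_dirac_pullback:
  assumes K: "almost_dirac_supported X \<O> Q Z K"
  shows "almost_dirac Y \<O>Z PC (pullback_dirac X \<O> Q Z K)"
  unfolding almost_dirac_def almost_dirac_supportedD(5)[OF K]
  using P.subbundle_image[OF almost_dirac_supportedD(1)[OF K] _ almost_dirac_supportedD(4)[OF K]]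
    P.maximal_isotropic_image[OF almost_dirac_supportedD(3,4)[OF K]] conormal_image_subset[OF K] by simp

lemma preimage_pullback:
  assumes K: "almost_dirac_supported X \<O> Q Z K"
  shows "P.preimage_sheaf (pullback_dirac X \<O> Q Z K) = K"
  unfolding almost_dirac_supportedD(5)[OF K]
  by (rule P.preimage_image_maximal_isotropic[OF almost_dirac_supportedD(3,4)[OF K]])

text \<open>The orthogonal complement of \<open>N\<close> is contained in \<open>F\<close>, as required for maximality among all isotropic
  submodules of \<open>i\<^sup>*\<Q>\<close>.\<close>

lemma almost_dirac_supported_preimage:
  assumes F: "subbundle Y \<O>Z A.Quo F" and N: "subbundle Y \<O>Z A.Quo N" and L: "almost_dirac Y \<O>Z PC L"
  shows "almost_dirac_supported X \<O> Q Z (P.preimage_sheaf L)"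
    and "pullback_dirac X \<O> Q Z (P.preimage_sheaf L) = L"
proof -
  have L': "subbundle Y \<O>Z PC L" "maximal_isotropic Y \<O>Z PC (pairing PC) L" "subsheaf Y \<O>Z PC L"
    using L by (auto simp: almost_dirac_def subbundle_def)
  have "maximal_isotropic Y \<O>Z A.Quo (restr_pairing X Q) (P.preimage_sheaf L)"
  proof (rule P.maximal_isotropic_preimage[OF L'(2)])
    fix U a assume U: "openin Y U" and a: "a \<in> carrier (Mod A.Quo U)"
      and perp: "\<And>V n. \<lbrakk>openin Y V; V \<subseteq> U; n \<in> N V\<rbrakk> \<Longrightarrow> restr_pairing X Q V (Res A.Quo U V a) n = (\<lambda>x\<in>V. 0)"
    show "a \<in> F U" by (rule F_if_orthogonal[OF U a]) (use perp in simp)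
  qed
  then show "almost_dirac_supported X \<O> Q Z (P.preimage_sheaf L)"
    using P.subbundle_preimage[OF F N L'(1)] P.preimage_subset_F by (simp add: almost_dirac_supported_def iQ_eq)
  show "pullback_dirac X \<O> Q Z (P.preimage_sheaf L) = L"
    using pullback_dirac_eq[OF P.subsheaf_preimage[OF L'(3)] P.preimage_subset_F] P.image_preimage[OF L'(3)] by simp
qed

section \<open>The bracket of the inverse image\<close>

text \<open>The sum \<open>{n, p} + {p, n}\<close> is \<open>\<pi>\<^sup>\<dagger>(d h)\<close> for the function \<open>h = \<langle>n, p\<rangle>\<close>, which vanishes on \<open>Z\<close>; hence the claim
  follows from the one for \<open>{p, n}\<close>.\<close>

lemma bracket_conormal_tangent:
  assumes V: "openin X V" and p: "p \<in> tangent_sections V" and n: "n \<in> carrier (Mod Q V)" "A.gsec V n \<in> N (V \<inter> Z)"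
  shows "A.gsec V (bracket Q V n p) \<in> N (V \<inter> Z)"
proof -
  have pQ: "p \<in> carrier (Mod Q V)" using p by (simp add: tangent_sections_def)
  define h where "h = pairing Q V n p"
  have h: "h \<in> \<O> V" unfolding h_def by (rule pairing_closed[OF V n(1) pQ])
  have VZ: "openin Y (V \<inter> Z)" by (rule A.openin_Int_Z[OF V])
  have h0: "h y = 0" if y: "y \<in> V \<inter> Z" for y
  proof -
    have "restr_pairing X Q (V \<inter> Z) (A.gsec V n) (A.gsec V p) y = 0"
      by (rule restr_pairing_N_F[OF VZ n(2) gsec_F[OF V p] y])
    then show ?thesis
      using restr_pairing_rep[OF A.rep_gsec[OF V n(1)] A.rep_gsec[OF V pQ]] y by (simp add: h_def)
  qed
  have nc: "null_comb V 1 (\<lambda>_. \<lambda>x\<in>V. 1) (\<lambda>_. h)" by (rule differential_null_comb(1)[OF V h h0])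
  have dh: "differential X \<O> V h = lin_comb X \<O> V 1 (\<lambda>_. \<lambda>x\<in>V. 1) (\<lambda>_. h)"
    by (rule differential_null_comb(2)[OF V h h0])
  define c where "c = coanchor Q V (differential X \<O> V h)"
  have c: "c \<in> conormal_sections V" unfolding c_def dh by (rule coanchor_null_comb(1)[OF nc])
  then have cQ: "c \<in> carrier (Mod Q V)" by (simp add: conormal_sections_def)
  have br: "bracket Q V n p \<in> carrier (Mod Q V)" "bracket Q V p n \<in> carrier (Mod Q V)"
    using bracket_closed[OF V] n(1) pQ by auto
  \<comment> \<open>The symmetric part of the bracket is the co-anchor of an exact form.\<close>
  have "bracket Q V n p \<oplus>\<^bsub>Mod Q V\<^esub> bracket Q V p n = c"
    using bracket_sym[OF V n(1) pQ] by (simp add: c_def h_def)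
  then have "bracket Q V n p = c \<ominus>\<^bsub>Mod Q V\<^esub> bracket Q V p n"
    using section_arith(2)[OF V br] by simp
  then have "A.gsec V (bracket Q V n p) = A.gsec V c \<ominus>\<^bsub>Mod A.Quo (V \<inter> Z)\<^esub> A.gsec V (bracket Q V p n)"
    using A.gsec_minus[OF V cQ br(2)] by simp
  then show ?thesis
    using A.Q.subsheaf_simps(5)[OF subsheaf_N VZ gsec_N[OF V c] bracket_tangent_conormal[OF V p n]] by simp
qed

text \<open>\<open>{q, p} - {q', p'} = {q - q', p} + {q', p - p'}\<close>.\<close>

lemma bracket_congruent:
  assumes V: "openin X V" and t: "q \<in> tangent_sections V" "q' \<in> tangent_sections V" "p \<in> tangent_sections V" "p' \<in> tangent_sections V"
    and q: "A.gsec V (q \<ominus>\<^bsub>Mod Q V\<^esub> q') \<in> N (V \<inter> Z)" and p: "A.gsec V (p \<ominus>\<^bsub>Mod Q V\<^esub> p') \<in> N (V \<inter> Z)"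
  shows "A.gsec V (bracket Q V q p \<ominus>\<^bsub>Mod Q V\<^esub> bracket Q V q' p') \<in> N (V \<inter> Z)"
proof -
  have c: "q \<in> carrier (Mod Q V)" "q' \<in> carrier (Mod Q V)" "p \<in> carrier (Mod Q V)" "p' \<in> carrier (Mod Q V)"
    using t by (auto simp: tangent_sections_def)
  define m n where "m = q \<ominus>\<^bsub>Mod Q V\<^esub> q'" and "n = p \<ominus>\<^bsub>Mod Q V\<^esub> p'"
  have mn: "m \<in> carrier (Mod Q V)" "n \<in> carrier (Mod Q V)" using c V by (auto simp: m_def n_def)
  have "q = m \<oplus>\<^bsub>Mod Q V\<^esub> q'" "p = n \<oplus>\<^bsub>Mod Q V\<^esub> p'"
    using section_arith(1)[OF V c(1,2)] section_arith(1)[OF V c(3,4)] by (auto simp: m_def n_def)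
  then have "bracket Q V q p = bracket Q V m p \<oplus>\<^bsub>Mod Q V\<^esub> bracket Q V q' p"
    "bracket Q V q' p = bracket Q V q' n \<oplus>\<^bsub>Mod Q V\<^esub> bracket Q V q' p'"
    using bracket_add[OF V mn(1) c(2,3)] bracket_add[OF V mn(2) c(4,2)] by auto
  then have "bracket Q V q p \<ominus>\<^bsub>Mod Q V\<^esub> bracket Q V q' p' = bracket Q V m p \<oplus>\<^bsub>Mod Q V\<^esub> bracket Q V q' n"
    using section_arith(2)[OF V, of "bracket Q V m p \<oplus>\<^bsub>Mod Q V\<^esub> bracket Q V q' n" "bracket Q V q' p'"]
      abelian_monoid.a_assoc[OF abelian_group.axioms(1)[OF sections_abelian_group[OF V]]] bracket_closed[OF V] c mn V by simp
  then have "A.gsec V (bracket Q V q p \<ominus>\<^bsub>Mod Q V\<^esub> bracket Q V q' p') =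
      A.gsec V (bracket Q V m p) \<oplus>\<^bsub>Mod A.Quo (V \<inter> Z)\<^esub> A.gsec V (bracket Q V q' n)"
    using A.gsec_add[OF V bracket_closed[OF V mn(1) c(3)] bracket_closed[OF V c(2) mn(2)]] by simp
  moreover have "A.gsec V (bracket Q V m p) \<in> N (V \<inter> Z)"
    using bracket_conormal_tangent[OF V t(3) mn(1)] q by (simp add: m_def)
  moreover have "A.gsec V (bracket Q V q' n) \<in> N (V \<inter> Z)"
    using bracket_tangent_conormal[OF V t(2) mn(2)] p by (simp add: n_def)
  ultimately show ?thesis using A.Q.subsheaf_simps(3)[OF subsheaf_N A.openin_Int_Z[OF V]] by simp
qed

lemma pullback_class_eq: "y \<in> Z \<Longrightarrow> pullback_class X \<O> Q Z y V q = G.cls y (V \<inter> Z) (A.gsec V q)"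
  by (simp add: pullback_class_def rsec_eq)

text \<open>An element of a stalk of \<open>F/N\<close> is a class of sections that are themselves families of classes; here both
  levels are undone, and equality of germs becomes a statement on differences of sections of \<open>\<Q>\<close>.\<close>

lemma cls_gsec_eqE:
  assumes V: "openin X V" "y \<in> V" "q \<in> carrier (Mod Q V)" "A.gsec V q \<in> F (V \<inter> Z)"
    and V': "openin X V'" "y \<in> V'" "q' \<in> carrier (Mod Q V')" "A.gsec V' q' \<in> F (V' \<inter> Z)" and y: "y \<in> Z"
    and eq: "G.cls y (V \<inter> Z) (A.gsec V q) = G.cls y (V' \<inter> Z) (A.gsec V' q')"
  obtains U where "openin X U" "y \<in> U"
    "\<And>T. \<lbrakk>openin X T; T \<subseteq> U; T \<subseteq> V; T \<subseteq> V'\<rbrakk> \<Longrightarrow> A.gsec T (Res Q V T q \<ominus>\<^bsub>Mod Q T\<^esub> Res Q V' T q') \<in> N (T \<inter> Z)"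
proof -
  have o: "openin Y (V \<inter> Z)" "y \<in> V \<inter> Z" "openin Y (V' \<inter> Z)" "y \<in> V' \<inter> Z" using A.openin_Int_Z V V' y by auto
  obtain W where W: "openin Y W" "y \<in> W" "W \<subseteq> V \<inter> Z" "W \<subseteq> V' \<inter> Z"
    "Res FS (V \<inter> Z) W (A.gsec V q) \<ominus>\<^bsub>Mod FS W\<^esub> Res FS (V' \<inter> Z) W (A.gsec V' q') \<in> N W"
    by (rule G.cls_eqE[OF o(1,2) _ o(3,4) _ eq]) (use V V' in auto)
  obtain U where U: "openin X U" "W = U \<inter> Z" using W(1) by (auto simp: openin_subtopology)
  have Fr: "restrict (A.gsec V q) W \<in> F W" "restrict (A.gsec V' q') W \<in> F W"
    using subsheafD(2)[OF subsheaf_F o(1) W(1,3) V(4)] subsheafD(2)[OF subsheaf_F o(3) W(1,4) V'(4)] by auto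
  have inN: "restrict (A.gsec V q) W \<ominus>\<^bsub>Mod A.Quo W\<^esub> restrict (A.gsec V' q') W \<in> N W"
    using W(5) FS_minus[OF W(1) Fr] by simp
  show ?thesis
  proof (rule that[OF U(1)])
    show "y \<in> U" using W(2) U(2) by auto
    fix T assume T: "openin X T" "T \<subseteq> U" "T \<subseteq> V" "T \<subseteq> V'"
    have TZ: "openin Y (T \<inter> Z)" "T \<inter> Z \<subseteq> W" using A.openin_Int_Z[OF T(1)] T(2) U(2) by auto
    note in_A = A.Q.subsheaf_simps(1)[OF subsheaf_F W(1)]
    have "restrict (restrict (A.gsec V q) W \<ominus>\<^bsub>Mod A.Quo W\<^esub> restrict (A.gsec V' q') W) (T \<inter> Z) \<in> N (T \<inter> Z)"
      using subsheafD(2)[OF subsheaf_N W(1) TZ inN] by simp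
    moreover have "restrict (restrict (A.gsec V q) W \<ominus>\<^bsub>Mod A.Quo W\<^esub> restrict (A.gsec V' q') W) (T \<inter> Z) =
        restrict (A.gsec V q) (T \<inter> Z) \<ominus>\<^bsub>Mod A.Quo (T \<inter> Z)\<^esub> restrict (A.gsec V' q') (T \<inter> Z)"
      using A.Q.Res_minus[OF W(1) TZ in_A[OF Fr(1)] in_A[OF Fr(2)]] TZ(2) by (simp add: Int_absorb1)
    moreover have "\<dots> = A.gsec T (Res Q V T q \<ominus>\<^bsub>Mod Q T\<^esub> Res Q V' T q')"
      using A.gsec_minus[OF T(1) Res_closed[OF V(1) T(1,3) V(3)] Res_closed[OF V'(1) T(1,4) V'(3)]]
        A.gsec_Res[OF V(1) T(1,3) V(3)] A.gsec_Res[OF V'(1) T(1,4) V'(3)] by simp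
    ultimately show "A.gsec T (Res Q V T q \<ominus>\<^bsub>Mod Q T\<^esub> Res Q V' T q') \<in> N (T \<inter> Z)" by simp
  qed
qed

lemma bracket_cls:
  assumes V: "openin X V" "y \<in> V" "q \<in> tangent_sections V" "p \<in> tangent_sections V"
    and V': "openin X V'" "y \<in> V'" "q' \<in> tangent_sections V'" "p' \<in> tangent_sections V'" and y: "y \<in> Z"
    and eq: "G.cls y (V \<inter> Z) (A.gsec V q) = G.cls y (V' \<inter> Z) (A.gsec V' q')"
      "G.cls y (V \<inter> Z) (A.gsec V p) = G.cls y (V' \<inter> Z) (A.gsec V' p')"
  shows "G.cls y (V \<inter> Z) (A.gsec V (bracket Q V q p)) = G.cls y (V' \<inter> Z) (A.gsec V' (bracket Q V' q' p'))"
proof -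
  have c: "q \<in> carrier (Mod Q V)" "p \<in> carrier (Mod Q V)" "q' \<in> carrier (Mod Q V')" "p' \<in> carrier (Mod Q V')"
    using V V' by (auto simp: tangent_sections_def)
  obtain U1 where U1: "openin X U1" "y \<in> U1" "\<And>T. \<lbrakk>openin X T; T \<subseteq> U1; T \<subseteq> V; T \<subseteq> V'\<rbrakk> \<Longrightarrow>
      A.gsec T (Res Q V T q \<ominus>\<^bsub>Mod Q T\<^esub> Res Q V' T q') \<in> N (T \<inter> Z)"
    by (rule cls_gsec_eqE[OF V(1,2) c(1) gsec_F[OF V(1,3)] V'(1,2) c(3) gsec_F[OF V'(1,3)] y eq(1)]) blast
  obtain U2 where U2: "openin X U2" "y \<in> U2" "\<And>T. \<lbrakk>openin X T; T \<subseteq> U2; T \<subseteq> V; T \<subseteq> V'\<rbrakk> \<Longrightarrow>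
      A.gsec T (Res Q V T p \<ominus>\<^bsub>Mod Q T\<^esub> Res Q V' T p') \<in> N (T \<inter> Z)"
    by (rule cls_gsec_eqE[OF V(1,2) c(2) gsec_F[OF V(1,4)] V'(1,2) c(4) gsec_F[OF V'(1,4)] y eq(2)]) blast
  define T where "T = U1 \<inter> U2 \<inter> V \<inter> V'"
  have T: "openin X T" "y \<in> T" "T \<subseteq> U1" "T \<subseteq> U2" "T \<subseteq> V" "T \<subseteq> V'" using U1 U2 V V' by (auto simp: T_def)
  have br: "bracket Q V q p \<in> tangent_sections V" "bracket Q V' q' p' \<in> tangent_sections V'"
    using bracket_tangent V V' by auto
  then have brc: "bracket Q V q p \<in> carrier (Mod Q V)" "bracket Q V' q' p' \<in> carrier (Mod Q V')"
    by (auto simp: tangent_sections_def)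
  have tr: "Res Q V T (bracket Q V q p) \<in> tangent_sections T" "Res Q V' T (bracket Q V' q' p') \<in> tangent_sections T"
    using tangent_sections_Res[OF V(1) T(1,5) br(1)] tangent_sections_Res[OF V'(1) T(1,6) br(2)] by auto
  then have trc: "Res Q V T (bracket Q V q p) \<in> carrier (Mod Q T)" "Res Q V' T (bracket Q V' q' p') \<in> carrier (Mod Q T)"
    by (auto simp: tangent_sections_def)
  have "A.gsec T (bracket Q T (Res Q V T q) (Res Q V T p) \<ominus>\<^bsub>Mod Q T\<^esub> bracket Q T (Res Q V' T q') (Res Q V' T p')) \<in> N (T \<inter> Z)"
    using U1(3)[OF T(1,3,5,6)] U2(3)[OF T(1,4,5,6)] tangent_sections_Res T V V'
    by (intro bracket_congruent) auto
  then have "A.gsec T (Res Q V T (bracket Q V q p)) \<ominus>\<^bsub>Mod A.Quo (T \<inter> Z)\<^esub> A.gsec T (Res Q V' T (bracket Q V' q' p')) \<in> N (T \<inter> Z)"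
    using bracket_Res[OF V(1) T(1,5) c(1,2)] bracket_Res[OF V'(1) T(1,6) c(3,4)] A.gsec_minus[OF T(1) trc] by simp
  then have "restrict (A.gsec V (bracket Q V q p)) (T \<inter> Z) \<ominus>\<^bsub>Mod FS (T \<inter> Z)\<^esub> restrict (A.gsec V' (bracket Q V' q' p')) (T \<inter> Z) \<in> N (T \<inter> Z)"
    using FS_minus[OF A.openin_Int_Z[OF T(1)] gsec_F[OF T(1) tr(1)] gsec_F[OF T(1) tr(2)]]
      A.gsec_Res[OF V(1) T(1,5) brc(1)] A.gsec_Res[OF V'(1) T(1,6) brc(2)] by simp
  then show ?thesis
    using V V' T y br gsec_F A.openin_Int_Z by (intro G.cls_eqI[of _ _ _ _ _ "T \<inter> Z"]) auto
qed

text \<open>Locally the two sections are classes of sections \<open>q\<close> and \<open>p\<close> of \<open>\<Q>\<close> that restrict to \<open>K\<close>. By \<open>bracket_cls\<close>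
  the bracket of the classes is the class of \<open>{q, p}\<close>, whatever lifts are used in its definition, and
  \<open>{q, p}\<close> restricts to \<open>K\<close> by assumption.\<close>

lemma dirac_pullback:
  assumes K: "dirac_supported X \<O> Q Z K"
  shows "dirac Y \<O>Z PC (pullback_dirac X \<O> Q Z K)"
proof -
  have aK: "almost_dirac_supported X \<O> Q Z K" using K by (simp add: dirac_supported_def)
  note D = almost_dirac_supportedD[OF aK]
  let ?L = "P.image_sheaf K"
  have "bracket PC U s t \<in> ?L U" if U: "openin Y U" and s: "s \<in> ?L U" and t: "t \<in> ?L U" for U s t
  proof -
    have local: "\<exists>V c. openin X V \<and> z \<in> V \<and> V \<inter> Z \<subseteq> U \<and> c \<in> K (V \<inter> Z) \<and> c \<in> F (V \<inter> Z) \<and>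
        (\<forall>y\<in>V \<inter> Z. bracket PC U s t y = G.cls y (V \<inter> Z) c)" if z: "z \<in> U" for z
    proof -
      obtain W a b where W: "openin Y W" "z \<in> W" "W \<subseteq> U" "a \<in> K W" "b \<in> K W" "Res PC U W s = proj W a" "Res PC U W t = proj W b"
        by (rule P.image_sheaf_common[OF D(2,4) U s t z])
      have top: "openin X (topspace X)" "z \<in> topspace X" using z A.open_in_Z[OF U] Z_topspace by auto
      note in_A = A.Q.subsheaf_simps(1)[OF D(2) W(1)]
      obtain V1 q where V1: "openin X V1" "z \<in> V1" "V1 \<inter> Z \<subseteq> W" "q \<in> carrier (Mod Q V1)" "restrict a (V1 \<inter> Z) = A.gsec V1 q"
        by (rule A.gsec_exists[OF W(1) in_A[OF W(4)] W(2) top]) blast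
      obtain V p where V: "openin X V" "z \<in> V" "V \<subseteq> V1" "V \<inter> Z \<subseteq> W" "p \<in> carrier (Mod Q V)" "restrict b (V \<inter> Z) = A.gsec V p"
        by (rule A.gsec_exists[OF W(1) in_A[OF W(5)] W(2) V1(1,2)]) blast
      define q' where "q' = Res Q V1 V q"
      have q': "q' \<in> carrier (Mod Q V)" unfolding q'_def by (rule Res_closed[OF V1(1) V(1,3) V1(4)])
      have "restrict a (V \<inter> Z) = restrict (restrict a (V1 \<inter> Z)) (V \<inter> Z)" using V(3) by (auto simp: fun_eq_iff restrict_def)
      then have aV: "restrict a (V \<inter> Z) = A.gsec V q'" using A.gsec_Res[OF V1(1) V(1,3) V1(4)] V1(5) by (simp add: q'_def)
      have VZ: "openin Y (V \<inter> Z)" by (rule A.openin_Int_Z[OF V(1)])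
      have KV: "A.gsec V q' \<in> K (V \<inter> Z)" "A.gsec V p \<in> K (V \<inter> Z)"
        using subsheafD(2)[OF D(2) W(1) VZ V(4) W(4)] subsheafD(2)[OF D(2) W(1) VZ V(4) W(5)] aV V(6) by auto
      then have FV: "A.gsec V q' \<in> F (V \<inter> Z)" "A.gsec V p \<in> F (V \<inter> Z)" using D(4)[OF VZ] by auto
      have tan: "q' \<in> tangent_sections V" "p \<in> tangent_sections V"
        using tangent_if_gsec_F[OF V(1) q' FV(1)] tangent_if_gsec_F[OF V(1,5) FV(2)] by auto
      have KB: "A.gsec V (bracket Q V q' p) \<in> K (V \<inter> Z)"
        using K V(1,5) q' KV unfolding dirac_supported_def lifted_sections_def rsec_eq by blast
      have FW: "a \<in> F W" "b \<in> F W" using D(4)[OF W(1)] W(4,5) by auto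
      have sy: "s y = G.cls y (V \<inter> Z) (A.gsec V q')" and ty: "t y = G.cls y (V \<inter> Z) (A.gsec V p)" if y: "y \<in> V \<inter> Z" for y
      proof -
        have yW: "y \<in> W" using y V(4) by auto
        have "restrict s W y = proj W a y" "restrict t W y = proj W b y" using W(6,7) by (simp_all add: PC_simps)
        then have "s y = G.cls y W a" "t y = G.cls y W b" using yW y by (simp_all add: germ_section_def)
        then show "s y = G.cls y (V \<inter> Z) (A.gsec V q')" "t y = G.cls y (V \<inter> Z) (A.gsec V p)"
          using G.cls_Res[OF W(1) VZ V(4) y, of a] G.cls_Res[OF W(1) VZ V(4) y, of b] FW aV V(6) by simp_all
      qed
      have "bracket PC U s t y = G.cls y (V \<inter> Z) (A.gsec V (bracket Q V q' p))" if y: "y \<in> V \<inter> Z" for y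
      proof -
        have y': "y \<in> V" "y \<in> Z" "y \<in> U" using y V(4) W(3) by auto
        have lift_iff: "lifts_at X \<O> Q Z y (G.cls y (V \<inter> Z) (A.gsec V r)) V2 r2 \<longleftrightarrow>
            openin X V2 \<and> y \<in> V2 \<and> r2 \<in> carrier (Mod Q V2) \<and> A.gsec V2 r2 \<in> F (V2 \<inter> Z) \<and>
            G.cls y (V \<inter> Z) (A.gsec V r) = G.cls y (V2 \<inter> Z) (A.gsec V2 r2)"
          if "A.gsec V r \<in> F (V \<inter> Z)" for r V2 r2
          using G.mem_cls_iff[of "V \<inter> Z" y "A.gsec V r" "V2 \<inter> Z" "A.gsec V2 r2"] VZ y that A.openin_Int_Z[of V2]
          unfolding lifts_at_def rsec_eq by auto
        have "{pullback_class X \<O> Q Z y V2 (bracket Q V2 q2 p2) | V2 q2 p2.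
            lifts_at X \<O> Q Z y (s y) V2 q2 \<and> lifts_at X \<O> Q Z y (t y) V2 p2} = {G.cls y (V \<inter> Z) (A.gsec V (bracket Q V q' p))}" (is "?A = ?B")
        proof
          show "?A \<subseteq> ?B"
          proof
            fix c assume "c \<in> ?A"
            then obtain V2 q2 p2 where c: "c = pullback_class X \<O> Q Z y V2 (bracket Q V2 q2 p2)"
              and l: "lifts_at X \<O> Q Z y (s y) V2 q2" "lifts_at X \<O> Q Z y (t y) V2 p2" by blast
            have l': "openin X V2" "y \<in> V2" "q2 \<in> carrier (Mod Q V2)" "A.gsec V2 q2 \<in> F (V2 \<inter> Z)"
              "G.cls y (V \<inter> Z) (A.gsec V q') = G.cls y (V2 \<inter> Z) (A.gsec V2 q2)"
              "p2 \<in> carrier (Mod Q V2)" "A.gsec V2 p2 \<in> F (V2 \<inter> Z)"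
              "G.cls y (V \<inter> Z) (A.gsec V p) = G.cls y (V2 \<inter> Z) (A.gsec V2 p2)"
              using l lift_iff[OF FV(1), of V2 q2] lift_iff[OF FV(2), of V2 p2] unfolding sy[OF y] ty[OF y] by auto
            have "q2 \<in> tangent_sections V2" "p2 \<in> tangent_sections V2"
              using tangent_if_gsec_F[OF l'(1,3,4)] tangent_if_gsec_F[OF l'(1,6,7)] by auto
            then show "c \<in> ?B"
              using bracket_cls[OF V(1) y'(1) tan l'(1,2) _ _ y'(2) l'(5,8)] c by (simp add: pullback_class_eq[OF y'(2)])
          qed
          have "lifts_at X \<O> Q Z y (s y) V q'" "lifts_at X \<O> Q Z y (t y) V p"
            using lift_iff[OF FV(1), of V q'] lift_iff[OF FV(2), of V p] V(1,5) q' FV y'(1) unfolding sy[OF y] ty[OF y] by auto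
          then show "?B \<subseteq> ?A" using pullback_class_eq[OF y'(2)] by blast
        qed
        then show ?thesis using y'(3) by (simp add: pullback_courant_def)
      qed
      then show ?thesis
        using V(1,2,4) W(3) KB D(4)[OF VZ] by (intro exI[of _ V] exI[of _ "A.gsec V (bracket Q V q' p)"]) auto
    qed
    have ext: "bracket PC U s t \<in> extensional U" by (simp add: pullback_courant_def)
    have res: "restrict (bracket PC U s t) (V \<inter> Z) = proj (V \<inter> Z) c" if "\<forall>y\<in>V \<inter> Z. bracket PC U s t y = G.cls y (V \<inter> Z) c" for V c
      using that by (auto simp: germ_section_def fun_eq_iff)
    show ?thesis
    proof (rule P.image_sheafI[OF U])
      have "bracket PC U s t \<in> carrier (Mod G.Quo U)"
        unfolding G.Quo_carrier G.rep_def
      proof (intro conjI ballI ext)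
        fix z assume z: "z \<in> U"
        obtain V c where V: "openin X V" "z \<in> V" "V \<inter> Z \<subseteq> U" "c \<in> F (V \<inter> Z)" "\<forall>y\<in>V \<inter> Z. bracket PC U s t y = G.cls y (V \<inter> Z) c"
          using local[OF z] by blast
        then show "\<exists>V' c. z \<in> V' \<and> openin Y V' \<and> V' \<inter> Z \<subseteq> U \<and> c \<in> carrier (Mod FS V') \<and>
            (\<forall>y\<in>V' \<inter> Z. bracket PC U s t y = G.cls y V' c)"
          using A.openin_Int_Z[OF V(1)] A.open_in_Z[OF U] z by (intro exI[of _ "V \<inter> Z"] exI[of _ c]) auto
      qed
      then show "bracket PC U s t \<in> carrier (Mod PC U)" by (simp add: PC_simps)
      fix z assume z: "z \<in> U"
      obtain V c where V: "openin X V" "z \<in> V" "V \<inter> Z \<subseteq> U" "c \<in> K (V \<inter> Z)" "\<forall>y\<in>V \<inter> Z. bracket PC U s t y = G.cls y (V \<inter> Z) c"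
        using local[OF z] by blast
      then show "\<exists>V a. openin Y V \<and> z \<in> V \<and> V \<subseteq> U \<and> a \<in> K V \<and> Res PC U V (bracket PC U s t) = proj V a"
        using A.openin_Int_Z[OF V(1)] A.open_in_Z[OF U] z res[OF V(5)]
        by (intro exI[of _ "V \<inter> Z"] exI[of _ c]) (auto simp: PC_simps)
    qed
  qed
  then show ?thesis using almost_dirac_pullback[OF aK] unfolding dirac_def D(5) by blast
qed

end

theorem proposition31:
  fixes k :: manifold_kind and X :: "'x topology" and \<O> :: "'x set \<Rightarrow> ('x \<Rightarrow> complex) set"
    and Z :: "'x set" and Q :: "('x, 's) courant"
  assumes "manifold k X \<O>"
    and "submanifold k X \<O> Z"
    and "courant_algebroid X \<O> Q"
    and "locally_free_finite_rank X \<O> Q"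
  shows
    "(\<forall>K. almost_dirac_supported X \<O> Q Z K \<longrightarrow>
        (\<forall>W. conormal_image X \<O> Q Z W \<subseteq> K W \<and> K W \<subseteq> fibre_product X \<O> Q Z W)) \<and>
     (\<forall>K. dirac_supported X \<O> Q Z K \<longrightarrow>
        dirac (subtopology X Z) (restr_sheaf X \<O> Z) (pullback_courant X \<O> Q Z)
          (pullback_dirac X \<O> Q Z K)) \<and>
     pullback_dirac X \<O> Q Z ` {K. almost_dirac_supported X \<O> Q Z K}
        \<subseteq> {L. almost_dirac (subtopology X Z) (restr_sheaf X \<O> Z) (pullback_courant X \<O> Q Z) L} \<and>
     inj_on (pullback_dirac X \<O> Q Z) {K. almost_dirac_supported X \<O> Q Z K} \<and>
     (subbundle (subtopology X Z) (restr_sheaf X \<O> Z) (inverse_image X \<O> Q Z)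
          (fibre_product X \<O> Q Z) \<and>
        subbundle (subtopology X Z) (restr_sheaf X \<O> Z) (inverse_image X \<O> Q Z)
          (conormal_image X \<O> Q Z) \<longrightarrow>
      bij_betw (pullback_dirac X \<O> Q Z)
        {K. almost_dirac_supported X \<O> Q Z K}
        {L. almost_dirac (subtopology X Z) (restr_sheaf X \<O> Z) (pullback_courant X \<O> Q Z) L})"
proof -
  interpret courant_restriction X \<O> Q Z
    using assms(2,3) by (simp add: courant_restriction_def courant_restriction_axioms_def submanifold_def)
  have image: "pullback_dirac X \<O> Q Z ` {K. almost_dirac_supported X \<O> Q Z K} \<subseteq> {L. almost_dirac Y \<O>Z PC L}"
    using almost_dirac_pullback by blast
  have inj: "inj_on (pullback_dirac X \<O> Q Z) {K. almost_dirac_supported X \<O> Q Z K}"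
    by (rule inj_on_inverseI[of _ P.preimage_sheaf]) (simp add: preimage_pullback)
  have "bij_betw (pullback_dirac X \<O> Q Z) {K. almost_dirac_supported X \<O> Q Z K} {L. almost_dirac Y \<O>Z PC L}"
    if "subbundle Y \<O>Z iQ F \<and> subbundle Y \<O>Z iQ N"
  proof (rule bij_betw_imageI[OF inj])
    have "L \<in> pullback_dirac X \<O> Q Z ` {K. almost_dirac_supported X \<O> Q Z K}" if L: "almost_dirac Y \<O>Z PC L" for L
      using almost_dirac_supported_preimage[OF _ _ L] \<open>subbundle Y \<O>Z iQ F \<and> subbundle Y \<O>Z iQ N\<close>
      by (intro image_eqI[of _ _ "P.preimage_sheaf L"]) (auto simp: iQ_eq)
    with image show "pullback_dirac X \<O> Q Z ` {K. almost_dirac_supported X \<O> Q Z K} = {L. almost_dirac Y \<O>Z PC L}" by blast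
  qed
  then show ?thesis
    using conormal_image_subset dirac_pullback image inj by blast
qed

end
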